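(* Let $K$ be a convex body in $\mathbb{R}^d$, let $I$ be a random point uniformly distributed in $K$ and let $B$ be a random point uniformly distributed on the boundary $\partial K$. Assume that at least one of the following holds: (i) $d=2$ and $\mathbb{E} I=\mathbb{E} B$; (ii) $K$ is a circumscribed polytope whose inscribed sphere has center $O$ with $O=\mathbb{E} I=\mathbb{E} B$. Then $I\preceq_{cx} B$, i.e. $$\mathbb{E}\,\varphi(I)\le\mathbb{E}\,\varphi(B)$$ for every convex function $\varphi:\mathbb{R}^d\to\mathbb{R}$.
   Context: A convex body in $\mathbb{R}^d$ is a compact convex set with nonempty interior. "Uniformly distributed in $K$" means with law equal to Lebesgue measure restricted to $K$, normalized to be a probability measure. "Uniformly distributed on $\partial K$" means with law equal to the surface measure (the $(d-1)$-dimensional Hausdorff measure) restricted to $\partial K$, normalized to be a probability measure. A circumscribed polytope is a convex polytope (with nonempty interior) that has an inscribed sphere, i.e. a sphere contained in the polytope and tangent to all of its facets ($(d-1)$-dimensional faces). The notation $X\preceq_{cx}Y$ (convex order) means $\mathbb{E}\,\varphi(X)\le\mathbb{E}\,\varphi(Y)$ for every convex function $\varphi$. *)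

theory Defs
  imports "HOL-Analysis.Analysis" "HOL-Probability.Probability"
begin

section \<open>Hausdorff measure\<close>

text \<open>
  The summand for a set of diameter \<open>t\<close> is the volume of an \<open>s\<close>-dimensional ball of
  diameter \<open>t\<close>. The empty set has summand \<open>0\<close> also for \<open>s = 0\<close>, so that
  the \<open>0\<close>-dimensional measure is the counting measure. The covering sets are required to be
  bounded because \<^const>\<open>diameter\<close> is meaningless on unbounded sets.
\<close>

definition hausdorff_term :: "nat \<Rightarrow> 'a::metric_space set \<Rightarrow> ennreal" where
  "hausdorff_term s U =
     (if U = {} then 0 else ennreal (unit_ball_vol (real s) * (diameter U / 2) ^ s))"

definition hausdorff_pre :: "nat \<Rightarrow> real \<Rightarrow> 'a::metric_space set \<Rightarrow> ennreal" where
  "hausdorff_pre s \<delta> A =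
     (INF U \<in> {U :: nat \<Rightarrow> 'a set. A \<subseteq> (\<Union>i. U i) \<and> (\<forall>i. bounded (U i) \<and> diameter (U i) \<le> \<delta>)}.
        \<Sum>i. hausdorff_term s (U i))"

definition hausdorff_outer :: "nat \<Rightarrow> 'a::metric_space set \<Rightarrow> ennreal" where
  "hausdorff_outer s A = (SUP \<delta>\<in>{0<..}. hausdorff_pre s \<delta> A)"

definition hausdorff_measure :: "nat \<Rightarrow> 'a::metric_space measure" where
  "hausdorff_measure s = measure_of UNIV (sets borel) (hausdorff_outer s)"

lemma space_hausdorff_measure [simp]: "space (hausdorff_measure s) = UNIV"
  by (simp add: hausdorff_measure_def space_measure_of_conv)

lemma sets_hausdorff_measure [simp, measurable_cong]: "sets (hausdorff_measure s) = sets borel"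
  by (metis hausdorff_measure_def sets.sets_measure_of_eq space_borel)

text \<open>
  \<^const>\<open>measure_of\<close> yields the null measure unless the given set function is countably
  additive on the given sets. The following lemmas exclude this: Borel sets are measurable in the
  sense of Caratheodory for every metric outer measure.
\<close>

lemma outer_measure_leD:
  fixes f :: "'a set \<Rightarrow> ennreal"
  assumes oms: "outer_measure_space UNIV f"
  shows "A \<subseteq> B \<Longrightarrow> f A \<le> f B" "f {} = 0" "f (\<Union>i. D i) \<le> (\<Sum>i. f (D i))"
    "f (A \<union> B) \<le> f A + f B"
proof -
  have pos: "positive UNIV f" and inc: "increasing UNIV f"
    and sub: "\<And>D. disjoint_family D \<Longrightarrow> f (\<Union>i. D i) \<le> (\<Sum>i. f (D i))"
    using oms unfolding outer_measure_space_def countably_subadditive_def by auto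
  show mono: "A \<subseteq> B \<Longrightarrow> f A \<le> f B" for A B
    using inc by (auto simp: increasing_def)
  show "f {} = 0" using pos by (auto simp: positive_def)
  show *: "f (\<Union>i. D i) \<le> (\<Sum>i. f (D i))" for D
  proof -
    have "f (\<Union>i. D i) = f (\<Union>i. disjointed D i)" by (simp add: UN_disjointed_eq)
    also have "\<dots> \<le> (\<Sum>i. f (disjointed D i))" by (intro sub disjoint_family_disjointed)
    also have "\<dots> \<le> (\<Sum>i. f (D i))"
      by (intro suminf_le mono disjointed_subset summableI)
    finally show ?thesis .
  qed
  show "f (A \<union> B) \<le> f A + f B"
  proof -
    have "(\<Sum>i. f (binaryset A B i)) = f A + f B"
      using suminf_binaryset_eq[of f A B] \<open>f {} = 0\<close> by simp
    then show ?thesis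
      using *[of "binaryset A B"] by (simp add: UN_binaryset_eq)
  qed
qed

lemma metric_outer_closed:
  fixes f :: "'a::metric_space set \<Rightarrow> ennreal" and X C :: "'a set"
  assumes oms: "outer_measure_space UNIV f"
    and sep: "\<And>A B d. \<lbrakk>0 < d; \<And>x y. x \<in> A \<Longrightarrow> y \<in> B \<Longrightarrow> d \<le> dist x y\<rbrakk> \<Longrightarrow> f A + f B \<le> f (A \<union> B)"
    and C: "closed C"
  shows "f (X \<inter> C) + f (X - C) \<le> f X"
proof (cases "f X = \<top> \<or> C = {}")
  case True
  then show ?thesis using outer_measure_leD(2)[OF oms] by auto
next
  case False
  then have fin: "f X < \<top>" and ne: "C \<noteq> {}" by (auto simp: less_top)
  note mono = outer_measure_leD(1)[OF oms]
  have infd: "infdist x C - infdist y C \<le> dist x y" for x y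
    using infdist_triangle[of x C y] by simp
  have sepd: "f A + f B \<le> f (A \<union> B)"
    if "b < a" "\<And>x. x \<in> A \<Longrightarrow> a \<le> infdist x C" "\<And>y. y \<in> B \<Longrightarrow> infdist y C \<le> b" for a b A B
  proof (rule sep)
    show "0 < a - b" using that(1) by simp
    show "a - b \<le> dist x y" if "x \<in> A" "y \<in> B" for x y
      using \<open>\<And>x. x \<in> A \<Longrightarrow> a \<le> infdist x C\<close>[OF that(1)]
        \<open>\<And>y. y \<in> B \<Longrightarrow> infdist y C \<le> b\<close>[OF that(2)] infd[of x y] by linarith
  qed
  define D where "D n = {x\<in>X. 1 / real (Suc n) \<le> infdist x C}" for n
  define R where "R n = {x\<in>X. 1 / real (n + 2) \<le> infdist x C \<and> infdist x C < 1 / real (n + 1)}" for n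
  have sumR: "(\<Sum>k<n. f (R (2 * k + i))) \<le> f (\<Union>k<n. R (2 * k + i))" for n i
  proof (induction n)
    case 0
    then show ?case by simp
  next
    case (Suc n)
    have "(\<Sum>k<Suc n. f (R (2 * k + i))) \<le> f (\<Union>k<n. R (2 * k + i)) + f (R (2 * n + i))"
      using Suc by (simp add: add_right_mono)
    also have "\<dots> \<le> f ((\<Union>k<n. R (2 * k + i)) \<union> R (2 * n + i))"
    proof (cases "n = 0")
      case True
      then show ?thesis by (simp add: outer_measure_leD(2)[OF oms])
    next
      case n: False
      show ?thesis
      proof (rule sepd[of "1 / real (2 * n + i + 1)" "1 / real (2 * n + i)"])
        show "1 / real (2 * n + i + 1) < 1 / real (2 * n + i)"
          using n by (intro divide_strict_left_mono) auto
      next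
        fix x assume "x \<in> (\<Union>k<n. R (2 * k + i))"
        then obtain k where k: "k < n" "1 / real (2 * k + i + 2) \<le> infdist x C"
          by (auto simp: R_def)
        have "1 / real (2 * n + i) \<le> 1 / real (2 * k + i + 2)"
          using k n by (intro divide_left_mono) auto
        with k show "1 / real (2 * n + i) \<le> infdist x C" by linarith
      qed (auto simp: R_def)
    qed
    also have "(\<Union>k<n. R (2 * k + i)) \<union> R (2 * n + i) = (\<Union>k<Suc n. R (2 * k + i))"
      by (auto simp: less_Suc_eq)
    finally show ?case .
  qed
  have sumR': "(\<Sum>k<n. f (R (2 * k + i))) \<le> f X" for n i
    by (rule order.trans[OF sumR]) (auto intro!: mono simp: R_def)
  have "(\<Sum>k<n. f (R k)) \<le> 2 * f X" for n
  proof -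
    have "(\<Sum>k<n. f (R k)) \<le> (\<Sum>k<2 * n. f (R k))"
      by (rule sum_mono2) auto
    also have "\<dots> = (\<Sum>k<n. f (R (2 * k + 0))) + (\<Sum>k<n. f (R (2 * k + 1)))"
      by (induction n) (auto simp: algebra_simps)
    also have "\<dots> \<le> f X + f X"
      by (intro add_mono sumR')
    finally show ?thesis by (simp add: mult_2)
  qed
  then have "(\<Sum>k. f (R k)) \<le> 2 * f X"
    by (intro suminf_le_const summableI)
  also have "\<dots> < \<top>" using fin by (simp add: ennreal_mult_less_top)
  finally have sumfin: "(\<Sum>k. f (R k)) < \<top>" .
  define g where "g k = enn2real (f (R k))" for k
  have "f (R k) < \<top>" for k
    using fin mono[of "R k" X] by (auto simp: R_def intro: le_less_trans)
  then have g: "f (R k) = ennreal (g k)" and g0: "0 \<le> g k" for k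
    by (auto simp: g_def)
  have gsum: "summable g"
    using sumfin g g0 by (intro summable_suminf_not_top) auto
  have XC: "f (X - C) \<le> f (D n) + (\<Sum>k. f (R (k + n)))" for n
  proof -
    have "X - C \<subseteq> D n \<union> (\<Union>k. R (k + n))"
    proof
      fix x assume x: "x \<in> X - C"
      then have pos: "0 < infdist x C"
        using C ne by (simp add: infdist_pos_not_in_closed)
      show "x \<in> D n \<union> (\<Union>k. R (k + n))"
      proof (cases "1 / real (Suc n) \<le> infdist x C")
        case True
        then show ?thesis using x by (simp add: D_def)
      next
        case False
        define m where "m = (LEAST m. 1 / real (Suc m) \<le> infdist x C)"
        have ex: "\<exists>m. 1 / real (Suc m) \<le> infdist x C"
          using reals_Archimedean[OF pos] by (auto simp: inverse_eq_divide intro: less_imp_le)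
        then have m: "1 / real (Suc m) \<le> infdist x C"
          unfolding m_def by (rule LeastI_ex)
        have "n < m"
        proof (rule ccontr)
          assume "\<not> n < m"
          then have "1 / real (Suc n) \<le> 1 / real (Suc m)"
            by (intro divide_left_mono) auto
          with m False show False by linarith
        qed
        moreover have "\<not> 1 / real (Suc (m - 1)) \<le> infdist x C"
          unfolding m_def by (rule not_less_Least) (use \<open>n < m\<close> in \<open>simp add: m_def\<close>)
        ultimately have "x \<in> R ((m - 1 - n) + n)"
          using m x by (auto simp: R_def not_le Suc_diff_Suc)
        then show ?thesis by blast
      qed
    qed
    then have "f (X - C) \<le> f (D n \<union> (\<Union>k. R (k + n)))" by (rule mono)
    also have "\<dots> \<le> f (D n) + f (\<Union>k. R (k + n))" by (rule outer_measure_leD(4)[OF oms])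
    also have "\<dots> \<le> f (D n) + (\<Sum>k. f (R (k + n)))"
      by (intro add_left_mono outer_measure_leD(3)[OF oms])
    finally show ?thesis .
  qed
  show ?thesis
  proof (rule ennreal_le_epsilon)
    fix e :: real assume e: "0 < e"
    obtain n where n: "norm (\<Sum>k. g (k + n)) < e"
      using suminf_exist_split[OF e gsum] by blast
    have "(\<Sum>k. f (R (k + n))) = ennreal (\<Sum>k. g (k + n))"
      unfolding g using gsum g0 by (intro suminf_ennreal2) (auto simp: summable_iff_shift)
    also have "\<dots> \<le> ennreal e"
      using n by (intro ennreal_leI) auto
    finally have tail: "(\<Sum>k. f (R (k + n))) \<le> ennreal e" .
    have "f (D n) + f (X \<inter> C) \<le> f (D n \<union> (X \<inter> C))"
      by (rule sepd[of 0 "1 / real (Suc n)"]) (auto simp: D_def)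
    also have "\<dots> \<le> f X" by (rule mono) (auto simp: D_def)
    finally have DC: "f (D n) + f (X \<inter> C) \<le> f X" .
    have "f (X \<inter> C) + f (X - C) \<le> f (X \<inter> C) + (f (D n) + ennreal e)"
      using XC[of n] tail by (meson add_left_mono order_trans)
    also have "\<dots> \<le> f X + ennreal e"
      using DC by (metis add.assoc add.commute add_right_mono)
    finally show "f (X \<inter> C) + f (X - C) \<le> f X + ennreal e" .
  qed
qed

lemma metric_outer_measure_space:
  fixes f :: "'a::metric_space set \<Rightarrow> ennreal"
  assumes oms: "outer_measure_space UNIV f"
    and sep: "\<And>A B d. \<lbrakk>0 < d; \<And>x y. x \<in> A \<Longrightarrow> y \<in> B \<Longrightarrow> d \<le> dist x y\<rbrakk> \<Longrightarrow> f A + f B \<le> f (A \<union> B)"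
  shows "measure_space UNIV (sets borel) f"
proof -
  let ?L = "lambda_system UNIV UNIV f"
  interpret P: sigma_algebra UNIV "UNIV :: 'a set set"
    using sigma_algebra_Pow[of "UNIV :: 'a set"] by simp
  have L: "measure_space UNIV ?L f"
    by (rule P.caratheodory_lemma[OF oms])
  then interpret L: sigma_algebra UNIV ?L by (simp add: measure_space_def)
  have "C \<in> ?L" if "closed C" for C
  proof -
    have "f (X \<inter> C) + f (X - C) = f X" for X
    proof (rule antisym)
      show "f (X \<inter> C) + f (X - C) \<le> f X"
        by (rule metric_outer_closed[OF oms _ that]) (rule sep)
      show "f X \<le> f (X \<inter> C) + f (X - C)"
        using outer_measure_leD(4)[OF oms, of "X \<inter> C" "X - C"] by (simp add: Int_Diff_Un)
    qed
    then show ?thesis by (simp add: P.lambda_system_eq)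
  qed
  then have "sigma_sets UNIV (Collect closed) \<subseteq> ?L"
    by (intro L.sigma_sets_subset) auto
  then have sub: "sets borel \<subseteq> ?L"
    by (simp add: borel_eq_closed)
  then show ?thesis
    using L sets.sigma_algebra_axioms[of "borel :: 'a measure"]
    unfolding measure_space_def positive_def countably_additive_def by auto
qed

lemma hausdorff_pre_mono: "A \<subseteq> B \<Longrightarrow> hausdorff_pre s \<delta> A \<le> hausdorff_pre s \<delta> B"
  unfolding hausdorff_pre_def by (rule INF_superset_mono) auto

lemma hausdorff_pre_empty: "0 \<le> \<delta> \<Longrightarrow> hausdorff_pre s \<delta> {} = 0"
  unfolding hausdorff_pre_def
  by (rule antisym, rule INF_lower2[of "\<lambda>_. {}"]) (auto simp: hausdorff_term_def)

lemma hausdorff_pre_antimono: "\<delta> \<le> \<epsilon> \<Longrightarrow> hausdorff_pre s \<epsilon> A \<le> hausdorff_pre s \<delta> A"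
  unfolding hausdorff_pre_def by (rule INF_superset_mono) (auto intro: order.trans)

lemma hausdorff_pre_less:
  assumes "hausdorff_pre s \<delta> A < c"
  obtains U where "A \<subseteq> (\<Union>i. U i)" "\<And>i :: nat. bounded (U i)" "\<And>i. diameter (U i) \<le> \<delta>"
    "(\<Sum>i. hausdorff_term s (U i)) < c"
  using assms unfolding hausdorff_pre_def INF_less_iff by auto

lemma hausdorff_pre_subadditive:
  "hausdorff_pre s \<delta> (\<Union>n :: nat. A n) \<le> (\<Sum>n. hausdorff_pre s \<delta> (A n))"
proof (rule ennreal_le_epsilon)
  fix e :: real assume e: "0 < e" and "(\<Sum>n. hausdorff_pre s \<delta> (A n)) < \<top>"
  then have *: "hausdorff_pre s \<delta> (A n) < hausdorff_pre s \<delta> (A n) + e * (1 / 2) ^ Suc n" for n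
    by (auto simp add: less_top dest!: ennreal_suminf_lessD)
  have "\<exists>U. A n \<subseteq> (\<Union>i. U i) \<and> (\<forall>i :: nat. bounded (U i) \<and> diameter (U i) \<le> \<delta>) \<and>
      (\<Sum>i. hausdorff_term s (U i)) \<le> hausdorff_pre s \<delta> (A n) + e * (1 / 2) ^ Suc n" for n
    by (rule hausdorff_pre_less[OF *[of n]]) (metis less_imp_le)
  then obtain U where U: "\<And>n. A n \<subseteq> (\<Union>i. U n i)"
      "\<And>n i :: nat. bounded (U n i) \<and> diameter (U n i) \<le> \<delta>"
      "\<And>n. (\<Sum>i. hausdorff_term s (U n i)) \<le> hausdorff_pre s \<delta> (A n) + e * (1 / 2) ^ Suc n"
    by metis
  define V where "V = case_prod U o prod_decode"
  have "(\<Union>n. A n) \<subseteq> (\<Union>i. V i)"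
    using U(1) by (auto simp add: V_def subset_eq) (metis prod.case prod_encode_inverse)
  then have "hausdorff_pre s \<delta> (\<Union>n. A n) \<le> (\<Sum>i. hausdorff_term s (V i))"
    unfolding hausdorff_pre_def using U(2) by (intro INF_lower) (auto simp: V_def split_beta)
  also have "\<dots> = (\<Sum>i. (\<lambda>(m, n). hausdorff_term s (U m n)) (prod_decode i))"
    by (simp add: V_def split_beta)
  also have "\<dots> = (\<Sum>n. \<Sum>i. hausdorff_term s (U n i))"
    using suminf_ennreal_2dimen[of "\<lambda>n. \<Sum>i. hausdorff_term s (U n i)"
        "\<lambda>(m, n). hausdorff_term s (U m n)"] by (simp add: comp_def)
  also have "\<dots> \<le> (\<Sum>n. hausdorff_pre s \<delta> (A n) + e * (1 / 2) ^ Suc n)"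
    by (intro suminf_le U summableI)
  also have "\<dots> = (\<Sum>n. hausdorff_pre s \<delta> (A n)) + (\<Sum>n. ennreal e * ennreal ((1 / 2) ^ Suc n))"
    using e by (subst suminf_add[symmetric])
      (auto simp del: ennreal_suminf_cmult simp add: ennreal_mult[symmetric])
  also have "\<dots> = (\<Sum>n. hausdorff_pre s \<delta> (A n)) + e"
    unfolding ennreal_suminf_cmult
    by (subst suminf_ennreal_eq[OF zero_le_power power_half_series]) auto
  finally show "hausdorff_pre s \<delta> (\<Union>n. A n) \<le> (\<Sum>n. hausdorff_pre s \<delta> (A n)) + e" .
qed

lemma outer_measure_space_hausdorff_outer:
  "outer_measure_space UNIV (hausdorff_outer s :: 'a::metric_space set \<Rightarrow> ennreal)"
  unfolding outer_measure_space_def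
proof (intro conjI)
  show "positive UNIV (hausdorff_outer s)"
    by (auto simp: positive_def hausdorff_outer_def hausdorff_pre_empty)
  show "increasing UNIV (hausdorff_outer s)"
    unfolding increasing_def hausdorff_outer_def
    by (intro ballI impI SUP_mono) (use hausdorff_pre_mono in blast)
  show "countably_subadditive UNIV (hausdorff_outer s :: 'a set \<Rightarrow> ennreal)"
    unfolding countably_subadditive_def
  proof safe
    fix A :: "nat \<Rightarrow> 'a set"
    show "hausdorff_outer s (\<Union>i. A i) \<le> (\<Sum>i. hausdorff_outer s (A i))"
      unfolding hausdorff_outer_def[of s "\<Union>i. A i"]
    proof (rule SUP_least)
      fix \<delta> :: real assume "\<delta> \<in> {0<..}"
      then have "hausdorff_pre s \<delta> (A i) \<le> hausdorff_outer s (A i)" for i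
        unfolding hausdorff_outer_def by (rule SUP_upper)
      then have "(\<Sum>i. hausdorff_pre s \<delta> (A i)) \<le> (\<Sum>i. hausdorff_outer s (A i))"
        by (intro suminf_le summableI)
      then show "hausdorff_pre s \<delta> (\<Union>i. A i) \<le> (\<Sum>i. hausdorff_outer s (A i))"
        using hausdorff_pre_subadditive order.trans by blast
    qed
  qed
qed

lemma hausdorff_pre_separated:
  fixes A B :: "'a::metric_space set"
  assumes sep: "\<And>x y. x \<in> A \<Longrightarrow> y \<in> B \<Longrightarrow> d \<le> dist x y" and \<delta>: "0 < \<delta>" "\<delta> < d"
  shows "hausdorff_pre s \<delta> A + hausdorff_pre s \<delta> B \<le> hausdorff_pre s \<delta> (A \<union> B)"
  unfolding hausdorff_pre_def[of s \<delta> "A \<union> B"]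
proof (rule INF_greatest, clarify)
  fix U :: "nat \<Rightarrow> 'a set"
  assume cov: "A \<union> B \<subseteq> (\<Union>i. U i)" and U: "\<forall>i. bounded (U i) \<and> diameter (U i) \<le> \<delta>"
  define V where "V S i = (if U i \<inter> S = {} then {} else U i)" for S i
  have le: "hausdorff_pre s \<delta> S \<le> (\<Sum>i. hausdorff_term s (V S i))" if "S \<subseteq> A \<union> B" for S
    unfolding hausdorff_pre_def
  proof (rule INF_lower, safe)
    fix x assume "x \<in> S"
    with that cov obtain i where "x \<in> U i" by blast
    with \<open>x \<in> S\<close> have "x \<in> V S i" by (auto simp: V_def)
    then show "x \<in> (\<Union>i. V S i)" by blast
  qed (use U \<delta> in \<open>auto simp: V_def\<close>)
  have "hausdorff_term s (V A i) + hausdorff_term s (V B i) \<le> hausdorff_term s (U i)" for i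
  proof (cases "U i \<inter> A = {} \<or> U i \<inter> B = {}")
    case True
    then show ?thesis by (auto simp: V_def hausdorff_term_def)
  next
    case False
    then obtain x y where "x \<in> U i" "x \<in> A" "y \<in> U i" "y \<in> B" by blast
    with sep U have "d \<le> diameter (U i)"
      by (meson diameter_bounded_bound order.trans)
    with U \<delta> have False by (metis linorder_not_le order.trans)
    then show ?thesis ..
  qed
  then have "(\<Sum>i. hausdorff_term s (V A i)) + (\<Sum>i. hausdorff_term s (V B i))
      \<le> (\<Sum>i. hausdorff_term s (U i))"
    by (subst suminf_add) (auto intro!: suminf_le summableI)
  moreover have "hausdorff_pre s \<delta> A + hausdorff_pre s \<delta> B
      \<le> (\<Sum>i. hausdorff_term s (V A i)) + (\<Sum>i. hausdorff_term s (V B i))"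
    by (intro add_mono le) auto
  ultimately show "hausdorff_pre s \<delta> A + hausdorff_pre s \<delta> B \<le> (\<Sum>i. hausdorff_term s (U i))"
    by order
qed

lemma hausdorff_outer_separated:
  assumes d: "0 < d" and sep: "\<And>x y. x \<in> A \<Longrightarrow> y \<in> B \<Longrightarrow> d \<le> dist x y"
  shows "hausdorff_outer s A + hausdorff_outer s B \<le> hausdorff_outer s (A \<union> B)"
proof -
  have "hausdorff_pre s \<delta> A + hausdorff_pre s \<epsilon> B \<le> hausdorff_outer s (A \<union> B)"
    if "0 < \<delta>" "0 < \<epsilon>" for \<delta> \<epsilon>
  proof -
    define \<eta> where "\<eta> = min (d / 2) (min \<delta> \<epsilon>)"
    have \<eta>: "0 < \<eta>" "\<eta> < d" "\<eta> \<le> \<delta>" "\<eta> \<le> \<epsilon>" using d that by (auto simp: \<eta>_def)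
    have "hausdorff_pre s \<delta> A + hausdorff_pre s \<epsilon> B \<le> hausdorff_pre s \<eta> A + hausdorff_pre s \<eta> B"
      by (intro add_mono hausdorff_pre_antimono \<eta>)
    also have "\<dots> \<le> hausdorff_pre s \<eta> (A \<union> B)"
      using hausdorff_pre_separated[OF sep \<eta>(1,2)] by blast
    also have "\<dots> \<le> hausdorff_outer s (A \<union> B)"
      unfolding hausdorff_outer_def using \<eta> by (intro SUP_upper) auto
    finally show ?thesis .
  qed
  then have "hausdorff_pre s \<delta> A + hausdorff_outer s B \<le> hausdorff_outer s (A \<union> B)" if "0 < \<delta>" for \<delta>
    unfolding hausdorff_outer_def[of s B] using that
    by (subst ennreal_SUP_add_right) (auto intro!: SUP_least)
  then show ?thesis
    unfolding hausdorff_outer_def[of s A]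
    by (subst ennreal_SUP_add_left[symmetric]) (auto intro!: SUP_least)
qed

lemma emeasure_hausdorff_measure:
  "A \<in> sets borel \<Longrightarrow> emeasure (hausdorff_measure s) A = hausdorff_outer s A"
proof -
  assume A: "A \<in> sets borel"
  have "measure_space UNIV (sets borel) (hausdorff_outer s :: 'a set \<Rightarrow> ennreal)"
    by (rule metric_outer_measure_space[OF outer_measure_space_hausdorff_outer])
       (rule hausdorff_outer_separated)
  then show ?thesis
    using A unfolding hausdorff_measure_def
    by (intro emeasure_measure_of_sigma) (auto simp: measure_space_def)
qed

section \<open>Convex bodies, circumscribed polytopes and the convex order\<close>

definition convex_body :: "'a::euclidean_space set \<Rightarrow> bool" where
  "convex_body K \<longleftrightarrow> compact K \<and> convex K \<and> interior K \<noteq> {}"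

definition surface_measure :: "'a::euclidean_space measure" where
  "surface_measure = hausdorff_measure (DIM('a) - 1)"

text \<open>A sphere is tangent to a facet if it meets the hyperplane spanned by the facet in exactly
  one point, and that point belongs to the facet.\<close>

definition inscribed_sphere :: "'a::euclidean_space \<Rightarrow> real \<Rightarrow> 'a set \<Rightarrow> bool" where
  "inscribed_sphere c r K \<longleftrightarrow>
     0 < r \<and> sphere c r \<subseteq> K \<and>
     (\<forall>F. F facet_of K \<longrightarrow> (\<exists>p\<in>F. sphere c r \<inter> affine hull F = {p}))"

text \<open>As the Bochner integral of a non-integrable function is \<open>0\<close>, both expectations are
  required to exist. For essentially bounded random vectors they always do.\<close>

definition convex_order_le ::
    "'w measure \<Rightarrow> ('w \<Rightarrow> 'a::euclidean_space) \<Rightarrow> 'v measure \<Rightarrow> ('v \<Rightarrow> 'a) \<Rightarrow> bool" where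
  "convex_order_le M X N Y \<longleftrightarrow>
     (\<forall>\<phi> :: 'a \<Rightarrow> real. convex_on UNIV \<phi> \<longrightarrow>
        integrable M (\<lambda>w. \<phi> (X w)) \<and> integrable N (\<lambda>v. \<phi> (Y v)) \<and>
        (\<integral>w. \<phi> (X w) \<partial>M) \<le> (\<integral>v. \<phi> (Y v) \<partial>N))"

end

theory Submission
  imports Defs "HOL-Analysis.Analysis" "HOL-Probability.Probability"
begin

text \<open>
  Circumscribed polytopes: all facets have the same distance from the centre \<open>O\<close>, so the cone with
  apex \<open>O\<close> over a part of the boundary has volume proportional to the surface measure of that part.
  Hence the radial projection of \<open>I\<close> to the boundary has the law of \<open>B\<close>. Since the dilations of a centred
  random point increase in the convex order, the mean of a convex function over a thin shell inside
  the boundary is at least its mean over \<open>K\<close>; the shell may be replaced by the projected points in the limit.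

  Planar bodies: up to an arbitrarily small error on the boundary, a convex function is dominated on \<open>K\<close>
  by an affine function plus a nonnegative combination of functions \<open>max 0 (a \<bullet> x + b)\<close> that
  interpolates it at the vertices of a polygon. As the means agree, it suffices to compare the expectations of
  \<open>max 0 (X - a)\<close> for a coordinate \<open>X\<close>. Their difference vanishes outside the range of \<open>X\<close>. At an interior
  minimum \<open>a\<close> of the difference, \<open>B\<close> lies beyond \<open>a\<close> with at least the probability of \<open>I\<close>. The width of \<open>K\<close> at
  abscissa \<open>x\<close> is concave in \<open>x\<close>, so it is nonincreasing to the right of \<open>a\<close> or nondecreasing to the left of \<open>a\<close>,
  and on such a side the centroid of the boundary arc is at least as far from the line \<open>X = a\<close> as
  the centroid of the cap, because the slopes of the boundary are monotone. Hence the difference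
  is nonnegative at its minimum.
\<close>

section \<open>Hausdorff measure and Lebesgue measure\<close>

text \<open>For polytopes the Hausdorff measure of a facet is never computed: translation invariance
  makes it proportional to the volume of the cone over it, and reflections show that the factor is
  the same for all facet normals, so it cancels in the normalised law. In the plane the actual
  length matters, since \<open>cap_length_ge\<close> bounds an arc below by a chord of
  \<open>K\<close>. A convex function of two variables is in general not a finite nonnegative
  combination of functions \<open>max 0 (a \<bullet> x + b)\<close> plus an affine one:
  \<open>max 0 (max x y)\<close> has creases along half-lines only. Such a combination is therefore
  sought above \<open>\<phi>\<close> on \<open>K\<close> and almost equal to it on the frontier,
  which suffices because \<open>B\<close> lives there. The boundary slopes may blow up at the
  extreme abscissae. Arcs are therefore truncated, and the missing end is estimated through its
  position and its length, which is at least the width at the cut. The boundary need not be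
  differentiable: superderivatives are selected, and integral formulas follow because an additive
  interval function bounded by interval length times an increment vanishes
  (\<open>additive_increments_zero\<close>).\<close>

lemma hausdorff_pre_lipschitz_image:
  fixes f :: "'a::metric_space \<Rightarrow> 'b::metric_space"
  assumes L: "0 < L" and lip: "\<And>x y. x \<in> A \<Longrightarrow> y \<in> A \<Longrightarrow> dist (f x) (f y) \<le> L * dist x y"
  shows "hausdorff_pre s (L * \<delta>) (f ` A) \<le> ennreal (L ^ s) * hausdorff_pre s \<delta> A"
proof -
  have le: "hausdorff_pre s (L * \<delta>) (f ` A) \<le> ennreal (L ^ s) * (\<Sum>i. hausdorff_term s (U i))"
    if cov: "A \<subseteq> (\<Union>i. U i)" and U: "\<And>i. bounded (U i) \<and> diameter (U i) \<le> \<delta>"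
    for U :: "nat \<Rightarrow> 'a set"
  proof -
    \<comment> \<open>Intersecting with \<open>A\<close> first matters: \<open>f\<close> is
      Lipschitz on \<open>A\<close> only, and \<open>U i\<close> may stick out.\<close>
    define V where "V i = f ` (U i \<inter> A)" for i
    have d0: "0 \<le> diameter (U i)" for i using U diameter_ge_0 by blast
    have VV: "dist a b \<le> L * diameter (U i)" if "a \<in> V i" "b \<in> V i" for a b i
    proof -
      obtain x y where "x \<in> U i" "x \<in> A" "a = f x" "y \<in> U i" "y \<in> A" "b = f y"
        using \<open>a \<in> V i\<close> \<open>b \<in> V i\<close> unfolding V_def by blast
      then show ?thesis
        using lip[of x y] diameter_bounded_bound[of "U i" x y] U[of i] L
        by (meson mult_left_mono order.trans less_imp_le)
    qed
    have bV: "bounded (V i)" for i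
      unfolding bounded_two_points using VV by blast
    have dV: "diameter (V i) \<le> L * diameter (U i)" for i
      unfolding diameter_def[of "V i"] using VV d0[of i] L by (auto intro!: cSUP_least)
    have le_i: "hausdorff_term s (V i) \<le> ennreal (L ^ s) * hausdorff_term s (U i)" for i
    proof (cases "V i = {}")
      case True then show ?thesis by (simp add: hausdorff_term_def)
    next
      case False
      then have "U i \<noteq> {}" by (auto simp: V_def)
      have "unit_ball_vol (real s) * (diameter (V i) / 2) ^ s
          \<le> unit_ball_vol (real s) * (L * diameter (U i) / 2) ^ s"
        using dV[of i] bV[of i] by (intro mult_left_mono power_mono) (auto simp: diameter_ge_0)
      also have "\<dots> = L ^ s * (unit_ball_vol (real s) * (diameter (U i) / 2) ^ s)"
        by (simp add: power_mult_distrib power_divide)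
      finally show ?thesis using False \<open>U i \<noteq> {}\<close> L d0[of i]
        by (simp add: hausdorff_term_def ennreal_mult[symmetric])
    qed
    have "f ` A \<subseteq> (\<Union>i. V i)" using cov unfolding V_def by blast
    moreover have "\<forall>i. bounded (V i) \<and> diameter (V i) \<le> L * \<delta>"
      using bV dV U L by (meson mult_left_mono order.trans less_imp_le)
    ultimately have "hausdorff_pre s (L * \<delta>) (f ` A) \<le> (\<Sum>i. hausdorff_term s (V i))"
      unfolding hausdorff_pre_def by (intro INF_lower) auto
    also have "\<dots> \<le> (\<Sum>i. ennreal (L ^ s) * hausdorff_term s (U i))"
      by (intro suminf_le summableI le_i)
    finally show ?thesis by simp
  qed
  have c: "ennreal (L ^ s) \<noteq> 0" "ennreal (L ^ s) \<noteq> \<top>" using L by auto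
  have "hausdorff_pre s (L * \<delta>) (f ` A) / ennreal (L ^ s) \<le> hausdorff_pre s \<delta> A"
    unfolding hausdorff_pre_def[of s \<delta>]
  proof (rule INF_greatest, clarify)
    fix U :: "nat \<Rightarrow> 'a set"
    assume "A \<subseteq> (\<Union>i. U i)" "\<forall>i. bounded (U i) \<and> diameter (U i) \<le> \<delta>"
    then show "hausdorff_pre s (L * \<delta>) (f ` A) / ennreal (L ^ s) \<le> (\<Sum>i. hausdorff_term s (U i))"
      using le[of U] c by (subst divide_le_posI_ennreal) (auto simp: mult.commute zero_less_iff_neq_zero)
  qed
  then have "hausdorff_pre s (L * \<delta>) (f ` A) / ennreal (L ^ s) * ennreal (L ^ s)
      \<le> hausdorff_pre s \<delta> A * ennreal (L ^ s)" by (rule mult_right_mono) simp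
  moreover have cc: "x / c * c = x" if "c \<noteq> 0" "c \<noteq> \<top>" for x c :: ennreal
    using ennreal_mult_divide_eq[OF that, of x] by (simp add: ennreal_divide_times ennreal_times_divide)
  ultimately show ?thesis unfolding cc[OF c] by (simp add: mult.commute)
qed

lemma hausdorff_outer_lipschitz_image:
  fixes f :: "'a::metric_space \<Rightarrow> 'b::metric_space"
  assumes L: "0 < L" and lip: "\<And>x y. x \<in> A \<Longrightarrow> y \<in> A \<Longrightarrow> dist (f x) (f y) \<le> L * dist x y"
  shows "hausdorff_outer s (f ` A) \<le> ennreal (L ^ s) * hausdorff_outer s A"
  unfolding hausdorff_outer_def[of s "f ` A"]
proof (rule SUP_least)
  fix \<delta> :: real assume "\<delta> \<in> {0<..}"
  then have "hausdorff_pre s (L * (\<delta> / L)) (f ` A) \<le> ennreal (L ^ s) * hausdorff_pre s (\<delta> / L) A"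
    by (intro hausdorff_pre_lipschitz_image L lip)
  also have "\<dots> \<le> ennreal (L ^ s) * hausdorff_outer s A"
    unfolding hausdorff_outer_def using L \<open>\<delta> \<in> {0<..}\<close> by (intro mult_left_mono SUP_upper) auto
  finally show "hausdorff_pre s \<delta> (f ` A) \<le> ennreal (L ^ s) * hausdorff_outer s A"
    using L by simp
qed

lemma hausdorff_outer_isometry:
  fixes f :: "'a::metric_space \<Rightarrow> 'b::metric_space"
  assumes iso: "\<And>x y. x \<in> A \<Longrightarrow> y \<in> A \<Longrightarrow> dist (f x) (f y) = dist x y"
  shows "hausdorff_outer s (f ` A) = hausdorff_outer s A"
proof (rule antisym)
  show "hausdorff_outer s (f ` A) \<le> hausdorff_outer s A"
    using hausdorff_outer_lipschitz_image[of 1 A f s] iso by simp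
  have inj: "inj_on f A"
    by (rule inj_onI) (use iso in \<open>metis dist_eq_0_iff\<close>)
  have "hausdorff_outer s (inv_into A f ` f ` A) \<le> ennreal (1 ^ s) * hausdorff_outer s (f ` A)"
    by (rule hausdorff_outer_lipschitz_image) (auto simp: inj iso)
  then show "hausdorff_outer s A \<le> hausdorff_outer s (f ` A)"
    using inj by simp
qed

lemma emeasure_hausdorff_isometry:
  fixes f :: "'a::metric_space \<Rightarrow> 'b::metric_space"
  assumes "\<And>x y. dist (f x) (f y) = dist x y" "A \<in> sets borel" "f ` A \<in> sets borel"
  shows "emeasure (hausdorff_measure s) (f ` A) = emeasure (hausdorff_measure s) A"
  using assms by (simp add: emeasure_hausdorff_measure hausdorff_outer_isometry)

lemma hausdorff_outer_Icc_le:
  fixes s t :: real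
  assumes "s \<le> t"
  shows "hausdorff_outer 1 {s..t} \<le> ennreal (t - s)"
  unfolding hausdorff_outer_def
proof (rule SUP_least)
  fix \<delta> :: real assume "\<delta> \<in> {0<..}" then have \<delta>: "0 < \<delta>" by simp
  \<comment> \<open>\<open>n\<close> pieces of length \<open>h \<le> \<delta>\<close> cover the
    interval; since \<open>unit_ball_vol 1 = 2\<close>, a piece contributes exactly its length
    \<open>h\<close>.\<close>
  obtain n :: nat where n: "(t - s) / \<delta> < real n" using reals_Archimedean2 by blast
  have n0: "0 < n"
    using n assms \<delta> by (metis divide_nonneg_pos diff_ge_0_iff_ge gr0I not_less of_nat_0)
  define h where "h = (t - s) / n"
  have h: "0 \<le> h" "h \<le> \<delta>" "n * h = t - s"
    using n n0 assms \<delta> by (auto simp: h_def field_simps)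
  define U where "U i = (if i < n then {s + i * h .. s + (i + 1) * h} else {})" for i :: nat
  have dU: "diameter (U i) = (if i < n then h else 0)" for i
    using h by (auto simp: U_def diameter_closed_interval algebra_simps)
  have "{s..t} \<subseteq> (\<Union>i. U i)"
  proof
    fix x assume x: "x \<in> {s..t}"
    show "x \<in> (\<Union>i. U i)"
    \<comment> \<open>The floor formula would give index \<open>n\<close> to the right end
      \<open>t\<close>, so \<open>t\<close> is put into the last piece; \<open>h = 0\<close> is the
      one-point interval.\<close>
    proof (cases "x = t \<or> h = 0")
      case True
      then have "x \<in> U (n - 1)"
        using n0 h x by (auto simp: U_def algebra_simps of_nat_diff)
      then show ?thesis by blast
    next
      case False
      then have hp: "0 < h" using h by simp
      define i where "i = nat \<lfloor>(x - s) / h\<rfloor>"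
      have "real i \<le> (x - s) / h" "(x - s) / h < real i + 1"
        using x hp by (auto simp: i_def of_nat_nat)
      then have i: "real i * h \<le> x - s" "x - s < (real i + 1) * h"
        using hp by (auto simp: field_simps)
      have "real i * h < n * h" using i(1) x False h by auto
      then have "i < n" using hp by simp
      then have "x \<in> U i" using i by (auto simp: U_def algebra_simps)
      then show ?thesis by blast
    qed
  qed
  then have "hausdorff_pre 1 \<delta> {s..t} \<le> (\<Sum>i. hausdorff_term 1 (U i))"
    unfolding hausdorff_pre_def using dU h \<delta> by (intro INF_lower) (auto simp: U_def)
  also have "\<dots> = (\<Sum>i<n. hausdorff_term 1 (U i))"
    by (rule suminf_finite) (auto simp: U_def hausdorff_term_def)
  also have "\<dots> = (\<Sum>i<n. ennreal h)"
  proof (rule sum.cong[OF refl])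
    fix i assume i: "i \<in> {..<n}"
    then have "s + i * h \<in> U i" using h by (auto simp: U_def algebra_simps)
    then show "hausdorff_term 1 (U i) = ennreal h"
      using dU[of i] i by (auto simp: hausdorff_term_def unit_ball_vol_1)
  qed
  also have "\<dots> = ennreal (t - s)"
    using h by (simp add: ennreal_of_nat_eq_real_of_nat ennreal_mult'[symmetric])
  finally show "hausdorff_pre 1 \<delta> {s..t} \<le> ennreal (t - s)" .
qed

text \<open>Each covering set is enlarged to the interval between its infimum and supremum, whose
  Lebesgue measure is at most the diameter of the set; then countable subadditivity of Lebesgue
  measure applies. A single value of \<open>\<delta>\<close> bounds the supremum from below.\<close>

lemma hausdorff_outer_Icc_ge:
  fixes s t :: real
  assumes "{s..t} \<subseteq> A"
  shows "ennreal (t - s) \<le> hausdorff_outer 1 A"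
proof (cases "s \<le> t")
  case False then show ?thesis by (simp add: ennreal_neg)
next
  case st: True
  have "ennreal (t - s) \<le> hausdorff_pre 1 1 A"
    unfolding hausdorff_pre_def
  proof (rule INF_greatest, clarify)
    fix U :: "nat \<Rightarrow> real set"
    assume cov: "A \<subseteq> (\<Union>i. U i)" and U: "\<forall>i. bounded (U i) \<and> diameter (U i) \<le> 1"
    define V where "V i = (if U i = {} then {} else {Inf (U i)..Sup (U i)})" for i
    have UV: "U i \<subseteq> V i" for i
      using U bounded_imp_bdd_above bounded_imp_bdd_below
      by (auto simp: V_def intro!: cInf_lower cSup_upper)
    have VT: "emeasure lborel (V i) \<le> hausdorff_term 1 (U i)" for i
    proof (cases "U i = {}")
      case False
      have "Sup (U i) - Inf (U i) \<le> diameter (U i)"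
      proof -
        have "x - y \<le> diameter (U i)" if "x \<in> U i" "y \<in> U i" for x y
          using diameter_bounded_bound[of "U i" x y] U that by (auto simp: dist_real_def)
        then have "x \<le> diameter (U i) + Inf (U i)" if "x \<in> U i" for x
          using that False by (metis cInf_greatest diff_le_eq le_diff_eq add.commute)
        then have "Sup (U i) \<le> diameter (U i) + Inf (U i)"
          using False by (intro cSup_least)
        then show ?thesis by simp
      qed
      moreover have "Inf (U i) \<le> Sup (U i)"
        using False U by (intro cInf_le_cSup) (auto simp: bounded_imp_bdd_above bounded_imp_bdd_below)
      ultimately show ?thesis using False
        by (simp add: V_def hausdorff_term_def unit_ball_vol_1 ennreal_leI)
    qed (simp add: V_def)
    have "ennreal (t - s) = emeasure lborel {s..t}" using st by simp
    also have "\<dots> \<le> emeasure lborel (\<Union>i. V i)"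
    proof (intro emeasure_mono)
      show "{s..t} \<subseteq> (\<Union>i. V i)" using assms cov UV by (meson UN_mono order.trans subset_refl)
    qed (auto simp: V_def)
    also have "\<dots> \<le> (\<Sum>i. emeasure lborel (V i))"
      by (intro emeasure_subadditive_countably) (auto simp: V_def)
    also have "\<dots> \<le> (\<Sum>i. hausdorff_term 1 (U i))" by (intro suminf_le summableI VT)
    finally show "ennreal (t - s) \<le> (\<Sum>i. hausdorff_term 1 (U i))" .
  qed
  also have "\<dots> \<le> hausdorff_outer 1 A"
    unfolding hausdorff_outer_def by (intro SUP_upper) auto
  finally show ?thesis .
qed

section \<open>Invariant measures, reflections and shears\<close>

lemma translation_invariant_measure_unique:
  fixes \<mu> \<nu> :: "'a::euclidean_space measure"
  assumes [measurable_cong]: "sets \<mu> = sets borel" "sets \<nu> = sets borel"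
    and sf: "sigma_finite_measure \<mu>" "sigma_finite_measure \<nu>"
    and V: "subspace V"
    and null: "emeasure \<mu> (UNIV - V) = 0" "emeasure \<nu> (UNIV - V) = 0"
    and inv: "\<And>v. v \<in> V \<Longrightarrow> distr \<mu> borel (\<lambda>x. v + x) = \<mu>" "\<And>v. v \<in> V \<Longrightarrow> distr \<nu> borel (\<lambda>x. v + x) = \<nu>"
    and [measurable]: "A \<in> sets borel" "B \<in> sets borel"
  shows "emeasure \<mu> A * emeasure \<nu> B = emeasure \<nu> A * emeasure \<mu> (uminus -` B)"
proof -
  interpret M: sigma_finite_measure \<mu> by fact
  interpret N: sigma_finite_measure \<nu> by fact
  interpret MN: pair_sigma_finite \<mu> \<nu> ..
  have [measurable]: "V \<in> sets borel" using closed_subspace[OF V] by simp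
  have AE: "AE x in \<mu>. x \<in> V" "AE x in \<nu>. x \<in> V"
    using null by (auto intro!: AE_I[where N = "UNIV - V"])
  have int: "(\<integral>\<^sup>+x. g (v + x) \<partial>\<mu>) = (\<integral>\<^sup>+x. g x \<partial>\<mu>)" "(\<integral>\<^sup>+x. g (v + x) \<partial>\<nu>) = (\<integral>\<^sup>+x. g x \<partial>\<nu>)"
    if "v \<in> V" and [measurable]: "g \<in> borel_measurable borel" for g :: "'a \<Rightarrow> ennreal" and v
    using nn_integral_distr[of "\<lambda>x. v + x" \<mu> borel g] nn_integral_distr[of "\<lambda>x. v + x" \<nu> borel g]
      inv[OF that(1)] by auto
  \<comment> \<open>The uniqueness argument for Haar measure: integrate
    \<open>indicator B y * indicator A (y + x)\<close> in both orders. Translating \<open>x\<close>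
    by \<open>y\<close> gives the left-hand side; translating \<open>y\<close> by \<open>x\<close>
    and then \<open>x\<close> by \<open>y\<close> separates \<open>A\<close> from the reflected
    \<open>B\<close>.\<close>
  have "emeasure \<mu> A * emeasure \<nu> B = (\<integral>\<^sup>+y. indicator B y * (\<integral>\<^sup>+x. indicator A x \<partial>\<mu>) \<partial>\<nu>)"
    by (simp add: nn_integral_multc mult.commute)
  also have "\<dots> = (\<integral>\<^sup>+y. (\<integral>\<^sup>+x. indicator B y * indicator A (y + x) \<partial>\<mu>) \<partial>\<nu>)"
    using AE(2) by (intro nn_integral_cong_AE) (auto simp: int nn_integral_cmult elim!: eventually_mono)
  also have "\<dots> = (\<integral>\<^sup>+x. (\<integral>\<^sup>+y. indicator B y * indicator A (y + x) \<partial>\<nu>) \<partial>\<mu>)"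
    by (rule MN.Fubini') measurable
  also have "\<dots> = (\<integral>\<^sup>+x. (\<integral>\<^sup>+y. indicator B (y - x) * indicator A y \<partial>\<nu>) \<partial>\<mu>)"
  proof (rule nn_integral_cong_AE, use AE(1) in eventually_elim)
    fix x assume "x \<in> V"
    then show "(\<integral>\<^sup>+y. indicator B y * indicator A (y + x) \<partial>\<nu>)
        = (\<integral>\<^sup>+y. indicator B (y - x) * indicator A y \<partial>\<nu>)"
      using int(2)[of x "\<lambda>y. indicator B (y - x) * indicator A y"] by (simp add: add.commute)
  qed
  also have "\<dots> = (\<integral>\<^sup>+y. (\<integral>\<^sup>+x. indicator B (y - x) * indicator A y \<partial>\<mu>) \<partial>\<nu>)"
    by (rule MN.Fubini'[symmetric]) measurable
  also have "\<dots> = (\<integral>\<^sup>+y. indicator A y * (\<integral>\<^sup>+x. indicator (uminus -` B) x \<partial>\<mu>) \<partial>\<nu>)"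
  proof (rule nn_integral_cong_AE, use AE(2) in eventually_elim)
    fix y assume "y \<in> V"
    then have "(\<integral>\<^sup>+x. indicator B (y - x) \<partial>\<mu>) = (\<integral>\<^sup>+x. indicator (uminus -` B) x \<partial>\<mu>)"
      using int(1)[of y "\<lambda>x. indicator B (y - x)"] by (simp add: indicator_def)
    then show "(\<integral>\<^sup>+x. indicator B (y - x) * indicator A y \<partial>\<mu>)
        = indicator A y * (\<integral>\<^sup>+x. indicator (uminus -` B) x \<partial>\<mu>)"
      by (subst nn_integral_multc) (auto simp: mult.commute)
  qed
  also have "\<dots> = emeasure \<nu> A * (\<integral>\<^sup>+x. indicator (uminus -` B) x \<partial>\<mu>)"
    by (subst nn_integral_multc) auto
  also have "(\<integral>\<^sup>+x. indicator (uminus -` B) x \<partial>\<mu>) = emeasure \<mu> (uminus -` B)"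
    using measurable_sets_borel[of uminus borel B] by (intro nn_integral_indicator) auto
  finally show ?thesis .
qed

lemma sigma_finite_measureI_cball:
  fixes \<mu> :: "'a::euclidean_space measure"
  assumes sets: "sets \<mu> = sets borel" and fin: "\<And>k::nat. emeasure \<mu> (cball 0 (real k)) < \<top>"
  shows "sigma_finite_measure \<mu>"
proof
  have "(\<Union>k::nat. cball (0::'a) (real k)) = UNIV"
    using real_arch_simple by (auto simp: UN_iff)
  then have "countable (range (\<lambda>k::nat. cball (0::'a) (real k))) \<and>
      range (\<lambda>k::nat. cball (0::'a) (real k)) \<subseteq> sets \<mu> \<and>
      \<Union> (range (\<lambda>k::nat. cball (0::'a) (real k))) = space \<mu> \<and>
      (\<forall>a\<in>range (\<lambda>k::nat. cball (0::'a) (real k)). emeasure \<mu> a \<noteq> \<infinity>)"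
    using fin sets_eq_imp_space_eq[OF sets] by (auto simp: sets less_top)
  then show "\<exists>A. countable A \<and> A \<subseteq> sets \<mu> \<and> \<Union> A = space \<mu> \<and> (\<forall>a\<in>A. emeasure \<mu> a \<noteq> \<infinity>)"
    by blast
qed

lemma emeasure_lborel_unit_cball:
  obtains l where "0 < l" "emeasure lborel (cball 0 1 :: 'a::euclidean_space set) = ennreal l"
proof -
  have "emeasure lborel (cball 0 1 :: 'a set) < \<infinity>" by (rule emeasure_bounded_finite) simp
  then have "emeasure lborel (cball 0 1 :: 'a set) = ennreal (measure lborel (cball 0 1 :: 'a set))"
    by (simp add: emeasure_eq_ennreal_measure less_top)
  moreover have "0 < measure lborel (cball 0 1 :: 'a set)"
    using content_cball_pos[of 1 "0::'a"] by simp
  ultimately show thesis using that by blast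
qed

lemma sum_less_top_ennreal:
  fixes g :: "'b \<Rightarrow> ennreal"
  assumes "finite C" "\<And>y. y \<in> C \<Longrightarrow> g y < \<top>"
  shows "sum g C < \<top>"
  using assms by (induction C rule: finite_induct) auto

text \<open>The push-forward of Lebesgue measure under a linear bijection is again translation
  invariant, so uniqueness makes it a multiple of Lebesgue measure. Domain and range may be
  different spaces, as required for the coordinates in \<open>area_integral\<close>.\<close>

lemma lborel_linear_vimage:
  fixes L :: "'b::euclidean_space \<Rightarrow> 'a::euclidean_space"
  assumes lin: "linear L" and bij: "bij L"
  obtains c where "0 < c" "\<And>A. A \<in> sets borel \<Longrightarrow> emeasure lborel (L -` A) = ennreal c * emeasure lborel A"
proof -
  have [measurable]: "L \<in> borel_measurable borel"
    using lin linear_continuous_on linear_linear by (metis borel_measurable_continuous_onI)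
  define \<mu> where "\<mu> = distr lborel borel L"
  have sets\<mu>: "sets \<mu> = sets borel" by (simp add: \<mu>_def)
  have em: "emeasure \<mu> A = emeasure lborel (L -` A)" if "A \<in> sets borel" for A
    using that by (simp add: \<mu>_def emeasure_distr)
  obtain L' where L': "linear L'" "L' \<circ> L = id"
    using linear_injective_left_inverse[OF lin bij_is_inj[OF bij]] by blast
  have bd: "bounded (L -` S)" if "bounded S" for S
  proof -
    have "L -` S \<subseteq> L' ` S" using L'(2) by (auto simp: fun_eq_iff image_iff) (metis)
    moreover have "bounded (L' ` S)"
      using L'(1) that by (simp add: bounded_linear_image linear_linear)
    ultimately show ?thesis using bounded_subset by blast
  qed
  have fin: "emeasure \<mu> S < \<top>" if "S \<in> sets borel" "bounded S" for S
    using em[OF that(1)] emeasure_bounded_finite[OF bd[OF that(2)]] by (simp add: less_top)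
  have inv: "distr \<mu> borel (\<lambda>x. v + x) = \<mu>" for v
  proof -
    obtain w where w: "L w = v" using bij by (metis bij_pointE)
    have "distr \<mu> borel (\<lambda>x. v + x) = distr lborel borel (\<lambda>x. L (w + x))"
      unfolding \<mu>_def by (subst distr_distr) (auto simp: comp_def w[symmetric] linear_add[OF lin])
    also have "\<dots> = distr (distr lborel borel (\<lambda>x. w + x)) borel L"
      by (subst distr_distr) (auto simp: comp_def)
    finally show ?thesis by (simp add: \<mu>_def lborel_distr_plus)
  qed
  have haar: "emeasure \<mu> A * emeasure lborel (cball 0 1 :: 'a set)
      = emeasure lborel A * emeasure \<mu> (cball 0 1)" if "A \<in> sets borel" for A
  proof -
    have "emeasure \<mu> A * emeasure lborel (cball 0 1 :: 'a set)
        = emeasure lborel A * emeasure \<mu> (uminus -` cball 0 1)"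
    proof (rule translation_invariant_measure_unique[where V = UNIV])
      show "sigma_finite_measure \<mu>"
        by (rule sigma_finite_measureI_cball) (auto simp: fin \<mu>_def[symmetric] sets\<mu>)
    qed (use that inv lborel_distr_plus sigma_finite_lborel in \<open>auto simp: \<mu>_def\<close>)
    \<comment> \<open>The unit ball is symmetric, which removes the reflection left by the
      uniqueness lemma.\<close>
    also have "uminus -` cball 0 1 = (cball 0 1 :: 'a set)" by auto
    finally show ?thesis .
  qed
  obtain l where l0: "0 < l" and l: "emeasure lborel (cball 0 1 :: 'a set) = ennreal l"
    by (rule emeasure_lborel_unit_cball)
  define m where "m = measure \<mu> (cball 0 1 :: 'a set)"
  have m: "emeasure \<mu> (cball 0 1 :: 'a set) = ennreal m"
    using fin[of "cball 0 1"] by (simp add: m_def emeasure_eq_ennreal_measure less_top)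
  have m0: "0 < m"
  proof (rule ccontr)
    \<comment> \<open>With factor 0 the push-forward would be null, whereas its total mass is that
      of the whole domain, \<open>\<infinity>\<close>.\<close>
    assume "\<not> 0 < m"
    then have "m = 0" using measure_nonneg[of \<mu> "cball 0 1"] by (simp add: m_def)
    then have "emeasure \<mu> UNIV * ennreal l = 0"
      using haar[of UNIV] l m by simp
    then show False using em[of UNIV] l0 by (simp add: ennreal_eq_0_iff)
  qed
  have "emeasure lborel (L -` A) = ennreal (m / l) * emeasure lborel A" if A: "A \<in> sets borel" for A
  proof -
    have "emeasure \<mu> A = emeasure \<mu> A * ennreal l * ennreal (1 / l)"
      using l0 by (simp add: mult.assoc ennreal_mult'[symmetric])
    also have "\<dots> = emeasure lborel A * ennreal m * ennreal (1 / l)"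
      using haar[OF A] l m by simp
    also have "\<dots> = ennreal (m / l) * emeasure lborel A"
    proof -
      have "ennreal (m / l) = ennreal m * ennreal (1 / l)"
        using l0 m0 by (simp add: ennreal_mult[symmetric])
      then show ?thesis by (simp add: ac_simps)
    qed
    finally show ?thesis using em[OF A] by simp
  qed
  then show thesis using that[of "m / l"] l0 m0 by simp
qed

text \<open>A norm-preserving bijection maps the unit ball to itself, and the ball has positive
  finite volume, so the volume factor is 1.\<close>

lemma lborel_orthogonal_vimage:
  fixes R :: "'a::euclidean_space \<Rightarrow> 'a"
  assumes lin: "linear R" and inv: "\<And>x. R (R x) = x" and nrm: "\<And>x. norm (R x) = norm x"
    and A: "A \<in> sets borel"
  shows "emeasure lborel (R -` A) = emeasure lborel A"
proof -
  have "bij R" using inv by (metis bijI')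
  then obtain c where c: "0 < c"
      "\<And>A. A \<in> sets borel \<Longrightarrow> emeasure lborel (R -` A) = ennreal c * emeasure lborel A"
    using lborel_linear_vimage[OF lin] by blast
  have "R -` cball 0 1 = cball 0 1" using nrm by auto
  then have e: "emeasure lborel (cball 0 1 :: 'a set) = ennreal c * emeasure lborel (cball 0 1 :: 'a set)"
    using c(2)[of "cball 0 1"] by simp
  obtain l where l0: "0 < l" and l: "emeasure lborel (cball 0 1 :: 'a set) = ennreal l"
    by (rule emeasure_lborel_unit_cball)
  have "ennreal l = ennreal (c * l)" using e l l0 c(1) by (simp add: ennreal_mult)
  then have "l = c * l" using l0 c(1) by (subst (asm) ennreal_inj) auto
  then show ?thesis using c(2)[OF A] l0 by simp
qed

text \<open>The Householder reflection in the hyperplane orthogonal to \<open>d\<close>. For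
  \<open>d = 0\<close> division by zero makes it the identity, so that
  \<open>reflect_along_diff\<close> also covers equal vectors.\<close>

definition reflect_along :: "'a::euclidean_space \<Rightarrow> 'a \<Rightarrow> 'a" where
  "reflect_along d x = x - (2 * (x \<bullet> d) / (d \<bullet> d)) *\<^sub>R d"

lemma linear_reflect_along: "linear (reflect_along d)"
  by (rule linearI)
    (simp_all add: reflect_along_def inner_add_left distrib_left add_divide_distrib scaleR_add_left
      scaleR_diff_right mult.left_commute)

lemma inner_reflect_along_self: "reflect_along d x \<bullet> d = - (x \<bullet> d)"
  by (cases "d = 0") (simp_all add: reflect_along_def inner_diff_left)

lemma reflect_along_involution [simp]: "reflect_along d (reflect_along d x) = x"
  unfolding reflect_along_def[of d "reflect_along d x"] inner_reflect_along_self
  by (simp add: reflect_along_def)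

lemma inner_reflect_along [simp]: "reflect_along d x \<bullet> reflect_along d y = x \<bullet> y"
proof -
  have "reflect_along d x \<bullet> reflect_along d y
      = reflect_along d x \<bullet> y - (2 * (y \<bullet> d) / (d \<bullet> d)) * (reflect_along d x \<bullet> d)"
    by (subst (2) reflect_along_def) (simp add: inner_diff_right)
  also have "\<dots> = x \<bullet> y"
    unfolding inner_reflect_along_self
    by (simp add: reflect_along_def inner_diff_left inner_commute[of d y])
  finally show ?thesis .
qed

lemma norm_reflect_along [simp]: "norm (reflect_along d x) = norm x"
  by (simp add: norm_eq_sqrt_inner)

text \<open>For unit vectors, \<open>d = n - m\<close> satisfies
  \<open>d \<bullet> d = 2 * (n \<bullet> d)\<close>, so exactly one copy of \<open>d\<close> is
  subtracted from \<open>n\<close>.\<close>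

lemma reflect_along_diff:
  assumes "norm n = 1" "norm m = 1"
  shows "reflect_along (n - m) n = m"
proof (cases "n = m")
  case False
  have nn: "n \<bullet> n = 1" "m \<bullet> m = 1" using assms by (simp_all add: dot_square_norm)
  have dd: "(n - m) \<bullet> (n - m) = 2 * (n \<bullet> (n - m))"
    using nn by (simp add: inner_diff_left inner_diff_right inner_commute)
  moreover have "(n - m) \<bullet> (n - m) \<noteq> 0" using False by simp
  ultimately show ?thesis by (simp add: reflect_along_def)
qed (simp add: reflect_along_def)

text \<open>The reflection along \<open>n\<close> conjugates the shear to its inverse, so both multiply volumes by the same
  factor, whose square is therefore 1.\<close>

lemma lborel_shear_vimage:
  fixes n v :: "'a::euclidean_space"
  assumes "n \<bullet> v = 0" and A: "A \<in> sets borel"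
  shows "emeasure lborel ((\<lambda>x. x + (x \<bullet> n) *\<^sub>R v) -` A) = emeasure lborel A"
proof -
  define S where "S v x = x + (x \<bullet> n) *\<^sub>R v" for v x :: 'a
  have lin: "linear (S v)" by (rule linearI) (auto simp: S_def algebra_simps inner_simps)
  have SS: "S (- v) (S v x) = x" "S v (S (- v) x) = x" for x
    using assms(1) by (simp_all add: S_def inner_simps inner_commute)
  then have "bij (S v)" by (metis bijI')
  then obtain c where c: "0 < c"
      "\<And>A. A \<in> sets borel \<Longrightarrow> emeasure lborel (S v -` A) = ennreal c * emeasure lborel A"
    using lborel_linear_vimage[OF lin] by blast
  have meas: "f -` X \<in> sets borel" if "linear f" "X \<in> sets borel" for f :: "'a \<Rightarrow> 'a" and X
    using that by (metis borel_measurable_continuous_onI linear_continuous_on linear_linear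
        measurable_sets_borel)
  have Rv: "reflect_along n v = v" using assms(1) by (simp add: reflect_along_def inner_commute)
  have RS: "reflect_along n (S v (reflect_along n x)) = S (- v) x" for x
    by (simp add: S_def linear_add[OF linear_reflect_along] linear_diff[OF linear_reflect_along]
        linear_scale[OF linear_reflect_along] inner_reflect_along_self Rv)
  have "emeasure lborel (S (- v) -` X) = ennreal c * emeasure lborel X" if X: "X \<in> sets borel" for X
  proof -
    have "S (- v) -` X = reflect_along n -` S v -` reflect_along n -` X"
      by (auto simp: RS[symmetric])
    moreover have m1: "reflect_along n -` X \<in> sets borel"
      by (rule meas[OF linear_reflect_along X])
    moreover have "S v -` reflect_along n -` X \<in> sets borel"
      by (rule meas[OF lin m1])
    ultimately show ?thesis
      using X c(2)[OF m1] by (simp add: lborel_orthogonal_vimage linear_reflect_along)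
  qed
  from this[of "S v -` cball 0 1"] have
    e: "emeasure lborel (cball 0 1 :: 'a set) = ennreal c * (ennreal c * emeasure lborel (cball 0 1 :: 'a set))"
    using meas[OF lin, of "cball 0 1"] c(2)[of "cball 0 1"]
    by (simp add: vimage_def SS del: mem_cball mem_cball_0)
  obtain l where l0: "0 < l" and l: "emeasure lborel (cball 0 1 :: 'a set) = ennreal l"
    by (rule emeasure_lborel_unit_cball)
  have "ennreal l = ennreal (c * (c * l))" using e l l0 c(1) by (simp add: ennreal_mult)
  then have "l = c * (c * l)" using l0 c(1) by (subst (asm) ennreal_inj) auto
  then have "c * c = 1" using l0 by simp
  then have "c = 1" using c(1) by (simp add: square_eq_1_iff)
  then show ?thesis using c(2)[OF A] by (simp add: S_def[abs_def])
qed

text \<open>For a unit vector \<open>n\<close>, the cone with apex 0 (apex removed) over the part of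
  \<open>A\<close> in the hyperplane at distance \<open>r\<close>. The encoding by central
  projection makes measurability immediate and allows \<open>A\<close> to be a full ball, of which
  only the hyperplane section counts.\<close>

definition hyperplane_cone :: "'a::euclidean_space \<Rightarrow> real \<Rightarrow> 'a set \<Rightarrow> 'a set" where
  "hyperplane_cone n r A = {x. 0 < x \<bullet> n \<and> x \<bullet> n \<le> r \<and> (r / (x \<bullet> n)) *\<^sub>R x \<in> A}"

lemma hyperplane_cone_measurable [measurable]: "A \<in> sets borel \<Longrightarrow> hyperplane_cone n r A \<in> sets borel"
proof -
  assume [measurable]: "A \<in> sets borel"
  have "hyperplane_cone n r A = {x \<in> space borel. 0 < x \<bullet> n} \<inter> {x \<in> space borel. x \<bullet> n \<le> r} \<inter>
      ((\<lambda>x. (r / (x \<bullet> n)) *\<^sub>R x) -` A \<inter> space borel)"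
    by (auto simp: hyperplane_cone_def)
  also have "\<dots> \<in> sets borel" by measurable
  finally show ?thesis .
qed

lemma emeasure_hyperplane_cone_cball_finite:
  fixes n :: "'a::euclidean_space"
  assumes "0 < r"
  shows "emeasure lborel (hyperplane_cone n r (cball a k)) < \<top>"
proof -
  have "hyperplane_cone n r (cball a k) \<subseteq> cball 0 (norm a + k)"
  proof
    fix x assume x: "x \<in> hyperplane_cone n r (cball a k)"
    then have p: "0 < x \<bullet> n" "x \<bullet> n \<le> r" "norm ((r / (x \<bullet> n)) *\<^sub>R x) \<le> norm a + k"
      using norm_triangle_sub[of "(r / (x \<bullet> n)) *\<^sub>R x" a]
      by (auto simp: hyperplane_cone_def dist_norm norm_minus_commute)
    then have "1 * norm x \<le> (r / (x \<bullet> n)) * norm x"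
      by (intro mult_right_mono) auto
    with p assms show "x \<in> cball 0 (norm a + k)" by simp
  qed
  then have "emeasure lborel (hyperplane_cone n r (cball a k)) \<le> emeasure lborel (cball 0 (norm a + k) :: 'a set)"
    by (intro emeasure_mono) auto
  also have "\<dots> < \<infinity>" by (rule emeasure_bounded_finite) simp
  finally show ?thesis by simp
qed

lemma hausdorff_translate:
  fixes A :: "'a::euclidean_space set"
  assumes "A \<in> sets borel"
  shows "emeasure (hausdorff_measure s) ((\<lambda>x. a + x) ` A) = emeasure (hausdorff_measure s) A"
proof (rule emeasure_hausdorff_isometry)
  have "(\<lambda>x. a + x) ` A = (\<lambda>x. x - a) -` A" by (auto simp: image_iff) (metis add_diff_cancel_left' diff_add_cancel)
  then show "(\<lambda>x. a + x) ` A \<in> sets borel"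
    using measurable_sets_borel[of "\<lambda>x. x - a" borel A] assms by simp
qed (use assms in auto)

text \<open>Translations of the hyperplane act on the cones as shears. Hence Hausdorff measure and cone volume
  are both translation invariant on the hyperplane, and so they are proportional.\<close>

lemma hausdorff_hyperplane_cone:
  fixes n :: "'a::euclidean_space"
  assumes n: "norm n = 1" and r: "0 < r"
    and z: "z \<bullet> n = r" "0 < e" "emeasure (hausdorff_measure s) (ball z e \<inter> {x. x \<bullet> n = r}) < \<top>"
  shows "emeasure (hausdorff_measure s) (cball 0 1 \<inter> {x. x \<bullet> n = 0}) < \<top>"
    and "A \<in> sets borel \<Longrightarrow> A \<subseteq> {x. x \<bullet> n = r} \<Longrightarrow>
      emeasure (hausdorff_measure s) A * emeasure lborel (hyperplane_cone n r (cball (r *\<^sub>R n) 1)) =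
      emeasure lborel (hyperplane_cone n r A) * emeasure (hausdorff_measure s) (cball 0 1 \<inter> {x. x \<bullet> n = 0})"
proof -
  let ?H = "hausdorff_measure s :: 'a measure"
  define V where "V = {x. x \<bullet> n = 0}"
  have V: "subspace V" by (auto simp: V_def subspace_def inner_simps)
  have [measurable]: "V \<in> sets borel" using closed_subspace[OF V] by simp
  \<comment> \<open>Only one small disc is known to have finite measure. Finitely many translates of
    it cover any compact part of the parallel subspace \<open>V\<close>, which gives
    sigma-finiteness below.\<close>
  have fin: "emeasure ?H (cball 0 k \<inter> V) < \<top>" for k
  proof -
    have "compact (cball 0 k \<inter> V)" using closed_subspace[OF V] by (intro compact_Int_closed) auto
    then obtain C where C: "C \<subseteq> cball 0 k \<inter> V" "finite C" "cball 0 k \<inter> V \<subseteq> (\<Union>y\<in>C. ball y e)"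
      using compactE_image[of "cball 0 k \<inter> V" "cball 0 k \<inter> V" "\<lambda>y. ball y e"] z(2)
      by (metis (no_types, lifting) UN_I centre_in_ball open_ball subsetI)
    have fy: "emeasure ?H (ball y e \<inter> V) < \<top>" if "y \<in> V" for y
    proof -
      have "ball y e \<inter> V = (\<lambda>x. (y - z) + x) ` (ball z e \<inter> {x. x \<bullet> n = r})"
      proof (intro equalityI subsetI)
        fix x assume x: "x \<in> ball y e \<inter> V"
        have "x = (y - z) + (x + z - y)" by simp
        moreover have "x + z - y \<in> ball z e \<inter> {x. x \<bullet> n = r}"
          using x that z(1) by (auto simp: V_def inner_simps dist_norm algebra_simps)
        ultimately show "x \<in> (\<lambda>x. (y - z) + x) ` (ball z e \<inter> {x. x \<bullet> n = r})" by blast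
      qed (use that z(1) in \<open>auto simp: V_def inner_simps dist_norm algebra_simps\<close>)
      then show ?thesis using z(3) by (simp add: hausdorff_translate)
    qed
    have "emeasure ?H (cball 0 k \<inter> V) \<le> emeasure ?H (\<Union>y\<in>C. ball y e \<inter> V)"
      using C by (intro emeasure_mono) (auto intro!: sets.finite_UN)
    also have "\<dots> \<le> (\<Sum>y\<in>C. emeasure ?H (ball y e \<inter> V))"
      using C by (intro emeasure_subadditive_finite) auto
    also have "\<dots> < \<top>" using C fy by (intro sum_less_top_ennreal) auto
    finally show ?thesis .
  qed
  show "emeasure ?H (cball 0 1 \<inter> {x. x \<bullet> n = 0}) < \<top>" using fin[of 1] by (simp add: V_def)
  assume A: "A \<in> sets borel" "A \<subseteq> {x. x \<bullet> n = r}"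
  define \<mu> where "\<mu> = density ?H (indicator V)"
  have [measurable_cong, simp]: "sets \<mu> = sets borel" by (simp add: \<mu>_def)
  have em\<mu>: "emeasure \<mu> X = emeasure ?H (X \<inter> V)" if [measurable]: "X \<in> sets borel" for X
    by (simp add: \<mu>_def emeasure_density indicator_inter_arith[symmetric] Int_commute)
  \<comment> \<open>Central projection to the hyperplane at distance \<open>r\<close>, moved into
    \<open>V\<close>; \<open>\<nu>\<close> is then cone volume viewed as a measure on
    \<open>V\<close>.\<close>
  define \<rho> where "\<rho> x = (r / (x \<bullet> n)) *\<^sub>R x - r *\<^sub>R n" for x
  have [measurable]: "\<rho> \<in> borel_measurable borel" unfolding \<rho>_def by measurable
  define Q where "Q = {x. 0 < x \<bullet> n \<and> x \<bullet> n \<le> r}"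
  have [measurable]: "Q \<in> sets borel" unfolding Q_def by measurable
  define \<nu> where "\<nu> = distr (density lborel (indicator Q)) borel \<rho>"
  have [measurable_cong, simp]: "sets \<nu> = sets borel" by (simp add: \<nu>_def)
  have em\<nu>: "emeasure \<nu> X = emeasure lborel (Q \<inter> \<rho> -` X)" if [measurable]: "X \<in> sets borel" for X
  proof -
    have "\<rho> -` X \<in> sets borel" using measurable_sets_borel[of \<rho> borel X] that by simp
    then show ?thesis
      by (simp add: \<nu>_def emeasure_distr emeasure_density indicator_inter_arith[symmetric])
  qed
  have cone: "hyperplane_cone n r ((\<lambda>x. x + r *\<^sub>R n) ` X) = Q \<inter> \<rho> -` X" for X
  proof -
    have "y \<in> (\<lambda>x. x + r *\<^sub>R n) ` X \<longleftrightarrow> y - r *\<^sub>R n \<in> X" for y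
      by (auto simp: image_iff) (metis diff_add_cancel)
    then show ?thesis by (auto simp: hyperplane_cone_def Q_def \<rho>_def)
  qed
  have nn: "n \<bullet> n = 1" using n by (simp add: dot_square_norm)
  have inv\<mu>: "distr \<mu> borel (\<lambda>x. v + x) = \<mu>" if v: "v \<in> V" for v
  proof (rule measure_eqI)
    fix X assume "X \<in> sets (distr \<mu> borel (\<lambda>x. v + x))"
    then have X[measurable]: "X \<in> sets borel" by simp
    have m: "(\<lambda>x. v + x) -` X \<in> sets borel" using measurable_sets_borel[of "\<lambda>x. v + x" borel X] by simp
    have "X \<inter> V = (\<lambda>x. v + x) ` ((\<lambda>x. v + x) -` X \<inter> V)"
    proof (intro equalityI subsetI)
      fix x assume "x \<in> X \<inter> V"
      then have "x = v + (x - v)" "x - v \<in> (\<lambda>x. v + x) -` X \<inter> V"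
        using v V by (auto intro: subspace_diff)
      then show "x \<in> (\<lambda>x. v + x) ` ((\<lambda>x. v + x) -` X \<inter> V)" by blast
    qed (use v V in \<open>auto intro: subspace_add\<close>)
    then show "emeasure (distr \<mu> borel (\<lambda>x. v + x)) X = emeasure \<mu> X"
      using m by (simp add: emeasure_distr em\<mu> hausdorff_translate \<mu>_def[symmetric]
          sets_eq_imp_space_eq[of \<mu> borel])
  qed simp
  have inv\<nu>: "distr \<nu> borel (\<lambda>x. v + x) = \<nu>" if v: "v \<in> V" for v
  proof (rule measure_eqI)
    fix X assume "X \<in> sets (distr \<nu> borel (\<lambda>x. v + x))"
    then have X[measurable]: "X \<in> sets borel" by simp
    have m: "(\<lambda>x. v + x) -` X \<in> sets borel" using measurable_sets_borel[of "\<lambda>x. v + x" borel X] by simp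
    have vn: "v \<bullet> n = 0" "n \<bullet> v = 0" using v by (auto simp: V_def inner_commute)
    \<comment> \<open>Translating the projected point by \<open>v\<close> amounts to moving
      \<open>x\<close> by \<open>v\<close> scaled with the height ratio
      \<open>(x \<bullet> n) / r\<close>, which is a shear.\<close>
    have "Q \<inter> \<rho> -` (\<lambda>x. v + x) -` X = (\<lambda>x. x + (x \<bullet> n) *\<^sub>R ((1 / r) *\<^sub>R v)) -` (Q \<inter> \<rho> -` X)"
      using r by (auto simp: Q_def \<rho>_def inner_simps vn algebra_simps)
    then have "emeasure lborel (Q \<inter> \<rho> -` (\<lambda>x. v + x) -` X) = emeasure lborel (Q \<inter> \<rho> -` X)"
      using lborel_shear_vimage[of n "(1 / r) *\<^sub>R v" "Q \<inter> \<rho> -` X"] vn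
        measurable_sets_borel[of \<rho> borel X] by simp
    then show "emeasure (distr \<nu> borel (\<lambda>x. v + x)) X = emeasure \<nu> X"
      using m by (simp add: emeasure_distr em\<nu> \<nu>_def[symmetric] sets_eq_imp_space_eq[of \<nu> borel])
  qed simp
  have fin\<nu>: "emeasure \<nu> (cball 0 k) < \<top>" for k
  proof -
    have "(\<lambda>x. x + r *\<^sub>R n) ` cball 0 k = cball (r *\<^sub>R n) k"
      using cball_translation[of "r *\<^sub>R n" 0 k] by (simp add: add.commute)
    then show ?thesis
      using em\<nu>[of "cball 0 k"] cone[of "cball 0 k"] emeasure_hyperplane_cone_cball_finite[OF r, of n "r *\<^sub>R n" k]
      by simp
  qed
  define A' where "A' = (\<lambda>x. x + r *\<^sub>R n) -` A"
  have A'[measurable]: "A' \<in> sets borel"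
    using measurable_sets_borel[of "\<lambda>x. x + r *\<^sub>R n" borel A] A by (simp add: A'_def)
  have A'V: "A' \<subseteq> V" using A(2) by (auto simp: A'_def V_def inner_simps nn)
  have AA': "A = (\<lambda>x. x + r *\<^sub>R n) ` A'"
  proof -
    have "y = (y - r *\<^sub>R n) + r *\<^sub>R n" for y by simp
    then show ?thesis unfolding A'_def image_iff by (auto simp: set_eq_iff image_iff)
  qed
  have "emeasure \<mu> A' * emeasure \<nu> (cball 0 1) = emeasure \<nu> A' * emeasure \<mu> (uminus -` cball 0 1)"
  proof (rule translation_invariant_measure_unique[where V = V])
    show "sigma_finite_measure \<mu>"
      using fin by (intro sigma_finite_measureI_cball) (auto simp: em\<mu>)
    show "sigma_finite_measure \<nu>"
      using fin\<nu> by (intro sigma_finite_measureI_cball) auto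
    have "Q \<inter> \<rho> -` (UNIV - V) = {}"
      by (auto simp: Q_def \<rho>_def V_def inner_simps nn)
    then show "emeasure \<nu> (UNIV - V) = 0" by (simp add: em\<nu>)
    have "(UNIV - V) \<inter> V = {}" by blast
    then show "emeasure \<mu> (UNIV - V) = 0" by (simp add: em\<mu>)
  qed (simp_all add: V inv\<mu> inv\<nu>)
  moreover have "uminus -` cball 0 1 = (cball 0 1 :: 'a set)" by auto
  moreover have "emeasure \<mu> A' = emeasure ?H A"
    using A'V hausdorff_translate[OF A', of s "r *\<^sub>R n"]
    by (subst AA') (simp add: em\<mu> Int_absorb2 add.commute)
  moreover have "emeasure \<nu> A' = emeasure lborel (hyperplane_cone n r A)"
    by (subst AA') (simp add: em\<nu> cone)
  moreover have "emeasure \<nu> (cball 0 1) = emeasure lborel (hyperplane_cone n r (cball (r *\<^sub>R n) 1))"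
    using cball_translation[of "r *\<^sub>R n" 0 1] cone[of "cball 0 1"] by (simp add: em\<nu> add.commute)
  ultimately show "emeasure ?H A * emeasure lborel (hyperplane_cone n r (cball (r *\<^sub>R n) 1)) =
      emeasure lborel (hyperplane_cone n r A) * emeasure ?H (cball 0 1 \<inter> {x. x \<bullet> n = 0})"
    by (simp add: em\<mu> V_def)
qed

text \<open>The factors relating surface and cone volume agree for all unit normals: the reflection
  along \<open>n - m\<close> is an isometry that maps \<open>n\<close> to \<open>m\<close> and
  preserves Lebesgue measure.\<close>

lemma hausdorff_cball_hyperplane_cong:
  fixes n m :: "'a::euclidean_space"
  assumes nm: "norm n = 1" "norm m = 1"
  shows "emeasure (hausdorff_measure s) (cball 0 1 \<inter> {x. x \<bullet> n = 0})
       = emeasure (hausdorff_measure s) (cball 0 1 \<inter> {x. x \<bullet> m = 0})"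
    and "emeasure lborel (hyperplane_cone n r (cball (r *\<^sub>R n) 1)) = emeasure lborel (hyperplane_cone m r (cball (r *\<^sub>R m) 1))"
proof -
  let ?R = "reflect_along (n - m)"
  have Rn: "?R n = m" "?R m = n"
    using reflect_along_diff[OF nm] reflect_along_involution by metis+
  have R: "?R x \<bullet> m = x \<bullet> n" for x using inner_reflect_along[of "n - m" x n] Rn by simp
  have dist: "dist (?R x) (?R y) = dist x y" for x y
    using linear_diff[OF linear_reflect_along, of "n - m" x y] by (simp add: dist_norm flip: norm_reflect_along[of "n - m" "x - y"])
  have sc: "?R (c *\<^sub>R x) = c *\<^sub>R ?R x" for c x by (rule linear_scale[OF linear_reflect_along])
  have vi: "?R ` X = ?R -` X" for X
    by (auto simp: image_iff) (metis reflect_along_involution)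
  have im: "?R ` (cball 0 1 \<inter> {x. x \<bullet> n = 0}) = cball 0 1 \<inter> {x. x \<bullet> m = 0}"
    unfolding vi using R[of "?R _"] by auto
  have "closed {x. x \<bullet> k = 0}" for k :: 'a using closed_hyperplane[of k 0] by (simp add: inner_commute)
  then have b: "cball 0 1 \<inter> {x. x \<bullet> k = 0} \<in> sets borel" for k :: 'a by (intro sets.Int) auto
  show "emeasure (hausdorff_measure s) (cball 0 1 \<inter> {x. x \<bullet> n = 0})
       = emeasure (hausdorff_measure s) (cball 0 1 \<inter> {x. x \<bullet> m = 0})"
    using emeasure_hausdorff_isometry[of ?R "cball 0 1 \<inter> {x. x \<bullet> n = 0}" s] dist b unfolding im by simp
  have "hyperplane_cone n r (cball (r *\<^sub>R n) 1) = ?R -` hyperplane_cone m r (cball (r *\<^sub>R m) 1)"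
  proof -
    have "dist (r *\<^sub>R m) (c *\<^sub>R ?R x) = dist (r *\<^sub>R n) (c *\<^sub>R x)" for c x
      using dist[of "r *\<^sub>R n" "c *\<^sub>R x"] by (simp add: sc Rn)
    then show ?thesis by (auto simp: hyperplane_cone_def R)
  qed
  then show "emeasure lborel (hyperplane_cone n r (cball (r *\<^sub>R n) 1)) = emeasure lborel (hyperplane_cone m r (cball (r *\<^sub>R m) 1))"
    using lborel_orthogonal_vimage[OF linear_reflect_along reflect_along_involution norm_reflect_along,
        of "hyperplane_cone m r (cball (r *\<^sub>R m) 1)" "n - m"] by (simp add: hyperplane_cone_measurable)
qed

section \<open>Subgradients, dilations and uniform measures\<close>

lemma convex_on_subgradient:
  fixes \<phi> :: "'a::euclidean_space \<Rightarrow> real"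
  assumes "convex_on UNIV \<phi>"
  obtains g where "\<And>x. \<phi> x \<ge> \<phi> y + g \<bullet> (x - y)"
proof -
  \<comment> \<open>Separate the strict epigraph from the point \<open>(y, \<phi> y)\<close>; the
    separating functional \<open>(g, c)\<close> has \<open>c < 0\<close>, and dividing by
    \<open>- c\<close> gives the subgradient.\<close>
  define E where "E = {p :: 'a \<times> real. \<phi> (fst p) < snd p}"
  have "convex E"
    unfolding convex_alt E_def
  proof clarsimp
    fix a s b t and u :: real
    assume "\<phi> a < s" "\<phi> b < t" "0 \<le> u" "u \<le> 1"
    then have "(1 - u) * \<phi> a + u * \<phi> b < (1 - u) * s + u * t"
      by (smt (verit) mult_left_mono mult_strict_left_mono)
    then show "\<phi> ((1 - u) *\<^sub>R a + u *\<^sub>R b) < (1 - u) * s + u * t"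
      using convex_onD[OF assms, of u a b] \<open>0 \<le> u\<close> \<open>u \<le> 1\<close> by auto
  qed
  moreover have "E \<noteq> {}"
  proof -
    have "(y, \<phi> y + 1) \<in> E" by (simp add: E_def)
    then show ?thesis by blast
  qed
  moreover have "E \<inter> {(y, \<phi> y)} = {}" by (auto simp: E_def)
  ultimately obtain a b where ab: "a \<noteq> 0" "\<forall>x\<in>E. a \<bullet> x \<le> b" "\<forall>x\<in>{(y, \<phi> y)}. b \<le> a \<bullet> x"
    using separating_hyperplane_sets[of E "{(y, \<phi> y)}"] by auto
  obtain g c where a: "a = (g, c)" by force
  have le: "g \<bullet> x + c * t \<le> g \<bullet> y + c * \<phi> y" if "\<phi> x < t" for x t
    using ab(2,3) that by (force simp: E_def a)
  have "c \<le> 0" using le[of y "\<phi> y + 1"] by (simp add: algebra_simps)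
  moreover have "c \<noteq> 0"
  proof
    assume c: "c = 0"
    \<comment> \<open>A vertical separating hyperplane is refuted by testing it at
      \<open>y + g\<close>.\<close>
    then have "g \<bullet> (y + g) \<le> g \<bullet> y" using le[of "y + g" "\<phi> (y + g) + 1"] by simp
    then have "g \<bullet> g \<le> 0" by (simp add: inner_add_right)
    then have "g = 0" using inner_gt_zero_iff[of g] by linarith
    then show False using ab(1) a c by (simp add: zero_prod_def)
  qed
  ultimately have c: "c < 0" by simp
  have "\<phi> x \<ge> \<phi> y + ((1 / - c) *\<^sub>R g) \<bullet> (x - y)" for x
  \<comment> \<open>The point \<open>(x, \<phi> x)\<close> itself is not in the strict epigraph, so
    the inequality is first obtained with an excess height \<open>e\<close>.\<close>
  proof (rule field_le_epsilon)
    fix e :: real assume "0 < e"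
    then have "g \<bullet> x + c * (\<phi> x + e) \<le> g \<bullet> y + c * \<phi> y" by (intro le) simp
    then have "g \<bullet> (x - y) \<le> - c * (\<phi> x + e - \<phi> y)" by (simp add: inner_diff_right algebra_simps)
    then have "(1 / - c) * (g \<bullet> (x - y)) \<le> (1 / - c) * (- c * (\<phi> x + e - \<phi> y))"
      using c by (intro mult_left_mono) auto
    then show "\<phi> y + ((1 / - c) *\<^sub>R g) \<bullet> (x - y) \<le> \<phi> x + e" using c by simp
  qed
  then show thesis by (rule that)
qed

lemma convex_on_UNIV_continuous:
  fixes \<phi> :: "'a::euclidean_space \<Rightarrow> real"
  shows "convex_on UNIV \<phi> \<Longrightarrow> continuous_on S \<phi>"
  using convex_on_continuous[of UNIV \<phi>] continuous_on_subset by blast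

lemma integral_lborel_scale:
  fixes f :: "'a::euclidean_space \<Rightarrow> 'b::{banach, second_countable_topology}"
  assumes "0 < s" and [measurable]: "f \<in> borel_measurable borel"
  shows "(\<integral>x. f x \<partial>lborel) = s ^ DIM('a) *\<^sub>R (\<integral>x. f (s *\<^sub>R x) \<partial>lborel)"
proof -
  have "(lborel :: 'a measure) = density (distr lborel borel (\<lambda>x. 0 + s *\<^sub>R x)) (\<lambda>_. \<bar>s\<bar> ^ DIM('a))"
    by (rule lborel_affine) (use assms in simp)
  then have "(\<integral>x. f x \<partial>lborel) = (\<integral>x. f x \<partial>density (distr lborel borel (\<lambda>x::'a. s *\<^sub>R x)) (\<lambda>_. ennreal (s ^ DIM('a))))"
    using assms(1) by simp
  also have "\<dots> = s ^ DIM('a) *\<^sub>R (\<integral>x. f (s *\<^sub>R x) \<partial>lborel)"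
    using assms(1) by (subst integral_density) (auto simp: integral_distr)
  finally show ?thesis .
qed

lemma emeasure_lborel_pos:
  fixes S :: "'a::euclidean_space set"
  assumes "x \<in> interior S" "S \<in> sets borel"
  shows "0 < emeasure lborel S"
proof -
  obtain e where e: "0 < e" "cball x e \<subseteq> S"
    using assms(1) mem_interior_cball by blast
  have "emeasure lborel (cball x e) \<noteq> 0"
    using content_cball_pos[OF e(1), of x] by (auto simp: measure_def)
  moreover have "emeasure lborel (cball x e) \<le> emeasure lborel S"
    using e assms by (intro emeasure_mono) auto
  ultimately show ?thesis by (metis not_gr_zero le_zero_eq)
qed

lemma emeasure_hyperplane_cone_pos:
  fixes n :: "'a::euclidean_space"
  assumes "norm n = 1" "0 < r"
  shows "0 < emeasure lborel (hyperplane_cone n r (cball (r *\<^sub>R n) 1))"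
proof -
  have nn: "n \<bullet> n = 1" using assms by (simp add: dot_square_norm)
  let ?S = "{x. 0 < x \<bullet> n} \<inter> {x. x \<bullet> n < r}"
  have oS: "open ?S" using open_halfspace_gt[of 0 n] open_halfspace_lt[of n r]
    by (simp add: inner_commute open_Int)
  have "continuous_on ?S (\<lambda>x. (r / (x \<bullet> n)) *\<^sub>R x)" by (auto intro!: continuous_intros)
  then have op: "open (?S \<inter> (\<lambda>x. (r / (x \<bullet> n)) *\<^sub>R x) -` ball (r *\<^sub>R n) 1)"
    by (rule continuous_open_preimage[OF _ oS]) auto
  have "(r / 2) *\<^sub>R n \<in> ?S \<inter> (\<lambda>x. (r / (x \<bullet> n)) *\<^sub>R x) -` ball (r *\<^sub>R n) 1"
    using assms by (auto simp: nn)
  moreover have "?S \<inter> (\<lambda>x. (r / (x \<bullet> n)) *\<^sub>R x) -` ball (r *\<^sub>R n) 1 \<subseteq> hyperplane_cone n r (cball (r *\<^sub>R n) 1)"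
    by (auto simp: hyperplane_cone_def)
  ultimately have "(r / 2) *\<^sub>R n \<in> interior (hyperplane_cone n r (cball (r *\<^sub>R n) 1))"
    using op by (meson interiorI)
  then show ?thesis by (rule emeasure_lborel_pos) (simp add: hyperplane_cone_measurable)
qed

lemma integral_uniform_measure:
  fixes f :: "'a \<Rightarrow> 'b::{banach, second_countable_topology}"
  assumes A: "A \<in> sets M" "emeasure M A \<noteq> 0" "emeasure M A \<noteq> \<top>" and f: "f \<in> borel_measurable M"
  shows "(\<integral>x. f x \<partial>uniform_measure M A) = (1 / measure M A) *\<^sub>R (LINT x:A|M. f x)"
proof -
  have m: "0 < measure M A" using A by (simp add: zero_less_measure_iff emeasure_eq_ennreal_measure)
  have "indicator A x / emeasure M A = ennreal (indicator A x / measure M A)" for x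
    using A m by (simp add: emeasure_eq_ennreal_measure divide_ennreal[symmetric] split: split_indicator)
  then have "uniform_measure M A = density M (\<lambda>x. ennreal (indicator A x / measure M A))"
    by (simp add: uniform_measure_def)
  also have "(\<integral>x. f x \<partial>\<dots>) = (\<integral>x. (indicator A x / measure M A) *\<^sub>R f x \<partial>M)"
    using A f by (intro integral_density) auto
  also have "\<dots> = (\<integral>x. (1 / measure M A) *\<^sub>R (indicator A x *\<^sub>R f x) \<partial>M)" by (simp add: mult.commute)
  also have "\<dots> = (1 / measure M A) *\<^sub>R (LINT x:A|M. f x)"
    unfolding set_lebesgue_integral_def by (rule integral_scaleR_right)
  finally show ?thesis .
qed

lemma uniform_measure_translate:
  fixes \<mu> :: "'a::euclidean_space measure"
  assumes sets: "sets \<mu> = sets borel"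
    and inv: "\<And>X. X \<in> sets borel \<Longrightarrow> emeasure \<mu> ((\<lambda>x. v + x) ` X) = emeasure \<mu> X"
    and A: "A \<in> sets borel"
  shows "distr (uniform_measure \<mu> A) borel (\<lambda>x. v + x) = uniform_measure \<mu> ((\<lambda>x. v + x) ` A)"
proof (rule measure_eqI)
  fix X assume "X \<in> sets (distr (uniform_measure \<mu> A) borel (\<lambda>x. v + x))"
  then have X: "X \<in> sets borel" by simp
  have im: "(\<lambda>x. v + x) ` Y = (\<lambda>x. x - v) -` Y" for Y :: "'a set"
    by (auto simp: image_iff) (metis add_diff_cancel_left' diff_add_cancel add.commute)
  have m: "(\<lambda>x. v + x) ` Y \<in> sets borel" if "Y \<in> sets borel" for Y
    unfolding im using measurable_sets_borel[of "\<lambda>x. x - v" borel Y] that by simp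
  have m': "(\<lambda>x. v + x) -` X \<in> sets borel"
    using measurable_sets_borel[of "\<lambda>x. v + x" borel X] X by simp
  have "(\<lambda>x. v + x) ` A \<inter> X = (\<lambda>x. v + x) ` (A \<inter> (\<lambda>x. v + x) -` X)" by auto
  then have "emeasure \<mu> ((\<lambda>x. v + x) ` A \<inter> X) = emeasure \<mu> (A \<inter> (\<lambda>x. v + x) -` X)"
    using inv[of "A \<inter> (\<lambda>x. v + x) -` X"] A m' by simp
  moreover have "(\<lambda>x. v + x) \<in> measurable \<mu> borel" by (subst measurable_cong_sets[OF sets refl]) simp
  ultimately show "emeasure (distr (uniform_measure \<mu> A) borel (\<lambda>x. v + x)) X
      = emeasure (uniform_measure \<mu> ((\<lambda>x. v + x) ` A)) X"
    using X A m m' inv[OF A] sets sets_eq_imp_space_eq[OF sets]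
    by (simp add: emeasure_distr emeasure_uniform_measure)
qed (simp add: sets)

text \<open>Cross-multiply the two proportions and cancel \<open>h\<close> and \<open>k\<close>;
  \<open>h\<close> is nonzero because \<open>P * k\<close> is positive. The finiteness assumptions
  transfer the computation to the reals.\<close>

lemma ratio_eq_ennreal:
  fixes a k l h P q :: ennreal
  assumes "a * k = l * h" "P * k = q * h" "0 < k" "k < \<top>" "0 < P" "P < \<top>" "0 < q" "q < \<top>" "h < \<top>" "l \<le> q" "a \<le> P"
  shows "a / P = l / q"
proof -
  define a' k' l' h' P' q' where d: "a' = enn2real a" "k' = enn2real k" "l' = enn2real l"
    "h' = enn2real h" "P' = enn2real P" "q' = enn2real q"
  have e: "a = ennreal a'" "k = ennreal k'" "l = ennreal l'" "h = ennreal h'" "P = ennreal P'" "q = ennreal q'"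
    using assms by (auto simp: d intro: order.strict_trans1)
  have nn: "0 \<le> a'" "0 \<le> k'" "0 \<le> l'" "0 \<le> h'" "0 \<le> P'" "0 \<le> q'" by (auto simp: d)
  have pos: "0 < k'" "0 < P'" "0 < q'" using assms(3,5,7) unfolding e by (auto simp: ennreal_less_zero_iff)
  have eq: "a' * k' = l' * h'" "P' * k' = q' * h'"
    using assms(1,2) nn unfolding e by (auto simp: ennreal_mult[symmetric])
  have "h' \<noteq> 0" using eq(2) pos by auto
  have "(a' * k') * (q' * h') = (l' * h') * (P' * k')" using eq by simp
  then have "a' * q' = l' * P'" using \<open>h' \<noteq> 0\<close> pos by (simp add: ac_simps)
  then have "a' / P' = l' / q'" using pos by (simp add: field_simps)
  then show ?thesis unfolding e using nn pos by (simp add: divide_ennreal)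
qed

section \<open>Circumscribed polytopes\<close>

text \<open>\<open>N\<close> is the set of outer unit normals of the facets, and the centre of the inscribed
  sphere has been moved to the origin.\<close>

locale circumscribed_body =
  fixes K :: "'a::euclidean_space set" and N :: "'a set" and r :: real
  assumes K: "compact K" "convex K" "0 \<in> interior K"
    and r: "0 < r" and fin: "finite N" and ne: "N \<noteq> {}" and unit: "\<And>n. n \<in> N \<Longrightarrow> norm n = 1"
    and sub: "\<And>n x. n \<in> N \<Longrightarrow> x \<in> K \<Longrightarrow> x \<bullet> n \<le> r"
    and fr: "frontier K = (\<Union>n\<in>N. K \<inter> {x. x \<bullet> n = r})"
    and facet_ball: "\<And>n. n \<in> N \<Longrightarrow> \<exists>z e. z \<bullet> n = r \<and> 0 < e \<and> ball z e \<inter> {x. x \<bullet> n = r} \<subseteq> K"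
begin

text \<open>The Minkowski functional of \<open>K\<close> (see \<open>mem_K_iff\<close>), written as
  the maximum of one linear form per facet.\<close>

definition facet_gauge :: "'a \<Rightarrow> real" where "facet_gauge x = Max ((\<lambda>n. x \<bullet> n / r) ` N)"

definition radial :: "'a \<Rightarrow> 'a" where "radial x = (1 / facet_gauge x) *\<^sub>R x"

lemma facet_gauge_ge: "n \<in> N \<Longrightarrow> x \<bullet> n / r \<le> facet_gauge x"
  unfolding facet_gauge_def using fin by (intro Max_ge) auto

lemma facet_gauge_attained: obtains n where "n \<in> N" "facet_gauge x = x \<bullet> n / r"
proof -
  have "facet_gauge x \<in> (\<lambda>n. x \<bullet> n / r) ` N" unfolding facet_gauge_def using fin ne by (intro Max_in) auto
  then show thesis using that by blast
qed

lemma facet_gauge_scale: assumes "0 \<le> t" shows "facet_gauge (t *\<^sub>R x) = t * facet_gauge x"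
proof (rule antisym)
  obtain n where "n \<in> N" "facet_gauge (t *\<^sub>R x) = (t *\<^sub>R x) \<bullet> n / r" by (rule facet_gauge_attained)
  then show "facet_gauge (t *\<^sub>R x) \<le> t * facet_gauge x"
    using facet_gauge_ge[of n x] assms by (metis inner_scaleR_left mult_left_mono times_divide_eq_right)
  obtain n where "n \<in> N" "facet_gauge x = x \<bullet> n / r" by (rule facet_gauge_attained)
  then show "t * facet_gauge x \<le> facet_gauge (t *\<^sub>R x)"
    using facet_gauge_ge[of n "t *\<^sub>R x"] by simp
qed

lemma facet_gauge_le_1: "x \<in> K \<Longrightarrow> facet_gauge x \<le> 1"
  by (rule facet_gauge_attained[of x]) (use sub r in auto)

lemma facet_gauge_frontier: "x \<in> frontier K \<Longrightarrow> facet_gauge x = 1"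
proof -
  assume x: "x \<in> frontier K"
  then obtain n where n: "n \<in> N" "x \<bullet> n = r" unfolding fr by auto
  have "x \<in> K" using x K(1) frontier_subset_closed compact_imp_closed by blast
  then show "facet_gauge x = 1" using facet_gauge_le_1[of x] facet_gauge_ge[OF n(1), of x] n(2) r by simp
qed

text \<open>The ray through \<open>x\<close> leaves \<open>K\<close> at a frontier point, where the
  gauge is 1; homogeneity then gives the gauge of \<open>x\<close>. This ties the maximum over the
  facets to the shape of \<open>K\<close>.\<close>

lemma ray:
  assumes "x \<noteq> 0"
  obtains d where "0 < d" "d *\<^sub>R x \<in> frontier K" "facet_gauge x = 1 / d"
proof -
  obtain d where d: "0 < d" "0 + d *\<^sub>R x \<in> frontier K"
    using ray_to_frontier[of K 0 x] K assms compact_imp_bounded by metis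
  then have "d * facet_gauge x = 1" using facet_gauge_frontier[of "d *\<^sub>R x"] facet_gauge_scale[of d x] by simp
  then show thesis using that[of d] d by (simp add: field_simps)
qed

lemma facet_gauge_0 [simp]: "facet_gauge 0 = 0" using facet_gauge_scale[of 0 0] by simp

lemma facet_gauge_pos: "x \<noteq> 0 \<Longrightarrow> 0 < facet_gauge x" by (rule ray) auto

lemma radial_frontier: "x \<noteq> 0 \<Longrightarrow> radial x \<in> frontier K"
  by (rule ray[of x]) (auto simp: radial_def)

lemma closed_K: "closed K" using K compact_imp_closed by blast

lemma frontier_subset: "frontier K \<subseteq> K" using closed_K by (rule frontier_subset_closed)

lemma mem_K_iff: "x \<in> K \<longleftrightarrow> facet_gauge x \<le> 1"
proof
  assume g: "facet_gauge x \<le> 1"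
  show "x \<in> K"
  proof (cases "x = 0")
    case True then show ?thesis using K interior_subset by auto
  next
    case False
    have "radial x \<in> K" using radial_frontier[OF False] frontier_subset by blast
    moreover have "0 \<in> K" using K interior_subset by auto
    ultimately have "facet_gauge x *\<^sub>R radial x + (1 - facet_gauge x) *\<^sub>R 0 \<in> K"
      using K(2) g facet_gauge_pos[OF False] by (intro convexD) auto
    then show ?thesis using facet_gauge_pos[OF False] by (simp add: radial_def)
  qed
qed (rule facet_gauge_le_1)

lemma facet_gauge_measurable [measurable]: "facet_gauge \<in> borel_measurable borel"
proof -
  have "(\<lambda>x. Max ((\<lambda>n. x \<bullet> n / r) ` N)) \<in> borel_measurable borel"
    using fin by (intro borel_measurable_Max) auto
  then show ?thesis by (simp add: facet_gauge_def[abs_def])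
qed

lemma radial_measurable [measurable]: "radial \<in> borel_measurable borel"
  unfolding radial_def[abs_def] by measurable

lemma radial_scale: "0 < t \<Longrightarrow> radial (t *\<^sub>R x) = radial x"
  by (simp add: radial_def facet_gauge_scale)

lemma K_measurable [measurable]: "K \<in> sets borel" "frontier K \<in> sets borel"
  using closed_K by auto

definition Cone :: "'a set \<Rightarrow> 'a set" where "Cone A = {x \<in> K - {0}. radial x \<in> A}"

lemma Cone_measurable [measurable]: "A \<in> sets borel \<Longrightarrow> Cone A \<in> sets borel"
proof -
  assume "A \<in> sets borel"
  then have "(K - {0}) \<inter> radial -` A \<in> sets borel"
    using measurable_sets_borel[OF radial_measurable] by (intro sets.Int) auto
  then show ?thesis by (simp add: Cone_def Int_def vimage_def conj_commute)
qed

text \<open>On rays through the facet with normal \<open>n\<close> the maximum in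
  \<open>facet_gauge\<close> is attained at \<open>n\<close>, so radial projection coincides there
  with central projection to the hyperplane of the facet.\<close>

lemma Cone_facet:
  assumes n: "n \<in> N" and A: "A \<subseteq> K \<inter> {x. x \<bullet> n = r}"
  shows "Cone A = hyperplane_cone n r A"
proof (intro equalityI subsetI)
  fix x assume x: "x \<in> Cone A"
  then have p: "0 < facet_gauge x" "facet_gauge x \<le> 1" "radial x \<in> A" using facet_gauge_pos facet_gauge_le_1 by (auto simp: Cone_def)
  then have "radial x \<bullet> n = r" using A by auto
  then have xn: "x \<bullet> n = r * facet_gauge x" using p by (simp add: radial_def field_simps)
  then show "x \<in> hyperplane_cone n r A" using p r by (simp add: hyperplane_cone_def radial_def mult_le_cancel_left1)
next
  fix x assume "x \<in> hyperplane_cone n r A"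
  then have x: "0 < x \<bullet> n" "x \<bullet> n \<le> r" "(r / (x \<bullet> n)) *\<^sub>R x \<in> A" by (auto simp: hyperplane_cone_def)
  then have "(r / (x \<bullet> n)) *\<^sub>R x \<in> frontier K" using A n unfolding fr by blast
  then have "facet_gauge ((r / (x \<bullet> n)) *\<^sub>R x) = 1" by (rule facet_gauge_frontier)
  then have g: "facet_gauge x = (x \<bullet> n) / r" using x r by (simp add: facet_gauge_scale field_simps)
  then show "x \<in> Cone A" using x r by (auto simp: Cone_def mem_K_iff radial_def)
qed

abbreviation "H \<equiv> surface_measure :: 'a measure"

text \<open>The constants are taken from one normal \<open>m\<close> and serve every facet by
  \<open>hausdorff_cball_hyperplane_cong\<close>. Finiteness of the measure of the frontier supplies
  the disc of finite measure that \<open>hausdorff_hyperplane_cone\<close> asks for.\<close>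

lemma surface_Cone:
  assumes P: "emeasure H (frontier K) < \<top>"
  obtains k h where "0 < k" "k < \<top>" "h < \<top>"
    "\<And>A. A \<in> sets borel \<Longrightarrow> A \<subseteq> frontier K \<Longrightarrow> emeasure H A * k = emeasure lborel (Cone A) * h"
proof -
  obtain m where m: "m \<in> N" using ne by blast
  define k where "k = emeasure lborel (hyperplane_cone m r (cball (r *\<^sub>R m) 1))"
  define h where "h = emeasure H (cball 0 1 \<inter> {x. x \<bullet> m = 0})"
  have *: "emeasure H (cball 0 1 \<inter> {x. x \<bullet> n = 0}) < \<top> \<and>
      (A \<in> sets borel \<longrightarrow> A \<subseteq> {x. x \<bullet> n = r} \<longrightarrow> emeasure H A * k = emeasure lborel (hyperplane_cone n r A) * h)"
    if n: "n \<in> N" for n A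
  proof -
    obtain z e where z: "z \<bullet> n = r" "0 < e" "ball z e \<inter> {x. x \<bullet> n = r} \<subseteq> K" using facet_ball[OF n] by blast
    have "ball z e \<inter> {x. x \<bullet> n = r} \<subseteq> frontier K" using z(3) n unfolding fr by blast
    then have "emeasure H (ball z e \<inter> {x. x \<bullet> n = r}) \<le> emeasure H (frontier K)"
      by (intro emeasure_mono) (auto simp: surface_measure_def)
    then have fin: "emeasure H (ball z e \<inter> {x. x \<bullet> n = r}) < \<top>" using P by simp
    show ?thesis
      using hausdorff_hyperplane_cone(1)[OF unit[OF n] r z(1,2) fin[unfolded surface_measure_def]]
        hausdorff_hyperplane_cone(2)[OF unit[OF n] r z(1,2) fin[unfolded surface_measure_def], of A]
        hausdorff_cball_hyperplane_cong[OF unit[OF n] unit[OF m]]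
      unfolding surface_measure_def k_def h_def by auto
  qed
  \<comment> \<open>Facets may overlap. The induction splits off the part of \<open>A\<close> in one
    facet hyperplane and hands the rest, disjoint from it, to the remaining facets.\<close>
  have step: "emeasure H A * k = emeasure lborel (Cone A) * h"
    if "N' \<subseteq> N" "A \<in> sets borel" "A \<subseteq> (\<Union>n\<in>N'. K \<inter> {x. x \<bullet> n = r})" for N' A
    using finite_subset[OF that(1) fin] that
  proof (induction N' arbitrary: A rule: finite_induct)
    case empty
    then show ?case by (simp add: Cone_def)
  next
    case (insert n N')
    have "closed {x. x \<bullet> n = r}" using closed_hyperplane[of n r] by (simp add: inner_commute)
    then have b: "{x. x \<bullet> n = r} \<in> sets borel" by simp
    define A1 A2 where "A1 = A \<inter> {x. x \<bullet> n = r}" and "A2 = A - {x. x \<bullet> n = r}"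
    have A12: "A1 \<in> sets borel" "A2 \<in> sets borel" "A1 \<inter> A2 = {}" "A1 \<union> A2 = A"
      using insert.prems(2) b by (auto simp: A1_def A2_def)
    have sA: "A \<subseteq> K" using insert.prems by auto
    have n: "n \<in> N" using insert.prems by auto
    have e1: "emeasure H A1 * k = emeasure lborel (Cone A1) * h"
    proof -
      have "A1 \<subseteq> K \<inter> {x. x \<bullet> n = r}" using sA by (auto simp: A1_def)
      then show ?thesis using *[OF n, of A1] A12(1) Cone_facet[OF n, of A1] by auto
    qed
    have e2: "emeasure H A2 * k = emeasure lborel (Cone A2) * h"
      using insert.prems by (intro insert.IH) (use A12 in \<open>auto simp: A2_def\<close>)
    have c: "Cone A1 \<inter> Cone A2 = {}" "Cone A1 \<union> Cone A2 = Cone A"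
      using A12(3,4) by (auto simp: Cone_def)
    have "emeasure H A = emeasure H A1 + emeasure H A2"
      using plus_emeasure[of A1 H A2] A12 by (simp add: surface_measure_def)
    moreover have "emeasure lborel (Cone A) = emeasure lborel (Cone A1) + emeasure lborel (Cone A2)"
      using plus_emeasure[of "Cone A1" lborel "Cone A2"] A12 c by (simp add: Cone_measurable)
    ultimately show ?case using e1 e2 by (simp add: distrib_right)
  qed
  have "k < \<top>" unfolding k_def by (rule emeasure_hyperplane_cone_cball_finite[OF r])
  moreover have "0 < k" unfolding k_def by (rule emeasure_hyperplane_cone_pos[OF unit[OF m] r])
  moreover have "h < \<top>" using *[OF m] by (simp add: h_def)
  ultimately show thesis using that[of k h] step[OF order.refl] fr by auto
qed

lemma volume_pos_finite: "0 < emeasure lborel K" "emeasure lborel K < \<top>"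
  using emeasure_lborel_pos[OF K(3) K_measurable(1)] emeasure_compact_finite[OF K(1)] by simp_all

lemma measure_pos: "0 < measure lborel K" "emeasure lborel K = ennreal (measure lborel K)"
proof -
  show e: "emeasure lborel K = ennreal (measure lborel K)"
    using volume_pos_finite(2) by (intro emeasure_eq_ennreal_measure) simp
  show "0 < measure lborel K" using volume_pos_finite(1) unfolding e by (simp add: ennreal_less_zero_iff)
qed

text \<open>Within \<open>K\<close>, the preimage under \<open>radial\<close> of a part of the
  frontier is the cone over it, up to the origin, a null set. Surface measure is proportional to
  cone volume, and the constants cancel after normalisation.\<close>

lemma uniform_frontier_radial:
  assumes P: "0 < emeasure H (frontier K)" "emeasure H (frontier K) < \<top>"
  shows "uniform_measure H (frontier K) = distr (uniform_measure lborel K) borel radial"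
proof (rule measure_eqI)
  fix X assume "X \<in> sets (uniform_measure H (frontier K))"
  then have X[measurable]: "X \<in> sets borel" by (simp add: surface_measure_def)
  obtain k h where kh: "0 < k" "k < \<top>" "h < \<top>"
    "\<And>A. A \<in> sets borel \<Longrightarrow> A \<subseteq> frontier K \<Longrightarrow> emeasure H A * k = emeasure lborel (Cone A) * h"
    using surface_Cone[OF P(2)] by blast
  have Cf: "Cone (frontier K) = K - {0}" using radial_frontier by (auto simp: Cone_def)
  have K0: "emeasure lborel (K - {0}) = emeasure lborel K"
    by (rule emeasure_Diff_null_set) auto
  have CX: "Cone (frontier K \<inter> X) = (K \<inter> radial -` X) - {0}" using radial_frontier by (auto simp: Cone_def)
  have pX: "radial -` X \<in> sets borel" using measurable_sets_borel[OF radial_measurable X] .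
  have KX: "emeasure lborel ((K \<inter> radial -` X) - {0}) = emeasure lborel (K \<inter> radial -` X)"
    by (rule emeasure_Diff_null_set) (use pX in auto)
  have "emeasure H (frontier K \<inter> X) / emeasure H (frontier K) = emeasure lborel (K \<inter> radial -` X) / emeasure lborel K"
  proof (rule ratio_eq_ennreal[OF _ _ kh(1,2) P volume_pos_finite kh(3)])
    show "emeasure H (frontier K \<inter> X) * k = emeasure lborel (K \<inter> radial -` X) * h"
      using kh(4)[of "frontier K \<inter> X"] CX KX by simp
    show "emeasure H (frontier K) * k = emeasure lborel K * h"
      using kh(4)[of "frontier K"] Cf K0 by simp
    show "emeasure lborel (K \<inter> radial -` X) \<le> emeasure lborel K"
      by (intro emeasure_mono) auto
    show "emeasure H (frontier K \<inter> X) \<le> emeasure H (frontier K)"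
      by (intro emeasure_mono) (auto simp: surface_measure_def)
  qed
  then show "emeasure (uniform_measure H (frontier K)) X = emeasure (distr (uniform_measure lborel K) borel radial) X"
    using pX by (simp add: emeasure_distr surface_measure_def emeasure_uniform_measure)
qed (simp add: surface_measure_def)

lemma bounded_integrable_K:
  fixes f :: "'a \<Rightarrow> real"
  assumes [measurable]: "f \<in> borel_measurable borel" and b: "\<And>x. x \<in> K \<Longrightarrow> \<bar>f x\<bar> \<le> M"
  shows "integrable lborel (\<lambda>x. indicator K x * f x)"
proof (rule Bochner_Integration.integrable_bound)
  show "integrable lborel (\<lambda>x. M * indicator K x :: real)"
    using volume_pos_finite by (intro integrable_mult_right) auto
  have "0 \<in> K" using K interior_subset by auto
  then have "0 \<le> M" using b[of 0] by simp
  then show "AE x in lborel. norm (indicator K x * f x) \<le> norm (M * indicator K x :: real)"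
    using b by (auto simp: indicator_def)
qed measurable

text \<open>The mean of \<open>\<phi>\<close> over the shell \<open>K - s K\<close> is at least its mean over \<open>K\<close>, because the dilations of a
  centred random point increase in the convex order; the radial projection moves the points of the
  shell by little when \<open>s\<close> is close to 1.\<close>

lemma integral_radial_ge:
  fixes \<phi> :: "'a \<Rightarrow> real"
  assumes cvx: "convex_on UNIV \<phi>" and mean: "(\<integral>x. indicator K x *\<^sub>R x \<partial>lborel) = 0"
  shows "(\<integral>x. indicator K x * \<phi> x \<partial>lborel) \<le> (\<integral>x. indicator K x * \<phi> (radial x) \<partial>lborel)"
proof -
  define d where "d = DIM('a)"
  define A where "A = measure lborel K"
  have A: "0 < A" "emeasure lborel K = ennreal A"
    using measure_pos by (simp_all add: A_def)
  have cont: "continuous_on S \<phi>" for S using convex_on_UNIV_continuous[OF cvx] .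
  have [measurable]: "\<phi> \<in> borel_measurable borel" using cont by (rule borel_measurable_continuous_onI)
  have zero: "0 \<in> K" using K interior_subset by auto
  have prjK: "radial x \<in> K" for x
    using radial_frontier[of x] frontier_subset zero by (cases "x = 0") (auto simp: radial_def)
  obtain M where M: "\<And>x. x \<in> K \<Longrightarrow> \<bar>\<phi> x\<bar> \<le> M"
  proof -
    have "bounded (\<phi> ` K)" using compact_continuous_image[OF cont K(1)] compact_imp_bounded by blast
    then show thesis using that unfolding bounded_iff by auto
  qed
  obtain R where R: "0 < R" "\<And>x. x \<in> K \<Longrightarrow> norm x \<le> R"
    using bounded_pos[of K] K(1) compact_imp_bounded by blast
  have int: "integrable lborel (\<lambda>x. indicator K x * \<phi> (h x))"
    if "h \<in> borel_measurable borel" "\<And>x. x \<in> K \<Longrightarrow> h x \<in> K" for h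
    by (rule bounded_integrable_K[of _ M]) (use that M in auto)
  note intp = int[OF radial_measurable prjK] and inti = int[of "\<lambda>x. x", simplified]
  define J where "J = (\<integral>x. indicator K x * \<phi> x \<partial>lborel)"
  define JP where "JP = (\<integral>x. indicator K x * \<phi> (radial x) \<partial>lborel)"
  \<comment> \<open>Jensen's inequality at the centroid 0, via a subgradient of
    \<open>\<phi>\<close> there.\<close>
  have jensen: "A * \<phi> 0 \<le> J"
  proof -
    obtain g where g: "\<And>x. \<phi> x \<ge> \<phi> 0 + g \<bullet> (x - 0)" using convex_on_subgradient[OF cvx, of 0] by blast
    have ix: "integrable lborel (\<lambda>x. indicator K x *\<^sub>R x)"
    proof (rule Bochner_Integration.integrable_bound)
      show "integrable lborel (\<lambda>x. R * indicator K x :: real)"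
        using volume_pos_finite by (intro integrable_mult_right) auto
    qed (use R in \<open>auto simp: indicator_def\<close>)
    have "(\<integral>x. indicator K x * (g \<bullet> x) \<partial>lborel) = g \<bullet> (\<integral>x. indicator K x *\<^sub>R x \<partial>lborel)"
      using ix by (subst integral_inner_right[symmetric]) auto
    then have e: "(\<integral>x. indicator K x * (g \<bullet> x) \<partial>lborel) = 0" using mean by simp
    have i2: "integrable lborel (\<lambda>x. indicator K x * (g \<bullet> x))"
      using integrable_inner_right[OF ix, of g] ix by simp
    have "A * \<phi> 0 = (\<integral>x. indicator K x * \<phi> 0 + indicator K x * (g \<bullet> x) \<partial>lborel)"
      using i2 volume_pos_finite by (subst Bochner_Integration.integral_add) (auto simp: e A_def)
    also have "\<dots> \<le> J"
      unfolding J_def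
    proof (rule integral_mono)
      show "integrable lborel (\<lambda>x. indicator K x * \<phi> 0 + indicator K x * (g \<bullet> x))"
        using i2 volume_pos_finite by (intro Bochner_Integration.integrable_add) auto
      show "indicator K x * \<phi> 0 + indicator K x * (g \<bullet> x) \<le> indicator K x * \<phi> x" for x
        using g[of x] by (auto simp: indicator_def)
    qed (rule inti)
    finally show ?thesis .
  qed
  have "J \<le> JP + e * A" if e: "0 < e" for e
  proof -
    have "uniformly_continuous_on K \<phi>" by (rule compact_uniformly_continuous[OF cont K(1)])
    then obtain \<delta> where \<delta>: "0 < \<delta>" "\<And>x y. x \<in> K \<Longrightarrow> y \<in> K \<Longrightarrow> dist y x < \<delta> \<Longrightarrow> dist (\<phi> y) (\<phi> x) < e"
      using e unfolding uniformly_continuous_on_def by metis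
    \<comment> \<open>A point of the shell moves by at most \<open>(1 - s) * R\<close> under
      \<open>radial\<close>, which has to be smaller than \<open>\<delta>\<close>; the bound
      \<open>1 / 2\<close> keeps \<open>s\<close> positive.\<close>
    define s where "s = max (1 / 2) (1 - \<delta> / (2 * R))"
    have s: "0 < s" "s < 1" "(1 - s) * R < \<delta>"
      using R(1) \<delta>(1) by (auto simp: s_def max_def field_simps)
    have sd: "0 < s ^ d" "s ^ d < 1" using s by (simp_all add: d_def power_Suc_less_one power_less_one_iff)
    define sK where "sK = {x. facet_gauge x \<le> s}"
    have sKK: "sK \<subseteq> K" using s by (auto simp: sK_def mem_K_iff)
    have [measurable]: "sK \<in> sets borel"
      unfolding sK_def using measurable_sets_borel[OF facet_gauge_measurable, of "{..s}"] by (simp add: vimage_def)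
    have scaleK: "indicator sK (s *\<^sub>R x) = (indicator K x :: real)" for x
      using s by (auto simp: indicator_def sK_def mem_K_iff facet_gauge_scale)
    have ints: "integrable lborel (\<lambda>x. indicator sK x * \<phi> (h x))"
      if "h \<in> borel_measurable borel" "\<And>x. x \<in> K \<Longrightarrow> h x \<in> K" for h
    proof -
      have [measurable]: "h \<in> borel_measurable borel" by fact
      have "(\<lambda>x. indicator sK x * \<phi> (h x)) = (\<lambda>x. indicator K x * (indicator sK x * \<phi> (h x)))"
        using sKK by (auto simp: indicator_def fun_eq_iff)
      moreover have "integrable lborel (\<lambda>x. indicator K x * (indicator sK x * \<phi> (h x)))"
        by (rule bounded_integrable_K[of _ M]) (use that M zero in \<open>auto simp: indicator_def intro: order.trans[OF abs_ge_zero]\<close>)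
      ultimately show ?thesis by simp
    qed
    \<comment> \<open>\<open>radial\<close> is constant on open rays from 0, so the integral of the
      projected function over the dilated body is exactly \<open>s ^ d\<close> times the one over
      \<open>K\<close>.\<close>
    have E1: "(\<integral>x. indicator sK x * \<phi> (radial x) \<partial>lborel) = s ^ d * JP"
      using s by (subst integral_lborel_scale[OF s(1)]) (auto simp: scaleK radial_scale JP_def d_def)
    have E2: "(\<integral>x. indicator sK x * \<phi> x \<partial>lborel) = s ^ d * (\<integral>x. indicator K x * \<phi> (s *\<^sub>R x) \<partial>lborel)"
      using s by (subst integral_lborel_scale[OF s(1)]) (auto simp: scaleK d_def)
    have E3: "(\<integral>x. indicator sK x * e \<partial>lborel) = s ^ d * (e * A)"
      using s by (subst integral_lborel_scale[OF s(1)]) (auto simp: scaleK d_def A_def)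
    have sxK: "s *\<^sub>R x \<in> K" if "x \<in> K" for x
      using that s by (simp add: mem_K_iff facet_gauge_scale) (metis facet_gauge_0 facet_gauge_pos less_eq_real_def mult_le_one)
    \<comment> \<open>Convexity on the segment from \<open>0\<close> to \<open>x\<close>, combined
      with Jensen: a contraction towards the centroid does not increase the integral of
      \<open>\<phi>\<close>.\<close>
    have "(\<integral>x. indicator K x * \<phi> (s *\<^sub>R x) \<partial>lborel) \<le> (\<integral>x. s * (indicator K x * \<phi> x) + (1 - s) * (indicator K x * \<phi> 0) \<partial>lborel)"
    proof (rule integral_mono)
      show "integrable lborel (\<lambda>x. indicator K x * \<phi> (s *\<^sub>R x))" by (rule int) (use sxK in auto)
      show "integrable lborel (\<lambda>x. s * (indicator K x * \<phi> x) + (1 - s) * (indicator K x * \<phi> 0))"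
        using inti volume_pos_finite by (intro Bochner_Integration.integrable_add integrable_mult_right) auto
      fix x
      have "\<phi> (s *\<^sub>R x) \<le> s * \<phi> x + (1 - s) * \<phi> 0"
        using convex_onD[OF cvx, of "1 - s" x 0] s by simp
      then show "indicator K x * \<phi> (s *\<^sub>R x) \<le> s * (indicator K x * \<phi> x) + (1 - s) * (indicator K x * \<phi> 0)"
        by (auto simp: indicator_def)
    qed
    also have "\<dots> = s * J + (1 - s) * (A * \<phi> 0)"
      using inti volume_pos_finite by (subst Bochner_Integration.integral_add) (auto simp: J_def A_def)
    also have "\<dots> \<le> s * J + (1 - s) * J"
      using jensen s by (intro add_left_mono mult_left_mono) auto
    finally have mono: "(\<integral>x. indicator K x * \<phi> (s *\<^sub>R x) \<partial>lborel) \<le> J" by (simp add: algebra_simps)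
    let ?f = "\<lambda>x. indicator K x * \<phi> x - indicator sK x * \<phi> x"
    let ?g = "\<lambda>x. (indicator K x * \<phi> (radial x) - indicator sK x * \<phi> (radial x)) + (indicator K x * e - indicator sK x * e)"
    have isK: "integrable lborel (\<lambda>x. indicator sK x * e)"
    proof -
      have "emeasure lborel sK \<le> emeasure lborel K" using sKK by (intro emeasure_mono) auto
      then show ?thesis using volume_pos_finite by (intro integrable_mult_left) auto
    qed
    \<comment> \<open>The integral over the shell is at least \<open>(1 - s ^ d) * J\<close> and, by
      projecting, at most \<open>(1 - s ^ d) * (JP + e * A)\<close>; the positive factor is then
      cancelled.\<close>
    have "J - s ^ d * J \<le> J - (\<integral>x. indicator sK x * \<phi> x \<partial>lborel)"
      using E2 mono sd by simp
    also have "\<dots> = (\<integral>x. ?f x \<partial>lborel)"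
      using inti ints[of "\<lambda>x. x"] by (subst Bochner_Integration.integral_diff) (auto simp: J_def)
    also have "\<dots> \<le> (\<integral>x. ?g x \<partial>lborel)"
    proof (rule integral_mono)
      show "integrable lborel ?f" using inti ints[of "\<lambda>x. x"] by auto
      show "integrable lborel ?g" using intp ints[OF radial_measurable prjK] isK volume_pos_finite by auto
      fix x
      show "?f x \<le> ?g x"
      proof (cases "x \<in> K - sK")
        case True
        then have g: "s < facet_gauge x" "facet_gauge x \<le> 1" by (auto simp: sK_def mem_K_iff)
        have "facet_gauge x *\<^sub>R radial x = x" using g s by (simp add: radial_def)
        then have "radial x - x = (1 - facet_gauge x) *\<^sub>R radial x" by (simp add: scaleR_left_diff_distrib)
        then have "norm (radial x - x) = (1 - facet_gauge x) * norm (radial x)" using g by simp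
        also have "\<dots> \<le> (1 - s) * R" using g R(2)[OF prjK] s by (intro mult_mono) auto
        finally have "dist x (radial x) < \<delta>" using s(3) by (simp add: dist_norm norm_minus_commute)
        then have "\<bar>\<phi> x - \<phi> (radial x)\<bar> < e" using \<delta>(2)[OF prjK] True by (auto simp: dist_real_def)
        then show ?thesis using True by (auto simp: indicator_def)
      qed (use sKK in \<open>auto simp: indicator_def\<close>)
    qed
    also have "\<dots> = (JP - s ^ d * JP) + (A * e - s ^ d * (e * A))"
      using intp ints[OF radial_measurable prjK] isK volume_pos_finite E3
      by (simp add: Bochner_Integration.integral_add Bochner_Integration.integral_diff E1 JP_def[symmetric] A_def[symmetric])
    finally have "(1 - s ^ d) * J \<le> (1 - s ^ d) * (JP + e * A)" by (simp add: algebra_simps)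
    then show ?thesis using sd by (simp add: mult_le_cancel_left)
  qed
  then have "J \<le> JP + e" if "0 < e" for e
    using that A(1) by (metis divide_pos_pos nonzero_eq_divide_eq less_irrefl)
  then have "J \<le> JP" by (rule field_le_epsilon)
  then show ?thesis by (simp add: J_def JP_def)
qed

lemma integral_uniform_lborel:
  fixes f :: "'a \<Rightarrow> 'b::{banach, second_countable_topology}"
  assumes "f \<in> borel_measurable borel"
  shows "(\<integral>x. f x \<partial>uniform_measure lborel K) = (1 / measure lborel K) *\<^sub>R (\<integral>x. indicator K x *\<^sub>R f x \<partial>lborel)"
  using integral_uniform_measure[of K lborel f] volume_pos_finite assms by (simp add: set_lebesgue_integral_def)

lemma integral_uniform_le:
  fixes \<phi> :: "'a \<Rightarrow> real"
  assumes P: "0 < emeasure H (frontier K)" "emeasure H (frontier K) < \<top>"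
    and cvx: "convex_on UNIV \<phi>" and mean: "(\<integral>x. x \<partial>uniform_measure lborel K) = 0"
  shows "(\<integral>x. \<phi> x \<partial>uniform_measure lborel K) \<le> (\<integral>x. \<phi> x \<partial>uniform_measure H (frontier K))"
proof -
  have A: "0 < measure lborel K" by (rule measure_pos)
  have [measurable]: "\<phi> \<in> borel_measurable borel"
    using convex_on_UNIV_continuous[OF cvx] by (rule borel_measurable_continuous_onI)
  have "(\<integral>x. indicator K x *\<^sub>R x \<partial>lborel) = 0"
    using mean A by (simp add: integral_uniform_lborel)
  from integral_radial_ge[OF cvx this]
  have "(\<integral>x. \<phi> x \<partial>uniform_measure lborel K) \<le> (\<integral>x. \<phi> (radial x) \<partial>uniform_measure lborel K)"
    using A by (simp add: integral_uniform_lborel divide_right_mono)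
  also have "\<dots> = (\<integral>x. \<phi> x \<partial>uniform_measure H (frontier K))"
    unfolding uniform_frontier_radial[OF P] by (subst integral_distr) auto
  finally show ?thesis .
qed

end

text \<open>With a zero or infinite denominator the total mass, a quotient of extended reals, would
  be 0 instead of 1.\<close>

lemma uniform_measure_prob_pos:
  assumes "prob_space (uniform_measure \<mu> A)" "A \<in> sets \<mu>"
  shows "0 < emeasure \<mu> A" "emeasure \<mu> A < \<top>"
proof -
  interpret prob_space "uniform_measure \<mu> A" by fact
  have "emeasure \<mu> (A \<inter> A) / emeasure \<mu> A = emeasure (uniform_measure \<mu> A) A"
    using assms(2) by (simp add: emeasure_uniform_measure)
  moreover have "emeasure (uniform_measure \<mu> A) (space \<mu>) = 1"
    using emeasure_space_1 by simp
  then have 1: "emeasure \<mu> (A \<inter> space \<mu>) / emeasure \<mu> A = 1"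
    using assms(2) by (simp add: emeasure_uniform_measure)
  show "0 < emeasure \<mu> A" "emeasure \<mu> A < \<top>"
  proof -
    have A: "A \<inter> space \<mu> = A" using sets.sets_into_space[OF assms(2)] by blast
    show "0 < emeasure \<mu> A"
      using 1 A by (cases "emeasure \<mu> A = 0") (auto simp: zero_less_iff_neq_zero)
    show "emeasure \<mu> A < \<top>"
      using 1 A by (cases "emeasure \<mu> A = \<top>") (auto simp: less_top)
  qed
qed

section \<open>Moving the centre of the inscribed sphere to the origin\<close>

lemma surface_translate:
  fixes X :: "'a::euclidean_space set"
  shows "X \<in> sets borel \<Longrightarrow> emeasure surface_measure ((\<lambda>x. v + x) ` X) = emeasure surface_measure X"
  unfolding surface_measure_def by (rule hausdorff_translate)

lemma lborel_translate:
  fixes X :: "'a::euclidean_space set"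
  assumes "X \<in> sets borel"
  shows "emeasure lborel ((\<lambda>x. v + x) ` X) = emeasure lborel X"
proof -
  have "(\<lambda>x. v + x) ` X = (\<lambda>x. - v + x) -` X"
  proof (intro equalityI subsetI)
    fix y assume "y \<in> (\<lambda>x. - v + x) -` X"
    then have "y = v + (- v + y)" "- v + y \<in> X" by simp_all
    then show "y \<in> (\<lambda>x. v + x) ` X" by blast
  qed auto
  moreover have "emeasure (distr lborel borel (\<lambda>x. - v + x)) X = emeasure lborel ((\<lambda>x. - v + x) -` X \<inter> space lborel)"
    by (rule emeasure_distr) (use assms in auto)
  ultimately show ?thesis unfolding lborel_distr_plus by simp
qed

text \<open>The sphere lies in \<open>K\<close>, so the facet hyperplane has distance at least
  \<open>r\<close> from \<open>c\<close>; the tangent point lies on both, so by Cauchy-Schwarz the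
  distance is at most \<open>r\<close>. The disc in the facet comes from a relative interior point,
  since by dimension the facet spans its hyperplane.\<close>

lemma inscribed_sphere_facet:
  fixes K :: "'a::euclidean_space set"
  assumes K: "convex_body K" "polytope K" and sph: "inscribed_sphere c r K" and F: "F facet_of K"
  obtains n where "norm n = 1" "\<And>x. x \<in> K \<Longrightarrow> (x - c) \<bullet> n \<le> r" "F = K \<inter> {x. (x - c) \<bullet> n = r}"
    "\<exists>z e. (z - c) \<bullet> n = r \<and> 0 < e \<and> ball z e \<inter> {x. (x - c) \<bullet> n = r} \<subseteq> K"
proof -
  have r: "0 < r" and sK: "sphere c r \<subseteq> K" using sph by (auto simp: inscribed_sphere_def)
  obtain a b where ab: "a \<noteq> 0" "K \<subseteq> {x. a \<bullet> x \<le> b}" "F = K \<inter> {x. a \<bullet> x = b}"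
    using facet_of_polyhedron[OF polytope_imp_polyhedron[OF K(2)] F] .
  obtain p where p: "p \<in> F" "sphere c r \<inter> affine hull F = {p}"
    using sph F unfolding inscribed_sphere_def by blast
  have pc: "norm (p - c) = r" using p(2) by (auto simp: dist_norm norm_minus_commute)
  have "c + (r / norm a) *\<^sub>R a \<in> sphere c r" using ab(1) r by (simp add: dist_norm)
  then have "a \<bullet> (c + (r / norm a) *\<^sub>R a) \<le> b" using sK ab(2) by blast
  moreover have "a \<bullet> (c + (r / norm a) *\<^sub>R a) = a \<bullet> c + r * norm a"
    using ab(1) by (simp add: inner_add_right dot_square_norm power2_eq_square)
  moreover have "b = a \<bullet> c + a \<bullet> (p - c)" using p(1) ab(3) by (simp add: inner_diff_right)
  moreover have "a \<bullet> (p - c) \<le> norm a * r" using norm_cauchy_schwarz[of a "p - c"] pc by simp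
  ultimately have b: "b = a \<bullet> c + r * norm a" by (simp add: mult.commute)
  define n where "n = (1 / norm a) *\<^sub>R a"
  have le_iff: "(x - c) \<bullet> n \<le> r \<longleftrightarrow> a \<bullet> x \<le> b" and eq_iff: "(x - c) \<bullet> n = r \<longleftrightarrow> a \<bullet> x = b" for x
    using ab(1) by (auto simp: n_def b inner_diff_left inner_commute[of a] field_simps)
  have Fne: "F \<noteq> {}" "convex F" using F K facet_of_imp_face_of face_of_imp_convex
    by (auto simp: facet_of_def convex_body_def)
  obtain z where z: "z \<in> rel_interior F" using rel_interior_eq_empty[OF Fne(2)] Fne(1) by blast
  then obtain e where e: "0 < e" "ball z e \<inter> affine hull F \<subseteq> F" "z \<in> F"
    by (auto simp: mem_rel_interior_ball)
  have "aff_dim K = DIM('a)" using K(1) aff_dim_nonempty_interior by (auto simp: convex_body_def)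
  then have "aff_dim F = DIM('a) - 1" using F by (simp add: facet_of_def)
  then have "aff_dim F = aff_dim {x. a \<bullet> x = b}" using aff_dim_hyperplane[OF ab(1), of b] by simp
  then have hull: "affine hull F = {x. a \<bullet> x = b}"
    using aff_dim_eq_full_gen[of F "{x. a \<bullet> x = b}"] ab(3) affine_hyperplane[of a b] by (simp add: affine_hull_eq)
  show thesis
  proof (rule that[of n])
    show "norm n = 1" using ab(1) by (simp add: n_def)
    show "\<And>x. x \<in> K \<Longrightarrow> (x - c) \<bullet> n \<le> r" using le_iff ab(2) by blast
    show "F = K \<inter> {x. (x - c) \<bullet> n = r}" using ab(3) eq_iff by auto
    show "\<exists>z e. (z - c) \<bullet> n = r \<and> 0 < e \<and> ball z e \<inter> {x. (x - c) \<bullet> n = r} \<subseteq> K"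
      using e hull ab(3) eq_iff by (intro exI[of _ z] exI[of _ e]) auto
  qed
qed

lemma integral_uniform_circumscribed_polytope_le:
  fixes K :: "'a::euclidean_space set" and \<phi> :: "'a \<Rightarrow> real"
  assumes K: "convex_body K" "polytope K" and sph: "inscribed_sphere c r K"
    and P: "0 < emeasure surface_measure (frontier K)" "emeasure surface_measure (frontier K) < \<top>"
    and cvx: "convex_on UNIV \<phi>"
    and int: "integrable (uniform_measure lborel K) (\<lambda>x. x)"
    and mean: "(\<integral>x. x \<partial>uniform_measure lborel K) = c"
  shows "(\<integral>x. \<phi> x \<partial>uniform_measure lborel K) \<le> (\<integral>x. \<phi> x \<partial>uniform_measure surface_measure (frontier K))"
proof -
  have cK: "compact K" "convex K" "interior K \<noteq> {}" using K(1) by (auto simp: convex_body_def)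
  have clK: "closed K" using cK compact_imp_closed by blast
  define Fs where "Fs = {F. F facet_of K}"
  define Q where "Q F n \<longleftrightarrow> norm n = 1 \<and> (\<forall>x\<in>K. (x - c) \<bullet> n \<le> r) \<and> F = K \<inter> {x. (x - c) \<bullet> n = r} \<and>
    (\<exists>z e. (z - c) \<bullet> n = r \<and> 0 < e \<and> ball z e \<inter> {x. (x - c) \<bullet> n = r} \<subseteq> K)" for F n
  have "\<forall>F\<in>Fs. \<exists>n. Q F n"
  proof
    fix F assume "F \<in> Fs"
    then have F: "F facet_of K" by (simp add: Fs_def)
    show "\<exists>n. Q F n"
      by (rule inscribed_sphere_facet[OF K sph F]) (unfold Q_def, blast)
  qed
  from bchoice[OF this] obtain nf where Qnf: "\<forall>F\<in>Fs. Q F (nf F)" ..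
  then have nf: "norm (nf F) = 1" "x \<in> K \<Longrightarrow> (x - c) \<bullet> nf F \<le> r" "K \<inter> {x. (x - c) \<bullet> nf F = r} = F"
    "\<exists>z e. (z - c) \<bullet> nf F = r \<and> 0 < e \<and> ball z e \<inter> {x. (x - c) \<bullet> nf F = r} \<subseteq> K"
    if "F \<in> Fs" for F x using that unfolding Q_def by blast+
  have r: "0 < r" and sK: "sphere c r \<subseteq> K" using sph by (auto simp: inscribed_sphere_def)
  have frK: "frontier K = (\<Union>n\<in>nf ` Fs. K \<inter> {x. (x - c) \<bullet> n = r})"
  proof -
    have "frontier K = \<Union> Fs"
      using rel_frontier_of_polyhedron[OF polytope_imp_polyhedron[OF K(2)]]
        rel_frontier_nonempty_interior[OF cK(3)] by (simp add: Fs_def)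
    also have "\<dots> = (\<Union>F\<in>Fs. K \<inter> {x. (x - c) \<bullet> nf F = r})"
      by (simp add: nf(3))
    finally show ?thesis by simp
  qed
  have "frontier K \<noteq> {}" using P(1) by auto
  then have ne: "nf ` Fs \<noteq> {}" using frK by auto
  \<comment> \<open>\<open>c\<close> is the midpoint of two antipodal points of the sphere. It lies
    on no facet, because \<open>(c - c) \<bullet> n = 0 < r\<close> for each normal, and hence it is
    interior.\<close>
  have "c \<in> K"
  proof -
    obtain u :: 'a where u: "norm u = 1" using vector_choose_size[of 1] by auto
    have "c + r *\<^sub>R u \<in> K" "c - r *\<^sub>R u \<in> K" using sK r u by (auto simp: dist_norm)
    then have "(1 / 2) *\<^sub>R (c + r *\<^sub>R u) + (1 / 2) *\<^sub>R (c - r *\<^sub>R u) \<in> K"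
      using cK(2) by (intro convexD) auto
    then show ?thesis by (simp add: algebra_simps flip: scaleR_left.add)
  qed
  moreover have "c \<notin> frontier K" using r unfolding frK by auto
  ultimately have cint: "c \<in> interior K" using clK by (simp add: frontier_def)
  define T where "T = (\<lambda>x. - c + x)"
  have intT: "interior (T ` K) = T ` interior K" and frT: "frontier (T ` K) = T ` frontier K"
    unfolding T_def by (rule interior_translation, rule frontier_translation)
  have Tin: "y \<in> T ` X \<longleftrightarrow> y + c \<in> X" for y X by (force simp: T_def)
  interpret circumscribed_body "T ` K" "nf ` Fs" r
  proof
    show "compact (T ` K)" unfolding T_def by (rule compact_translation[OF cK(1)])
    show "convex (T ` K)" unfolding T_def by (rule convex_translation[OF cK(2)])
    show "0 \<in> interior (T ` K)" unfolding intT using cint Tin[of 0 "interior K"] by simp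
    show "finite (nf ` Fs)"
      using finite_polyhedron_facets[OF polytope_imp_polyhedron[OF K(2)]] by (simp add: Fs_def)
    show "frontier (T ` K) = (\<Union>n\<in>nf ` Fs. T ` K \<inter> {x. x \<bullet> n = r})"
      unfolding frT by (rule set_eqI) (simp add: Tin frK)
    fix n assume "n \<in> nf ` Fs"
    then obtain F where F: "F \<in> Fs" "n = nf F" by blast
    show "norm n = 1" using nf(1) F by blast
    show "x \<bullet> n \<le> r" if "x \<in> T ` K" for x
      using nf(2)[OF F(1), of "x + c"] that F(2) by (simp add: Tin)
    obtain z e where z: "(z - c) \<bullet> n = r" "0 < e" "ball z e \<inter> {x. (x - c) \<bullet> n = r} \<subseteq> K"
      using nf(4)[OF F(1)] F(2) by blast
    have "ball (z - c) e \<inter> {x. x \<bullet> n = r} \<subseteq> T ` K"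
    proof
      fix x assume "x \<in> ball (z - c) e \<inter> {x. x \<bullet> n = r}"
      moreover have "dist z (x + c) = dist (z - c) x" by (simp add: dist_norm diff_diff_eq add.commute)
      ultimately have "x + c \<in> ball z e \<inter> {x. (x - c) \<bullet> n = r}" by simp
      then show "x \<in> T ` K" using z(3) Tin by blast
    qed
    then show "\<exists>z e. z \<bullet> n = r \<and> 0 < e \<and> ball z e \<inter> {x. x \<bullet> n = r} \<subseteq> T ` K" using z by blast
  qed (use r ne in auto)
  have UL: "uniform_measure lborel (T ` K) = distr (uniform_measure lborel K) borel T"
    unfolding T_def
    by (rule uniform_measure_translate[symmetric]) (simp, erule lborel_translate, use clK in simp)
  have US: "uniform_measure surface_measure (T ` frontier K) = distr (uniform_measure surface_measure (frontier K)) borel T"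
    unfolding T_def
    by (rule uniform_measure_translate[symmetric])
      (simp add: surface_measure_def, erule surface_translate, simp)
  define \<psi> where "\<psi> y = \<phi> (c + y)" for y
  have cvx': "convex_on UNIV \<psi>"
  proof (rule convex_onI)
    fix t :: real and x y assume "0 < t" "t < 1"
    moreover have "c + ((1 - t) *\<^sub>R x + t *\<^sub>R y) = (1 - t) *\<^sub>R (c + x) + t *\<^sub>R (c + y)"
      by (simp add: algebra_simps)
    ultimately show "\<psi> ((1 - t) *\<^sub>R x + t *\<^sub>R y) \<le> (1 - t) * \<psi> x + t * \<psi> y"
      using convex_onD[OF cvx, of t "c + x" "c + y"] by (simp add: \<psi>_def)
  qed auto
  have [measurable]: "\<phi> \<in> borel_measurable borel"
    using convex_on_UNIV_continuous[OF cvx] by (rule borel_measurable_continuous_onI)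
  have [measurable]: "\<psi> \<in> borel_measurable borel"
    using convex_on_UNIV_continuous[OF cvx'] by (rule borel_measurable_continuous_onI)
  have [measurable]: "T \<in> borel_measurable borel" by (simp add: T_def)
  have pos: "0 < emeasure lborel K" "emeasure lborel K < \<top>"
    using emeasure_lborel_pos[OF cint] clK emeasure_compact_finite[OF cK(1)] by auto
  interpret U: prob_space "uniform_measure lborel K"
  proof (rule prob_space_uniform_measure)
    show "emeasure lborel K \<noteq> 0" using pos(1) by (metis less_irrefl)
    show "emeasure lborel K \<noteq> \<infinity>" using pos(2) by (metis less_irrefl infinity_ennreal_def)
  qed
  have m0: "(\<integral>x. x \<partial>uniform_measure lborel (T ` K)) = 0"
  proof -
    have "(\<integral>x. x \<partial>uniform_measure lborel (T ` K)) = (\<integral>x. T x \<partial>uniform_measure lborel K)"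
      unfolding UL by (rule integral_distr) auto
    also have "\<dots> = (\<integral>x. - c \<partial>uniform_measure lborel K) + (\<integral>x. x \<partial>uniform_measure lborel K)"
      unfolding T_def by (rule Bochner_Integration.integral_add[OF _ int]) simp
    also have "\<dots> = 0" using mean U.prob_space by simp
    finally show ?thesis .
  qed
  have Pos: "0 < emeasure surface_measure (frontier (T ` K))" "emeasure surface_measure (frontier (T ` K)) < \<top>"
  proof -
    have "emeasure surface_measure (T ` frontier K) = emeasure surface_measure (frontier K)"
      unfolding T_def by (rule surface_translate) simp
    then show "0 < emeasure surface_measure (frontier (T ` K))" "emeasure surface_measure (frontier (T ` K)) < \<top>"
      using P by (simp_all only: frT)
  qed
  have "(\<integral>x. \<psi> (T x) \<partial>uniform_measure lborel K) \<le> (\<integral>x. \<psi> (T x) \<partial>uniform_measure surface_measure (frontier K))"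
  proof -
    have "(\<integral>x. \<psi> x \<partial>uniform_measure lborel (T ` K)) = (\<integral>x. \<psi> (T x) \<partial>uniform_measure lborel K)"
      unfolding UL by (rule integral_distr) auto
    moreover have "(\<integral>x. \<psi> x \<partial>uniform_measure surface_measure (T ` frontier K)) =
        (\<integral>x. \<psi> (T x) \<partial>uniform_measure surface_measure (frontier K))"
      unfolding US by (rule integral_distr) (auto simp: surface_measure_def)
    ultimately show ?thesis using integral_uniform_le[OF Pos cvx' m0] by (simp only: frT)
  qed
  then show ?thesis by (simp add: \<psi>_def T_def)
qed

section \<open>Convex functions in the plane and ridge functions\<close>

text \<open>Otherwise the component of \<open>w\<close> orthogonal to \<open>u\<close> would be
  nonzero and orthogonal to both \<open>a\<close> and \<open>u\<close>, giving three independent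
  vectors in a plane.\<close>

lemma planar_orthogonal_eq:
  fixes a u w :: "'a::euclidean_space"
  assumes dim: "DIM('a) = 2" and "a \<noteq> 0" "u \<noteq> 0" "a \<bullet> u = 0" "a \<bullet> w = 0"
  shows "w = ((w \<bullet> u) / (u \<bullet> u)) *\<^sub>R u"
proof (rule ccontr)
  define w' where "w' = w - ((w \<bullet> u) / (u \<bullet> u)) *\<^sub>R u"
  assume "\<not> ?thesis"
  then have w0: "w' \<noteq> 0" by (simp add: w'_def)
  have wu: "w' \<bullet> u = 0" "a \<bullet> w' = 0"
    using assms by (simp_all add: w'_def inner_diff_left inner_diff_right)
  have ne: "a \<noteq> u" "a \<noteq> w'" "u \<noteq> w'"
    using assms wu w0 by (metis inner_eq_zero_iff)+
  have "independent {a, u, w'}"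
    using assms wu w0 by (intro pairwise_orthogonal_independent)
      (auto simp: pairwise_def orthogonal_def inner_commute)
  then have "card {a, u, w'} \<le> 2" using independent_bound dim by metis
  then show False using ne by simp
qed

text \<open>Deleting an extreme point leaves a convex set, which here contains \<open>S\<close> and
  thus its hull.\<close>

lemma extreme_not_in_hull:
  assumes "v extreme_point_of (convex hull G)" "S \<subseteq> convex hull G" "v \<notin> S"
  shows "v \<notin> convex hull S"
proof -
  have "convex (convex hull G - {v})"
    using assms(1) extreme_point_of_stillconvex[of "convex hull G" v] by simp
  then have "convex hull S \<subseteq> convex hull G - {v}"
    using assms(2,3) by (intro hull_minimal) auto
  then show ?thesis by blast
qed

text \<open>The cone generated by the functions \<open>max 0 (a \<bullet> x + b)\<close>.\<close>

inductive_set ridges :: "('a::euclidean_space \<Rightarrow> real) set" where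
  zero: "(\<lambda>_. 0) \<in> ridges"
| step: "\<Phi> \<in> ridges \<Longrightarrow> 0 \<le> s \<Longrightarrow> (\<lambda>x. \<Phi> x + s * max 0 (a \<bullet> x + b)) \<in> ridges"

lemma ridges_add: "\<Psi> \<in> ridges \<Longrightarrow> \<Phi> \<in> ridges \<Longrightarrow> (\<lambda>x. \<Phi> x + \<Psi> x) \<in> ridges"
proof (induction rule: ridges.induct)
  case (step \<Psi> s a b)
  then have "(\<lambda>x. (\<Phi> x + \<Psi> x) + s * max 0 (a \<bullet> x + b)) \<in> ridges" by (intro ridges.step)
  then show ?case by (simp add: add.assoc)
qed simp

lemma ridges_nonneg: "\<Phi> \<in> ridges \<Longrightarrow> 0 \<le> \<Phi> x"
  by (induction rule: ridges.induct) auto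

text \<open>\<open>G\<close> is in convex position: the vertex set of a polygon, possibly
  degenerate.\<close>

locale planar_extreme =
  fixes G :: "'a::euclidean_space set"
  assumes dim: "DIM('a) = 2" and fin: "finite G"
    and ext: "\<And>v. v \<in> G \<Longrightarrow> v extreme_point_of (convex hull G)"
begin

text \<open>A point of the hull on the line beyond \<open>e\<close> would put the vertex
  \<open>e\<close> strictly between that point and \<open>f\<close>, against extremality; likewise
  beyond \<open>f\<close>.\<close>

lemma on_line:
  assumes "e \<in> G" "f \<in> G" "e \<noteq> f" "a \<noteq> 0" "a \<bullet> e + b = 0" "a \<bullet> f + b = 0"
    and z: "z \<in> convex hull G" "a \<bullet> z + b = 0"
  shows "z \<in> convex hull {e, f}"
proof -
  define s where "s = ((z - e) \<bullet> (f - e)) / ((f - e) \<bullet> (f - e))"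
  have "a \<bullet> (f - e) = 0" "a \<bullet> (z - e) = 0" using assms by (simp_all add: inner_diff_right)
  then have "z - e = s *\<^sub>R (f - e)"
    unfolding s_def using assms by (intro planar_orthogonal_eq[OF dim]) auto
  then have zs: "z = (1 - s) *\<^sub>R e + s *\<^sub>R f" by (simp add: algebra_simps)
  have efG: "e \<in> convex hull G" "f \<in> convex hull G" using assms hull_inc by metis+
  have "0 \<le> s"
  proof (rule ccontr)
    assume "\<not> 0 \<le> s"
    then have s: "s < 0" by simp
    have "e = (1 / (1 - s)) *\<^sub>R z + (- s / (1 - s)) *\<^sub>R f"
    proof -
      have "(1 / (1 - s)) *\<^sub>R z = e + (s / (1 - s)) *\<^sub>R f" using s by (simp add: zs scaleR_add_right)
      then show ?thesis by simp
    qed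
    then have "e \<in> convex hull {z, f}"
      unfolding convex_hull_2 using s
      by (intro CollectI exI[of _ "1 / (1 - s)"] exI[of _ "- s / (1 - s)"]) (auto simp: divide_simps)
    moreover have "e \<noteq> z" using zs s assms(3) by (auto simp: algebra_simps)
    ultimately show False
      using extreme_not_in_hull[OF ext[OF assms(1)], of "{z, f}"] assms(3) z efG by auto
  qed
  moreover have "s \<le> 1"
  proof (rule ccontr)
    assume "\<not> s \<le> 1"
    then have s: "1 < s" by simp
    have "f = (1 / s) *\<^sub>R z + ((s - 1) / s) *\<^sub>R e"
    proof -
      have "(1 / s) *\<^sub>R z = ((1 - s) / s) *\<^sub>R e + f" using s by (simp add: zs scaleR_add_right)
      moreover have "((1 - s) / s) *\<^sub>R e = - (((s - 1) / s) *\<^sub>R e)"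
        by (simp add: minus_divide_left flip: scaleR_minus_left)
      ultimately show ?thesis by simp
    qed
    then have "f \<in> convex hull {z, e}"
      unfolding convex_hull_2 using s
      by (intro CollectI exI[of _ "1 / s"] exI[of _ "(s - 1) / s"]) (auto simp: divide_simps)
    moreover have "f \<noteq> z"
    proof
      assume "f = z"
      then have "((1 - s) *\<^sub>R e + s *\<^sub>R f) - f = 0" using zs by simp
      moreover have "(1 - s) *\<^sub>R (e - f) = ((1 - s) *\<^sub>R e + s *\<^sub>R f) - f" by (simp add: algebra_simps)
      ultimately have "(1 - s) *\<^sub>R (e - f) = 0" by simp
      then show False using s assms(3) by simp
    qed
    ultimately show False
      using extreme_not_in_hull[OF ext[OF assms(2)], of "{z, e}"] assms(3) z efG by auto
  qed
  ultimately show ?thesis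
    unfolding convex_hull_2 zs by (intro CollectI exI[of _ "1 - s"] exI[of _ s]) auto
qed

text \<open>The line through two vertices cuts the polygon into the hulls of the vertices on either
  side. Write \<open>x\<close> as a mixture of \<open>p\<close> in the hull of \<open>A\<close> and
  \<open>q\<close> in the hull of \<open>B\<close>; the segment from \<open>x\<close> to
  \<open>q\<close> meets the line in a point \<open>z\<close> of the chord, and \<open>x\<close>
  lies between \<open>p\<close> and \<open>z\<close>.\<close>

lemma hull_halfplane:
  assumes ef: "e \<in> G" "f \<in> G" "e \<noteq> f" "a \<noteq> 0" "a \<bullet> e + b = 0" "a \<bullet> f + b = 0"
    and AB: "A \<subseteq> G" "B \<subseteq> G" "e \<in> A" "f \<in> A" "\<And>v. v \<in> A \<Longrightarrow> a \<bullet> v + b \<ge> 0" "\<And>v. v \<in> B \<Longrightarrow> a \<bullet> v + b \<le> 0"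
    and x: "x \<in> convex hull (A \<union> B)" "a \<bullet> x + b \<ge> 0"
  shows "x \<in> convex hull A"
proof (cases "B = {}")
  case False
  have "A \<noteq> {}" using AB by auto
  then obtain p q \<theta> where pq: "p \<in> convex hull A" "q \<in> convex hull B" "0 \<le> \<theta>" "\<theta> \<le> 1"
    "x = (1 - \<theta>) *\<^sub>R p + \<theta> *\<^sub>R q"
  proof -
    have "convex hull (A \<union> B) = convex hull (convex hull A \<union> convex hull B)" by (rule hull_Un) (auto intro: convex_Inter)
    also have "\<dots> = {u *\<^sub>R s + v *\<^sub>R t | u v s t. u \<ge> 0 \<and> v \<ge> 0 \<and> u + v = 1 \<and> s \<in> convex hull A \<and> t \<in> convex hull B}"
      by (rule convex_hull_union_two) (use \<open>A \<noteq> {}\<close> False in auto)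
    finally obtain u v p q where "x = u *\<^sub>R p + v *\<^sub>R q" "0 \<le> u" "0 \<le> v" "u + v = 1"
      "p \<in> convex hull A" "q \<in> convex hull B" using x(1) by blast
    moreover have "u = 1 - v" using \<open>u + v = 1\<close> by simp
    ultimately show thesis using that[of p q v] by auto
  qed
  have half: "convex {z. a \<bullet> z + b \<le> 0}"
  proof -
    have "{z. a \<bullet> z + b \<le> 0} = {z. a \<bullet> z \<le> - b}" by auto
    then show ?thesis by (simp add: convex_halfspace_le)
  qed
  have qb: "a \<bullet> q + b \<le> 0"
    using hull_minimal[of B "{z. a \<bullet> z + b \<le> 0}" convex] half AB(6) pq(2) by auto
  have seg: "convex hull {e, f} \<subseteq> convex hull A" using AB by (intro hull_mono) auto
  have AG: "convex hull A \<subseteq> convex hull G" "convex hull B \<subseteq> convex hull G" using hull_mono[OF AB(1)] hull_mono[OF AB(2)] by auto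
  show ?thesis
  proof (cases "a \<bullet> q + b = 0")
    case True
    then have "q \<in> convex hull A"
      using on_line[OF ef, of q] pq(2) seg AG by blast
    then show ?thesis unfolding pq(5) using pq convex_convex_hull[of A] by (intro convexD) auto
  next
    case False
    then have q0: "a \<bullet> q + b < 0" using qb by simp
    define \<mu> where "\<mu> = (a \<bullet> x + b) / ((a \<bullet> x + b) - (a \<bullet> q + b))"
    have \<mu>: "0 \<le> \<mu>" "\<mu> < 1" using q0 x(2) by (auto simp: \<mu>_def divide_simps)
    define z where "z = (1 - \<mu>) *\<^sub>R x + \<mu> *\<^sub>R q"
    have "a \<bullet> z + b = (1 - \<mu>) * (a \<bullet> x + b) + \<mu> * (a \<bullet> q + b)"
      by (simp add: z_def inner_add_right algebra_simps)
    also have "\<dots> = (a \<bullet> x + b) - \<mu> * ((a \<bullet> x + b) - (a \<bullet> q + b))" by (simp add: algebra_simps)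
    also have "\<dots> = 0" using q0 x(2) by (simp add: \<mu>_def)
    finally have z0: "a \<bullet> z + b = 0" .
    have "x \<in> convex hull G" using x(1) AB hull_mono[of "A \<union> B" G convex] by blast
    then have "z \<in> convex hull G"
      unfolding z_def using \<mu> pq(2) AG by (intro convexD[OF convex_convex_hull]) auto
    then have zA: "z \<in> convex hull A" using on_line[OF ef _ z0] seg by blast
    \<comment> \<open>Eliminating \<open>q\<close> between the formulas for \<open>x\<close> and
      \<open>z\<close> gives \<open>D *\<^sub>R x = \<theta> *\<^sub>R z + (\<mu> * (1 - \<theta>))
      *\<^sub>R p\<close>, with \<open>D\<close> the sum of the weights.\<close>
    define D where "D = \<mu> * (1 - \<theta>) + \<theta>"
    show ?thesis
    proof (cases "\<mu> = 0")
      case True then show ?thesis using zA by (simp add: z_def)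
    next
      case False
      then have "0 < D" using \<mu> pq(3,4) unfolding D_def
        by (cases "\<theta> = 0") (auto intro: add_nonneg_pos)
      have "\<theta> *\<^sub>R z = (\<theta> * (1 - \<mu>)) *\<^sub>R x + \<mu> *\<^sub>R (\<theta> *\<^sub>R q)"
        by (simp add: z_def scaleR_add_right mult.commute)
      also have "\<theta> *\<^sub>R q = x - (1 - \<theta>) *\<^sub>R p" by (simp add: pq(5))
      finally have "\<theta> *\<^sub>R z + (\<mu> * (1 - \<theta>)) *\<^sub>R p = D *\<^sub>R x"
        by (simp add: D_def algebra_simps)
      then have "x = (1 / D) *\<^sub>R (\<theta> *\<^sub>R z + (\<mu> * (1 - \<theta>)) *\<^sub>R p)" using \<open>0 < D\<close> by simp
      then have "x = (\<theta> / D) *\<^sub>R z + (\<mu> * (1 - \<theta>) / D) *\<^sub>R p" by (simp add: scaleR_add_right)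
      moreover have "\<theta> / D + \<mu> * (1 - \<theta>) / D = 1" using \<open>0 < D\<close> by (simp add: D_def divide_simps)
      ultimately show ?thesis
        using zA pq(1,3,4) \<mu> \<open>0 < D\<close> convexD[OF convex_convex_hull[of A], of z p "\<theta> / D" "\<mu> * (1 - \<theta>) / D"]
        by (simp only:) simp
    qed
  qed
qed (use x in simp)

text \<open>The three affine forms are the barycentric coordinates for the triangle
  \<open>e t f\<close>. The one of \<open>t\<close> is the normalised height over the line
  \<open>e f\<close>; the forms with \<open>a1\<close> and \<open>a2\<close> vanish on the lines
  \<open>e t\<close> and \<open>t f\<close>.\<close>

lemma barycentric:
  assumes "e \<in> G" "f \<in> G" "e \<noteq> f" "a \<bullet> e + b = 0" "a \<bullet> f + b = 0" "a \<bullet> t + b > 0"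
  obtains a1 b1 a2 b2 where
    "\<And>x. x = (a2 \<bullet> x + b2) *\<^sub>R e + ((a \<bullet> x + b) / (a \<bullet> t + b)) *\<^sub>R t + (a1 \<bullet> x + b1) *\<^sub>R f"
    "\<And>x. (a2 \<bullet> x + b2) + ((a \<bullet> x + b) / (a \<bullet> t + b)) + (a1 \<bullet> x + b1) = 1"
    "a1 \<bullet> e + b1 = 0" "a1 \<bullet> t + b1 = 0" "a1 \<bullet> f + b1 = 1"
    "a2 \<bullet> f + b2 = 0" "a2 \<bullet> t + b2 = 0" "a2 \<bullet> e + b2 = 1"
proof -
  define u where "u = f - e"
  define h where "h = a \<bullet> t + b"
  have u0: "u \<noteq> 0" using assms(3) by (simp add: u_def)
  moreover have "u \<bullet> u \<noteq> 0" using u0 by simp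
  moreover have "a \<bullet> u = 0" using assms(4,5) by (simp add: u_def inner_diff_right)
  ultimately have u: "u \<noteq> 0" "a \<bullet> u = 0" "u \<bullet> u \<noteq> 0" by simp_all
  have h: "h \<noteq> 0" "h > 0" using assms by (auto simp: h_def)
  have a0: "a \<noteq> 0" using assms(4,6) by auto
  have b: "b = - (a \<bullet> e)" using assms(4) by simp
  \<comment> \<open>\<open>k\<close> is the coordinate of \<open>t\<close> along \<open>u\<close>;
    subtracting \<open>k / h\<close> times the height makes the form of \<open>a1\<close> vanish at
    \<open>t\<close> as well as at \<open>e\<close>.\<close>
  define k where "k = ((t - e) \<bullet> u) / (u \<bullet> u)"
  define a1 where "a1 = (1 / (u \<bullet> u)) *\<^sub>R u - (k / h) *\<^sub>R a"
  define b1 where "b1 = - (a1 \<bullet> e)"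
  define a2 where "a2 = - a1 - (1 / h) *\<^sub>R a"
  define b2 where "b2 = 1 - b1 - b / h"
  have g1: "a1 \<bullet> x + b1 = ((x - e) \<bullet> u) / (u \<bullet> u) - (k / h) * (a \<bullet> x + b)" for x
    by (simp add: b1_def a1_def b inner_diff_left inner_diff_right inner_commute algebra_simps diff_divide_distrib)
  have g2: "a2 \<bullet> x + b2 = 1 - (a \<bullet> x + b) / h - (a1 \<bullet> x + b1)" for x
    by (simp add: a2_def b2_def inner_diff_left add_divide_distrib)
  have e1: "a1 \<bullet> e + b1 = 0" by (simp add: b1_def)
  have e2: "a1 \<bullet> t + b1 = 0" using h unfolding g1 h_def[symmetric] by (simp add: k_def)
  have e3: "a1 \<bullet> f + b1 = 1" using u assms(5) unfolding g1 by (simp add: u_def)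
  have rep: "x = (a2 \<bullet> x + b2) *\<^sub>R e + ((a \<bullet> x + b) / h) *\<^sub>R t + (a1 \<bullet> x + b1) *\<^sub>R f" for x
  proof -
    define g where "g = (a \<bullet> x + b) / h"
    define w where "w = x - e - g *\<^sub>R (t - e)"
    have "a \<bullet> w = (a \<bullet> x + b) - g * h"
      by (simp add: w_def inner_diff_right h_def b algebra_simps)
    then have "a \<bullet> w = 0" using h by (simp add: g_def)
    then have "w = ((w \<bullet> u) / (u \<bullet> u)) *\<^sub>R u"
      by (rule planar_orthogonal_eq[OF dim a0 u(1,2)])
    moreover have "(w \<bullet> u) / (u \<bullet> u) = a1 \<bullet> x + b1"
    proof -
      have "w \<bullet> u = (x - e) \<bullet> u - g * ((t - e) \<bullet> u)" by (simp add: w_def inner_diff_left)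
      then have "(w \<bullet> u) / (u \<bullet> u) = ((x - e) \<bullet> u) / (u \<bullet> u) - g * ((t - e) \<bullet> u) / (u \<bullet> u)"
        by (simp add: diff_divide_distrib)
      moreover have "(k / h) * (a \<bullet> x + b) = g * ((t - e) \<bullet> u) / (u \<bullet> u)" by (simp add: k_def g_def mult.commute)
      ultimately show ?thesis unfolding g1 by simp
    qed
    ultimately have "w = (a1 \<bullet> x + b1) *\<^sub>R u" by (simp only:)
    moreover have "x = e + g *\<^sub>R (t - e) + w" by (simp add: w_def)
    ultimately have "x = e + g *\<^sub>R (t - e) + (a1 \<bullet> x + b1) *\<^sub>R u" by (simp only:)
    also have "\<dots> = (1 - g - (a1 \<bullet> x + b1)) *\<^sub>R e + g *\<^sub>R t + (a1 \<bullet> x + b1) *\<^sub>R f"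
      unfolding u_def by (simp add: scaleR_diff_right scaleR_diff_left)
    finally show ?thesis unfolding g2 g_def .
  qed
  show thesis
  proof (rule that[of a2 b2 a1 b1])
    show "a2 \<bullet> f + b2 = 0" "a2 \<bullet> t + b2 = 0" "a2 \<bullet> e + b2 = 1"
      unfolding g2 using e1 e2 e3 assms(4,5) h by (simp_all add: h_def)
  qed (use rep g2 e1 e2 e3 in \<open>auto simp: h_def\<close>)
qed

text \<open>Solving for \<open>z\<close> exhibits this vertex as a convex combination of
  \<open>v\<close>, \<open>p\<close> and \<open>q\<close>: no vertex lies in the sector opposite to
  a corner of a triangle of vertices.\<close>

lemma barycentric_sign:
  assumes abc: "p \<in> G" "q \<in> G" "z \<in> G" "p \<noteq> z" "q \<noteq> z" and v: "v \<in> G" "v \<noteq> z"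
    and rep: "v = \<alpha> *\<^sub>R p + \<beta> *\<^sub>R q + \<gamma> *\<^sub>R z" "\<alpha> + \<beta> + \<gamma> = 1" "\<alpha> \<le> 0" "\<beta> \<le> 0"
  shows False
proof -
  have g: "\<gamma> \<ge> 1" using rep by simp
  have "(1 / \<gamma>) *\<^sub>R v = (\<alpha> / \<gamma>) *\<^sub>R p + (\<beta> / \<gamma>) *\<^sub>R q + z"
    using g by (subst rep(1)) (simp add: scaleR_add_right)
  then have zc: "z = (1 / \<gamma>) *\<^sub>R v + (- \<alpha> / \<gamma>) *\<^sub>R p + (- \<beta> / \<gamma>) *\<^sub>R q" by (simp add: algebra_simps)
  moreover have "1 / \<gamma> + - \<alpha> / \<gamma> + - \<beta> / \<gamma> = (1 - \<alpha> - \<beta>) / \<gamma>" by (simp add: diff_divide_distrib)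
  moreover have "1 - \<alpha> - \<beta> = \<gamma>" using rep(2) by simp
  ultimately have w1: "1 / \<gamma> + - \<alpha> / \<gamma> + - \<beta> / \<gamma> = 1" using g by simp
  have "z \<in> convex hull {v, p, q}"
    unfolding convex_hull_3 using g rep(3,4) zc w1
    by (intro CollectI exI[of _ "1 / \<gamma>"] exI[of _ "- \<alpha> / \<gamma>"] exI[of _ "- \<beta> / \<gamma>"]) (auto simp: divide_nonpos_pos)
  moreover have "{v, p, q} \<subseteq> convex hull G" using abc v hull_inc by (metis empty_subsetI insert_subset)
  ultimately show False using extreme_not_in_hull[OF ext[OF abc(3)], of "{v, p, q}"] abc v by auto
qed

end

context planar_extreme
begin

text \<open>Among the points strictly above the chord \<open>e f\<close>, let \<open>t\<close> minimise the ratio \<open>s\<close> of \<open>y\<close> to the affine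
  function \<open>l\<close> of the chord. The data \<open>y - s * l\<close> vanish at \<open>e\<close>, \<open>t\<close> and \<open>f\<close>, and the recursion continues
  with the chords \<open>e t\<close> and \<open>t f\<close>.\<close>

lemma ridge_interpolation:
  fixes y :: "'a \<Rightarrow> real"
  assumes "e \<in> G" "f \<in> G" "e \<noteq> f" "a \<noteq> 0" "a \<bullet> e + b = 0" "a \<bullet> f + b = 0" "y e = 0" "y f = 0"
    and "\<And>v. v \<in> G \<Longrightarrow> 0 \<le> a \<bullet> v + b \<Longrightarrow> 0 \<le> y v"
  shows "\<exists>\<Phi>\<in>ridges. (\<forall>v\<in>G. 0 \<le> a \<bullet> v + b \<longrightarrow> \<Phi> v = y v) \<and> (\<forall>v\<in>G. a \<bullet> v + b \<le> 0 \<longrightarrow> \<Phi> v = 0) \<and>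
    (\<forall>\<psi>. convex_on UNIV \<psi> \<longrightarrow> (\<forall>v\<in>G. 0 \<le> a \<bullet> v + b \<longrightarrow> \<psi> v \<le> y v) \<longrightarrow>
      (\<forall>x\<in>convex hull {v \<in> G. 0 \<le> a \<bullet> v + b}. \<psi> x \<le> \<Phi> x))"
  using assms
proof (induction "card {v \<in> G. 0 \<le> a \<bullet> v + b}" arbitrary: e f a b y rule: less_induct)
  case less
  note ef = less.prems(1-6) and y0 = less.prems(7-8) and ynn = less.prems(9)
  let ?Gp = "{v \<in> G. 0 \<le> a \<bullet> v + b}"
  have line: "v = e \<or> v = f" if v: "v \<in> G" "a \<bullet> v + b = 0" for v
  proof (rule ccontr)
    assume "\<not> ?thesis"
    moreover have "v \<in> convex hull {e, f}" using on_line[OF ef hull_inc v(2)] v by blast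
    moreover have "{e, f} \<subseteq> convex hull G" using ef hull_inc by (metis empty_subsetI insert_subset)
    ultimately show False using extreme_not_in_hull[OF ext[OF v(1)], of "{e, f}"] by blast
  qed
  show ?case
  proof (cases "?Gp = {e, f}")
    \<comment> \<open>No vertex lies beyond the chord: the zero function interpolates, and a convex
      \<open>\<psi>\<close> that is nonpositive at \<open>e\<close> and \<open>f\<close> is
      nonpositive on the segment.\<close>
    case True
    have psi_le: "\<psi> x \<le> 0" if cv: "convex_on UNIV \<psi>" and le: "\<forall>v\<in>G. 0 \<le> a \<bullet> v + b \<longrightarrow> \<psi> v \<le> y v"
      and x: "x \<in> convex hull ?Gp" for \<psi> x
    proof -
      have "convex_on (convex hull {e, f}) \<psi>" by (rule convex_on_subset[OF cv]) auto
      moreover have "\<psi> e \<le> 0" "\<psi> f \<le> 0"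
        using le[rule_format, OF ef(1)] le[rule_format, OF ef(2)] y0 ef(5,6) by simp_all
      then have "\<forall>v\<in>{e, f}. \<psi> v \<le> 0" by blast
      ultimately have "\<forall>x\<in>convex hull {e, f}. \<psi> x \<le> 0" by (rule convex_on_convex_hull_bound)
      moreover have "x \<in> convex hull {e, f}" using x by (simp only: True)
      ultimately show ?thesis by (rule bspec)
    qed
    have y_eq: "y v = 0" if "v \<in> G" "0 \<le> a \<bullet> v + b" for v
    proof -
      have "v \<in> {e, f}" using that unfolding True[symmetric] by simp
      then show ?thesis using y0 by blast
    qed
    show ?thesis
    proof (intro bexI[OF _ ridges.zero] conjI ballI allI impI)
      show "0 = y v" if "v \<in> G" "0 \<le> a \<bullet> v + b" for v using y_eq[OF that] by (rule sym)
      show "\<psi> x \<le> 0" if "convex_on UNIV \<psi>" "\<forall>v\<in>G. 0 \<le> a \<bullet> v + b \<longrightarrow> \<psi> v \<le> y v"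
        "x \<in> convex hull ?Gp" for \<psi> x by (rule psi_le[OF that])
    qed (rule refl)
  next
    case False
    define S where "S = ?Gp - {e, f}"
    have S: "finite S" "S \<noteq> {}" using False ef fin by (auto simp: S_def)
    have Spos: "0 < a \<bullet> v + b" if "v \<in> S" for v using that line[of v] by (auto simp: S_def less_le)
    define q where "q v = y v / (a \<bullet> v + b)" for v
    have "Min (q ` S) \<in> q ` S" using S by (intro Min_in) auto
    then obtain t where t: "t \<in> S" "q t = Min (q ` S)" by force
    have t: "t \<in> S" "\<And>v. v \<in> S \<Longrightarrow> q t \<le> q v" using t S by auto
    define s where "s = q t"
    have tG: "t \<in> G" "t \<noteq> e" "t \<noteq> f" and tp: "0 < a \<bullet> t + b" using t(1) Spos by (auto simp: S_def)
    have s0: "0 \<le> s" using ynn[OF tG(1)] tp by (simp add: s_def q_def)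
    define y' where "y' v = y v - s * (a \<bullet> v + b)" for v
    have y': "y' e = 0" "y' f = 0" "y' t = 0" using y0 ef tp by (auto simp: y'_def s_def q_def)
    have y'nn: "0 \<le> y' v" if "v \<in> G" "0 \<le> a \<bullet> v + b" for v
    proof (cases "v \<in> S")
      case True
      then have "s \<le> y v / (a \<bullet> v + b)" using t(2) by (simp add: s_def q_def)
      then show ?thesis using Spos[OF True] by (simp add: y'_def field_simps)
    next
      case False
      then show ?thesis using that y' by (auto simp: S_def)
    qed
    obtain a1 b1 a2 b2 where bary:
      "\<And>x. x = (a2 \<bullet> x + b2) *\<^sub>R e + ((a \<bullet> x + b) / (a \<bullet> t + b)) *\<^sub>R t + (a1 \<bullet> x + b1) *\<^sub>R f"
      "\<And>x. (a2 \<bullet> x + b2) + ((a \<bullet> x + b) / (a \<bullet> t + b)) + (a1 \<bullet> x + b1) = 1"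
      and z1: "a1 \<bullet> e + b1 = 0" "a1 \<bullet> t + b1 = 0" "a1 \<bullet> f + b1 = 1"
      and z2: "a2 \<bullet> f + b2 = 0" "a2 \<bullet> t + b2 = 0" "a2 \<bullet> e + b2 = 1"
      by (rule barycentric[OF ef(1-3,5,6) tp]) (rule that)
    define ge gt gf where "ge x = a2 \<bullet> x + b2" and "gt x = (a \<bullet> x + b) / (a \<bullet> t + b)" and "gf x = a1 \<bullet> x + b1" for x
    have rep: "x = ge x *\<^sub>R e + gt x *\<^sub>R t + gf x *\<^sub>R f" "ge x + gt x + gf x = 1" for x
      unfolding ge_def gt_def gf_def by (rule bary(1), rule bary(2))
    have rep1: "x = ge x *\<^sub>R e + gf x *\<^sub>R f + gt x *\<^sub>R t" and rep2: "x = gf x *\<^sub>R f + gt x *\<^sub>R t + ge x *\<^sub>R e" for x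
    proof -
      have "ge x *\<^sub>R e + gf x *\<^sub>R f + gt x *\<^sub>R t = ge x *\<^sub>R e + gt x *\<^sub>R t + gf x *\<^sub>R f"
        "gf x *\<^sub>R f + gt x *\<^sub>R t + ge x *\<^sub>R e = ge x *\<^sub>R e + gt x *\<^sub>R t + gf x *\<^sub>R f"
        by (simp_all add: ac_simps)
      then show "x = ge x *\<^sub>R e + gf x *\<^sub>R f + gt x *\<^sub>R t" "x = gf x *\<^sub>R f + gt x *\<^sub>R t + ge x *\<^sub>R e"
        using rep(1)[of x] by (simp_all only:)
    qed
    have gt_sign: "0 \<le> gt x \<longleftrightarrow> 0 \<le> a \<bullet> x + b" "gt x \<le> 0 \<longleftrightarrow> a \<bullet> x + b \<le> 0" for x
      using tp by (auto simp: gt_def zero_le_divide_iff divide_le_0_iff)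
    \<comment> \<open>No vertex has two nonpositive coordinates one of which is negative:
      \<open>barycentric_sign\<close> excludes this at each corner. The strict sign ensures that
      \<open>v\<close> is not the corner itself.\<close>
    have two: "gf v \<le> 0 \<Longrightarrow> ge v < 0 \<Longrightarrow> False" "ge v \<le> 0 \<Longrightarrow> gf v < 0 \<Longrightarrow> False"
      "gf v \<le> 0 \<Longrightarrow> gt v < 0 \<Longrightarrow> False" "gt v \<le> 0 \<Longrightarrow> gf v < 0 \<Longrightarrow> False"
      "ge v \<le> 0 \<Longrightarrow> gt v < 0 \<Longrightarrow> False" "gt v \<le> 0 \<Longrightarrow> ge v < 0 \<Longrightarrow> False"
      if v: "v \<in> G" for v
    proof -
      note B = rep(2)[of v]
      have te: "gt t = 1" "gf t = 0" "ge t = 0" "gt e = 0" "ge e = 1" "gf e = 0" "gt f = 0" "gf f = 1" "ge f = 0"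
        using z1 z2 ef tp by (auto simp: gt_def ge_def gf_def)
      show False if "gf v \<le> 0" "ge v < 0"
      proof (rule barycentric_sign[OF ef(1,2) tG(1) tG(2,3)[symmetric] v])
        show "v \<noteq> t" using that te by auto
        show "v = ge v *\<^sub>R e + gf v *\<^sub>R f + gt v *\<^sub>R t" by (rule rep1)
      qed (use that B in auto)
      show False if "ge v \<le> 0" "gf v < 0"
      proof (rule barycentric_sign[OF ef(1,2) tG(1) tG(2,3)[symmetric] v])
        show "v \<noteq> t" using that te by auto
        show "v = ge v *\<^sub>R e + gf v *\<^sub>R f + gt v *\<^sub>R t" by (rule rep1)
      qed (use that B in auto)
      show False if "gf v \<le> 0" "gt v < 0"
      proof (rule barycentric_sign[OF ef(2) tG(1) ef(1) ef(3)[symmetric] tG(2) v])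
        show "v \<noteq> e" using that te by auto
        show "v = gf v *\<^sub>R f + gt v *\<^sub>R t + ge v *\<^sub>R e" by (rule rep2)
      qed (use that B in auto)
      show False if "gt v \<le> 0" "gf v < 0"
      proof (rule barycentric_sign[OF ef(2) tG(1) ef(1) ef(3)[symmetric] tG(2) v])
        show "v \<noteq> e" using that te by auto
        show "v = gf v *\<^sub>R f + gt v *\<^sub>R t + ge v *\<^sub>R e" by (rule rep2)
      qed (use that B in auto)
      show False if "ge v \<le> 0" "gt v < 0"
      proof (rule barycentric_sign[OF ef(1) tG(1) ef(2) ef(3) tG(3) v])
        show "v \<noteq> f" using that te by auto
        show "v = ge v *\<^sub>R e + gt v *\<^sub>R t + gf v *\<^sub>R f" by (rule rep(1))
      qed (use that B in auto)
      show False if "gt v \<le> 0" "ge v < 0"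
      proof (rule barycentric_sign[OF ef(1) tG(1) ef(2) ef(3) tG(3) v])
        show "v \<noteq> f" using that te by auto
        show "v = ge v *\<^sub>R e + gt v *\<^sub>R t + gf v *\<^sub>R f" by (rule rep(1))
      qed (use that B in auto)
    qed
    \<comment> \<open>A vertex on this side of the chord with both of these coordinates positive
      would lie in the triangle \<open>e t f\<close> without being one of its corners.\<close>
    have three: "gf v \<le> 0 \<or> ge v \<le> 0" if v: "v \<in> G" "0 \<le> gt v" for v
    proof (rule ccontr)
      assume "\<not> ?thesis"
      then have p: "0 < gf v" "0 < ge v" by auto
      have "v \<in> convex hull {e, t, f}"
        unfolding convex_hull_3 using rep(2)[of v] p v(2)
        by (intro CollectI exI[of _ "ge v"] exI[of _ "gt v"] exI[of _ "gf v"] conjI rep(1)) auto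
      moreover have "v \<notin> {e, t, f}" using p z1 z2 by (auto simp: ge_def gf_def)
      moreover have "{e, t, f} \<subseteq> convex hull G" using ef tG hull_inc by (metis empty_subsetI insert_subset)
      ultimately show False using extreme_not_in_hull[OF ext[OF v(1)], of "{e, t, f}"] by blast
    qed
    \<comment> \<open>The vertices beyond the sides \<open>e t\<close> and \<open>t f\<close>, seen
      from the triangle; hence the change of sign, as the forms are positive at \<open>f\<close> and
      at \<open>e\<close>. Each set loses one of these two vertices, so the recursion
      terminates.\<close>
    define G1 G2 where "G1 = {v \<in> G. 0 \<le> (- a1) \<bullet> v + (- b1)}" and "G2 = {v \<in> G. 0 \<le> (- a2) \<bullet> v + (- b2)}"
    have G1: "v \<in> G1 \<longleftrightarrow> v \<in> G \<and> gf v \<le> 0" and G2: "v \<in> G2 \<longleftrightarrow> v \<in> G \<and> ge v \<le> 0" for v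
      by (auto simp: G1_def G2_def gf_def ge_def)
    have G1p: "G1 \<subseteq> ?Gp" and G2p: "G2 \<subseteq> ?Gp"
      using two(3,5) gt_sign(1) by (auto simp: G1 G2 not_less[symmetric]) 
    have "f \<notin> G1" "e \<notin> G2" using z1 z2 by (auto simp: G1 G2 gf_def ge_def)
    then have "G1 \<subset> ?Gp" "G2 \<subset> ?Gp" using G1p G2p ef by auto
    then have card: "card G1 < card ?Gp" "card G2 < card ?Gp" using fin by (auto intro!: psubset_card_mono)
    have "- a1 \<noteq> 0" "- a2 \<noteq> 0" using z1 z2 by auto
    then obtain \<Phi>1 \<Phi>2 where P1: "\<Phi>1 \<in> ridges" "\<And>v. v \<in> G1 \<Longrightarrow> \<Phi>1 v = y' v" "\<And>v. v \<in> G \<Longrightarrow> 0 \<le> gf v \<Longrightarrow> \<Phi>1 v = 0"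
        "\<And>\<psi> x. convex_on UNIV \<psi> \<Longrightarrow> \<forall>v\<in>G1. \<psi> v \<le> y' v \<Longrightarrow> x \<in> convex hull G1 \<Longrightarrow> \<psi> x \<le> \<Phi>1 x"
      and P2: "\<Phi>2 \<in> ridges" "\<And>v. v \<in> G2 \<Longrightarrow> \<Phi>2 v = y' v" "\<And>v. v \<in> G \<Longrightarrow> 0 \<le> ge v \<Longrightarrow> \<Phi>2 v = 0"
        "\<And>\<psi> x. convex_on UNIV \<psi> \<Longrightarrow> \<forall>v\<in>G2. \<psi> v \<le> y' v \<Longrightarrow> x \<in> convex hull G2 \<Longrightarrow> \<psi> x \<le> \<Phi>2 x"
    proof -
      have A1: "0 \<le> y' v" if "v \<in> G1" for v using that G1p y'nn by auto
      have A2: "0 \<le> y' v" if "v \<in> G2" for v using that G2p y'nn by auto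
      have "\<exists>\<Phi>\<in>ridges. (\<forall>v\<in>G. 0 \<le> (- a1) \<bullet> v + (- b1) \<longrightarrow> \<Phi> v = y' v) \<and> (\<forall>v\<in>G. (- a1) \<bullet> v + (- b1) \<le> 0 \<longrightarrow> \<Phi> v = 0) \<and>
        (\<forall>\<psi>. convex_on UNIV \<psi> \<longrightarrow> (\<forall>v\<in>G. 0 \<le> (- a1) \<bullet> v + (- b1) \<longrightarrow> \<psi> v \<le> y' v) \<longrightarrow>
          (\<forall>x\<in>convex hull {v \<in> G. 0 \<le> (- a1) \<bullet> v + (- b1)}. \<psi> x \<le> \<Phi> x))"
        using z1 A1 y' card(1) ef tG \<open>- a1 \<noteq> 0\<close> unfolding G1_def by (intro less.hyps[of _ _ e t]) auto
      then obtain \<Phi>1 where "\<Phi>1 \<in> ridges" "\<And>v. v \<in> G1 \<Longrightarrow> \<Phi>1 v = y' v" "\<And>v. v \<in> G \<Longrightarrow> 0 \<le> gf v \<Longrightarrow> \<Phi>1 v = 0"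
        "\<And>\<psi> x. convex_on UNIV \<psi> \<Longrightarrow> \<forall>v\<in>G1. \<psi> v \<le> y' v \<Longrightarrow> x \<in> convex hull G1 \<Longrightarrow> \<psi> x \<le> \<Phi>1 x"
        unfolding G1_def gf_def by auto
      moreover have "\<exists>\<Phi>\<in>ridges. (\<forall>v\<in>G. 0 \<le> (- a2) \<bullet> v + (- b2) \<longrightarrow> \<Phi> v = y' v) \<and> (\<forall>v\<in>G. (- a2) \<bullet> v + (- b2) \<le> 0 \<longrightarrow> \<Phi> v = 0) \<and>
        (\<forall>\<psi>. convex_on UNIV \<psi> \<longrightarrow> (\<forall>v\<in>G. 0 \<le> (- a2) \<bullet> v + (- b2) \<longrightarrow> \<psi> v \<le> y' v) \<longrightarrow>
          (\<forall>x\<in>convex hull {v \<in> G. 0 \<le> (- a2) \<bullet> v + (- b2)}. \<psi> x \<le> \<Phi> x))"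
        using z2 A2 y' card(2) ef tG \<open>- a2 \<noteq> 0\<close> unfolding G2_def by (intro less.hyps[of _ _ f t]) auto
      then obtain \<Phi>2 where "\<Phi>2 \<in> ridges" "\<And>v. v \<in> G2 \<Longrightarrow> \<Phi>2 v = y' v" "\<And>v. v \<in> G \<Longrightarrow> 0 \<le> ge v \<Longrightarrow> \<Phi>2 v = 0"
        "\<And>\<psi> x. convex_on UNIV \<psi> \<Longrightarrow> \<forall>v\<in>G2. \<psi> v \<le> y' v \<Longrightarrow> x \<in> convex hull G2 \<Longrightarrow> \<psi> x \<le> \<Phi>2 x"
        unfolding G2_def ge_def by auto
      ultimately show thesis by (rule that)
    qed
    define \<Phi> where "\<Phi> x = (\<Phi>1 x + \<Phi>2 x) + s * max 0 (a \<bullet> x + b)" for x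
    have "\<Phi> \<in> ridges"
      unfolding \<Phi>_def[abs_def] by (intro ridges.step ridges_add P1 P2 s0)
    moreover have "\<Phi> v = y v" if v: "v \<in> G" "0 \<le> a \<bullet> v + b" for v
    proof -
      have "gf v \<le> 0 \<or> ge v \<le> 0" using three[OF v(1)] v(2) gt_sign by blast
      then have "\<Phi>1 v + \<Phi>2 v = y' v"
      proof
        assume 1: "gf v \<le> 0"
        then have "0 \<le> ge v" using two(1)[OF v(1)] by force
        then show ?thesis using 1 P1(2)[of v] P2(3)[of v] v(1) G1 by simp
      next
        assume 1: "ge v \<le> 0"
        then have "0 \<le> gf v" using two(2)[OF v(1)] by force
        then show ?thesis using 1 P2(2)[of v] P1(3)[of v] v(1) G2 by simp
      qed
      then show ?thesis using v(2) by (simp add: \<Phi>_def y'_def)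
    qed
    moreover have "\<Phi> v = 0" if v: "v \<in> G" "a \<bullet> v + b \<le> 0" for v
    proof -
      have "0 \<le> gf v" "0 \<le> ge v" using two(4,6)[OF v(1)] v(2) gt_sign(2)[of v] by force+
      then show ?thesis using P1(3) P2(3) v by (simp add: \<Phi>_def max_def)
    qed
    moreover have "\<psi> x \<le> \<Phi> x"
      if cv: "convex_on UNIV \<psi>" and le: "\<forall>v\<in>G. 0 \<le> a \<bullet> v + b \<longrightarrow> \<psi> v \<le> y v" and x: "x \<in> convex hull ?Gp" for \<psi> x
    proof -
      \<comment> \<open>On this side of the chord \<open>max 0\<close> has no effect on its affine
        function, so subtracting that function reduces the domination claim to
        \<open>\<psi>'\<close> and the data \<open>y'\<close>.\<close>
      define \<psi>' where "\<psi>' x = \<psi> x - s * (a \<bullet> x + b)" for x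
      have cv': "convex_on UNIV \<psi>'"
      proof (rule convex_onI)
        fix r :: real and x y assume r: "0 < r" "r < 1"
        have "a \<bullet> ((1 - r) *\<^sub>R x + r *\<^sub>R y) + b = (1 - r) * (a \<bullet> x + b) + r * (a \<bullet> y + b)"
          by (simp add: inner_add_right algebra_simps)
        then show "\<psi>' ((1 - r) *\<^sub>R x + r *\<^sub>R y) \<le> (1 - r) * \<psi>' x + r * \<psi>' y"
          using convex_onD[OF cv, of r x y] r by (simp add: \<psi>'_def algebra_simps)
      qed auto
      have le': "\<psi>' v \<le> y' v" if "v \<in> ?Gp" for v using le that by (auto simp: \<psi>'_def y'_def)
      have half: "convex {z. 0 \<le> a \<bullet> z + b}"
      proof -
        have "{z. 0 \<le> a \<bullet> z + b} = {z. a \<bullet> z \<ge> - b}" by auto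
        then show ?thesis by (simp add: convex_halfspace_ge)
      qed
      have x0: "0 \<le> a \<bullet> x + b"
        using hull_minimal[of ?Gp "{z. 0 \<le> a \<bullet> z + b}" convex] half x by auto
      have GpU: "?Gp = G1 \<union> G2"
      proof (intro equalityI subsetI)
        fix v assume "v \<in> ?Gp"
        then show "v \<in> G1 \<union> G2" using three[of v] gt_sign(1)[of v] G1[of v] G2[of v] by auto
      qed (use G1p G2p in auto)
      have n1: "0 \<le> \<Phi>1 x" and n2: "0 \<le> \<Phi>2 x" using P1(1) P2(1) by (auto intro: ridges_nonneg)
      \<comment> \<open>The polygon beyond the chord consists of the two parts handled by recursion
        and the triangle \<open>e t f\<close>; on the triangle \<open>\<psi>'\<close> is nonpositive
        because \<open>y'\<close> vanishes at the corners.\<close>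
      consider "gf x \<le> 0" | "ge x \<le> 0" | "0 < gf x" "0 < ge x" by linarith
      then have "\<psi>' x \<le> \<Phi>1 x + \<Phi>2 x"
      proof cases
        case 1
        have "x \<in> convex hull G1"
        proof (rule hull_halfplane[of e t "- a1" "- b1" G1 G2])
          show "(- a1) \<bullet> v + (- b1) \<le> 0" if "v \<in> G2" for v
            using that two(2)[of v] by (force simp: G2 gf_def)
        qed (use 1 x GpU z1 ef tG \<open>- a1 \<noteq> 0\<close> in \<open>auto simp: G1 G2 gf_def\<close>)
        then show ?thesis using P1(4)[OF cv' _ \<open>x \<in> convex hull G1\<close>] le' G1p n2 by fastforce
      next
        case 2
        have "x \<in> convex hull G2"
        proof (rule hull_halfplane[of f t "- a2" "- b2" G2 G1])
          show "(- a2) \<bullet> v + (- b2) \<le> 0" if "v \<in> G1" for v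
            using that two(1)[of v] by (force simp: G1 ge_def)
        qed (use 2 x GpU z2 ef tG \<open>- a2 \<noteq> 0\<close> in \<open>auto simp: G1 G2 ge_def Un_commute\<close>)
        then show ?thesis using P2(4)[OF cv' _ \<open>x \<in> convex hull G2\<close>] le' G2p n1 by fastforce
      next
        case 3
        have "x \<in> convex hull {e, t, f}"
          unfolding convex_hull_3 using rep(2)[of x] 3 x0 gt_sign(1)[of x]
          by (intro CollectI exI[of _ "ge x"] exI[of _ "gt x"] exI[of _ "gf x"] conjI rep(1)) auto
        moreover have "\<forall>v\<in>{e, t, f}. \<psi>' v \<le> 0"
          using le'[of e] le'[of t] le'[of f] y' ef tG tp by auto
        ultimately have "\<psi>' x \<le> 0"
          using convex_on_convex_hull_bound[of "{e, t, f}" \<psi>' 0] convex_on_subset[OF cv'] by blast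
        then show ?thesis using n1 n2 by simp
      qed
      then show ?thesis using x0 by (simp add: \<Phi>_def \<psi>'_def)
    qed
    ultimately show ?thesis by blast
  qed
qed

end

section \<open>Ridge majorants on a polygon\<close>

lemma convex_on_minus_affine:
  fixes \<phi> :: "'a::euclidean_space \<Rightarrow> real"
  assumes "convex_on UNIV \<phi>"
  shows "convex_on UNIV (\<lambda>x. \<phi> x - (a \<bullet> x + b))"
proof (rule convex_onI)
  fix t :: real and x y assume t: "0 < t" "t < 1"
  have "a \<bullet> ((1 - t) *\<^sub>R x + t *\<^sub>R y) + b = (1 - t) * (a \<bullet> x + b) + t * (a \<bullet> y + b)"
    by (simp add: inner_add_right algebra_simps)
  then show "\<phi> ((1 - t) *\<^sub>R x + t *\<^sub>R y) - (a \<bullet> ((1 - t) *\<^sub>R x + t *\<^sub>R y) + b)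
      \<le> (1 - t) * (\<phi> x - (a \<bullet> x + b)) + t * (\<phi> y - (a \<bullet> y + b))"
    using convex_onD[OF assms, of t x y] t by (simp add: right_diff_distrib)
qed auto

lemma convex_on_plus_affine:
  fixes \<phi> :: "'a::euclidean_space \<Rightarrow> real"
  assumes "convex_on UNIV \<phi>"
  shows "convex_on UNIV (\<lambda>x. \<phi> x + a \<bullet> x + b)"
  using convex_on_minus_affine[OF assms, of "- a" "- b"] by (simp add: algebra_simps)

lemma ridges_convex: "\<Phi> \<in> ridges \<Longrightarrow> convex_on UNIV \<Phi>"
proof (induction rule: ridges.induct)
  case (step \<Phi> s a b)
  have "convex_on UNIV (\<lambda>x. s * max 0 (a \<bullet> x + b))"
  proof (rule convex_onI)
    fix t :: real and x y assume t: "0 < t" "t < 1"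
    have "a \<bullet> ((1 - t) *\<^sub>R x + t *\<^sub>R y) + b = (1 - t) * (a \<bullet> x + b) + t * (a \<bullet> y + b)"
      by (simp add: inner_add_right algebra_simps)
    also have "\<dots> \<le> (1 - t) * max 0 (a \<bullet> x + b) + t * max 0 (a \<bullet> y + b)"
      using t by (intro add_mono mult_left_mono) auto
    finally have "max 0 (a \<bullet> ((1 - t) *\<^sub>R x + t *\<^sub>R y) + b) \<le> (1 - t) * max 0 (a \<bullet> x + b) + t * max 0 (a \<bullet> y + b)"
      using t by auto
    from mult_left_mono[OF this step.hyps(2)]
    show "s * max 0 (a \<bullet> ((1 - t) *\<^sub>R x + t *\<^sub>R y) + b)
        \<le> (1 - t) * (s * max 0 (a \<bullet> x + b)) + t * (s * max 0 (a \<bullet> y + b))"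
      by (simp add: algebra_simps)
  qed auto
  then show ?case using convex_on_add[OF step.IH] by simp
qed (simp add: convex_on_const)

text \<open>An affine function is chosen that lies below the data at all vertices and meets them at
  two vertices \<open>e\<close> and \<open>f\<close>. The remainder is interpolated on each side of
  the line \<open>e f\<close> by \<open>ridge_interpolation\<close>; each of the two summands
  vanishes at the vertices of the other side.\<close>

lemma (in planar_extreme) ridge_majorant:
  fixes \<phi> :: "'a \<Rightarrow> real"
  assumes cvx: "convex_on UNIV \<phi>"
  obtains \<Phi> a b where "\<Phi> \<in> ridges" "\<And>v. v \<in> G \<Longrightarrow> \<Phi> v + a \<bullet> v + b = \<phi> v"
    "\<And>x. x \<in> convex hull G \<Longrightarrow> \<phi> x \<le> \<Phi> x + a \<bullet> x + b"
proof (cases "\<exists>e v1. e \<in> G \<and> v1 \<in> G \<and> e \<noteq> v1")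
  case False
  then consider "G = {}" | v where "G = {v}" by blast
  then show thesis
  proof cases
    case 1 show thesis by (rule that[OF ridges.zero, of 0 0]) (use 1 in auto)
  next
    case (2 v) show thesis by (rule that[OF ridges.zero, of 0 "\<phi> v"]) (use 2 in auto)
  qed
next
  case True
  then obtain e v1 where e: "e \<in> G" "v1 \<in> G" "e \<noteq> v1" by blast
  obtain g where g: "\<And>x. \<phi> x \<ge> \<phi> e + g \<bullet> (x - e)" using convex_on_subgradient[OF cvx, of e] by blast
  define n where "n = v1 - e"
  define S where "S = {v \<in> G. 0 < n \<bullet> (v - e)}"
  have "0 < n \<bullet> n" using e(3) by (simp add: n_def)
  then have "v1 \<in> S" using e by (simp add: S_def n_def)
  then have S: "finite S" "S \<noteq> {}" using fin by (auto simp: S_def)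
  \<comment> \<open>The affine function given by a subgradient at \<open>e\<close> is tilted in the
    direction \<open>n\<close> until it touches the data at a second vertex. \<open>q v\<close> is
    the tilt at which \<open>v\<close> is reached, so the least one is taken; at the vertices
    outside \<open>S\<close> the nonnegative tilt does not raise the function.\<close>
  define q where "q v = (\<phi> v - \<phi> e - g \<bullet> (v - e)) / (n \<bullet> (v - e))" for v
  have "Min (q ` S) \<in> q ` S" using S by (intro Min_in) auto
  then obtain f where f: "f \<in> S" "q f = Min (q ` S)" by force
  have qf: "q f \<le> q v" if "v \<in> S" for v using that f S by auto
  have fG: "f \<in> G" "0 < n \<bullet> (f - e)" using f by (auto simp: S_def)
  then have ef: "e \<noteq> f" by auto
  define s where "s = q f"
  have s0: "0 \<le> s" using g[of f] fG by (simp add: s_def q_def)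
  define h where "h = g + s *\<^sub>R n"
  define c where "c = \<phi> e - h \<bullet> e"
  define y where "y v = \<phi> v - (h \<bullet> v + c)" for v
  have y_alt: "y v = (\<phi> v - \<phi> e - g \<bullet> (v - e)) - s * (n \<bullet> (v - e))" for v
    by (simp add: y_def c_def h_def inner_add_left inner_diff_right algebra_simps)
  have ye: "y e = 0" by (simp add: y_alt)
  have yf: "y f = 0" using fG by (simp add: y_alt s_def q_def)
  have ynn: "0 \<le> y v" if v: "v \<in> G" for v
  proof (cases "v \<in> S")
    case True
    then have "s \<le> q v" "0 < n \<bullet> (v - e)" using qf by (auto simp: s_def S_def)
    then show ?thesis by (simp add: y_alt q_def pos_le_divide_eq)
  next
    case False
    then have "n \<bullet> (v - e) \<le> 0" using v by (auto simp: S_def)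
    then have "s * (n \<bullet> (v - e)) \<le> 0" using s0 by (simp add: mult_nonneg_nonpos)
    then show ?thesis using g[of v] by (simp add: y_alt)
  qed
  obtain a where a: "a \<noteq> 0" "orthogonal (f - e) a" using orthogonal_to_vector_exists[of "f - e"] dim by auto
  define b where "b = - (a \<bullet> e)"
  have ab: "a \<bullet> e + b = 0" "a \<bullet> f + b = 0"
    using a(2) by (simp_all add: b_def orthogonal_def inner_diff_left inner_diff_right inner_commute)
  have R: "\<exists>\<Phi>\<in>ridges. (\<forall>v\<in>G. 0 \<le> a \<bullet> v + b \<longrightarrow> \<Phi> v = y v) \<and> (\<forall>v\<in>G. a \<bullet> v + b \<le> 0 \<longrightarrow> \<Phi> v = 0) \<and>
    (\<forall>\<psi>. convex_on UNIV \<psi> \<longrightarrow> (\<forall>v\<in>G. 0 \<le> a \<bullet> v + b \<longrightarrow> \<psi> v \<le> y v) \<longrightarrow>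
      (\<forall>x\<in>convex hull {v \<in> G. 0 \<le> a \<bullet> v + b}. \<psi> x \<le> \<Phi> x))"
    if "a \<noteq> 0" "a \<bullet> e + b = 0" "a \<bullet> f + b = 0" for a b
    by (rule ridge_interpolation[OF e(1) fG(1) ef that ye yf ynn])
  obtain \<Phi>1 where P1: "\<Phi>1 \<in> ridges" "\<forall>v\<in>G. 0 \<le> a \<bullet> v + b \<longrightarrow> \<Phi>1 v = y v" "\<forall>v\<in>G. a \<bullet> v + b \<le> 0 \<longrightarrow> \<Phi>1 v = 0"
    "\<forall>\<psi>. convex_on UNIV \<psi> \<longrightarrow> (\<forall>v\<in>G. 0 \<le> a \<bullet> v + b \<longrightarrow> \<psi> v \<le> y v) \<longrightarrow>
      (\<forall>x\<in>convex hull {v \<in> G. 0 \<le> a \<bullet> v + b}. \<psi> x \<le> \<Phi>1 x)"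
    using R[OF a(1) ab] by blast
  have ab': "- a \<noteq> 0" "(- a) \<bullet> e + (- b) = 0" "(- a) \<bullet> f + (- b) = 0" using a(1) ab by auto
  obtain \<Phi>2 where P2: "\<Phi>2 \<in> ridges" "\<forall>v\<in>G. 0 \<le> (- a) \<bullet> v + (- b) \<longrightarrow> \<Phi>2 v = y v" "\<forall>v\<in>G. (- a) \<bullet> v + (- b) \<le> 0 \<longrightarrow> \<Phi>2 v = 0"
    "\<forall>\<psi>. convex_on UNIV \<psi> \<longrightarrow> (\<forall>v\<in>G. 0 \<le> (- a) \<bullet> v + (- b) \<longrightarrow> \<psi> v \<le> y v) \<longrightarrow>
      (\<forall>x\<in>convex hull {v \<in> G. 0 \<le> (- a) \<bullet> v + (- b)}. \<psi> x \<le> \<Phi>2 x)"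
    using R[OF ab'] by blast
  show thesis
  proof (rule that[of "\<lambda>x. \<Phi>1 x + \<Phi>2 x" h c])
    show "(\<lambda>x. \<Phi>1 x + \<Phi>2 x) \<in> ridges" by (rule ridges_add[OF P2(1) P1(1)])
    show "\<Phi>1 v + \<Phi>2 v + h \<bullet> v + c = \<phi> v" if v: "v \<in> G" for v
    proof -
      have "\<Phi>1 v + \<Phi>2 v = y v"
      proof (cases "0 \<le> a \<bullet> v + b")
        case True
        then have "(- a) \<bullet> v + (- b) \<le> 0" by simp
        then show ?thesis using P1(2) P2(3) v True by simp
      next
        case False
        then have "0 \<le> (- a) \<bullet> v + (- b)" by simp
        then show ?thesis using P2(2) P1(3) v False by simp
      qed
      then show ?thesis by (simp add: y_def)
    qed
    show "\<phi> x \<le> \<Phi>1 x + \<Phi>2 x + h \<bullet> x + c" if x: "x \<in> convex hull G" for x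
    proof -
      define \<psi> where "\<psi> x = \<phi> x - (h \<bullet> x + c)" for x
      have cv: "convex_on UNIV \<psi>" unfolding \<psi>_def[abs_def] by (rule convex_on_minus_affine[OF cvx])
      have n: "0 \<le> \<Phi>1 x" "0 \<le> \<Phi>2 x" using P1(1) P2(1) ridges_nonneg by blast+
      define A where "A = {v \<in> G. 0 \<le> a \<bullet> v + b}"
      define B where "B = {v \<in> G. 0 \<le> (- a) \<bullet> v + (- b)}"
      have AB: "A \<union> B = G" by (auto simp: A_def B_def)
      have "\<psi> x \<le> \<Phi>1 x + \<Phi>2 x"
      proof (cases "0 \<le> a \<bullet> x + b")
        case True
        have "x \<in> convex hull A"
          by (rule hull_halfplane[OF e(1) fG(1) ef a(1) ab, of A B])
            (use True x AB ab e fG in \<open>auto simp: A_def B_def\<close>)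
        then have "\<psi> x \<le> \<Phi>1 x"
          unfolding A_def by (intro P1(4)[rule_format, OF cv]) (auto simp: \<psi>_def y_def)
        then show ?thesis using n by simp
      next
        case False
        have "x \<in> convex hull B"
          by (rule hull_halfplane[OF e(1) fG(1) ef ab', of B A])
            (use False x AB ab e fG in \<open>auto simp: A_def B_def Un_commute\<close>)
        then have "\<psi> x \<le> \<Phi>2 x"
          unfolding B_def by (intro P2(4)[rule_format, OF cv]) (auto simp: \<psi>_def y_def)
        then show ?thesis using n by simp
      qed
      then show ?thesis by (simp add: \<psi>_def)
    qed
  qed
qed

section \<open>Polygons inscribed in a strictly convex neighbourhood of the body\<close>

lemma infdist_convex:
  fixes K :: "'a::euclidean_space set"
  assumes "closed K" "convex K" "K \<noteq> {}" "0 \<le> u" "u \<le> 1"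
  shows "infdist ((1 - u) *\<^sub>R a + u *\<^sub>R b) K \<le> (1 - u) * infdist a K + u * infdist b K"
proof -
  obtain p where p: "p \<in> K" "infdist a K = dist a p" using infdist_attains_inf[OF assms(1,3)] by blast
  obtain q where q: "q \<in> K" "infdist b K = dist b q" using infdist_attains_inf[OF assms(1,3)] by blast
  have "(1 - u) *\<^sub>R p + u *\<^sub>R q \<in> K" using assms p q by (intro convexD) auto
  then have "infdist ((1 - u) *\<^sub>R a + u *\<^sub>R b) K \<le> dist ((1 - u) *\<^sub>R a + u *\<^sub>R b) ((1 - u) *\<^sub>R p + u *\<^sub>R q)"
    by (rule infdist_le)
  also have "\<dots> = norm ((1 - u) *\<^sub>R (a - p) + u *\<^sub>R (b - q))" by (simp add: dist_norm algebra_simps)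
  also have "\<dots> \<le> (1 - u) * norm (a - p) + u * norm (b - q)"
    using norm_triangle_ineq[of "(1 - u) *\<^sub>R (a - p)" "u *\<^sub>R (b - q)"] assms by simp
  finally show ?thesis using p q by (simp add: dist_norm)
qed

text \<open>The last term is the defect that makes the squared norm strictly convex on
  segments.\<close>

lemma norm_convex_combination_sq:
  fixes a b :: "'a::euclidean_space"
  shows "(norm ((1 - u) *\<^sub>R a + u *\<^sub>R b))\<^sup>2 = (1 - u) * (norm a)\<^sup>2 + u * (norm b)\<^sup>2 - u * (1 - u) * (norm (a - b))\<^sup>2"
  by (simp add: power2_norm_eq_inner inner_add_left inner_add_right inner_diff_left inner_diff_right
      inner_commute algebra_simps)

text \<open>Interpolate on a fine net of the boundary of the strictly convex body \<open>K'\<close>, which is slightly larger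
  than \<open>K\<close>. Strict convexity makes every point of the net an extreme point of its convex hull.\<close>

lemma ridge_approximation:
  fixes K :: "'a::euclidean_space set" and \<phi> :: "'a \<Rightarrow> real"
  assumes dim: "DIM('a) = 2" and K: "convex_body K" and cvx: "convex_on UNIV \<phi>" and \<epsilon>: "0 < \<epsilon>"
  obtains \<Phi> a b where "\<Phi> \<in> ridges" "\<And>x. x \<in> K \<Longrightarrow> \<phi> x \<le> \<Phi> x + a \<bullet> x + b"
    "\<And>x. x \<in> frontier K \<Longrightarrow> \<Phi> x + a \<bullet> x + b \<le> \<phi> x + \<epsilon>"
proof -
  have cK: "compact K" "convex K" "interior K \<noteq> {}" "closed K"
    using K compact_imp_closed by (auto simp: convex_body_def)
  obtain z0 where z0: "z0 \<in> interior K" using cK by blast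
  then have z0K: "z0 \<in> K" using interior_subset by blast
  obtain r where r: "0 < r" "cball z0 r \<subseteq> K" using z0 mem_interior_cball by blast
  have "bounded ((\<lambda>x. x - z0) ` K)" using cK(1) compact_imp_bounded bounded_translation_minus by blast
  then obtain M where M: "0 < M" "\<And>x. x \<in> K \<Longrightarrow> norm (x - z0) \<le> M" unfolding bounded_pos by auto
  have cont: "continuous_on S \<phi>" for S using convex_on_UNIV_continuous[OF cvx] .
  have cB: "compact (cball z0 (2 * M))" by simp
  have "bounded (\<phi> ` cball z0 (2 * M))" using compact_continuous_image[OF cont cB] compact_imp_bounded by blast
  then obtain C where C: "0 < C" "\<And>x. x \<in> cball z0 (2 * M) \<Longrightarrow> \<bar>\<phi> x\<bar> \<le> C" unfolding bounded_pos by auto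
  have "uniformly_continuous_on (cball z0 (2 * M)) \<phi>" by (rule compact_uniformly_continuous[OF cont cB])
  then obtain \<delta>1 where \<delta>1: "0 < \<delta>1"
    "\<And>x y. x \<in> cball z0 (2 * M) \<Longrightarrow> y \<in> cball z0 (2 * M) \<Longrightarrow> dist y x < \<delta>1 \<Longrightarrow> dist (\<phi> y) (\<phi> x) < \<epsilon> / 2"
    using \<epsilon> unfolding uniformly_continuous_on_def by (meson half_gt_zero)
  \<comment> \<open>The last two bounds control the error on the frontier: the net point used for
    \<open>x\<close> is closer than \<open>\<delta> * (M / r + r / (4 * M))\<close>, where
    \<open>\<phi>\<close> varies by less than \<open>\<epsilon> / 2\<close>, and the weight
    \<open>\<delta> / r\<close> times the oscillation \<open>2 * C\<close> is at most
    \<open>\<epsilon> / 2\<close>.\<close>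
  define \<delta> where "\<delta> = min (M / 2) (min (\<delta>1 / (2 * (M / r + r / (4 * M)))) (\<epsilon> * r / (4 * C)))"
  have pos: "0 < M / r + r / (4 * M)" using M r by (intro add_pos_pos) auto
  have \<delta>: "0 < \<delta>" "\<delta> \<le> M / 2" "\<delta> * (M / r + r / (4 * M)) < \<delta>1" "(\<delta> / r) * (2 * C) \<le> \<epsilon> / 2"
  proof -
    show "0 < \<delta>" unfolding \<delta>_def using M r C \<epsilon> \<delta>1 pos by (auto simp: min_def)
    show "\<delta> \<le> M / 2" unfolding \<delta>_def by (rule min.cobounded1)
    have "\<delta> \<le> \<delta>1 / (2 * (M / r + r / (4 * M)))" unfolding \<delta>_def by (meson min.cobounded1 min.cobounded2 order.trans)
    then have "\<delta> * (2 * (M / r + r / (4 * M))) \<le> \<delta>1" using pos by (subst (asm) pos_le_divide_eq) auto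
    then have "2 * (\<delta> * (M / r + r / (4 * M))) \<le> \<delta>1" by (simp only: mult.left_commute)
    then show "\<delta> * (M / r + r / (4 * M)) < \<delta>1" using \<delta>1(1) by simp
    have "\<delta> \<le> \<epsilon> * r / (4 * C)" unfolding \<delta>_def by (meson min.cobounded2 order.trans)
    then show "(\<delta> / r) * (2 * C) \<le> \<epsilon> / 2" using C(1) r(1) by (simp add: field_simps)
  qed
  \<comment> \<open>With this factor the quadratic term of \<open>F\<close> is at most
    \<open>\<delta> / 2\<close> on \<open>K\<close>, so \<open>K\<close> stays well inside the
    sublevel set \<open>K'\<close>; positivity of \<open>\<tau>\<close> makes \<open>K'\<close>
    strictly convex.\<close>
  define \<tau> where "\<tau> = \<delta> / (2 * M\<^sup>2)"
  have \<tau>: "0 < \<tau>" using \<delta> M by (simp add: \<tau>_def)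
  define F where "F x = infdist x K + \<tau> * (norm (x - z0))\<^sup>2" for x
  define K' where "K' = {x. F x \<le> \<delta>}"
  have contF: "continuous_on S F" for S unfolding F_def by (intro continuous_intros)
  have closedK': "closed K'"
    unfolding K'_def using closed_Collect_le[OF contF continuous_on_const[of UNIV \<delta>]] by simp
  have openF: "{x. F x < \<delta>} \<subseteq> interior K'"
    using open_Collect_less[OF contF continuous_on_const[of UNIV \<delta>]]
    by (intro interior_maximal) (auto simp: K'_def)
  have frF: "F x = \<delta>" if "x \<in> frontier K'" for x
  proof -
    have "x \<in> K'" "x \<notin> interior K'" using that frontier_subset_closed[OF closedK'] by (auto simp: frontier_def)
    then have "F x \<le> \<delta>" "\<not> F x < \<delta>" using openF unfolding K'_def by blast+
    then show ?thesis by simp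
  qed
  have Kin: "F x \<le> \<delta> / 2" if "x \<in> K" for x
  proof -
    have "(norm (x - z0))\<^sup>2 \<le> M\<^sup>2" using M(2)[OF that] by (intro power_mono) auto
    then have "\<tau> * (norm (x - z0))\<^sup>2 \<le> \<tau> * M\<^sup>2" using \<tau> by simp
    also have "\<dots> = \<delta> / 2" using M(1) by (simp add: \<tau>_def)
    finally show ?thesis using that by (simp add: F_def)
  qed
  have near: "\<exists>k\<in>K. norm (x - k) \<le> \<delta>" if "x \<in> K'" for x
  proof -
    obtain k where "k \<in> K" "infdist x K = dist x k" using infdist_attains_inf[OF cK(4), of x] z0K by blast
    moreover have "0 \<le> \<tau> * (norm (x - z0))\<^sup>2" using \<tau> by simp
    then have "infdist x K \<le> \<delta>" using that by (simp add: K'_def F_def)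
    ultimately show ?thesis by (auto simp: dist_norm)
  qed
  have K'B: "K' \<subseteq> cball z0 (2 * M)"
  proof
    fix x assume "x \<in> K'"
    then obtain k where "k \<in> K" "norm (x - k) \<le> \<delta>" using near by blast
    then have "norm (x - z0) \<le> \<delta> + M" using norm_triangle_ineq[of "x - k" "k - z0"] M(2) by fastforce
    then show "x \<in> cball z0 (2 * M)" using \<delta>(2) M(1) by (simp add: dist_norm norm_minus_commute)
  qed
  have KB: "K \<subseteq> cball z0 (2 * M)" using M by (force simp: dist_norm norm_minus_commute)
  have compactK': "compact K'" using closedK' K'B bounded_subset compact_eq_bounded_closed by blast
  have strict: "F ((1 - u) *\<^sub>R a + u *\<^sub>R b) < \<delta>" if "a \<in> K'" "b \<in> K'" "a \<noteq> b" "0 < u" "u < 1" for a b u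
  proof -
    have "(1 - u) *\<^sub>R a + u *\<^sub>R b - z0 = (1 - u) *\<^sub>R (a - z0) + u *\<^sub>R (b - z0)" by (simp add: algebra_simps)
    then have n: "(norm ((1 - u) *\<^sub>R a + u *\<^sub>R b - z0))\<^sup>2
        = (1 - u) * (norm (a - z0))\<^sup>2 + u * (norm (b - z0))\<^sup>2 - u * (1 - u) * (norm (a - b))\<^sup>2"
      using norm_convex_combination_sq[of u "a - z0" "b - z0"] by simp
    have "0 < u * (1 - u) * (norm (a - b))\<^sup>2" using that by simp
    then have "(norm ((1 - u) *\<^sub>R a + u *\<^sub>R b - z0))\<^sup>2 < (1 - u) * (norm (a - z0))\<^sup>2 + u * (norm (b - z0))\<^sup>2" using n by simp
    then have "\<tau> * (norm ((1 - u) *\<^sub>R a + u *\<^sub>R b - z0))\<^sup>2 < \<tau> * ((1 - u) * (norm (a - z0))\<^sup>2 + u * (norm (b - z0))\<^sup>2)"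
      using \<tau> by simp
    moreover have "infdist ((1 - u) *\<^sub>R a + u *\<^sub>R b) K \<le> (1 - u) * infdist a K + u * infdist b K"
      using that cK z0K by (intro infdist_convex) auto
    ultimately have "F ((1 - u) *\<^sub>R a + u *\<^sub>R b) < (1 - u) * F a + u * F b" by (simp add: F_def algebra_simps)
    also have "\<dots> \<le> (1 - u) * \<delta> + u * \<delta>" using that by (intro add_mono mult_left_mono) (auto simp: K'_def)
    finally show ?thesis by (simp add: algebra_simps)
  qed
  have convK': "convex K'"
  proof (rule convexI)
    fix a b and s t :: real assume ab: "a \<in> K'" "b \<in> K'" and st: "0 \<le> s" "0 \<le> t" "s + t = 1"
    then have s: "s = 1 - t" by simp
    show "s *\<^sub>R a + t *\<^sub>R b \<in> K'"
    proof (cases "a = b \<or> t = 0 \<or> t = 1")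
      case True
      then show ?thesis using ab s by (auto simp flip: scaleR_left.add)
    next
      case False
      then show ?thesis using strict[OF ab, of t] st unfolding s by (simp add: K'_def less_imp_le)
    qed
  qed
  \<comment> \<open>The mesh is \<open>r\<close> times \<open>\<delta> / (4 * M)\<close>, the least
    relative amount by which a ray from \<open>z0\<close> through a point of \<open>K\<close>
    continues before it leaves \<open>K'\<close>.\<close>
  define \<gamma> where "\<gamma> = r * \<delta> / (4 * M)"
  have \<gamma>: "0 < \<gamma>" using r \<delta> M by (simp add: \<gamma>_def)
  have "compact (frontier K')" by (rule compact_frontier[OF compactK'])
  then obtain G where G: "G \<subseteq> frontier K'" "finite G" "frontier K' \<subseteq> (\<Union>v\<in>G. ball v \<gamma>)"
    using compactE_image[of "frontier K'" "frontier K'" "\<lambda>v. ball v \<gamma>"] \<gamma>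
    by (metis (no_types, lifting) UN_I centre_in_ball open_ball subsetI)
  have GK': "G \<subseteq> K'" using G(1) closedK' frontier_subset_closed by blast
  have hullK': "convex hull G \<subseteq> K'" using GK' convK' by (rule hull_minimal)
  interpret planar_extreme G
  proof
    show "v extreme_point_of convex hull G" if v: "v \<in> G" for v
    proof -
      have "v \<in> convex hull G" using v by (rule hull_inc)
      moreover have "v \<notin> open_segment a b" if "a \<in> convex hull G" "b \<in> convex hull G" for a b
      proof
        assume "v \<in> open_segment a b"
        then obtain u where u: "a \<noteq> b" "0 < u" "u < 1" "v = (1 - u) *\<^sub>R a + u *\<^sub>R b" unfolding in_segment by blast
        then have "F v < \<delta>" using strict[of a b u] that hullK' by blast
        then show False using frF[of v] v G(1) by auto
      qed
      ultimately show ?thesis by (simp add: extreme_point_of_def)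
    qed
  qed (use dim G in auto)
  have exit: "\<exists>d x' v. \<delta> / (4 * M) \<le> d - 1 \<and> x' = z0 + d *\<^sub>R (x - z0) \<and> x' \<in> frontier K' \<and> v \<in> G \<and> norm (x' - v) < \<gamma>"
    if x: "x \<in> K" "x \<noteq> z0" for x
  proof -
    have "F z0 < \<delta>" using \<delta>(1) z0K by (simp add: F_def)
    then have "z0 \<in> interior K'" using openF by blast
    then obtain d where d: "0 < d" "z0 + d *\<^sub>R (x - z0) \<in> frontier K'"
      using ray_to_frontier[of K' z0 "x - z0"] compact_imp_bounded[OF compactK'] x(2) by auto
    define x' where "x' = z0 + d *\<^sub>R (x - z0)"
    have Fx': "F x' = \<delta>" using frF d(2) by (simp add: x'_def)
    have "1 < d"
    proof (rule ccontr)
      assume "\<not> 1 < d"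
      then have "(1 - d) *\<^sub>R z0 + d *\<^sub>R x \<in> K" using cK(2) z0K x(1) d(1) by (intro convexD) auto
      then have "x' \<in> K" by (simp add: x'_def algebra_simps)
      then show False using Kin[of x'] Fx' \<delta>(1) by simp
    qed
    have nM: "norm (x - z0) \<le> M" using M(2) x(1) .
    have "\<delta> / (4 * M) \<le> d - 1"
    \<comment> \<open>If \<open>d \<le> 6 / 5\<close>, the quadratic term is at most
      \<open>(6 / 5)\<^sup>2 / 2 = 18 / 25\<close> of \<open>\<delta>\<close>, so the distance term
      makes up at least \<open>7 / 25\<close> of it. A larger \<open>d\<close> is more than enough
      because \<open>\<delta> \<le> M / 2\<close>.\<close>
    proof (cases "d \<le> 6 / 5")
      case True
      have "infdist x' K \<le> dist x' x" using x(1) by (rule infdist_le)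
      also have "x' - x = (d - 1) *\<^sub>R (x - z0)" by (simp add: x'_def algebra_simps)
      then have "dist x' x = (d - 1) * norm (x - z0)" using \<open>1 < d\<close> by (simp add: dist_norm)
      also have "\<dots> \<le> (d - 1) * M" using nM \<open>1 < d\<close> by simp
      finally have i: "infdist x' K \<le> (d - 1) * M" .
      have "(norm (x' - z0))\<^sup>2 = d\<^sup>2 * (norm (x - z0))\<^sup>2" using d(1) by (simp add: x'_def power_mult_distrib)
      also have "\<dots> \<le> (6 / 5)\<^sup>2 * M\<^sup>2" using True d(1) nM by (intro mult_mono power_mono) auto
      finally have "\<tau> * (norm (x' - z0))\<^sup>2 \<le> \<tau> * ((6 / 5)\<^sup>2 * M\<^sup>2)" using \<tau> by simp
      also have "\<dots> = 18 / 25 * \<delta>" using M(1) by (simp add: \<tau>_def power2_eq_square)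
      finally have "7 / 25 * \<delta> \<le> (d - 1) * M" using i Fx' by (simp add: F_def)
      then have "\<delta> / 4 \<le> (d - 1) * M" using \<delta>(1) by linarith
      then show ?thesis using M(1) by (simp add: field_simps)
    next
      case False
      have "\<delta> / (4 * M) \<le> 1 / 8" using \<delta>(2) M(1) by (simp add: field_simps)
      then show ?thesis using False by simp
    qed
    moreover obtain v where "v \<in> G" "x' \<in> ball v \<gamma>" using G(3) d(2) unfolding x'_def by blast
    ultimately show ?thesis using d(2) by (auto simp: x'_def dist_norm norm_minus_commute)
  qed
  \<comment> \<open>Suppose a line separates a point of \<open>K\<close> from the net. The ray from
    \<open>z0\<close> through the point \<open>k\<close> of \<open>K\<close> lowest in direction
    \<open>n\<close> reaches the frontier of \<open>K'\<close> lower than \<open>k\<close> by at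
    least \<open>\<gamma> * norm n\<close>, so a net point within the mesh is not above
    \<open>k\<close>.\<close>
  have KG: "K \<subseteq> convex hull G"
  proof (rule ccontr)
    assume "\<not> K \<subseteq> convex hull G"
    then obtain y where y: "y \<in> K" "y \<notin> convex hull G" by blast
    have "closed (convex hull G)" using G(2) by (simp add: compact_imp_closed finite_imp_compact_convex_hull)
    then obtain n c where nc: "n \<bullet> y < c" "\<And>x. x \<in> convex hull G \<Longrightarrow> c < n \<bullet> x"
      using separating_hyperplane_closed_point[of "convex hull G" y] y(2) by auto
    have "continuous_on K (\<lambda>x. n \<bullet> x)" by (intro continuous_intros)
    then obtain k where k: "k \<in> K" "\<And>x. x \<in> K \<Longrightarrow> n \<bullet> k \<le> n \<bullet> x"
      using continuous_attains_inf[OF cK(1)] z0K by blast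
    have n0: "n \<noteq> 0"
    proof
      assume "n = 0"
      then have "c > 0" using nc(1) by simp
      have "z0 + M *\<^sub>R 0 \<in> K" using z0K by simp
      have "G \<noteq> {}"
      proof
        assume "G = {}"
        then have "frontier K' = {}" using G(3) by simp
        then have "K' = {} \<or> K' = UNIV" using frontier_eq_empty by blast
        moreover have "z0 \<in> K'" using Kin[OF z0K] \<delta>(1) by (simp add: K'_def)
        moreover have "K' \<noteq> UNIV" using compactK' not_compact_UNIV by metis
        ultimately show False by blast
      qed
      then obtain g where "g \<in> G" by blast
      then have "c < 0" using nc(2)[of g] \<open>n = 0\<close> hull_inc[of g G convex] by simp
      then show False using \<open>c > 0\<close> by simp
    qed
    have "z0 - (r / norm n) *\<^sub>R n \<in> K" using r n0 by (intro subsetD[OF r(2)]) (simp add: dist_norm)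
    then have "n \<bullet> k \<le> n \<bullet> (z0 - (r / norm n) *\<^sub>R n)" by (rule k(2))
    also have "\<dots> = n \<bullet> z0 - r * norm n" using n0 by (simp add: inner_diff_right dot_square_norm power2_eq_square)
    finally have nk: "n \<bullet> (k - z0) \<le> - (r * norm n)" by (simp add: inner_diff_right)
    moreover have "0 < r * norm n" using r n0 by simp
    ultimately have "k \<noteq> z0" by auto
    then obtain d x' v where dv: "\<delta> / (4 * M) \<le> d - 1" "x' = z0 + d *\<^sub>R (k - z0)" "v \<in> G" "norm (x' - v) < \<gamma>"
      using exit[OF k(1)] by blast
    have "n \<bullet> v = n \<bullet> x' - n \<bullet> (x' - v)" by (simp add: inner_diff_right)
    also have "\<dots> \<le> n \<bullet> x' + norm n * norm (x' - v)" using Cauchy_Schwarz_ineq2[of n "x' - v"] by linarith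
    also have "\<dots> \<le> n \<bullet> x' + norm n * \<gamma>" using dv(4) by (intro add_left_mono mult_left_mono) auto
    also have "n \<bullet> x' = n \<bullet> k + (d - 1) * (n \<bullet> (k - z0))" by (simp add: dv(2) inner_add_right inner_diff_right algebra_simps)
    also have "(d - 1) * (n \<bullet> (k - z0)) \<le> (d - 1) * (- (r * norm n))"
    proof (rule mult_left_mono[OF nk])
      have "0 \<le> \<delta> / (4 * M)" using \<delta>(1) M(1) by simp
      then show "0 \<le> d - 1" using dv(1) by linarith
    qed
    also have "\<dots> \<le> (\<delta> / (4 * M)) * (- (r * norm n))"
      using dv(1) \<open>0 < r * norm n\<close> by (intro mult_right_mono_neg) auto
    finally have "n \<bullet> v \<le> n \<bullet> k" by (simp add: \<gamma>_def algebra_simps)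
    moreover have "c < n \<bullet> v" using nc(2) dv(3) hull_inc by metis
    ultimately show False using nc(1) k(2)[OF y(1)] by linarith
  qed
  obtain \<Phi> a b where \<Phi>: "\<Phi> \<in> ridges" "\<And>v. v \<in> G \<Longrightarrow> \<Phi> v + a \<bullet> v + b = \<phi> v"
    "\<And>x. x \<in> convex hull G \<Longrightarrow> \<phi> x \<le> \<Phi> x + a \<bullet> x + b" using ridge_majorant[OF cvx] by blast
  define \<Psi> where "\<Psi> x = \<Phi> x + a \<bullet> x + b" for x
  have cv\<Psi>: "convex_on UNIV \<Psi>" unfolding \<Psi>_def[abs_def] by (rule convex_on_plus_affine[OF ridges_convex[OF \<Phi>(1)]])
  have \<Psi>C: "\<Psi> x \<le> C" if "x \<in> convex hull G" for x
  proof -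
    have "\<forall>v\<in>G. \<Psi> v \<le> C" using \<Phi>(2) C(2) GK' K'B by (fastforce simp: \<Psi>_def abs_le_iff)
    then show ?thesis
      using convex_on_convex_hull_bound[OF convex_on_subset[OF cv\<Psi>]] that by blast
  qed
  show thesis
  proof (rule that[OF \<Phi>(1), of a b])
    show "\<phi> x \<le> \<Phi> x + a \<bullet> x + b" if "x \<in> K" for x using \<Phi>(3) KG that by blast
    show "\<Phi> x + a \<bullet> x + b \<le> \<phi> x + \<epsilon>" if x: "x \<in> frontier K" for x
    proof -
      have xK: "x \<in> K" using x cK(4) frontier_subset_closed by blast
      have "x \<noteq> z0" using x z0 by (auto simp: frontier_def)
      then obtain d x' v where dv: "\<delta> / (4 * M) \<le> d - 1" "x' = z0 + d *\<^sub>R (x - z0)" "x' \<in> frontier K'" "v \<in> G" "norm (x' - v) < \<gamma>"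
        using exit[OF xK] by blast
      have "0 < \<delta> / (4 * M)" using \<delta>(1) M(1) by simp
      then have d1: "1 < d" using dv(1) by linarith
      \<comment> \<open>If \<open>x'\<close> were farther out, \<open>x\<close> would be a
        combination of a point \<open>k\<close> of \<open>K\<close> close to \<open>x'\<close> and a
        point \<open>q\<close> in the ball around \<open>z0\<close>, and hence interior to
        \<open>K\<close>.\<close>
      have dr: "d - 1 \<le> \<delta> / r"
      proof (rule ccontr)
        assume "\<not> d - 1 \<le> \<delta> / r"
        then have dd: "\<delta> < r * (d - 1)" using r(1) by (simp add: field_simps)
        have "x' \<in> K'" using dv(3) closedK' frontier_subset_closed by blast
        then obtain k where k: "k \<in> K" "norm (x' - k) \<le> \<delta>" using near by blast
        define q where "q = z0 + (1 / (d - 1)) *\<^sub>R (x' - k)"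
        have "norm (x' - k) < r * (d - 1)" using k dd by simp
        then have "norm (x' - k) / (d - 1) < r" using d1 by (simp add: pos_divide_less_eq)
        moreover have "dist z0 q = norm (x' - k) / (d - 1)" using d1 by (simp add: q_def dist_norm)
        ultimately have "q \<in> ball z0 r" by simp
        then have "q \<in> interior K" using r(2) ball_subset_cball by (meson interior_maximal open_ball order.trans subsetD)
        moreover have "x = k - (1 - 1 / d) *\<^sub>R (k - q)"
        proof -
          have e: "(d - 1) *\<^sub>R q = (d - 1) *\<^sub>R z0 + (x' - k)" using d1 by (simp add: q_def scaleR_add_right)
          have "d *\<^sub>R x = k + (d - 1) *\<^sub>R q" unfolding e dv(2) by (simp add: algebra_simps)
          also have "\<dots> = d *\<^sub>R (k - (1 - 1 / d) *\<^sub>R (k - q))"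
          proof -
            have "d *\<^sub>R ((1 - 1 / d) *\<^sub>R (k - q)) = (d - 1) *\<^sub>R (k - q)" using d1 by (simp add: right_diff_distrib)
            then show ?thesis by (simp add: scaleR_diff_right) (simp add: algebra_simps)
          qed
          finally show ?thesis using d1 by simp
        qed
        moreover have "0 < 1 - 1 / d" "1 - 1 / d \<le> 1" using d1 by simp_all
        ultimately have "x \<in> interior K"
          using mem_interior_convex_shrink[OF cK(2), of q k "1 - 1 / d"] k(1) by (simp only:)
        then show False using x by (simp add: frontier_def)
      qed
      define \<eta> where "\<eta> = 1 - 1 / d"
      have \<eta>: "0 < \<eta>" "\<eta> < 1" "\<eta> \<le> \<delta> / r"
      proof -
        show "0 < \<eta>" "\<eta> < 1" using d1 by (auto simp: \<eta>_def)
        have "\<eta> = (d - 1) / d" using d1 by (simp add: \<eta>_def diff_divide_distrib)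
        also have "\<dots> \<le> (d - 1) / 1" using d1 by (intro divide_left_mono) auto
        finally show "\<eta> \<le> \<delta> / r" using dr by simp
      qed
      \<comment> \<open>Chosen so that \<open>x\<close> is the combination of \<open>v\<close> and
        \<open>z\<close> with weight \<open>\<eta>\<close> at \<open>z\<close>: the error of
        replacing \<open>x'\<close> by the net point \<open>v\<close> is absorbed inside the ball
        around \<open>z0\<close>. Convexity then bounds \<open>\<Psi> x\<close> through
        \<open>\<phi> v\<close> and \<open>C\<close>.\<close>
      define z where "z = z0 + (1 / (d - 1)) *\<^sub>R (x' - v)"
      have "\<gamma> \<le> r * (d - 1)" using mult_left_mono[OF dv(1), of r] r(1) by (simp add: \<gamma>_def)
      then have "norm (x' - v) \<le> r * (d - 1)" using dv(5) by simp
      then have "norm (x' - v) / (d - 1) \<le> r" using d1 by (simp add: pos_divide_le_eq)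
      moreover have "dist z0 z = norm (x' - v) / (d - 1)" using d1 by (simp add: z_def dist_norm)
      ultimately have "z \<in> cball z0 r" by simp
      then have zG: "z \<in> convex hull G" using r(2) KG by blast
      have xz: "x = (1 - \<eta>) *\<^sub>R v + \<eta> *\<^sub>R z"
      proof -
        have e: "(d - 1) *\<^sub>R z = (d - 1) *\<^sub>R z0 + (x' - v)" using d1 by (simp add: z_def scaleR_add_right)
        have "d *\<^sub>R x = v + (d - 1) *\<^sub>R z" unfolding e dv(2) by (simp add: algebra_simps)
        then have "(1 / d) *\<^sub>R (d *\<^sub>R x) = (1 / d) *\<^sub>R v + ((d - 1) / d) *\<^sub>R z" by (simp add: scaleR_add_right)
        moreover have "(d - 1) / d = \<eta>" using d1 by (simp add: \<eta>_def diff_divide_distrib)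
        ultimately show ?thesis using d1 by (simp add: \<eta>_def)
      qed
      have "\<Psi> x \<le> (1 - \<eta>) * \<Psi> v + \<eta> * \<Psi> z" unfolding xz using convex_onD[OF cv\<Psi>, of \<eta> v z] \<eta> by simp
      also have "\<dots> \<le> (1 - \<eta>) * \<phi> v + \<eta> * C"
        using \<Phi>(2)[OF dv(4)] \<Psi>C[OF zG] \<eta> by (simp add: \<Psi>_def)
      also have "\<dots> = \<phi> v + \<eta> * (C - \<phi> v)" by (simp add: algebra_simps)
      also have "\<dots> \<le> \<phi> v + (\<delta> / r) * (2 * C)"
      proof -
        have "v \<in> cball z0 (2 * M)" using dv(4) GK' K'B by blast
        then have "- C \<le> \<phi> v" "\<phi> v \<le> C" using C(2)[of v] by auto
        then show ?thesis using \<eta> C(1) by (intro add_left_mono mult_mono) auto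
      qed
      also have "\<dots> \<le> \<phi> v + \<epsilon> / 2" using \<delta>(4) by simp
      also have "\<phi> v \<le> \<phi> x + \<epsilon> / 2"
      proof -
        have "norm (x' - x) = (d - 1) * norm (x - z0)"
        proof -
          have "x' - x = (d - 1) *\<^sub>R (x - z0)" by (simp add: dv(2) algebra_simps)
          then show ?thesis using d1 by simp
        qed
        also have "\<dots> \<le> (\<delta> / r) * M" using dr d1 M(2)[OF xK] M(1) \<delta>(1) r(1) by (intro mult_mono) auto
        finally have "norm (v - x) < \<gamma> + (\<delta> / r) * M"
          using norm_triangle_ineq[of "v - x'" "x' - x"] dv(5) by (simp add: norm_minus_commute)
        also have "\<dots> = \<delta> * (M / r + r / (4 * M))" by (simp add: \<gamma>_def algebra_simps)
        also have "\<dots> < \<delta>1" by (rule \<delta>(3))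
        finally have "dist v x < \<delta>1" by (simp add: dist_norm)
        moreover have "v \<in> cball z0 (2 * M)" "x \<in> cball z0 (2 * M)" using dv(4) GK' K'B xK KB by blast+
        ultimately have "dist (\<phi> v) (\<phi> x) < \<epsilon> / 2" using \<delta>1(2) by blast
        then show ?thesis unfolding dist_real_def by linarith
      qed
      finally show ?thesis by (simp add: \<Psi>_def)
    qed
  qed
qed

section \<open>An inequality for the centroid of a convex arc\<close>

lemma integrable_on_mono_mult:
  fixes g h :: "real \<Rightarrow> real"
  assumes "a \<le> b" "mono_on {a..b} g" "continuous_on {a..b} h"
  shows "(\<lambda>x. g x * h x) integrable_on {a..b}"
proof -
  have "h integrable_on {a..b}" using assms(3) by (rule integrable_continuous_interval)
  moreover have "g x \<le> g y" if "a \<le> x" "x \<le> y" "y \<le> b" for x y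
    using assms(2) that by (auto simp: mono_on_def)
  ultimately show ?thesis
    by (rule second_mean_value_theorem_full[OF _ assms(1)]) (auto simp: integrable_on_def)
qed

text \<open>The second mean value theorem writes the integral as \<open>g a\<close> times the full
  integral of \<open>h\<close> plus the increase of \<open>g\<close> times a tail integral of
  \<open>h\<close>.\<close>

lemma integral_mono_mult_nonneg:
  fixes g h :: "real \<Rightarrow> real"
  assumes ab: "a \<le> b" and g: "mono_on {a..b} g" "0 \<le> g a" and h: "h integrable_on {a..b}"
    and tail: "\<And>c. c \<in> {a..b} \<Longrightarrow> 0 \<le> integral {c..b} h"
  shows "0 \<le> integral {a..b} (\<lambda>x. g x * h x)"
proof -
  obtain c where c: "c \<in> {a..b}"
    "integral {a..b} (\<lambda>x. g x * h x) = g a * integral {a..c} h + g b * integral {c..b} h"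
    using second_mean_value_theorem[OF h ab, of g] g(1) by (auto simp: mono_on_def)
  have "integral {a..b} h = integral {a..c} h + integral {c..b} h"
    using c h by (simp add: Henstock_Kurzweil_Integration.integral_combine)
  then have "integral {a..b} (\<lambda>x. g x * h x) = g a * integral {a..b} h + (g b - g a) * integral {c..b} h"
    using c(2) by (simp add: algebra_simps)
  moreover have "g a \<le> g b" using g(1) ab by (auto simp: mono_on_def)
  ultimately show ?thesis using g(2) tail[of a] tail[OF c(1)] ab by simp
qed

text \<open>\<open>(x - m) * (g x - g m)\<close> is nonnegative for monotone \<open>g\<close>, so
  \<open>g\<close> may be replaced by the constant \<open>g m\<close>; what remains is
  \<open>g m * (b * (b - 2 * m) / 2)\<close>.\<close>

lemma integral_linear_mono_nonneg:
  fixes g :: "real \<Rightarrow> real"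
  assumes "0 \<le> b" "0 \<le> m" "2 * m \<le> b" "mono_on {0..b} g" "0 \<le> g m"
  shows "0 \<le> integral {0..b} (\<lambda>x. (x - m) * g x)"
proof -
  have i1: "(\<lambda>x. (x - m) * g x) integrable_on {0..b}"
    using integrable_on_mono_mult[OF assms(1,4), of "\<lambda>x. x - m"] by (simp add: mult.commute continuous_intros)
  have h: "((\<lambda>x. (x - m) * g m) has_integral ((b - m)\<^sup>2 / 2 * g m - (0 - m)\<^sup>2 / 2 * g m)) {0..b}"
    using assms(1)
    by (intro fundamental_theorem_of_calculus)
       (auto intro!: derivative_eq_intros simp: has_real_derivative_iff_has_vector_derivative[symmetric])
  have "(b - m)\<^sup>2 / 2 * g m - (0 - m)\<^sup>2 / 2 * g m = g m * (b * (b - 2 * m) / 2)"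
    by (simp add: power2_eq_square algebra_simps diff_divide_distrib)
  then have "integral {0..b} (\<lambda>x. (x - m) * g m) = g m * (b * (b - 2 * m) / 2)"
    using integral_unique[OF h] by (simp only:)
  moreover have "0 \<le> g m * (b * (b - 2 * m) / 2)" using assms by simp
  ultimately have "0 \<le> integral {0..b} (\<lambda>x. (x - m) * g m)" by (simp only:)
  also have "\<dots> \<le> integral {0..b} (\<lambda>x. (x - m) * g x)"
  proof (rule integral_le[OF _ i1])
    show "(\<lambda>x. (x - m) * g m) integrable_on {0..b}" using h by blast
    show "(x - m) * g m \<le> (x - m) * g x" if "x \<in> {0..b}" for x
    proof (cases "m \<le> x")
      case True
      then show ?thesis using assms that by (intro mult_left_mono) (auto simp: mono_on_def)
    next
      case False
      then show ?thesis using assms that by (intro mult_left_mono_neg) (auto simp: mono_on_def)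
    qed
  qed
  finally show ?thesis .
qed

text \<open>The factor of \<open>q - p\<close> that remains when the speeds are replaced by their tangents at \<open>p 0\<close> and
  \<open>- p 0\<close> in the integral of \<open>cap_inequality\<close>.\<close>

definition kern :: "real \<Rightarrow> real \<Rightarrow> real" where
  "kern m t = (if t \<le> 2 * m then - \<bar>t - m\<bar> else t - m)"

text \<open>The tail integrals come from piecewise cubic antiderivatives with breaks at
  \<open>m\<close> and \<open>2 * m\<close>; nonnegativity is then a polynomial inequality in
  \<open>m\<close>, \<open>B\<close> and \<open>\<tau> = 2 * m - c\<close>. It is the tail condition
  of \<open>integral_mono_mult_nonneg\<close>.\<close>

lemma kern_tail:
  assumes m: "0 \<le> m" and b: "b = 2 * m + B" "0 \<le> B"
  shows "(\<lambda>t. B * kern m t - t * (t - 2 * m) / 2) integrable_on {0..b}"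
    and "c \<in> {0..b} \<Longrightarrow> 0 \<le> integral {c..b} (\<lambda>t. B * kern m t - t * (t - 2 * m) / 2)"
proof -
  let ?F = "\<lambda>t. B * kern m t - t * (t - 2 * m) / 2"
  have I1: "(?F has_integral ((B * (m - m)\<^sup>2 / 2 - (m ^ 3 / 6 - m * m\<^sup>2 / 2)) - (B * (c - m)\<^sup>2 / 2 - (c ^ 3 / 6 - m * c\<^sup>2 / 2)))) {c..m}"
    if "c \<le> m" for c
  proof (rule has_integral_eq[where f = "\<lambda>t. B * (t - m) - t * (t - 2 * m) / 2"])
    show "((\<lambda>t. B * (t - m) - t * (t - 2 * m) / 2) has_integral
      ((B * (m - m)\<^sup>2 / 2 - (m ^ 3 / 6 - m * m\<^sup>2 / 2)) - (B * (c - m)\<^sup>2 / 2 - (c ^ 3 / 6 - m * c\<^sup>2 / 2)))) {c..m}"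
      using that by (intro fundamental_theorem_of_calculus)
       (auto intro!: derivative_eq_intros simp: has_real_derivative_iff_has_vector_derivative[symmetric] field_simps power2_eq_square)
  qed (use m in \<open>auto simp: kern_def\<close>)
  have I2: "(?F has_integral ((- B * (2 * m - m)\<^sup>2 / 2 - ((2 * m) ^ 3 / 6 - m * (2 * m)\<^sup>2 / 2)) - (- B * (c - m)\<^sup>2 / 2 - (c ^ 3 / 6 - m * c\<^sup>2 / 2)))) {c..2 * m}"
    if "m \<le> c" "c \<le> 2 * m" for c
  proof (rule has_integral_eq[where f = "\<lambda>t. - B * (t - m) - t * (t - 2 * m) / 2"])
    show "((\<lambda>t. - B * (t - m) - t * (t - 2 * m) / 2) has_integral
      ((- B * (2 * m - m)\<^sup>2 / 2 - ((2 * m) ^ 3 / 6 - m * (2 * m)\<^sup>2 / 2)) - (- B * (c - m)\<^sup>2 / 2 - (c ^ 3 / 6 - m * c\<^sup>2 / 2)))) {c..2 * m}"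
      using that by (intro fundamental_theorem_of_calculus)
       (auto intro!: derivative_eq_intros simp: has_real_derivative_iff_has_vector_derivative[symmetric] field_simps power2_eq_square)
  qed (use m that in \<open>auto simp: kern_def algebra_simps\<close>)
  have I3': "((\<lambda>t. B * (t - m) - t * (t - 2 * m) / 2) has_integral
      ((B * (b - m)\<^sup>2 / 2 - (b ^ 3 / 6 - m * b\<^sup>2 / 2)) - (B * (c - m)\<^sup>2 / 2 - (c ^ 3 / 6 - m * c\<^sup>2 / 2)))) {c..b}"
    if "c \<le> b" for c
    using that by (intro fundamental_theorem_of_calculus)
     (auto intro!: derivative_eq_intros simp: has_real_derivative_iff_has_vector_derivative[symmetric] field_simps power2_eq_square)
  have I3: "(?F has_integral ((B * (b - m)\<^sup>2 / 2 - (b ^ 3 / 6 - m * b\<^sup>2 / 2)) - (B * (c - m)\<^sup>2 / 2 - (c ^ 3 / 6 - m * c\<^sup>2 / 2)))) {c..b}"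
    if "2 * m \<le> c" "c \<le> b" for c
    \<comment> \<open>\<open>kern m\<close> may jump at \<open>2 * m\<close>, where its value
      belongs to the middle piece.\<close>
    by (rule has_integral_spike_finite[OF _ _ I3'[OF that(2)], where S = "{2 * m}"])
      (use m that in \<open>auto simp: kern_def\<close>)
  have mb: "0 \<le> m" "m \<le> 2 * m" "2 * m \<le> b" using m b by auto
  note C23 = has_integral_combine[OF _ mb(3) I2 I3]
  have J2: "(?F has_integral (m * (2 * m - c - B)\<^sup>2 / 2 + (B ^ 3 / 3 + B * (2 * m - c)\<^sup>2 / 2 - (2 * m - c) ^ 3 / 6))) {c..b}"
    if "m \<le> c" "c \<le> 2 * m" for c
  proof -
    have "(?F has_integral (((- B * (2 * m - m)\<^sup>2 / 2 - ((2 * m) ^ 3 / 6 - m * (2 * m)\<^sup>2 / 2)) - (- B * (c - m)\<^sup>2 / 2 - (c ^ 3 / 6 - m * c\<^sup>2 / 2)))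
      + ((B * (b - m)\<^sup>2 / 2 - (b ^ 3 / 6 - m * b\<^sup>2 / 2)) - (B * (2 * m - m)\<^sup>2 / 2 - ((2 * m) ^ 3 / 6 - m * (2 * m)\<^sup>2 / 2))))) {c..b}"
      using that mb by (intro has_integral_combine[OF _ _ I2 I3]) auto
    moreover have "((- B * (2 * m - m)\<^sup>2 / 2 - ((2 * m) ^ 3 / 6 - m * (2 * m)\<^sup>2 / 2)) - (- B * (c - m)\<^sup>2 / 2 - (c ^ 3 / 6 - m * c\<^sup>2 / 2)))
      + ((B * (b - m)\<^sup>2 / 2 - (b ^ 3 / 6 - m * b\<^sup>2 / 2)) - (B * (2 * m - m)\<^sup>2 / 2 - ((2 * m) ^ 3 / 6 - m * (2 * m)\<^sup>2 / 2)))
      = m * (2 * m - c - B)\<^sup>2 / 2 + (B ^ 3 / 3 + B * (2 * m - c)\<^sup>2 / 2 - (2 * m - c) ^ 3 / 6)"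
      unfolding b by (simp add: power2_eq_square power3_eq_cube field_simps)
    ultimately show ?thesis by (simp only:)
  qed
  have J1: "(?F has_integral (m * B\<^sup>2 / 2 + B ^ 3 / 3 - B * m\<^sup>2 + B * m * (2 * m - c) - B * (2 * m - c)\<^sup>2 / 2 + m * (2 * m - c)\<^sup>2 / 2 - (2 * m - c) ^ 3 / 6)) {c..b}"
    if "0 \<le> c" "c \<le> m" for c
  proof -
    have "(?F has_integral (((B * (m - m)\<^sup>2 / 2 - (m ^ 3 / 6 - m * m\<^sup>2 / 2)) - (B * (c - m)\<^sup>2 / 2 - (c ^ 3 / 6 - m * c\<^sup>2 / 2)))
      + (m * (2 * m - m - B)\<^sup>2 / 2 + (B ^ 3 / 3 + B * (2 * m - m)\<^sup>2 / 2 - (2 * m - m) ^ 3 / 6)))) {c..b}"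
      using that mb by (intro has_integral_combine[OF _ _ I1 J2]) auto
    moreover have "((B * (m - m)\<^sup>2 / 2 - (m ^ 3 / 6 - m * m\<^sup>2 / 2)) - (B * (c - m)\<^sup>2 / 2 - (c ^ 3 / 6 - m * c\<^sup>2 / 2)))
      + (m * (2 * m - m - B)\<^sup>2 / 2 + (B ^ 3 / 3 + B * (2 * m - m)\<^sup>2 / 2 - (2 * m - m) ^ 3 / 6))
      = m * B\<^sup>2 / 2 + B ^ 3 / 3 - B * m\<^sup>2 + B * m * (2 * m - c) - B * (2 * m - c)\<^sup>2 / 2 + m * (2 * m - c)\<^sup>2 / 2 - (2 * m - c) ^ 3 / 6"
      by (simp add: power2_eq_square power3_eq_cube field_simps)
    ultimately show ?thesis by (simp only:)
  qed
  show "?F integrable_on {0..b}" using J1[of 0] m by blast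
  assume c: "c \<in> {0..b}"
  define \<tau> where "\<tau> = 2 * m - c"
  consider "c \<le> m" | "m \<le> c" "c \<le> 2 * m" | "2 * m \<le> c" by linarith
  then show "0 \<le> integral {c..b} ?F"
  proof cases
    case 1
    have t: "m \<le> \<tau>" "\<tau> \<le> 2 * m" using 1 c by (auto simp: \<tau>_def)
    have "(\<tau> - m) * (\<tau> - 2 * m) \<le> 0" using t by (intro mult_nonneg_nonpos) auto
    then have a1: "m\<^sup>2 - m * \<tau> + \<tau>\<^sup>2 / 2 \<le> m * \<tau> / 2" by (simp add: power2_eq_square algebra_simps)
    have "\<tau> * ((\<tau> - m) * (\<tau> - 2 * m)) \<le> 0"
      using \<open>(\<tau> - m) * (\<tau> - 2 * m) \<le> 0\<close> t m by (intro mult_nonneg_nonpos) auto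
    then have a2: "m\<^sup>2 * \<tau> / 3 \<le> m * \<tau>\<^sup>2 / 2 - \<tau> ^ 3 / 6" by (simp add: power2_eq_square power3_eq_cube algebra_simps)
    have a3: "B * (m\<^sup>2 - m * \<tau> + \<tau>\<^sup>2 / 2) \<le> B * (m * \<tau> / 2)" using a1 b by (intro mult_left_mono) auto
    have a4: "0 \<le> m * B\<^sup>2 / 2 + B ^ 3 / 3 + \<tau> * (m\<^sup>2 / 3 - B * m / 2)"
    proof (cases "0 \<le> m\<^sup>2 / 3 - B * m / 2")
      case True
      then have "0 \<le> \<tau> * (m\<^sup>2 / 3 - B * m / 2)" using t m by simp
      moreover have "0 \<le> m * B\<^sup>2 / 2 + B ^ 3 / 3" using m b by simp
      ultimately show ?thesis by linarith
    next
      case False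
      \<comment> \<open>The expression is affine in \<open>\<tau>\<close> with negative slope here,
        so the worst case is \<open>\<tau> = 2 * m\<close>, where it factors as displayed.\<close>
      have "0 \<le> (B - m)\<^sup>2 * (B + 2 * m) / 3 + m * B\<^sup>2 / 2" using m b by simp
      also have "\<dots> = m * B\<^sup>2 / 2 + B ^ 3 / 3 + (2 * m) * (m\<^sup>2 / 3 - B * m / 2)"
        by (simp add: power2_eq_square power3_eq_cube field_simps)
      also have "(2 * m) * (m\<^sup>2 / 3 - B * m / 2) \<le> \<tau> * (m\<^sup>2 / 3 - B * m / 2)"
        using False t by (intro mult_right_mono_neg) auto
      finally show ?thesis by simp
    qed
    have "integral {c..b} ?F = m * B\<^sup>2 / 2 + B ^ 3 / 3 - B * m\<^sup>2 + B * m * \<tau> - B * \<tau>\<^sup>2 / 2 + m * \<tau>\<^sup>2 / 2 - \<tau> ^ 3 / 6"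
      using integral_unique[OF J1] 1 c by (simp add: \<tau>_def)
    also have "\<dots> = m * B\<^sup>2 / 2 + B ^ 3 / 3 - B * (m\<^sup>2 - m * \<tau> + \<tau>\<^sup>2 / 2) + (m * \<tau>\<^sup>2 / 2 - \<tau> ^ 3 / 6)"
      by (simp add: algebra_simps)
    also have "\<dots> \<ge> m * B\<^sup>2 / 2 + B ^ 3 / 3 - B * (m * \<tau> / 2) + m\<^sup>2 * \<tau> / 3" using a2 a3 by linarith
    moreover have "m * B\<^sup>2 / 2 + B ^ 3 / 3 - B * (m * \<tau> / 2) + m\<^sup>2 * \<tau> / 3 = m * B\<^sup>2 / 2 + B ^ 3 / 3 + \<tau> * (m\<^sup>2 / 3 - B * m / 2)"
      by (simp add: algebra_simps)
    ultimately show ?thesis using a4 by linarith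
  next
    case 2
    have t: "0 \<le> \<tau>" "\<tau> \<le> m" using 2 by (auto simp: \<tau>_def)
    have "0 \<le> m * (\<tau> - B)\<^sup>2 / 2 + (B ^ 3 / 3 + B * \<tau>\<^sup>2 / 2 - \<tau> ^ 3 / 6)"
    \<comment> \<open>For \<open>\<tau> \<le> 3 * B\<close> the cubic is absorbed by
      \<open>B * \<tau>\<^sup>2 / 2\<close>; otherwise
      \<open>\<tau> - B \<ge> 2 * \<tau> / 3\<close>, and the square term absorbs it because
      \<open>m \<ge> \<tau>\<close>.\<close>
    proof (cases "\<tau> \<le> 3 * B")
      case True
      have "B * \<tau>\<^sup>2 / 2 - \<tau> ^ 3 / 6 = \<tau>\<^sup>2 * (3 * B - \<tau>) / 6" by (simp add: power2_eq_square power3_eq_cube field_simps)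
      moreover have "0 \<le> \<tau>\<^sup>2 * (3 * B - \<tau>) / 6" using True by simp
      ultimately have "0 \<le> B * \<tau>\<^sup>2 / 2 - \<tau> ^ 3 / 6" by linarith
      moreover have "0 \<le> m * (\<tau> - B)\<^sup>2 / 2" "0 \<le> B ^ 3 / 3" using m b by auto
      ultimately show ?thesis by linarith
    next
      case False
      have "(2 * \<tau> / 3)\<^sup>2 \<le> (\<tau> - B)\<^sup>2" using False t by (intro power_mono) auto
      then have "\<tau> * (2 * \<tau> / 3)\<^sup>2 \<le> m * (\<tau> - B)\<^sup>2" using t by (intro mult_mono) auto
      then have "4 * \<tau> ^ 3 / 9 \<le> m * (\<tau> - B)\<^sup>2" by (simp add: power2_eq_square power3_eq_cube)
      moreover have "0 \<le> B ^ 3 / 3" "0 \<le> B * \<tau>\<^sup>2 / 2" "0 \<le> \<tau> ^ 3" using t b by auto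
      ultimately show ?thesis by linarith
    qed
    then show ?thesis using integral_unique[OF J2[OF 2]] by (simp add: \<tau>_def)
  next
    case 3
    have cb: "c \<le> b" using c by simp
    have "0 \<le> B * (t - m) - t * (t - 2 * m) / 2" if "t \<in> {c..b}" for t
    proof -
      have t: "2 * m \<le> t" "t - 2 * m \<le> B" using that 3 b by auto
      have "t * (t - 2 * m) \<le> t * B" using t m by (intro mult_left_mono) auto
      also have "\<dots> \<le> (2 * (t - m)) * B" using t m b by (intro mult_right_mono) auto
      also have "\<dots> = 2 * (B * (t - m))" by (simp add: ac_simps)
      finally show ?thesis by linarith
    qed
    then show ?thesis
      using has_integral_nonneg[OF I3'[OF cb]] integral_unique[OF I3[OF 3 cb]] by simp
  qed
qed

text \<open>With \<open>B = b - 2 * m\<close>, subtract the constraint from \<open>B\<close> times the claim: the tail integrals of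
  \<open>B * kern m t - (t\<^sup>2 / 2 - m * t)\<close> are nonnegative and \<open>v\<close> is nondecreasing.\<close>

lemma integral_kern_nonneg:
  fixes v :: "real \<Rightarrow> real"
  assumes b: "0 < b" and m: "0 \<le> m" "2 * m \<le> b" and v: "mono_on {0..b} v" "0 \<le> v 0" and w: "0 \<le> wb"
    and mean: "integral {0..b} (\<lambda>t. v t * (t\<^sup>2 / 2 - m * t)) + wb * (b\<^sup>2 / 2 - m * b) = 0"
  shows "(\<lambda>t. v t * kern m t) integrable_on {0..b}" "0 \<le> integral {0..b} (\<lambda>t. v t * kern m t) + (b - m) * wb"
proof -
  define B where "B = b - 2 * m"
  have B: "b = 2 * m + B" "0 \<le> B" using m by (auto simp: B_def)
  have v0: "0 \<le> v t" if "t \<in> {0..b}" for t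
    using v that b by (auto simp: mono_on_def intro: order.trans)
  have iq: "(\<lambda>t. v t * (t\<^sup>2 / 2 - m * t)) integrable_on {0..b}"
    using b v(1) by (intro integrable_on_mono_mult) (auto intro!: continuous_intros)
  \<comment> \<open>Integrability of \<open>kern m\<close> is read off from
    \<open>kern_tail\<close>, which gives it only multiplied by \<open>B\<close>; a small
    \<open>b\<close> is therefore treated inside the larger interval for which
    \<open>B = 1\<close>.\<close>
  have ik: "kern m integrable_on {0..b}"
  proof -
    have "(\<lambda>t. 1 * kern m t - t * (t - 2 * m) / 2) integrable_on {0..2 * m + 1}"
      using kern_tail(1)[of m "2 * m + 1" 1] m by simp
    moreover have "(\<lambda>t. t * (t - 2 * m) / 2) integrable_on {0..2 * m + 1}"
      by (intro integrable_continuous_interval) (auto intro!: continuous_intros)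
    ultimately have "(\<lambda>t. (1 * kern m t - t * (t - 2 * m) / 2) + t * (t - 2 * m) / 2) integrable_on {0..2 * m + 1}"
      by (rule integrable_add)
    then have i: "kern m integrable_on {0..2 * m + 1}" by simp
    show ?thesis
    proof (cases "b \<le> 2 * m + 1")
      case True
      show ?thesis by (rule integrable_on_subinterval[OF i]) (use True in auto)
    next
      case False
      then have B1: "1 \<le> B" by (simp add: B_def)
      have j: "(\<lambda>t. t * (t - 2 * m) / 2) integrable_on {0..b}"
        by (intro integrable_continuous_interval) (auto intro!: continuous_intros)
      have "(\<lambda>t. (1 / B) * ((B * kern m t - t * (t - 2 * m) / 2) + t * (t - 2 * m) / 2)) integrable_on {0..b}"
        using integrable_cmul[OF integrable_add[OF kern_tail(1)[OF m(1) B] j], of "1 / B"] by simp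
      then show ?thesis using B1 by simp
    qed
  qed
  show vk: "(\<lambda>t. v t * kern m t) integrable_on {0..b}"
  proof -
    have gm: "v x \<le> v y" if "0 \<le> x" "x \<le> y" "y \<le> b" for x y
      using v(1) that by (auto simp: mono_on_def)
    have b0: "0 \<le> b" using b by simp
    show ?thesis
      by (rule second_mean_value_theorem_full[OF ik b0 gm]) (auto simp: integrable_on_def)
  qed
  have quad: "t\<^sup>2 / 2 - m * t = t * (t - 2 * m) / 2" for t
    by (simp add: power2_eq_square algebra_simps diff_divide_distrib)
  show "0 \<le> integral {0..b} (\<lambda>t. v t * kern m t) + (b - m) * wb"
  proof (cases "B = 0")
    case False
    then have Bp: "0 < B" using B by simp
    have "0 \<le> integral {0..b} (\<lambda>t. v t * (B * kern m t - t * (t - 2 * m) / 2))"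
      using b v kern_tail[OF m(1) B] by (intro integral_mono_mult_nonneg) auto
    also have "(\<lambda>t. v t * (B * kern m t - t * (t - 2 * m) / 2)) = (\<lambda>t. B * (v t * kern m t) - v t * (t\<^sup>2 / 2 - m * t))"
      unfolding quad by (simp add: right_diff_distrib mult.left_commute)
    also have "integral {0..b} \<dots> = B * integral {0..b} (\<lambda>t. v t * kern m t) - integral {0..b} (\<lambda>t. v t * (t\<^sup>2 / 2 - m * t))"
      using vk iq by (subst Henstock_Kurzweil_Integration.integral_diff) (auto intro!: integrable_on_mult_right)
    also have "\<dots> = B * integral {0..b} (\<lambda>t. v t * kern m t) + wb * (b\<^sup>2 / 2 - m * b)" using mean by linarith
    also have "\<dots> = B * (integral {0..b} (\<lambda>t. v t * kern m t) + (b - m) * wb) - wb * B\<^sup>2 / 2"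
      unfolding B(1) by (simp add: power2_eq_square field_simps)
    finally have "wb * B\<^sup>2 / 2 \<le> B * (integral {0..b} (\<lambda>t. v t * kern m t) + (b - m) * wb)" by simp
    moreover have "0 \<le> wb * B\<^sup>2 / 2" using w by simp
    ultimately have "0 \<le> B * (integral {0..b} (\<lambda>t. v t * kern m t) + (b - m) * wb)" by linarith
    then show ?thesis using Bp by (simp add: zero_le_mult_iff)
  next
    case True
    then have bm: "b = 2 * m" using B by simp
    have z: "integral {0..b} (\<lambda>t. v t * (t\<^sup>2 / 2 - m * t)) = 0"
      using mean bm by (simp add: power2_eq_square)
    \<comment> \<open>For \<open>b = 2 * m\<close> the weight \<open>t\<^sup>2 / 2 - m * t\<close>
      equals \<open>- (t * (b - t) / 2)\<close>, negative inside the interval. As the constraint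
      makes the weighted integral zero, the nonnegative monotone \<open>v\<close> vanishes
      there.\<close>
    have vz: "v s = 0" if s: "s \<in> {0<..<b}" for s
    proof (rule ccontr)
      assume "v s \<noteq> 0"
      then have vs: "0 < v s" using v0[of s] s by auto
      have i2: "(\<lambda>t. v t * (t * (b - t) / 2)) integrable_on {0..b}"
        using b v(1) by (intro integrable_on_mono_mult) (auto intro!: continuous_intros)
      have h: "((\<lambda>t. v s * (t * (b - t) / 2)) has_integral (v s * (b * b\<^sup>2 / 4 - b ^ 3 / 6) - v s * (b * s\<^sup>2 / 4 - s ^ 3 / 6))) {s..b}"
        using s by (intro fundamental_theorem_of_calculus)
          (auto intro!: derivative_eq_intros simp: has_real_derivative_iff_has_vector_derivative[symmetric] field_simps power2_eq_square)
      have "0 < v s * ((b - s)\<^sup>2 * (b + 2 * s) / 12)" using vs s by simp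
      also have "\<dots> = v s * (b * b\<^sup>2 / 4 - b ^ 3 / 6) - v s * (b * s\<^sup>2 / 4 - s ^ 3 / 6)"
        by (simp add: power2_eq_square power3_eq_cube field_simps)
      also have "\<dots> = integral {s..b} (\<lambda>t. v s * (t * (b - t) / 2))" by (rule integral_unique[OF h, symmetric])
      also have "\<dots> \<le> integral {s..b} (\<lambda>t. v t * (t * (b - t) / 2))"
      proof (rule integral_le)
        show "(\<lambda>t. v s * (t * (b - t) / 2)) integrable_on {s..b}" using h by blast
        show "(\<lambda>t. v t * (t * (b - t) / 2)) integrable_on {s..b}"
          by (rule integrable_on_subinterval[OF i2]) (use s in auto)
        show "v s * (t * (b - t) / 2) \<le> v t * (t * (b - t) / 2)" if "t \<in> {s..b}" for t
          using v(1) s that by (intro mult_right_mono) (auto simp: mono_on_def)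
      qed
      also have "\<dots> \<le> integral {0..b} (\<lambda>t. v t * (t * (b - t) / 2))"
      proof (rule integral_subset_le)
        show "(\<lambda>t. v t * (t * (b - t) / 2)) integrable_on {s..b}"
          by (rule integrable_on_subinterval[OF i2]) (use s in auto)
        show "\<forall>t\<in>{0..b}. 0 \<le> v t * (t * (b - t) / 2)" using v0 by auto
      qed (use s i2 in auto)
      also have "(\<lambda>t. v t * (t * (b - t) / 2)) = (\<lambda>t. - (v t * (t\<^sup>2 / 2 - m * t)))"
        by (simp add: fun_eq_iff bm power2_eq_square field_simps)
      finally show False using z by (simp add: Henstock_Kurzweil_Integration.integral_neg)
    qed
    have "integral {0..b} (\<lambda>t. v t * kern m t) = integral {0..b} (\<lambda>t. 0)"
      by (rule integral_spike[of "{0, b}"]) (use vz in \<open>auto intro!: negligible_finite\<close>)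
    then show ?thesis using m w by simp
  qed
qed

section \<open>The arc length element and the centroid inequality\<close>

definition arc_speed :: "real \<Rightarrow> real" where "arc_speed y = sqrt (1 + y\<^sup>2)"

lemma arc_speed_pos: "0 < arc_speed y" "1 \<le> arc_speed y"
  by (auto simp: arc_speed_def add_pos_nonneg)

lemma arc_speed_sq: "(arc_speed y)\<^sup>2 = 1 + y\<^sup>2"
  by (simp add: arc_speed_def)

lemma arc_speed_uminus: "arc_speed (- y) = arc_speed y" by (simp add: arc_speed_def)

lemma arc_speed_abs_mono: "\<bar>x\<bar> \<le> \<bar>y\<bar> \<Longrightarrow> arc_speed x \<le> arc_speed y"
  unfolding arc_speed_def by (simp add: abs_le_square_iff)

text \<open>Cauchy-Schwarz for the vectors \<open>(1, z)\<close> and \<open>(1, y)\<close>; the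
  left-hand side is the tangent at \<open>z\<close> to the convex function \<open>arc_speed\<close>,
  evaluated at \<open>y\<close>.\<close>

lemma arc_speed_tangent:
  "1 / arc_speed z + (z / arc_speed z) * y \<le> arc_speed y"
proof -
  have "(1 + z * y)\<^sup>2 \<le> (1 + z\<^sup>2) * (1 + y\<^sup>2)"
  proof -
    have "(1 + z\<^sup>2) * (1 + y\<^sup>2) - (1 + z * y)\<^sup>2 = (z - y)\<^sup>2" by (simp add: power2_eq_square algebra_simps)
    then show ?thesis using zero_le_power2[of "z - y"] by linarith
  qed
  then have "(1 + z * y)\<^sup>2 \<le> (arc_speed z * arc_speed y)\<^sup>2" by (simp add: power_mult_distrib arc_speed_sq)
  then have "\<bar>1 + z * y\<bar> \<le> \<bar>arc_speed z * arc_speed y\<bar>" by (simp only: abs_le_square_iff)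
  moreover have "\<bar>arc_speed z * arc_speed y\<bar> = arc_speed z * arc_speed y"
    using arc_speed_pos(1)[of z] arc_speed_pos(1)[of y] by (intro abs_of_pos mult_pos_pos)
  ultimately have "1 + z * y \<le> arc_speed z * arc_speed y" by linarith
  then have "(1 + z * y) / arc_speed z \<le> arc_speed y" using arc_speed_pos[of z] by (simp add: pos_divide_le_eq mult.commute)
  then show ?thesis by (simp add: add_divide_distrib)
qed

lemma arc_speed_tangent_eq: "1 / arc_speed z + (z / arc_speed z) * z = arc_speed z"
  using arc_speed_sq[of z] arc_speed_pos[of z] by (simp add: field_simps power2_eq_square)

lemma arc_speed_tangent_abs:
  assumes "0 \<le> z" shows "1 / arc_speed z + (z / arc_speed z) * \<bar>y\<bar> \<le> arc_speed y"
  using arc_speed_tangent[of z "\<bar>y\<bar>"] by (simp add: arc_speed_def)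

text \<open>Beyond \<open>z\<close> the derivative of the convex function \<open>arc_speed\<close>
  is at least its value \<open>z / arc_speed z\<close> at \<open>z\<close>.\<close>

lemma arc_speed_diff_mono:
  assumes "0 \<le> z" "z \<le> x" "x \<le> y"
  shows "arc_speed x - (z / arc_speed z) * x \<le> arc_speed y - (z / arc_speed z) * y"
proof -
  have "z / arc_speed z \<le> x / arc_speed x"
  proof -
    have "(z * arc_speed x)\<^sup>2 \<le> (x * arc_speed z)\<^sup>2"
      using assms by (simp add: power_mult_distrib arc_speed_sq algebra_simps power_mono)
    moreover have "0 \<le> x * arc_speed z" using assms arc_speed_pos(1)[of z] by simp
    ultimately have "z * arc_speed x \<le> x * arc_speed z" by (rule power2_le_imp_le)
    then show ?thesis using arc_speed_pos by (simp add: divide_simps mult.commute)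
  qed
  then have "(z / arc_speed z) * (y - x) \<le> (x / arc_speed x) * (y - x)" using assms by (intro mult_right_mono) auto
  moreover have "1 / arc_speed x + (x / arc_speed x) * y \<le> arc_speed y" by (rule arc_speed_tangent)
  moreover have "1 / arc_speed x + (x / arc_speed x) * x = arc_speed x" by (rule arc_speed_tangent_eq)
  ultimately show ?thesis by (simp add: right_diff_distrib)
qed

text \<open>\<open>arc_speed\<close> decreases and then increases, so its composition with a
  monotone \<open>q\<close> need not be monotone; treating the positive and negative parts of
  \<open>q\<close> separately writes it as a combination of monotone functions.\<close>

lemma arc_speed_mono_integrable:
  fixes q h :: "real \<Rightarrow> real"
  assumes "a \<le> b" "mono_on {a..b} q" and c: "continuous_on {a..b} h"
  shows "(\<lambda>x. h x * arc_speed (q x)) integrable_on {a..b}"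
proof -
  define g1 where "g1 x = arc_speed (max 0 (q x))" for x
  define g2 where "g2 x = - arc_speed (min 0 (q x))" for x
  have m1: "mono_on {a..b} g1"
  proof (rule mono_onI)
    fix r s assume "r \<in> {a..b}" "s \<in> {a..b}" "r \<le> s"
    then have "q r \<le> q s" using assms(2) by (auto simp: mono_on_def)
    then show "g1 r \<le> g1 s"
      by (auto simp: g1_def max_def intro!: arc_speed_abs_mono)
  qed
  have m2: "mono_on {a..b} g2"
  proof (rule mono_onI)
    fix r s assume "r \<in> {a..b}" "s \<in> {a..b}" "r \<le> s"
    then have "q r \<le> q s" using assms(2) by (auto simp: mono_on_def)
    then show "g2 r \<le> g2 s"
      by (auto simp: g2_def min_def intro!: arc_speed_abs_mono)
  qed
  have e: "h x * arc_speed (q x) = g1 x * h x - g2 x * h x - h x" for x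
    by (cases "0 \<le> q x") (auto simp: g1_def g2_def max_def min_def arc_speed_def algebra_simps)
  show ?thesis
    unfolding e
    by (intro integrable_diff integrable_on_mono_mult[OF assms(1) m1 c] integrable_on_mono_mult[OF assms(1) m2 c]
        integrable_continuous_interval[OF c])
qed

lemma arc_speed_comp_integrable:
  fixes q :: "real \<Rightarrow> real"
  assumes "0 \<le> b" "mono_on {0..b} q"
  shows "(\<lambda>x. (x - m) * arc_speed (q x)) integrable_on {0..b}"
  by (intro arc_speed_mono_integrable assms continuous_intros)

text \<open>The lower arc alone has nonnegative moment about \<open>m\<close>, its speed being
  nondecreasing. If the upper arc descends steeply enough by \<open>m\<close>, its moment is
  nonnegative too. Otherwise the tangents of \<open>arc_speed\<close> at \<open>z = p 0\<close> and
  \<open>- z\<close> reduce the sum to the integral of \<open>kern\<close> against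
  \<open>q - p\<close> plus nonnegative terms.\<close>

lemma cap_inequality_pos:
  fixes p q :: "real \<Rightarrow> real"
  assumes b: "0 < b" and m: "0 \<le> m" "2 * m \<le> b"
    and p: "antimono_on {0..b} p" and q: "mono_on {0..b} q" and pq: "p 0 \<le> q 0" and q0: "0 \<le> q 0"
    and w: "0 \<le> wb" "wb \<le> R"
    and mean: "integral {0..b} (\<lambda>t. (q t - p t) * (t\<^sup>2 / 2 - m * t)) + wb * (b\<^sup>2 / 2 - m * b) = 0"
  shows "0 \<le> integral {0..b} (\<lambda>x. (x - m) * (arc_speed (p x) + arc_speed (q x))) + (b - m) * R"
proof -
  have bR: "0 \<le> (b - m) * R" using m w by simp
  have pm: "p y \<le> p x" if "0 \<le> x" "x \<le> y" "y \<le> b" for x y using p that by (auto simp: monotone_on_def)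
  have qm: "q x \<le> q y" if "0 \<le> x" "x \<le> y" "y \<le> b" for x y using q that by (auto simp: mono_on_def)
  have qpos: "0 \<le> q x" if "x \<in> {0..b}" for x using qm[of 0 x] q0 that by auto
  have iq: "(\<lambda>x. (x - m) * arc_speed (q x)) integrable_on {0..b}"
    using b q by (intro arc_speed_comp_integrable) auto
  have ip: "(\<lambda>x. (x - m) * arc_speed (p x)) integrable_on {0..b}"
  proof -
    have "mono_on {0..b} (\<lambda>x. - p x)" using p by (auto simp: monotone_on_def)
    then show ?thesis using arc_speed_comp_integrable[of b "\<lambda>x. - p x" m] b by (simp add: arc_speed_uminus)
  qed
  have sum: "integral {0..b} (\<lambda>x. (x - m) * (arc_speed (p x) + arc_speed (q x))) =
    integral {0..b} (\<lambda>x. (x - m) * arc_speed (p x)) + integral {0..b} (\<lambda>x. (x - m) * arc_speed (q x))"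
    using ip iq by (simp add: distrib_left Henstock_Kurzweil_Integration.integral_add)
  have qspeed: "0 \<le> integral {0..b} (\<lambda>x. (x - m) * arc_speed (q x))"
  proof (rule integral_linear_mono_nonneg)
    show "mono_on {0..b} (\<lambda>x. arc_speed (q x))"
      using qm qpos by (auto simp: mono_on_def intro!: arc_speed_abs_mono)
  qed (use b m arc_speed_pos less_imp_le in auto)
  have mb: "m \<in> {0..b}" using m by auto
  show ?thesis
  \<comment> \<open>In the first case \<open>\<bar>p x\<bar>\<close> is at most
    \<open>\<bar>p m\<bar>\<close> before \<open>m\<close> and at least that after it, so the speed
    may be replaced by its value at \<open>m\<close>.\<close>
  proof (cases "p m \<le> 0 \<and> p 0 \<le> - p m")
    case True
    have "0 \<le> integral {0..b} (\<lambda>x. (x - m) * arc_speed (p m))"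
      by (rule integral_linear_mono_nonneg) (use b m arc_speed_pos less_imp_le in \<open>auto simp: mono_on_def\<close>)
    also have "\<dots> \<le> integral {0..b} (\<lambda>x. (x - m) * arc_speed (p x))"
    proof (rule integral_le[OF _ ip])
      show "(\<lambda>x. (x - m) * arc_speed (p m)) integrable_on {0..b}"
        by (intro integrable_continuous_interval continuous_intros)
      fix x assume x: "x \<in> {0..b}"
      show "(x - m) * arc_speed (p m) \<le> (x - m) * arc_speed (p x)"
      proof (cases "x \<le> m")
        case xm: True
        have "p m \<le> p x" "p x \<le> p 0" using pm[of x m] pm[of 0 x] x xm mb by auto
        then have "\<bar>p x\<bar> \<le> \<bar>p m\<bar>" using True by auto
        then show ?thesis using xm by (intro mult_left_mono_neg arc_speed_abs_mono) auto
      next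
        case xm: False
        have "p x \<le> p m" using pm[of m x] x xm m by auto
        then have "\<bar>p m\<bar> \<le> \<bar>p x\<bar>" using True by auto
        then show ?thesis using xm by (intro mult_left_mono arc_speed_abs_mono) auto
      qed
    qed
    finally show ?thesis using sum qspeed bR by linarith
  next
    case False
    define z where "z = p 0"
    have pmz: "p m \<le> z" using pm[of 0 m] mb by (auto simp: z_def)
    have z0: "0 < z" using False pmz by (auto simp: z_def)
    have pz: "\<bar>p x\<bar> \<le> z" if "0 \<le> x" "x \<le> m" for x
      using pm[of 0 x] pm[of x m] that mb False by (auto simp: z_def)
    define c \<kappa> where "c = 1 / arc_speed z" and "\<kappa> = z / arc_speed z"
    have c0: "0 < c" using arc_speed_pos by (simp add: c_def)
    have k0: "0 < \<kappa>" using arc_speed_pos z0 by (simp add: \<kappa>_def)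
    have k1: "\<kappa> \<le> 1"
    proof -
      have "z\<^sup>2 \<le> (arc_speed z)\<^sup>2" by (simp add: arc_speed_sq)
      then have "z \<le> arc_speed z" using arc_speed_pos[of z] by (simp add: power2_le_iff_abs_le)
      then show ?thesis using arc_speed_pos[of z] by (simp add: \<kappa>_def pos_divide_le_eq)
    qed
    define v where "v x = q x - p x" for x
    have v: "mono_on {0..b} v" "0 \<le> v 0" using pm qm pq by (auto simp: mono_on_def v_def intro!: diff_mono)
    \<comment> \<open>\<open>l\<close> will minorise \<open>(x - m) * (ph + q x)\<close> on each of
      the three ranges below \<open>m\<close>, up to \<open>2 * m\<close> and beyond; its part
      \<open>l1\<close> is antisymmetric about \<open>m\<close> on \<open>{0..2 * m}\<close> and
      integrates to zero.\<close>
    define l1 where "l1 x = (if x \<le> 2 * m then 2 * z * (x - m) else 0)" for x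
    define l where "l x = l1 x + v x * kern m x" for x
    note K = integral_kern_nonneg[OF b m v w(1) mean[folded v_def]]
    have l1: "(l1 has_integral 0) {0..b}"
    proof -
      have "((\<lambda>x. 2 * z * (x - m)) has_integral (z * (2 * m - m)\<^sup>2 - z * (0 - m)\<^sup>2)) {0..2 * m}"
        using m by (intro fundamental_theorem_of_calculus)
          (auto intro!: derivative_eq_intros simp: has_real_derivative_iff_has_vector_derivative[symmetric])
      then have a: "(l1 has_integral 0) {0..2 * m}"
        by (rule has_integral_eq_rhs[OF has_integral_eq[rotated]]) (auto simp: l1_def)
      have "(l1 has_integral 0) {2 * m..b}"
        by (rule has_integral_spike_finite[of "{2 * m}" _ _ "\<lambda>_. 0"]) (auto simp: l1_def)
      then show ?thesis using has_integral_combine[OF _ m(2) a, of 0] m by simp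
    qed
    have il: "l integrable_on {0..b}" unfolding l_def using l1 K(1) by (intro integrable_add) auto
    have int_l: "integral {0..b} l = integral {0..b} (\<lambda>t. v t * kern m t)"
      unfolding l_def using l1 K(1) by (subst Henstock_Kurzweil_Integration.integral_add) (auto simp: integral_unique)
    \<comment> \<open>The excess of \<open>arc_speed (q x)\<close> over its linear part of slope
      \<open>\<kappa>\<close>; it is nondecreasing by \<open>arc_speed_diff_mono\<close>, since
      \<open>q\<close> stays above \<open>z\<close>.\<close>
    define h where "h x = arc_speed (q x) - \<kappa> * q x" for x
    have hz: "z \<le> q x" if "x \<in> {0..b}" for x using qm[of 0 x] that pq by (auto simp: z_def)
    have hmono: "mono_on {0..b} h"
    proof (rule mono_onI)
      fix r s assume rs: "r \<in> {0..b}" "s \<in> {0..b}" "r \<le> s"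
      show "h r \<le> h s"
        using arc_speed_diff_mono[of z "q r" "q s"] hz[OF rs(1)] qm[of r s] rs z0 by (simp add: h_def \<kappa>_def)
    qed
    have h0: "0 \<le> h m"
    proof -
      have "arc_speed z - \<kappa> * z \<le> h m" unfolding h_def \<kappa>_def using hz[OF mb] z0 by (intro arc_speed_diff_mono) auto
      moreover have "arc_speed z - \<kappa> * z = c" using arc_speed_tangent_eq[of z] by (simp add: c_def \<kappa>_def)
      ultimately show ?thesis using c0 by simp
    qed
    have ih: "(\<lambda>x. (x - m) * h x) integrable_on {0..b}"
      using integrable_on_mono_mult[OF _ hmono, of "\<lambda>x. x - m"] b by (simp add: mult.commute continuous_intros)
    have ic: "(\<lambda>x. (x - m) * c) integrable_on {0..b}" by (intro integrable_continuous_interval continuous_intros)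
    have "0 \<le> integral {0..b} (\<lambda>x. (x - m) * h x)"
      using b m hmono h0 by (intro integral_linear_mono_nonneg) auto
    moreover have "0 \<le> integral {0..b} (\<lambda>x. (x - m) * c)"
      using b m c0 by (intro integral_linear_mono_nonneg) (auto simp: mono_on_def)
    moreover have "integral {0..b} (\<lambda>x. (x - m) * c + \<kappa> * l x + (x - m) * h x)
        = integral {0..b} (\<lambda>x. (x - m) * c) + \<kappa> * integral {0..b} l + integral {0..b} (\<lambda>x. (x - m) * h x)"
    proof -
      have ikl: "(\<lambda>x. \<kappa> * l x) integrable_on {0..b}" using integrable_cmul[OF il, of \<kappa>] by simp
      have "integral {0..b} (\<lambda>x. \<kappa> * l x) = \<kappa> * integral {0..b} l" by (rule integral_mult_right)
      then show ?thesis
        by (simp only: Henstock_Kurzweil_Integration.integral_add[OF integrable_add[OF ic ikl] ih]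
            Henstock_Kurzweil_Integration.integral_add[OF ic ikl])
    qed
    moreover have "integral {0..b} (\<lambda>x. (x - m) * c + \<kappa> * l x + (x - m) * h x)
        \<le> integral {0..b} (\<lambda>x. (x - m) * (arc_speed (p x) + arc_speed (q x)))"
    proof (rule integral_le)
      show "(\<lambda>x. (x - m) * c + \<kappa> * l x + (x - m) * h x) integrable_on {0..b}"
        using integrable_cmul[OF il, of \<kappa>] by (intro integrable_add ic ih) simp
      show "(\<lambda>x. (x - m) * (arc_speed (p x) + arc_speed (q x))) integrable_on {0..b}"
        using integrable_add[OF ip iq] by (simp add: distrib_left)
      fix x assume x: "x \<in> {0..b}"
      \<comment> \<open>Stands in for \<open>\<bar>p x\<bar>\<close> in the tangent bound. Before
        \<open>m\<close> the factor \<open>x - m\<close> is negative, so an upper bound of the speed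
        is wanted, and \<open>\<bar>p x\<bar> \<le> z\<close> gives one; after \<open>m\<close> the
        tangent bounds the speed from below.\<close>
      define ph where "ph = (if x < m then z else \<bar>p x\<bar>)"
      have 1: "(x - m) * (c + \<kappa> * ph) \<le> (x - m) * arc_speed (p x)"
      proof (cases "x < m")
        case True
        have "arc_speed (p x) \<le> arc_speed z" using pz[of x] x True z0 by (intro arc_speed_abs_mono) auto
        also have "\<dots> = c + \<kappa> * z" using arc_speed_tangent_eq[of z] by (simp add: c_def \<kappa>_def)
        finally show ?thesis using True by (intro mult_left_mono_neg) (auto simp: ph_def)
      next
        case False
        then show ?thesis
          using arc_speed_tangent_abs[of z "p x"] z0 by (intro mult_left_mono) (auto simp: ph_def c_def \<kappa>_def)
      qed
      have px: "p x \<le> z" "z \<le> q x" using pm[of 0 x] hz[OF x] x by (auto simp: z_def)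
      have 2: "l x \<le> (x - m) * (ph + q x)"
      proof -
        consider "x < m" | "m \<le> x" "x \<le> 2 * m" | "2 * m < x" by linarith
        then show ?thesis
        proof cases
          case 1
          have "l x = (x - m) * (2 * z + v x)" using 1 m by (simp add: l_def l1_def kern_def algebra_simps)
          also have "\<dots> \<le> (x - m) * (ph + q x)" using 1 px by (intro mult_left_mono_neg) (auto simp: ph_def v_def)
          finally show ?thesis .
        next
          case 2
          have "l x = (x - m) * (2 * z - v x)" using 2 by (simp add: l_def l1_def kern_def algebra_simps)
          also have "\<dots> \<le> (x - m) * (ph + q x)" using 2 px by (intro mult_left_mono) (auto simp: ph_def v_def)
          finally show ?thesis .
        next
          case 3
          have "l x = (x - m) * v x" using 3 by (simp add: l_def l1_def kern_def algebra_simps)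
          also have "\<dots> \<le> (x - m) * (ph + q x)" using 3 m by (intro mult_left_mono) (auto simp: ph_def v_def)
          finally show ?thesis .
        qed
      qed
      have "(x - m) * c + \<kappa> * l x + (x - m) * h x \<le> (x - m) * c + \<kappa> * ((x - m) * (ph + q x)) + (x - m) * h x"
      proof -
        have "\<kappa> * l x \<le> \<kappa> * ((x - m) * (ph + q x))" using 2 k0 by (intro mult_left_mono) auto
        then show ?thesis by linarith
      qed
      also have "\<dots> = (x - m) * (c + \<kappa> * ph) + (x - m) * arc_speed (q x)" by (simp add: h_def algebra_simps)
      also have "\<dots> \<le> (x - m) * (arc_speed (p x) + arc_speed (q x))" using 1 by (simp add: distrib_left)
      finally show "(x - m) * c + \<kappa> * l x + (x - m) * h x \<le> (x - m) * (arc_speed (p x) + arc_speed (q x))" .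
    qed
    moreover have "0 \<le> \<kappa> * integral {0..b} l + (b - m) * R"
    proof -
      have "0 \<le> \<kappa> * (integral {0..b} l + (b - m) * wb)" using K(2) k0 int_l by simp
      \<comment> \<open>By \<open>\<kappa> \<le> 1\<close> and \<open>wb \<le> R\<close>, the
        boundary term of \<open>integral_kern_nonneg\<close> is paid for by the cut-off arc.\<close>
      moreover have "\<kappa> * ((b - m) * wb) \<le> 1 * ((b - m) * R)"
        using k1 k0 m w by (intro mult_mono mult_left_mono) auto
      ultimately show ?thesis by (simp add: distrib_left)
    qed
    ultimately show ?thesis by linarith
  qed
qed

text \<open>Here \<open>p\<close> and \<open>q\<close> are the slopes of the upper and the lower arc of a cap that is truncated at \<open>b\<close>,
  \<open>wb\<close> is its width there, and \<open>R\<close> is the length of the arc that has been cut off. The last hypothesis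
  says, after an integration by parts, that \<open>m\<close> is the abscissa of the centroid of the truncated cap.\<close>

lemma cap_inequality:
  fixes p q :: "real \<Rightarrow> real"
  assumes b: "0 < b" and m: "0 \<le> m" "2 * m \<le> b"
    and p: "antimono_on {0..b} p" and q: "mono_on {0..b} q" and pq: "p 0 \<le> q 0"
    and w: "0 \<le> wb" "wb \<le> R"
    and mean: "integral {0..b} (\<lambda>t. (q t - p t) * (t\<^sup>2 / 2 - m * t)) + wb * (b\<^sup>2 / 2 - m * b) = 0"
  shows "0 \<le> integral {0..b} (\<lambda>x. (x - m) * (arc_speed (p x) + arc_speed (q x))) + (b - m) * R"
proof (cases "0 \<le> q 0")
  case True
  then show ?thesis using cap_inequality_pos[OF b m p q pq True w mean] by simp
next
  case False
  \<comment> \<open>Reflecting in the axis of abscissae exchanges the arcs: \<open>- q\<close> and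
    \<open>- p\<close> take the roles of \<open>p\<close> and \<open>q\<close>, and now
    \<open>- p 0 \<ge> - q 0 > 0\<close>.\<close>
  have "antimono_on {0..b} (\<lambda>x. - q x)" "mono_on {0..b} (\<lambda>x. - p x)"
    using p q by (auto simp: monotone_on_def)
  then show ?thesis
    using cap_inequality_pos[of b m "\<lambda>x. - q x" "\<lambda>x. - p x" wb R] False b m pq w mean
    by (simp add: arc_speed_uminus add.commute)
qed

section \<open>Length of convex graphs\<close>

text \<open>Over \<open>n\<close> equal pieces the bounds telescope to
  \<open>(t - s) * (\<rho> t - \<rho> s) / n\<close>, which tends to 0. Applied to the difference of
  two additive quantities, this yields integral formulas for lengths and moments.\<close>

lemma additive_increments_zero:
  fixes \<Delta> :: "real \<Rightarrow> real \<Rightarrow> real"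
  assumes st: "s \<le> t"
    and add: "\<And>x y z. s \<le> x \<Longrightarrow> x \<le> y \<Longrightarrow> y \<le> z \<Longrightarrow> z \<le> t \<Longrightarrow> \<Delta> x z = \<Delta> x y + \<Delta> y z"
    and small: "\<And>x y. s \<le> x \<Longrightarrow> x < y \<Longrightarrow> y \<le> t \<Longrightarrow> \<bar>\<Delta> x y\<bar> \<le> (y - x) * (\<rho> y - \<rho> x)"
  shows "\<Delta> s t = 0"
proof -
  have z: "\<Delta> s s = 0" using add[of s s s] st by simp
  have bound: "\<bar>\<Delta> s t\<bar> \<le> (t - s) * (\<rho> t - \<rho> s) / real (Suc n)" for n
  proof (cases "s = t")
    case True then show ?thesis using z by simp
  next
    case False
    define h where "h = (t - s) / real (Suc n)"
    have h: "0 < h" "h * real (Suc n) = t - s" using False st by (auto simp: h_def)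
    have step: "\<bar>\<Delta> s (s + real i * h)\<bar> \<le> h * (\<rho> (s + real i * h) - \<rho> s)" if "i \<le> Suc n" for i
      using that
    proof (induction i)
      case 0 then show ?case using z by simp
    next
      case (Suc i)
      have le: "s + real (Suc i) * h \<le> t"
      proof -
        have "real (Suc i) * h \<le> real (Suc n) * h" using Suc.prems h(1) by (intro mult_right_mono) auto
        then show ?thesis using h(2) by (simp add: mult.commute)
      qed
      have x0: "s \<le> s + real i * h" using h(1) by simp
      have xy: "s + real i * h < s + real (Suc i) * h" using h(1) by simp
      have "\<Delta> s (s + real (Suc i) * h) = \<Delta> s (s + real i * h) + \<Delta> (s + real i * h) (s + real (Suc i) * h)"
        using le x0 xy by (intro add) auto
      moreover have "\<bar>\<Delta> (s + real i * h) (s + real (Suc i) * h)\<bar>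
          \<le> (s + real (Suc i) * h - (s + real i * h)) * (\<rho> (s + real (Suc i) * h) - \<rho> (s + real i * h))"
        by (rule small[OF x0 xy le])
      moreover have "s + real (Suc i) * h - (s + real i * h) = h" by (simp add: algebra_simps)
      moreover have "\<bar>\<Delta> s (s + real i * h)\<bar> \<le> h * (\<rho> (s + real i * h) - \<rho> s)" using Suc by simp
      ultimately show ?case by (simp add: right_diff_distrib)
    qed
    have "s + real (Suc n) * h = t" using h(2) by (simp add: mult.commute)
    then have "\<bar>\<Delta> s t\<bar> \<le> h * (\<rho> t - \<rho> s)" using step[of "Suc n"] by simp
    then show ?thesis by (simp add: h_def)
  qed
  have "(\<lambda>n. (t - s) * (\<rho> t - \<rho> s) / real (Suc n)) \<longlonglongrightarrow> 0"
    using tendsto_mult[OF tendsto_const[of "(t - s) * (\<rho> t - \<rho> s)"] LIMSEQ_inverse_real_of_nat]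
    by (simp add: divide_inverse)
  then have "\<bar>\<Delta> s t\<bar> \<le> 0" by (rule LIMSEQ_le_const) (use bound in auto)
  then show ?thesis by simp
qed

lemma arc_speed_lipschitz: "\<bar>arc_speed x - arc_speed y\<bar> \<le> \<bar>x - y\<bar>"
proof -
  have *: "arc_speed x - arc_speed y \<le> \<bar>x - y\<bar>" for x y
  proof -
    have "1 / arc_speed x + (x / arc_speed x) * y \<le> arc_speed y" by (rule arc_speed_tangent)
    then have "arc_speed x - arc_speed y \<le> (x / arc_speed x) * (x - y)"
      using arc_speed_tangent_eq[of x] by (simp add: right_diff_distrib)
    also have "\<dots> \<le> \<bar>x / arc_speed x\<bar> * \<bar>x - y\<bar>" by (metis abs_ge_self abs_mult)
    also have "\<dots> \<le> 1 * \<bar>x - y\<bar>"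
    proof (rule mult_right_mono)
      have "x\<^sup>2 \<le> (arc_speed x)\<^sup>2" by (simp add: arc_speed_sq)
      then have "\<bar>x\<bar> \<le> \<bar>arc_speed x\<bar>" by (simp only: abs_le_square_iff)
      then show "\<bar>x / arc_speed x\<bar> \<le> 1" using arc_speed_pos(1)[of x] by (simp add: abs_divide)
    qed simp
    finally show ?thesis by simp
  qed
  show ?thesis using *[of x y] *[of y x] by (simp add: abs_le_iff abs_minus_commute)
qed

lemma arc_speed_between:
  assumes "lo \<le> y" "y \<le> hi"
  shows "arc_speed y \<le> max (arc_speed lo) (arc_speed hi)"
  using arc_speed_abs_mono[of y lo] arc_speed_abs_mono[of y hi] assms by (cases "0 \<le> y") auto

lemma hausdorff_outer_singleton: "hausdorff_outer 1 {z :: 'a::metric_space} = 0"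
proof -
  have "hausdorff_outer 1 ((\<lambda>_. z) ` {0..0::real}) \<le> ennreal (1 ^ 1) * hausdorff_outer 1 {0..0::real}"
    by (rule hausdorff_outer_lipschitz_image) auto
  also have "\<dots> \<le> ennreal (1 ^ 1) * ennreal (0 - 0)" by (intro mult_left_mono hausdorff_outer_Icc_le) auto
  finally show ?thesis by simp
qed

text \<open>Upper bound: the parametrisation is Lipschitz with constant \<open>L\<close>. Lower
  bound: the orthogonal projection to the chord is 1-Lipschitz and covers the chord by continuity.
  Each is within \<open>(y - x) * (hi - lo)\<close> of the value for the slope
  \<open>\<tau>\<close>. Half-open intervals make consecutive pieces disjoint.\<close>

lemma graph_length:
  fixes u u' :: "'a::euclidean_space" and g :: "real \<Rightarrow> real"
  assumes u: "norm u = 1" "norm u' = 1" "u \<bullet> u' = 0" and xy: "x < y"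
    and slope: "\<And>s t. x \<le> s \<Longrightarrow> s < t \<Longrightarrow> t \<le> y \<Longrightarrow> lo * (t - s) \<le> g t - g s \<and> g t - g s \<le> hi * (t - s)"
  defines "E \<equiv> (\<lambda>t. t *\<^sub>R u + g t *\<^sub>R u') ` {x<..y}"
  shows "E \<in> sets borel" "emeasure (hausdorff_measure 1) E < \<top>"
    "lo \<le> \<tau> \<Longrightarrow> \<tau> \<le> hi \<Longrightarrow> \<bar>measure (hausdorff_measure 1) E - (y - x) * arc_speed \<tau>\<bar> \<le> (y - x) * (hi - lo)"
proof -
  let ?H = "hausdorff_measure 1 :: 'a measure"
  define c where "c t = t *\<^sub>R u + g t *\<^sub>R u'" for t
  define L where "L = max (arc_speed lo) (arc_speed hi)"
  have L: "0 < L" using arc_speed_pos(1)[of lo] by (simp add: L_def max_def)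
  have uu: "u \<bullet> u = 1" "u' \<bullet> u' = 1" "u' \<bullet> u = 0" using u by (simp_all add: dot_square_norm inner_commute)
  have dist_c: "dist (c t) (c s) = sqrt ((t - s)\<^sup>2 + (g t - g s)\<^sup>2)" for t s
  proof -
    have "c t - c s = (t - s) *\<^sub>R u + (g t - g s) *\<^sub>R u'" by (simp add: c_def algebra_simps)
    then have "(dist (c t) (c s))\<^sup>2 = (t - s)\<^sup>2 + (g t - g s)\<^sup>2"
      unfolding dist_norm power2_norm_eq_inner
      by (simp add: inner_add_left inner_add_right uu u(3) power2_eq_square)
    then show ?thesis by (metis real_sqrt_unique zero_le_dist)
  qed
  have dist_slope: "dist (c t) (c s) = (t - s) * arc_speed ((g t - g s) / (t - s))" if "s < t" for s t
  proof -
    have "(t - s)\<^sup>2 + (g t - g s)\<^sup>2 = (t - s)\<^sup>2 * (1 + ((g t - g s) / (t - s))\<^sup>2)"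
      using that by (simp add: power_divide field_simps)
    then show ?thesis using that by (simp add: dist_c arc_speed_def real_sqrt_mult)
  qed
  have sl: "lo \<le> (g t - g s) / (t - s)" "(g t - g s) / (t - s) \<le> hi" if "x \<le> s" "s < t" "t \<le> y" for s t
    using slope[OF that] that by (auto simp: pos_le_divide_eq pos_divide_le_eq)
  have lip: "dist (c t) (c s) \<le> L * dist t s" if "t \<in> {x..y}" "s \<in> {x..y}" for s t
  proof -
    have *: "dist (c t) (c s) \<le> L * dist t s" if "s < t" "x \<le> s" "t \<le> y" for s t
    proof -
      have "(t - s) * arc_speed ((g t - g s) / (t - s)) \<le> (t - s) * L"
        using arc_speed_between[OF sl[OF that(2,1,3)]] that by (intro mult_left_mono) (auto simp: L_def)
      then show ?thesis using that by (simp add: dist_slope dist_real_def mult.commute)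
    qed
    consider "s < t" | "t < s" | "s = t" by linarith
    then show ?thesis
      by cases (use *[of s t] *[of t s] that in \<open>auto simp: dist_commute\<close>)
  qed
  have cont: "continuous_on {x..y} c"
    by (rule lipschitz_on_continuous_on[of L]) (auto intro!: lipschitz_onI lip simp: L less_imp_le)
  have cE: "compact (c ` {x..y})" by (rule compact_continuous_image[OF cont]) simp
  have inj: "c s \<noteq> c t" if "s \<noteq> t" for s t
  proof
    assume "c s = c t"
    then have "c s \<bullet> u = c t \<bullet> u" by simp
    then show False using that by (simp add: c_def inner_add_left uu)
  qed
  have EE: "E = c ` {x..y} - {c x}"
  proof -
    have "{x..y} = insert x {x<..y}" using xy by auto
    moreover have "c x \<notin> c ` {x<..y}" using inj by auto
    moreover have "E = c ` {x<..y}" unfolding E_def c_def ..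
    ultimately show ?thesis by auto
  qed
  show Eb: "E \<in> sets borel" unfolding EE using borel_compact[OF cE] by (intro sets.Diff) auto
  have up: "hausdorff_outer 1 (c ` {x..y}) \<le> ennreal (L * (y - x))"
  proof -
    have "hausdorff_outer 1 (c ` {x..y}) \<le> ennreal (L ^ 1) * hausdorff_outer 1 {x..y}"
      by (rule hausdorff_outer_lipschitz_image[OF L]) (rule lip)
    also have "\<dots> \<le> ennreal (L ^ 1) * ennreal (y - x)"
      using xy by (intro mult_left_mono hausdorff_outer_Icc_le) auto
    also have "\<dots> = ennreal (L * (y - x))" using L xy by (simp add: ennreal_mult)
    finally show ?thesis .
  qed
  note oms = outer_measure_space_hausdorff_outer[of 1, where ?'a = 'a]
  have eH: "emeasure ?H E = hausdorff_outer 1 E" by (rule emeasure_hausdorff_measure[OF Eb])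
  have up': "emeasure ?H E \<le> ennreal (L * (y - x))"
    unfolding eH by (rule order.trans[OF outer_measure_leD(1)[OF oms] up]) (auto simp: EE)
  then show fin: "emeasure ?H E < \<top>" by (meson ennreal_less_top le_less_trans)
  define d where "d = dist (c y) (c x)"
  have low: "ennreal d \<le> emeasure ?H E"
  proof (cases "d = 0")
    case False
    then have d: "0 < d" by (simp add: d_def)
    define e where "e = (1 / d) *\<^sub>R (c y - c x)"
    have ne: "norm e = 1" using d by (simp add: e_def d_def dist_norm)
    define h where "h z = (z - c x) \<bullet> e" for z
    have "continuous_on {x..y} (\<lambda>t. h (c t))" unfolding h_def by (intro continuous_intros cont)
    moreover have "h (c x) = 0" by (simp add: h_def)
    moreover have "h (c y) = d"
    proof -
      have "(c y - c x) \<bullet> (c y - c x) = d * d" by (simp add: d_def dist_norm dot_square_norm power2_eq_square)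
      then show ?thesis using d by (simp add: h_def e_def)
    qed
    ultimately have "{0..d} \<subseteq> h ` c ` {x..y}"
      using IVT'[of "\<lambda>t. h (c t)" x _ y] xy by (fastforce simp: image_iff)
    then have "ennreal (d - 0) \<le> hausdorff_outer 1 (h ` c ` {x..y})" by (rule hausdorff_outer_Icc_ge)
    also have "\<dots> \<le> ennreal (1 ^ 1) * hausdorff_outer 1 (c ` {x..y})"
    proof (rule hausdorff_outer_lipschitz_image)
      fix a b
      have "h a - h b = (a - b) \<bullet> e" by (simp add: h_def inner_diff_left)
      then show "dist (h a) (h b) \<le> 1 * dist a b"
        using Cauchy_Schwarz_ineq2[of "a - b" e] ne by (simp add: dist_real_def dist_norm)
    qed simp
    also have "\<dots> \<le> hausdorff_outer 1 (E \<union> {c x})"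
      using outer_measure_leD(1)[OF oms, of "c ` {x..y}" "E \<union> {c x}"] by (auto simp: EE)
    also have "\<dots> \<le> hausdorff_outer 1 E + hausdorff_outer 1 {c x}" by (rule outer_measure_leD(4)[OF oms])
    finally show ?thesis unfolding eH hausdorff_outer_singleton by simp
  qed simp
  have mE: "emeasure ?H E = ennreal (measure ?H E)" using fin by (simp add: emeasure_eq_ennreal_measure)
  have m1: "measure ?H E \<le> L * (y - x)"
    using up' L xy unfolding mE by (subst (asm) ennreal_le_iff) auto
  have m2: "d \<le> measure ?H E" using low unfolding mE by (subst (asm) ennreal_le_iff) auto
  assume \<tau>: "lo \<le> \<tau>" "\<tau> \<le> hi"
  define \<sigma> where "\<sigma> = (g y - g x) / (y - x)"
  have ds: "d = (y - x) * arc_speed \<sigma>" using dist_slope[OF xy] by (simp add: d_def \<sigma>_def)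
  have \<sigma>: "lo \<le> \<sigma>" "\<sigma> \<le> hi" using sl[of x y] xy by (auto simp: \<sigma>_def)
  have "L - arc_speed \<tau> \<le> hi - lo"
    using arc_speed_lipschitz[of lo \<tau>] arc_speed_lipschitz[of hi \<tau>] \<tau> by (auto simp: L_def max_def)
  then have "(y - x) * (L - arc_speed \<tau>) \<le> (y - x) * (hi - lo)" using xy by (intro mult_left_mono) auto
  moreover have "arc_speed \<tau> - arc_speed \<sigma> \<le> hi - lo"
    using arc_speed_lipschitz[of \<tau> \<sigma>] \<tau> \<sigma> by auto
  then have "(y - x) * (arc_speed \<tau> - arc_speed \<sigma>) \<le> (y - x) * (hi - lo)" using xy by (intro mult_left_mono) auto
  ultimately show "\<bar>measure ?H E - (y - x) * arc_speed \<tau>\<bar> \<le> (y - x) * (hi - lo)"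
    using m1 m2 unfolding ds by (simp add: right_diff_distrib mult.commute abs_le_iff)
qed

text \<open>The hypothesis on \<open>p\<close>, here and below, says that \<open>p\<close> selects a superderivative of the concave
  function \<open>g\<close>.\<close>

lemma slope_selection_mono:
  fixes g p :: "real \<Rightarrow> real"
  assumes sl: "\<And>s t. a \<le> s \<Longrightarrow> s < t \<Longrightarrow> t \<le> b \<Longrightarrow> p t * (t - s) \<le> g t - g s \<and> g t - g s \<le> p s * (t - s)"
    and st: "a \<le> s" "s \<le> t" "t \<le> b"
  shows "p t \<le> p s"
proof (cases "s = t")
  case False
  then have "p t * (t - s) \<le> p s * (t - s)" using sl[of s t] st by linarith
  then show ?thesis using False st by (simp add: mult_le_cancel_right)
qed simp

lemma slope_selection_lipschitz:
  fixes g p :: "real \<Rightarrow> real"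
  assumes sl: "\<And>s t. a \<le> s \<Longrightarrow> s < t \<Longrightarrow> t \<le> b \<Longrightarrow> p t * (t - s) \<le> g t - g s \<and> g t - g s \<le> p s * (t - s)"
    and st: "a \<le> s" "s \<le> t" "t \<le> b"
  shows "\<bar>g t - g s\<bar> \<le> (\<bar>p a\<bar> + \<bar>p b\<bar>) * (t - s)"
proof (cases "s = t")
  case False
  then have lt: "s < t" using st by simp
  have "p b \<le> p t" by (rule slope_selection_mono[OF sl]) (use st in auto)
  then have "p b * (t - s) \<le> p t * (t - s)" using lt by (intro mult_right_mono) auto
  moreover have "p s \<le> p a" by (rule slope_selection_mono[OF sl]) (use st in auto)
  then have "p s * (t - s) \<le> p a * (t - s)" using lt by (intro mult_right_mono) auto
  moreover have "p a * (t - s) \<le> \<bar>p a\<bar> * (t - s)" "(- p b) * (t - s) \<le> \<bar>p b\<bar> * (t - s)"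
    using lt by (intro mult_right_mono; simp)+
  moreover have "0 \<le> \<bar>p a\<bar> * (t - s)" "0 \<le> \<bar>p b\<bar> * (t - s)" using lt by auto
  ultimately show ?thesis using sl[OF st(1) lt st(3)] by (simp add: distrib_right abs_le_iff)
qed simp

lemma slope_selection_continuous:
  fixes g p :: "real \<Rightarrow> real"
  assumes sl: "\<And>s t. a \<le> s \<Longrightarrow> s < t \<Longrightarrow> t \<le> b \<Longrightarrow> p t * (t - s) \<le> g t - g s \<and> g t - g s \<le> p s * (t - s)"
  shows "continuous_on {a..b} g"
proof (rule lipschitz_on_continuous_on[of "\<bar>p a\<bar> + \<bar>p b\<bar>"], rule lipschitz_onI)
  fix s t assume st: "s \<in> {a..b}" "t \<in> {a..b}"
  show "dist (g s) (g t) \<le> (\<bar>p a\<bar> + \<bar>p b\<bar>) * dist s t"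
    using slope_selection_lipschitz[of a b p g s t, OF sl] slope_selection_lipschitz[of a b p g t s, OF sl] st
    by (cases "s \<le> t") (auto simp: dist_real_def abs_minus_commute)
qed simp

text \<open>Integration by parts against \<open>J t = t\<^sup>2 / 2 - m * t\<close>, which vanishes
  at 0 and has derivative \<open>t - m\<close>, for a function \<open>w\<close> of which only the
  selected slopes \<open>- v\<close> are known.\<close>

lemma weighted_slope_integral:
  fixes w v :: "real \<Rightarrow> real"
  assumes b: "0 < b" and m: "0 \<le> m" "m \<le> b"
    and sl: "\<And>s t. 0 \<le> s \<Longrightarrow> s < t \<Longrightarrow> t \<le> b \<Longrightarrow> - v t * (t - s) \<le> w t - w s \<and> w t - w s \<le> - v s * (t - s)"
  shows "integral {0..b} (\<lambda>t. v t * (t\<^sup>2 / 2 - m * t)) + w b * (b\<^sup>2 / 2 - m * b) = integral {0..b} (\<lambda>t. (t - m) * w t)"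
proof -
  define J where "J t = t\<^sup>2 / 2 - m * t" for t :: real
  define V where "V = \<bar>- v 0\<bar> + \<bar>- v b\<bar>"
  have V: "0 \<le> V" by (simp add: V_def)
  have vm: "v s \<le> v t" if "0 \<le> s" "s \<le> t" "t \<le> b" for s t
    using slope_selection_mono[of 0 b "\<lambda>t. - v t" w s t, OF sl] that by simp
  have vV: "\<bar>v t\<bar> \<le> V" if "0 \<le> t" "t \<le> b" for t
    using vm[of 0 t] vm[of t b] that by (auto simp: V_def)
  have wl: "\<bar>w t - w s\<bar> \<le> V * (t - s)" if "0 \<le> s" "s \<le> t" "t \<le> b" for s t
    unfolding V_def using slope_selection_lipschitz[of 0 b "\<lambda>t. - v t" w s t, OF sl] that by simp
  have wc: "continuous_on {0..b} w" using slope_selection_continuous[of 0 b "\<lambda>t. - v t" w, OF sl] by simp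
  have v_mono: "mono_on {0..b} v" using vm by (auto intro: mono_onI)
  define W where "W = \<bar>w 0\<bar> + V * b"
  have wW: "\<bar>w t\<bar> \<le> W" if "0 \<le> t" "t \<le> b" for t
  proof -
    have "V * t \<le> V * b" using V that by (intro mult_left_mono) auto
    then show ?thesis using wl[of 0 t] that by (auto simp: W_def)
  qed
  have Jl: "\<bar>J y - J t\<bar> \<le> b * (y - t)" if "0 \<le> t" "t \<le> y" "y \<le> b" for y t
  proof -
    have "J y - J t = ((y + t) / 2 - m) * (y - t)" by (simp add: J_def field_simps power2_eq_square)
    moreover have "\<bar>(y + t) / 2 - m\<bar> \<le> b"
    proof (rule abs_leI)
      have "y + t \<le> 2 * b + 2 * m" using that m by linarith
      then show "(y + t) / 2 - m \<le> b" by (simp add: field_simps)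
      have "2 * m \<le> 2 * b + (y + t)" using that m by linarith
      then show "- ((y + t) / 2 - m) \<le> b" by (simp add: field_simps)
    qed
    then have "\<bar>((y + t) / 2 - m) * (y - t)\<bar> \<le> b * (y - t)"
      unfolding abs_mult using that by (intro mult_mono) auto
    ultimately show ?thesis by simp
  qed
  have Jb: "\<bar>J y\<bar> \<le> b * b" if "0 \<le> y" "y \<le> b" for y
  proof -
    have "b * (y - 0) \<le> b * b" using that b by (intro mult_left_mono) auto
    then show ?thesis using Jl[of 0 y] that by (simp add: J_def)
  qed
  define F where "F t = (t - m) * w t - v t * J t" for t
  have cJ: "continuous_on {0..b} J" unfolding J_def by (intro continuous_intros) auto
  have i1: "(\<lambda>t. (t - m) * w t) integrable_on {0..b}"
    by (intro integrable_continuous_interval continuous_intros wc)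
  have i2: "(\<lambda>t. v t * J t) integrable_on {0..b}"
    using b by (intro integrable_on_mono_mult v_mono cJ) auto
  have iF: "F integrable_on {0..b}" unfolding F_def by (intro integrable_diff i1 i2)
  have iF': "F integrable_on {x..y}" if "0 \<le> x" "y \<le> b" for x y
    by (rule integrable_on_subinterval[OF iF]) (use that in auto)
  define \<Delta> where "\<Delta> x y = J y * w y - J x * w x - integral {x..y} F" for x y
  define C where "C = 2 * V * b + W + b * V"
  have C: "0 \<le> C" using V b wW[of 0] by (auto simp: C_def)
  have "\<Delta> 0 b = 0"
  proof (rule additive_increments_zero[of 0 b \<Delta> "\<lambda>t. C * t + b * b * v t"])
    show "0 \<le> b" using b by simp
    show "\<Delta> x z = \<Delta> x y + \<Delta> y z" if "0 \<le> x" "x \<le> y" "y \<le> z" "z \<le> b" for x y z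
      using Henstock_Kurzweil_Integration.integral_combine[OF that(2,3) iF'[OF that(1,4)]] by (simp add: \<Delta>_def)
    fix x y assume xy: "0 \<le> x" "x < y" "y \<le> b"
    define \<sigma> where "\<sigma> = (w y - w x) / (y - x)"
    have \<sigma>: "- v y \<le> \<sigma>" "\<sigma> \<le> - v x" "w y - w x = \<sigma> * (y - x)"
      using sl[OF xy] xy(2) by (auto simp: \<sigma>_def pos_le_divide_eq pos_divide_le_eq)
    \<comment> \<open>The increment of \<open>J * w\<close> over \<open>{x..y}\<close> is the
      integral of a constant; \<open>G\<close> subtracts \<open>F\<close> from that constant, and
      its size is controlled by the interval length and the increment of \<open>v\<close>, which
      together form the \<open>\<rho>\<close> above.\<close>
    define G where "G t = J y * \<sigma> + ((y + x) / 2 - m) * w x - F t" for t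
    have "(G has_integral ((J y * \<sigma> + ((y + x) / 2 - m) * w x) * (y - x) - integral {x..y} F)) {x..y}"
    proof -
      have "((\<lambda>t. J y * \<sigma> + ((y + x) / 2 - m) * w x) has_integral (y - x) *\<^sub>R (J y * \<sigma> + ((y + x) / 2 - m) * w x)) {x..y}"
        using has_integral_const_real[of "J y * \<sigma> + ((y + x) / 2 - m) * w x" x y] xy by simp
      from has_integral_diff[OF this integrable_integral[OF iF'[OF xy(1,3)]]]
      show ?thesis unfolding G_def by (simp add: mult.commute)
    qed
    moreover have "(J y * \<sigma> + ((y + x) / 2 - m) * w x) * (y - x) = J y * w y - J x * w x"
    proof -
      have "(J y * \<sigma> + ((y + x) / 2 - m) * w x) * (y - x)
          = J y * (\<sigma> * (y - x)) + (((y + x) / 2 - m) * (y - x)) * w x" by (simp add: algebra_simps)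
      also have "((y + x) / 2 - m) * (y - x) = J y - J x" by (simp add: J_def field_simps power2_eq_square)
      also have "\<sigma> * (y - x) = w y - w x" using \<sigma>(3) by simp
      finally show ?thesis by (simp add: algebra_simps)
    qed
    ultimately have G: "(G has_integral \<Delta> x y) {x..y}" by (simp add: \<Delta>_def)
    have bd: "norm (G t) \<le> C * (y - x) + b * b * (v y - v x)" if "t \<in> {x..y}" for t
    proof -
      have t: "x \<le> t" "t \<le> y" using that by auto
      have e: "G t = J y * (\<sigma> + v t) - v t * (J y - J t) + ((x - t) / 2 + (y - t) / 2) * w x + (t - m) * (w x - w t)"
        by (simp add: G_def F_def field_simps)
      have "\<bar>J y * (\<sigma> + v t)\<bar> \<le> b * b * (v y - v x)"
        unfolding abs_mult using Jb[of y] \<sigma>(1,2) vm[of x t] vm[of t y] t xy by (intro mult_mono) (auto simp: abs_le_iff)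
      moreover have "\<bar>v t * (J y - J t)\<bar> \<le> V * (b * (y - x))"
      proof -
        have "\<bar>v t * (J y - J t)\<bar> \<le> V * (b * (y - t))"
          unfolding abs_mult using vV[of t] Jl[of t y] t xy V by (intro mult_mono) auto
        also have "\<dots> \<le> V * (b * (y - x))" using V b t by (intro mult_left_mono) auto
        finally show ?thesis .
      qed
      moreover have "\<bar>((x - t) / 2 + (y - t) / 2) * w x\<bar> \<le> (y - x) * W"
        unfolding abs_mult using wW[of x] t xy by (intro mult_mono) (auto simp: abs_le_iff field_simps)
      moreover have "\<bar>(t - m) * (w x - w t)\<bar> \<le> b * (V * (y - x))"
      proof -
        have "\<bar>(t - m) * (w x - w t)\<bar> \<le> b * (V * (t - x))"
          unfolding abs_mult using wl[of x t] t xy m b by (intro mult_mono) (auto simp: abs_minus_commute)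
        also have "\<dots> \<le> b * (V * (y - x))" using V b t by (intro mult_left_mono) auto
        finally show ?thesis .
      qed
      moreover have "0 \<le> V * (b * (y - x))" using V b xy by simp
      moreover have "C * (y - x) = 2 * (V * (b * (y - x))) + (y - x) * W + b * (V * (y - x))"
        by (simp add: C_def algebra_simps)
      ultimately show ?thesis unfolding e real_norm_def by arith
    qed
    have "norm (\<Delta> x y) \<le> (C * (y - x) + b * b * (v y - v x)) * measure lborel {x..y}"
      by (rule has_integral_bound_real[OF _ _ G]) (use bd C xy b vm[of x y] in \<open>auto intro!: add_nonneg_nonneg mult_nonneg_nonneg\<close>)
    then show "\<bar>\<Delta> x y\<bar> \<le> (y - x) * (C * y + b * b * v y - (C * x + b * b * v x))"
      using xy by (simp add: algebra_simps)
  qed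
  moreover have "integral {0..b} F = integral {0..b} (\<lambda>t. (t - m) * w t) - integral {0..b} (\<lambda>t. v t * J t)"
    unfolding F_def by (rule integral_diff[OF i1 i2])
  ultimately show ?thesis unfolding \<Delta>_def J_def by (simp add: mult.commute)
qed

text \<open>Length and integral are both additive, and on each piece both are within
  \<open>(y - x) * (p x - p y)\<close> of \<open>(y - x) * arc_speed (p x)\<close>.\<close>

lemma graph_length_integral:
  fixes u u' :: "'a::euclidean_space" and g :: "real \<Rightarrow> real"
  assumes u: "norm u = 1" "norm u' = 1" "u \<bullet> u' = 0"
    and sl: "\<And>s t. a \<le> s \<Longrightarrow> s < t \<Longrightarrow> t \<le> b \<Longrightarrow> p t * (t - s) \<le> g t - g s \<and> g t - g s \<le> p s * (t - s)"
    and ab: "a \<le> b"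
  shows "measure (hausdorff_measure 1) ((\<lambda>t. t *\<^sub>R u + g t *\<^sub>R u') ` {a<..b}) = integral {a..b} (\<lambda>t. arc_speed (p t))"
    "(\<lambda>t. t *\<^sub>R u + g t *\<^sub>R u') ` {a<..b} \<in> sets borel"
proof -
  let ?H = "hausdorff_measure 1 :: 'a measure"
  define c where "c t = t *\<^sub>R u + g t *\<^sub>R u'" for t
  have pm: "p t \<le> p s" if "a \<le> s" "s \<le> t" "t \<le> b" for s t
    by (rule slope_selection_mono[OF sl that])
  have "mono_on {a..b} (\<lambda>t. - p t)" using pm by (auto intro!: mono_onI)
  from arc_speed_mono_integrable[OF ab this, of "\<lambda>_. 1"]
  have i: "(\<lambda>t. arc_speed (p t)) integrable_on {a..b}" by (simp add: arc_speed_uminus)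
  have i': "(\<lambda>t. arc_speed (p t)) integrable_on {x..y}" if "a \<le> x" "y \<le> b" for x y
    by (rule integrable_on_subinterval[OF i]) (use that in auto)
  have gl: "c ` {x<..y} \<in> sets borel" "emeasure ?H (c ` {x<..y}) < \<top>"
      "\<bar>measure ?H (c ` {x<..y}) - (y - x) * arc_speed (p x)\<bar> \<le> (y - x) * (p x - p y)"
    if xy: "a \<le> x" "x < y" "y \<le> b" for x y
  proof -
    have s: "p y * (t - s) \<le> g t - g s \<and> g t - g s \<le> p x * (t - s)" if "x \<le> s" "s < t" "t \<le> y" for s t
    proof -
      have "p y * (t - s) \<le> p t * (t - s)" "p s * (t - s) \<le> p x * (t - s)"
        using pm[of t y] pm[of x s] xy that by (auto intro!: mult_right_mono)
      moreover have "p t * (t - s) \<le> g t - g s" "g t - g s \<le> p s * (t - s)" using sl[of s t] that xy by auto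
      ultimately show ?thesis by linarith
    qed
    show "c ` {x<..y} \<in> sets borel" "emeasure ?H (c ` {x<..y}) < \<top>"
      "\<bar>measure ?H (c ` {x<..y}) - (y - x) * arc_speed (p x)\<bar> \<le> (y - x) * (p x - p y)"
      unfolding c_def using graph_length[OF u xy(2) s] pm[of x y] xy by auto
  qed
  show "(\<lambda>t. t *\<^sub>R u + g t *\<^sub>R u') ` {a<..b} \<in> sets borel"
    using gl(1)[of a b] by (cases "a < b") (auto simp: c_def)
  have inj: "inj c"
  proof (rule injI)
    fix s t assume "c s = c t"
    then have "c s \<bullet> u = c t \<bullet> u" by simp
    then show "s = t" using u by (simp add: c_def inner_add_left inner_add_right dot_square_norm inner_commute)
  qed
  define \<Delta> where "\<Delta> x y = measure ?H (c ` {x<..y}) - integral {x..y} (\<lambda>t. arc_speed (p t))" for x y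
  have "\<Delta> a b = 0"
  proof (rule additive_increments_zero[OF ab, of \<Delta> "\<lambda>t. - 2 * p t"])
    show "\<Delta> x z = \<Delta> x y + \<Delta> y z" if xyz: "a \<le> x" "x \<le> y" "y \<le> z" "z \<le> b" for x y z
    proof (cases "x = y \<or> y = z")
      case True then show ?thesis by (auto simp: \<Delta>_def)
    next
      case False
      then have lt: "x < y" "y < z" using xyz by auto
      have "{x<..z} = {x<..y} \<union> {y<..z}" using lt by auto
      then have "c ` {x<..z} = c ` {x<..y} \<union> c ` {y<..z}" by (simp only: image_Un)
      moreover have "c ` {x<..y} \<inter> c ` {y<..z} = {}" using inj by (auto dest: injD)
      moreover note gl(1,2)[of x y] gl(1,2)[of y z]
      ultimately have "measure ?H (c ` {x<..z}) = measure ?H (c ` {x<..y}) + measure ?H (c ` {y<..z})"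
        using lt xyz by (simp, intro measure_Union) auto
      moreover have "integral {x..y} (\<lambda>t. arc_speed (p t)) + integral {y..z} (\<lambda>t. arc_speed (p t)) = integral {x..z} (\<lambda>t. arc_speed (p t))"
        by (rule Henstock_Kurzweil_Integration.integral_combine[OF xyz(2,3) i'[OF xyz(1,4)]])
      ultimately show ?thesis by (simp add: \<Delta>_def)
    qed
    fix x y assume xy: "a \<le> x" "x < y" "y \<le> b"
    have "((\<lambda>t. arc_speed (p t) - arc_speed (p x)) has_integral
        (integral {x..y} (\<lambda>t. arc_speed (p t)) - (y - x) *\<^sub>R arc_speed (p x))) {x..y}"
      using has_integral_diff[OF integrable_integral[OF i'[OF xy(1,3)]] has_integral_const_real[of "arc_speed (p x)" x y]] xy
      by simp
    moreover have "norm (arc_speed (p t) - arc_speed (p x)) \<le> p x - p y" if "t \<in> {x..y}" for t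
      using arc_speed_lipschitz[of "p t" "p x"] pm[of x t] pm[of t y] that xy by auto
    ultimately have "norm (integral {x..y} (\<lambda>t. arc_speed (p t)) - (y - x) *\<^sub>R arc_speed (p x)) \<le> (p x - p y) * measure lborel {x..y}"
      using pm[of x y] xy by (intro has_integral_bound_real) auto
    moreover have "measure lborel {x..y} = y - x" using xy by simp
    ultimately have A: "\<bar>integral {x..y} (\<lambda>t. arc_speed (p t)) - (y - x) * arc_speed (p x)\<bar> \<le> (y - x) * (p x - p y)"
      by (simp add: mult.commute)
    have "(y - x) * (- 2 * p y - - 2 * p x) = 2 * ((y - x) * (p x - p y))" by (simp add: algebra_simps)
    then show "\<bar>\<Delta> x y\<bar> \<le> (y - x) * (- 2 * p y - - 2 * p x)"
      using gl(3)[OF xy] A unfolding \<Delta>_def by linarith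
  qed
  then show "measure ?H ((\<lambda>t. t *\<^sub>R u + g t *\<^sub>R u') ` {a<..b}) = integral {a..b} (\<lambda>t. arc_speed (p t))"
    by (simp add: \<Delta>_def c_def)
qed

lemma concave_three_slopes:
  fixes g :: "real \<Rightarrow> real"
  assumes g: "concave_on S g" and S: "x \<in> S" "z \<in> S" and xyz: "x < y" "y < z"
  shows "(g z - g y) / (z - y) \<le> (g y - g x) / (y - x)" "(g z - g x) / (z - x) \<le> (g y - g x) / (y - x)"
proof -
  have cvx: "convex_on S (\<lambda>x. - g x)" using g by (simp add: concave_on_def)
  define l where "l = (y - x) / (z - x)"
  have l: "0 \<le> l" "l \<le> 1" using xyz by (auto simp: l_def)
  have lz: "l * (z - x) = y - x" using xyz by (simp add: l_def)
  have ey: "y = (1 - l) * x + l * z" using lz by (simp add: algebra_simps)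
  have "- g ((1 - l) *\<^sub>R x + l *\<^sub>R z) \<le> (1 - l) * - g x + l * - g z"
    using convex_onD[OF cvx l, of x z] S by auto
  then have "(1 - l) * g x + l * g z \<le> g y" using ey by simp
  then have "((1 - l) * g x + l * g z) * (z - x) \<le> g y * (z - x)" using xyz by (intro mult_right_mono) auto
  moreover have "((1 - l) * g x + l * g z) * (z - x) = (z - x) * g x + (l * (z - x)) * (g z - g x)"
    by (simp add: algebra_simps)
  ultimately have "(z - x) * g x + (y - x) * (g z - g x) \<le> g y * (z - x)" by (simp only: lz)
  then have *: "(y - x) * (g z - g x) \<le> (g y - g x) * (z - x)" by (simp add: algebra_simps)
  then show "(g z - g x) / (z - x) \<le> (g y - g x) / (y - x)"
    using xyz by (simp add: divide_le_eq pos_le_divide_eq mult.commute)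
  have "(y - x) * (g z - g y) \<le> (g y - g x) * (z - y)" using * by (simp add: algebra_simps)
  then show "(g z - g y) / (z - y) \<le> (g y - g x) / (y - x)"
    using xyz by (simp add: divide_le_eq pos_le_divide_eq mult.commute)
qed

text \<open>\<open>P\<close> is the right derivative, a supremum because chord slopes from
  \<open>x\<close> decrease to the right. It needs a chord to the left of \<open>x\<close> for
  boundedness and a point to the right for nonemptiness, whence the strict inequalities at the
  ends.\<close>

lemma concave_slopes:
  fixes g :: "real \<Rightarrow> real"
  assumes g: "concave_on {\<alpha>..\<beta>} g"
  defines "P \<equiv> \<lambda>x. SUP y\<in>{x<..\<beta>}. (g y - g x) / (y - x)"
  shows "\<alpha> < s \<Longrightarrow> s < t \<Longrightarrow> t \<le> \<beta> \<Longrightarrow> g t - g s \<le> P s * (t - s)"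
    "\<alpha> \<le> s \<Longrightarrow> s < t \<Longrightarrow> t < \<beta> \<Longrightarrow> P t * (t - s) \<le> g t - g s"
proof -
  note three = concave_three_slopes(1)[OF g]
  show "g t - g s \<le> P s * (t - s)" if "\<alpha> < s" "s < t" "t \<le> \<beta>"
  proof -
    have "bdd_above ((\<lambda>y. (g y - g s) / (y - s)) ` {s<..\<beta>})"
      using three[of \<alpha> _ s] that by (intro bdd_aboveI2[of _ _ "(g s - g \<alpha>) / (s - \<alpha>)"]) auto
    then have "(g t - g s) / (t - s) \<le> P s" unfolding P_def using that by (intro cSUP_upper) auto
    then show ?thesis using that by (simp add: pos_divide_le_eq)
  qed
  show "P t * (t - s) \<le> g t - g s" if "\<alpha> \<le> s" "s < t" "t < \<beta>"
  proof -
    have "P t \<le> (g t - g s) / (t - s)" unfolding P_def using that three[of s _ t] by (intro cSUP_least) auto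
    then show ?thesis using that by (simp add: pos_le_divide_eq)
  qed
qed

section \<open>Planar convex bodies\<close>

text \<open>The orthonormal frame is a parameter because the comparison has to be carried out in
  every direction \<open>u\<close> and, within one proof, also in the reversed direction.\<close>

locale planar_body =
  fixes K :: "'a::euclidean_space set" and u u' :: 'a
  assumes dim: "DIM('a) = 2" and body: "convex_body K"
    and unit: "norm u = 1" "norm u' = 1" "u \<bullet> u' = 0"
    and surf: "emeasure surface_measure (frontier K) < \<top>"
begin

lemma cK: "compact K" "convex K" "interior K \<noteq> {}" "closed K" "K \<noteq> {}"
  using body compact_imp_closed interior_subset by (auto simp: convex_body_def)

lemma uu: "u \<bullet> u = 1" "u' \<bullet> u' = 1" "u' \<bullet> u = 0"
  using unit by (simp_all add: dot_square_norm inner_commute)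

definition pt :: "real \<Rightarrow> real \<Rightarrow> 'a" where "pt x y = x *\<^sub>R u + y *\<^sub>R u'"

lemma pt_inner [simp]: "pt x y \<bullet> u = x" "pt x y \<bullet> u' = y"
  using uu unit by (simp_all add: pt_def inner_add_left)

lemma pt_coords: "pt (z \<bullet> u) (z \<bullet> u') = z"
proof -
  define w where "w = z - (z \<bullet> u) *\<^sub>R u"
  have "u \<bullet> w = 0" by (simp add: w_def inner_diff_right uu inner_commute)
  then have "w = ((w \<bullet> u') / (u' \<bullet> u')) *\<^sub>R u'"
    using planar_orthogonal_eq[OF dim, of u u' w] uu unit by (metis inner_zero_left zero_neq_one)
  moreover have "w \<bullet> u' = z \<bullet> u'" by (simp add: w_def inner_diff_left unit)
  ultimately have "w = (z \<bullet> u') *\<^sub>R u'" by (simp only: uu div_by_1)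
  then show ?thesis by (simp add: pt_def w_def algebra_simps)
qed

lemma pt_convex:
  assumes "pt x a \<in> K" "pt y b \<in> K" "0 \<le> s" "0 \<le> t" "s + t = 1"
  shows "pt (s * x + t * y) (s * a + t * b) \<in> K"
proof -
  have "s *\<^sub>R pt x a + t *\<^sub>R pt y b \<in> K" using convexD[OF cK(2)] assms by blast
  moreover have "s *\<^sub>R pt x a + t *\<^sub>R pt y b = pt (s * x + t * y) (s * a + t * b)"
    by (simp add: pt_def algebra_simps)
  ultimately show ?thesis by simp
qed

definition left :: real where "left = Inf ((\<lambda>z. z \<bullet> u) ` K)"
definition right :: real where "right = Sup ((\<lambda>z. z \<bullet> u) ` K)"
definition upper :: "real \<Rightarrow> real" where "upper x = Sup {y. pt x y \<in> K}"
definition lower :: "real \<Rightarrow> real" where "lower x = Inf {y. pt x y \<in> K}"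
definition width :: "real \<Rightarrow> real" where "width x = upper x - lower x"

lemma shadow: "(\<lambda>z. z \<bullet> u) ` K = {left..right}"
proof -
  have "compact ((\<lambda>z. z \<bullet> u) ` K)" by (intro compact_continuous_image continuous_intros cK)
  moreover have "connected ((\<lambda>z. z \<bullet> u) ` K)"
    by (intro connected_continuous_image continuous_intros convex_connected cK)
  ultimately obtain a b where ab: "(\<lambda>z. z \<bullet> u) ` K = {a..b}" using connected_compact_interval_1 by metis
  moreover have "a \<le> b" using ab cK(5) by (metis atLeastatMost_empty_iff image_is_empty)
  ultimately show ?thesis by (simp add: left_def right_def)
qed

lemma slice:
  assumes "x \<in> {left..right}"
  shows "{y. pt x y \<in> K} = {lower x..upper x}" "lower x \<le> upper x"
proof -
  have e: "{y. pt x y \<in> K} = (\<lambda>z. z \<bullet> u') ` (K \<inter> {z. z \<bullet> u = x})"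
    by (auto simp: image_iff intro!: bexI[of _ "pt x _"]) (metis pt_coords)
  have cl: "closed {z. z \<bullet> u = x}" using closed_hyperplane[of u x] by (simp add: inner_commute)
  have cv: "convex {z. z \<bullet> u = x}" using convex_hyperplane[of u x] by (simp add: inner_commute)
  have "compact {y. pt x y \<in> K}"
    unfolding e by (intro compact_continuous_image continuous_intros compact_Int_closed cK cl)
  moreover have "connected {y. pt x y \<in> K}"
    unfolding e by (intro connected_continuous_image continuous_intros convex_connected convex_Int cK cv)
  ultimately obtain a b where ab: "{y. pt x y \<in> K} = {a..b}" using connected_compact_interval_1 by metis
  obtain z where "z \<in> K" "x = z \<bullet> u" using assms shadow by blast
  then have "z \<bullet> u' \<in> {y. pt x y \<in> K}" using pt_coords[of z] by simp
  then have "a \<le> b" using ab by auto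
  then show "{y. pt x y \<in> K} = {lower x..upper x}" "lower x \<le> upper x"
    unfolding lower_def upper_def ab by simp_all
qed

lemma pt_in_iff: "pt x y \<in> K \<longleftrightarrow> x \<in> {left..right} \<and> y \<in> {lower x..upper x}"
proof -
  have "x \<in> {left..right}" if "pt x y \<in> K" using imageI[OF that, of "\<lambda>z. z \<bullet> u"] shadow by simp
  then show ?thesis using slice(1)[of x] by blast
qed

lemma in_iff: "z \<in> K \<longleftrightarrow> z \<bullet> u \<in> {left..right} \<and> z \<bullet> u' \<in> {lower (z \<bullet> u)..upper (z \<bullet> u)}"
  using pt_in_iff[of "z \<bullet> u" "z \<bullet> u'"] by (simp add: pt_coords)

lemma upper_concave: "concave_on {left..right} upper"
  unfolding concave_on_iff
proof (intro conjI ballI allI impI)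
  fix x y s t :: real assume xy: "x \<in> {left..right}" "y \<in> {left..right}" and st: "0 \<le> s" "0 \<le> t" "s + t = 1"
  have "pt (s * x + t * y) (s * upper x + t * upper y) \<in> K"
    by (rule pt_convex) (use st xy slice(2) in \<open>auto simp: pt_in_iff\<close>)
  then show "s * upper x + t * upper y \<le> upper (s *\<^sub>R x + t *\<^sub>R y)" by (simp add: pt_in_iff)
qed simp

lemma uminus_lower_concave: "concave_on {left..right} (\<lambda>x. - lower x)"
  unfolding concave_on_iff
proof (intro conjI ballI allI impI)
  fix x y s t :: real assume xy: "x \<in> {left..right}" "y \<in> {left..right}" and st: "0 \<le> s" "0 \<le> t" "s + t = 1"
  have "pt (s * x + t * y) (s * lower x + t * lower y) \<in> K"
    by (rule pt_convex) (use st xy slice(2) in \<open>auto simp: pt_in_iff\<close>)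
  then show "s * - lower x + t * - lower y \<le> - lower (s *\<^sub>R x + t *\<^sub>R y)" by (simp add: pt_in_iff)
qed simp

lemma width_concave: "concave_on {left..right} width"
  unfolding concave_on_iff
proof (intro conjI ballI allI impI)
  fix x y s t :: real assume xy: "x \<in> {left..right}" "y \<in> {left..right}" and st: "0 \<le> s" "0 \<le> t" "s + t = 1"
  have "s * upper x + t * upper y \<le> upper (s *\<^sub>R x + t *\<^sub>R y)"
    "s * - lower x + t * - lower y \<le> - lower (s *\<^sub>R x + t *\<^sub>R y)"
    using upper_concave uminus_lower_concave xy st unfolding concave_on_iff by blast+
  then show "s * width x + t * width y \<le> width (s *\<^sub>R x + t *\<^sub>R y)"
    unfolding width_def right_diff_distrib by linarith
qed simp

lemma width_nonneg: "x \<in> {left..right} \<Longrightarrow> 0 \<le> width x"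
  using slice(2) by (simp add: width_def)

text \<open>A ball in \<open>K\<close> gives positive width at the abscissa \<open>x0\<close> of its
  centre. Every abscissa strictly inside the shadow is a mixture of \<open>x0\<close>, with positive
  weight, and an end, so concavity carries positivity over.\<close>

lemma left_less_right: "left < right" and width_pos: "\<lbrakk>left < x; x < right\<rbrakk> \<Longrightarrow> 0 < width x"
proof -
  obtain z r where zr: "0 < r" "cball z r \<subseteq> K" using cK(3) mem_interior_cball by blast
  define x0 y0 where "x0 = z \<bullet> u" and "y0 = z \<bullet> u'"
  have z: "z = pt x0 y0" by (simp add: x0_def y0_def pt_coords)
  have "pt (x0 + s) y0 \<in> K" "pt x0 (y0 + s) \<in> K" if "\<bar>s\<bar> \<le> r" for s
  proof -
    have "dist z (pt (x0 + s) y0) = \<bar>s\<bar>" "dist z (pt x0 (y0 + s)) = \<bar>s\<bar>"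
      by (simp_all add: z dist_norm pt_def algebra_simps unit)
    then show "pt (x0 + s) y0 \<in> K" "pt x0 (y0 + s) \<in> K" using zr(2) that by auto
  qed
  from this[of r] this[of "- r"] have x0: "left \<le> x0 - r" "x0 + r \<le> right" "lower x0 \<le> y0 - r" "y0 + r \<le> upper x0"
    using zr(1) by (auto simp: pt_in_iff)
  then show "left < right" using zr(1) by simp
  have w0: "0 < width x0" using x0 zr(1) by (simp add: width_def)
  assume x: "left < x" "x < right"
  have "\<exists>y\<in>{left..right}. \<exists>s t. 0 < s \<and> 0 \<le> t \<and> s + t = 1 \<and> s * x0 + t * y = x"
  proof (cases "x < x0")
    case True
    define s where "s = (x - left) / (x0 - left)"
    have "0 < s" "s \<le> 1" using True x by (auto simp: s_def)
    moreover have "s * (x0 - left) = x - left" using True x by (simp add: s_def)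
    then have "s * x0 + (1 - s) * left = x" by (simp add: algebra_simps)
    ultimately show ?thesis using left_def x by (intro bexI[of _ left] exI[of _ s] exI[of _ "1 - s"]) auto
  next
    case False
    define s where "s = (right - x) / (right - x0)"
    have "0 < s" "s \<le> 1" using False x by (auto simp: s_def)
    moreover have "s * (right - x0) = right - x" using False x by (simp add: s_def)
    then have "s * x0 + (1 - s) * right = x" by (simp add: algebra_simps)
    ultimately show ?thesis using x by (intro bexI[of _ right] exI[of _ s] exI[of _ "1 - s"]) auto
  qed
  then obtain y s t where y: "y \<in> {left..right}" and st: "0 < s" "0 \<le> t" "s + t = 1" and e: "s * x0 + t * y = x" by blast
  have "s * width x0 + t * width y \<le> width x"
    using width_concave y st x0 zr(1) e unfolding concave_on_iff by (auto simp: less_imp_le)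
  moreover have "0 < s * width x0" using st w0 by simp
  moreover have "0 \<le> t * width y" using st width_nonneg[OF y] by simp
  ultimately show "0 < width x" by linarith
qed

text \<open>At a frontier point strictly between the two graphs a supporting functional would vanish
  on \<open>u'\<close>, since \<open>K\<close> extends both up and down, and then on
  \<open>u\<close>, since \<open>K\<close> extends both left and right.\<close>

lemma frontier_iff:
  assumes x: "left < z \<bullet> u" "z \<bullet> u < right"
  shows "z \<in> frontier K \<longleftrightarrow> z \<bullet> u' = upper (z \<bullet> u) \<or> z \<bullet> u' = lower (z \<bullet> u)"
proof -
  define x y where "x = z \<bullet> u" and "y = z \<bullet> u'"
  have z: "z = pt x y" by (simp add: x_def y_def pt_coords)
  have fK: "frontier K = K - interior K" using cK(4) by (simp add: frontier_def)
  have xin: "x \<in> {left..right}" using x by (simp add: x_def)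
  note sl = slice(2)[OF xin]
  show ?thesis unfolding x_def[symmetric] y_def[symmetric]
  proof
    assume zf: "z \<in> frontier K"
    then have zK: "z \<in> K" and "z \<notin> rel_interior K" using fK rel_interior_nonempty_interior[OF cK(3)] by auto
    then obtain n where n: "n \<noteq> 0" "\<And>k. k \<in> K \<Longrightarrow> n \<bullet> z \<le> n \<bullet> k"
      using supporting_hyperplane_rel_boundary[OF cK(2)] by blast
    have np: "n \<bullet> u * x + n \<bullet> u' * y \<le> n \<bullet> u * x' + n \<bullet> u' * y'" if "pt x' y' \<in> K" for x' y'
      using n(2)[OF that] by (simp add: z pt_def inner_add_right mult.commute)
    show "y = upper x \<or> y = lower x"
    proof (rule ccontr)
      assume "\<not> ?thesis"
      then have y: "lower x < y" "y < upper x" using zK z pt_in_iff[of x y] by auto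
      have "pt x (upper x) \<in> K" "pt x (lower x) \<in> K" using xin sl by (auto simp: pt_in_iff)
      from np[OF this(1)] np[OF this(2)] have "0 \<le> n \<bullet> u' * (upper x - y)" "n \<bullet> u' * (y - lower x) \<le> 0"
        by (simp_all add: right_diff_distrib)
      then have n': "n \<bullet> u' = 0" using y by (auto simp: zero_le_mult_iff mult_le_0_iff)
      have "pt left (lower left) \<in> K" "pt right (lower right) \<in> K"
        using slice(2)[of left] slice(2)[of right] left_less_right by (auto simp: pt_in_iff)
      from np[OF this(1)] np[OF this(2)] have "0 \<le> n \<bullet> u * (right - x)" "n \<bullet> u * (x - left) \<le> 0"
        by (simp_all add: n' right_diff_distrib)
      then have "n \<bullet> u = 0" using x by (auto simp: zero_le_mult_iff mult_le_0_iff x_def)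
      then have "n = 0" using n' pt_coords[of n] by (simp add: pt_def)
      then show False using n(1) by simp
    qed
  next
    assume y: "y = upper x \<or> y = lower x"
    have zK: "z \<in> K" using y xin sl by (auto simp: z pt_in_iff)
    have "z \<notin> interior K"
    proof
      assume "z \<in> interior K"
      then obtain r where r: "0 < r" "cball z r \<subseteq> K" using mem_interior_cball by blast
      have "dist z (pt x (y + r)) = r" "dist z (pt x (y - r)) = r" using r(1)
        by (simp_all add: z dist_norm pt_def algebra_simps unit)
      then have "pt x (y + r) \<in> K" "pt x (y - r) \<in> K" using r by auto
      then show False using y r(1) by (auto simp: pt_in_iff)
    qed
    then show "z \<in> frontier K" using zK fK by simp
  qed
qed

section \<open>Slopes and length of the boundary arcs\<close>

definition upper_slope :: "real \<Rightarrow> real" where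
  "upper_slope x = (SUP y\<in>{x<..right}. (upper y - upper x) / (y - x))"

text \<open>The right derivative of the convex function \<open>lower\<close>, expressed through the
  concave function \<open>- lower\<close> so that \<open>concave_slopes\<close> covers both
  arcs.\<close>

definition lower_slope :: "real \<Rightarrow> real" where
  "lower_slope x = - (SUP y\<in>{x<..right}. (- lower y - - lower x) / (y - x))"

definition speed :: "real \<Rightarrow> real" where
  "speed x = arc_speed (upper_slope x) + arc_speed (lower_slope x)"

lemma upper_slope:
  assumes "left < s" "s < t" "t < right"
  shows "upper_slope t * (t - s) \<le> upper t - upper s \<and> upper t - upper s \<le> upper_slope s * (t - s)"
  using concave_slopes[OF upper_concave, of s t] assms by (simp add: upper_slope_def)

lemma lower_slope:
  assumes "left < s" "s < t" "t < right"
  shows "- lower_slope t * (t - s) \<le> - lower t - - lower s \<and> - lower t - - lower s \<le> - lower_slope s * (t - s)"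
  using concave_slopes[OF uminus_lower_concave, of s t] assms by (simp add: lower_slope_def)

lemma slope_mono:
  assumes "left < s" "s \<le> t" "t < right"
  shows "upper_slope t \<le> upper_slope s" "lower_slope s \<le> lower_slope t"
proof -
  show "upper_slope t \<le> upper_slope s"
    by (rule slope_selection_mono[of s t upper_slope upper]) (use upper_slope assms in auto)
  have "- lower_slope t \<le> - lower_slope s"
    by (rule slope_selection_mono[of s t "\<lambda>x. - lower_slope x" "\<lambda>x. - lower x"]) (use lower_slope assms in auto)
  then show "lower_slope s \<le> lower_slope t" by simp
qed

lemma speed_parts_integrable:
  assumes "left < x" "x \<le> y" "y < right" "continuous_on {x..y} h"
  shows "(\<lambda>t. h t * arc_speed (upper_slope t)) integrable_on {x..y}"
    "(\<lambda>t. h t * arc_speed (lower_slope t)) integrable_on {x..y}"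
proof -
  have "mono_on {x..y} (\<lambda>t. - upper_slope t)" using slope_mono assms by (intro mono_onI) auto
  from arc_speed_mono_integrable[OF assms(2) this assms(4)]
  show "(\<lambda>t. h t * arc_speed (upper_slope t)) integrable_on {x..y}" by (simp add: arc_speed_uminus)
  have "mono_on {x..y} lower_slope" using slope_mono assms by (intro mono_onI) auto
  from arc_speed_mono_integrable[OF assms(2) this assms(4)]
  show "(\<lambda>t. h t * arc_speed (lower_slope t)) integrable_on {x..y}" .
qed

lemma speed_integrable:
  assumes "left < x" "x \<le> y" "y < right" "continuous_on {x..y} h"
  shows "(\<lambda>t. h t * speed t) integrable_on {x..y}"
  unfolding speed_def distrib_left by (intro integrable_add speed_parts_integrable assms)

text \<open>Open on the left and closed on the right, so that adjacent strips are disjoint and a cap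
  splits into a strip and a smaller cap.\<close>

definition strip :: "real \<Rightarrow> real \<Rightarrow> 'a set" where
  "strip x y = frontier K \<inter> {z. x < z \<bullet> u \<and> z \<bullet> u \<le> y}"

definition cap :: "real \<Rightarrow> 'a set" where
  "cap x = frontier K \<inter> {z. x < z \<bullet> u}"

lemma surface_measure_eq: "(surface_measure :: 'a measure) = hausdorff_measure 1"
  by (simp add: surface_measure_def dim)

lemma sets_surface: "sets (surface_measure :: 'a measure) = sets borel"
  by (simp add: surface_measure_def)

lemma sets_strip: "strip x y \<in> sets borel" and sets_cap: "cap x \<in> sets borel"
  unfolding strip_def cap_def by (measurable; simp)+

lemma surface_finite: "A \<subseteq> frontier K \<Longrightarrow> emeasure surface_measure A < \<top>"
  by (rule le_less_trans[OF emeasure_mono surf]) (auto simp: sets_surface)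

lemma frontier_bounded: obtains C where "\<And>z. z \<in> frontier K \<Longrightarrow> \<bar>z \<bullet> u\<bar> \<le> C"
proof -
  obtain C where C: "\<And>z. z \<in> K \<Longrightarrow> norm z \<le> C"
    using compact_imp_bounded[OF cK(1)] bounded_iff by blast
  have "\<bar>z \<bullet> u\<bar> \<le> C" if "z \<in> frontier K" for z
  proof -
    have "z \<in> K" using that cK(4) frontier_subset_closed by blast
    then show ?thesis using Cauchy_Schwarz_ineq2[of z u] C[of z] unit by simp
  qed
  then show thesis by (rule that)
qed

lemma moment_integrable:
  assumes "A \<subseteq> frontier K" "A \<in> sets borel"
  shows "set_integrable surface_measure A (\<lambda>z. z \<bullet> u - c)"
proof -
  obtain C where C: "\<And>z. z \<in> frontier K \<Longrightarrow> \<bar>z \<bullet> u\<bar> \<le> C" using frontier_bounded by blast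
  show ?thesis unfolding set_integrable_def
  proof (rule integrableI_bounded_set_indicator[where B = "C + \<bar>c\<bar>"])
    show "A \<in> sets surface_measure" using assms by (simp add: sets_surface)
    have "(\<lambda>z. z \<bullet> u - c) \<in> borel_measurable borel" by measurable
    then show "(\<lambda>z. z \<bullet> u - c) \<in> borel_measurable surface_measure"
      by (simp add: measurable_cong_sets[OF sets_surface refl])
    show "emeasure surface_measure A < \<infinity>" using surface_finite[OF assms(1)] by simp
    show "AE z in surface_measure. z \<in> A \<longrightarrow> norm (z \<bullet> u - c) \<le> C + \<bar>c\<bar>"
      using C assms(1) by (intro AE_I2) (force simp: abs_le_iff)
  qed
qed

lemma strip_length:
  assumes xy: "left < x" "x \<le> y" "y < right"
  shows "measure surface_measure (strip x y) = integral {x..y} speed"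
proof -
  \<comment> \<open>The lower arc is the graph of the concave function \<open>- lower\<close> in the
    frame \<open>u\<close>, \<open>- u'\<close>, so one length formula serves both arcs. They are
    disjoint because the width is positive inside the shadow.\<close>
  define G1 G2 where "G1 = (\<lambda>t. t *\<^sub>R u + upper t *\<^sub>R u') ` {x<..y}"
    and "G2 = (\<lambda>t. t *\<^sub>R u + (- lower t) *\<^sub>R (- u')) ` {x<..y}"
  have u2: "norm (- u') = 1" "u \<bullet> (- u') = 0" using unit by auto
  have g1: "measure (hausdorff_measure 1) G1 = integral {x..y} (\<lambda>t. arc_speed (upper_slope t))" "G1 \<in> sets borel"
    unfolding G1_def by (rule graph_length_integral[OF unit, where p = upper_slope]; use upper_slope xy in auto)+
  have g2: "measure (hausdorff_measure 1) G2 = integral {x..y} (\<lambda>t. arc_speed (- lower_slope t))" "G2 \<in> sets borel"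
    unfolding G2_def
    by (rule graph_length_integral[OF unit(1) u2, where p = "\<lambda>t. - lower_slope t"]; use lower_slope xy in auto)+
  have "strip x y = G1 \<union> G2"
  proof (intro set_eqI iffI)
    fix z assume z: "z \<in> strip x y"
    then have "z \<bullet> u' = upper (z \<bullet> u) \<or> z \<bullet> u' = lower (z \<bullet> u)" "z \<bullet> u \<in> {x<..y}"
      using frontier_iff[of z] xy by (auto simp: strip_def)
    then show "z \<in> G1 \<union> G2"
      using pt_coords[of z, symmetric] unfolding pt_def G1_def G2_def by (auto intro!: rev_image_eqI)
  next
    fix z assume "z \<in> G1 \<union> G2"
    then obtain t where t: "t \<in> {x<..y}" "z = pt t (upper t) \<or> z = pt t (lower t)"
      by (auto simp: G1_def G2_def pt_def)
    then show "z \<in> strip x y" using frontier_iff[of z] xy by (auto simp: strip_def)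
  qed
  moreover have "G1 \<inter> G2 = {}"
  proof -
    have False if "s \<in> {x<..y}" "t \<in> {x<..y}" "pt s (upper s) = pt t (lower t)" for s t
    proof -
      have "s = t" "upper s = lower t" using that(3) by (metis pt_inner)+
      then show False using width_pos[of s] that xy by (auto simp: width_def)
    qed
    then show ?thesis unfolding G1_def G2_def by (fastforce simp: pt_def)
  qed
  moreover have "emeasure (hausdorff_measure 1) G1 < \<top>" "emeasure (hausdorff_measure 1) G2 < \<top>"
    using surface_finite[of G1] surface_finite[of G2] \<open>strip x y = G1 \<union> G2\<close>
    by (auto simp: surface_measure_eq strip_def)
  ultimately have "measure surface_measure (strip x y) = measure (hausdorff_measure 1) G1 + measure (hausdorff_measure 1) G2"
    using g1(2) g2(2) by (simp only: surface_measure_eq) (intro measure_Union; auto)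
  also have "\<dots> = integral {x..y} speed"
    unfolding g1 g2 speed_def arc_speed_uminus
    using speed_parts_integrable[OF xy, of "\<lambda>_. 1"] by (intro integral_add[symmetric]) auto
  finally show ?thesis .
qed

end

context planar_body
begin

section \<open>Moments of arcs and caps\<close>

lemma moment_between:
  assumes A: "A \<subseteq> frontier K" "A \<in> sets borel" and c: "\<And>z. z \<in> A \<Longrightarrow> lo \<le> z \<bullet> u - c \<and> z \<bullet> u - c \<le> hi"
  shows "lo * measure surface_measure A \<le> (LINT z:A|surface_measure. z \<bullet> u - c)"
    "(LINT z:A|surface_measure. z \<bullet> u - c) \<le> hi * measure surface_measure A"
proof -
  have s: "A \<in> sets surface_measure" "emeasure surface_measure A < \<infinity>"
    using A surface_finite by (auto simp: sets_surface)
  have k: "set_integrable surface_measure A (\<lambda>_. k)" "(LINT z:A|surface_measure. k) = k * measure surface_measure A" for k :: real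
    using s by (auto simp: set_integrable_def set_lebesgue_integral_def)
  note m = moment_integrable[OF A, of c]
  show "lo * measure surface_measure A \<le> (LINT z:A|surface_measure. z \<bullet> u - c)"
    using set_integral_mono[OF k(1)[of lo] m] c by (simp add: k(2))
  show "(LINT z:A|surface_measure. z \<bullet> u - c) \<le> hi * measure surface_measure A"
    using set_integral_mono[OF m k(1)[of hi]] c by (simp add: k(2))
qed

lemma moment_shift:
  assumes A: "A \<subseteq> frontier K" "A \<in> sets borel"
  shows "(LINT z:A|surface_measure. z \<bullet> u - d) = (LINT z:A|surface_measure. z \<bullet> u - c) + (c - d) * measure surface_measure A"
proof -
  have s: "A \<in> sets surface_measure" "emeasure surface_measure A < \<infinity>"
    using A surface_finite by (auto simp: sets_surface)
  have k: "set_integrable surface_measure A (\<lambda>_. k)" "(LINT z:A|surface_measure. k) = k * measure surface_measure A" for k :: real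
    using s by (auto simp: set_integrable_def set_lebesgue_integral_def)
  have "(LINT z:A|surface_measure. z \<bullet> u - d) = (LINT z:A|surface_measure. (z \<bullet> u - c) + (c - d))" by simp
  also have "\<dots> = (LINT z:A|surface_measure. z \<bullet> u - c) + (LINT z:A|surface_measure. c - d)"
    by (rule set_integral_add(2)[OF moment_integrable[OF A] k(1)])
  finally show ?thesis by (simp add: k(2))
qed

lemma moment_split:
  assumes A: "A \<subseteq> frontier K" "A \<in> sets borel" and B: "B \<subseteq> frontier K" "B \<in> sets borel" and "A \<inter> B = {}"
  shows "(LINT z:A \<union> B|surface_measure. z \<bullet> u - c) = (LINT z:A|surface_measure. z \<bullet> u - c) + (LINT z:B|surface_measure. z \<bullet> u - c)"
  by (intro set_integral_Un moment_integrable assms)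

text \<open>Both sides are additive over strips. On \<open>strip x y\<close> the moments about
  \<open>x\<close> lie between 0 and \<open>y - x\<close> times the length, so
  \<open>additive_increments_zero\<close> applies with \<open>\<rho>\<close> the arc length.\<close>

lemma strip_moment:
  assumes ab: "left < a" "a \<le> b" "b < right"
  shows "(LINT z:strip a b|surface_measure. z \<bullet> u - c) = integral {a..b} (\<lambda>t. (t - c) * speed t)"
proof -
  have st: "strip x y \<subseteq> frontier K" for x y by (simp add: strip_def)
  have si: "speed integrable_on {x..y}" and mi: "(\<lambda>t. (t - d) * speed t) integrable_on {x..y}"
    if "left < x" "x \<le> y" "y < right" for x y d
  proof -
    have "continuous_on {x..y} (\<lambda>t. t - d)" by (intro continuous_intros)
    then show "(\<lambda>t. (t - d) * speed t) integrable_on {x..y}" by (rule speed_integrable[OF that])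
    show "speed integrable_on {x..y}" using speed_integrable[OF that, of "\<lambda>_. 1"] by simp
  qed
  have s0: "0 \<le> speed t" for t using arc_speed_pos(1) by (simp add: speed_def add_nonneg_nonneg less_imp_le)
  define \<Delta> where "\<Delta> x y = (LINT z:strip x y|surface_measure. z \<bullet> u - c) - integral {x..y} (\<lambda>t. (t - c) * speed t)" for x y
  define \<rho> where "\<rho> t = integral {a..t} speed" for t
  have "\<Delta> a b = 0"
  proof (rule additive_increments_zero[OF ab(2), of \<Delta> \<rho>])
    fix x y z assume xyz: "a \<le> x" "x \<le> y" "y \<le> z" "z \<le> b"
    have "strip x z = strip x y \<union> strip y z" "strip x y \<inter> strip y z = {}" using xyz by (auto simp: strip_def)
    then have "(LINT z:strip x z|surface_measure. z \<bullet> u - c)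
        = (LINT z:strip x y|surface_measure. z \<bullet> u - c) + (LINT z:strip y z|surface_measure. z \<bullet> u - c)"
      using moment_split[OF st sets_strip st sets_strip] by simp
    moreover have "integral {x..y} (\<lambda>t. (t - c) * speed t) + integral {y..z} (\<lambda>t. (t - c) * speed t)
        = integral {x..z} (\<lambda>t. (t - c) * speed t)"
      by (rule Henstock_Kurzweil_Integration.integral_combine) (use xyz ab in \<open>auto intro!: mi\<close>)
    ultimately show "\<Delta> x z = \<Delta> x y + \<Delta> y z" by (simp add: \<Delta>_def)
  next
    fix x y assume xy: "a \<le> x" "x < y" "y \<le> b"
    then have xy': "left < x" "x \<le> y" "y < right" using ab by auto
    define L where "L = integral {x..y} speed"
    have L: "measure surface_measure (strip x y) = L" using strip_length[OF xy'] by (simp add: L_def)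
    have "\<rho> y - \<rho> x = L"
      using Henstock_Kurzweil_Integration.integral_combine[of a x y speed] si[of a y] ab xy
      by (simp add: \<rho>_def L_def)
    moreover have "0 * L \<le> (LINT z:strip x y|surface_measure. z \<bullet> u - x)"
        "(LINT z:strip x y|surface_measure. z \<bullet> u - x) \<le> (y - x) * L"
    proof -
      have "0 \<le> z \<bullet> u - x \<and> z \<bullet> u - x \<le> y - x" if "z \<in> strip x y" for z
        using that by (simp add: strip_def)
      from moment_between[OF st[of x y] sets_strip this]
      show "0 * L \<le> (LINT z:strip x y|surface_measure. z \<bullet> u - x)"
        "(LINT z:strip x y|surface_measure. z \<bullet> u - x) \<le> (y - x) * L" unfolding L by blast+
    qed
    moreover have "0 \<le> integral {x..y} (\<lambda>t. (t - x) * speed t)"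
      by (rule integral_nonneg[OF mi[OF xy']]) (use s0 in auto)
    moreover have "integral {x..y} (\<lambda>t. (t - x) * speed t) \<le> integral {x..y} (\<lambda>t. (y - x) * speed t)"
      by (rule integral_le[OF mi[OF xy']])
         (use s0 si[OF xy'] in \<open>auto intro: integrable_on_mult_right mult_right_mono\<close>)
    moreover have "integral {x..y} (\<lambda>t. (y - x) * speed t) = (y - x) * L" by (simp add: L_def)
    moreover have "integral {x..y} (\<lambda>t. (t - c) * speed t) = integral {x..y} (\<lambda>t. (t - x) * speed t) + (x - c) * L"
    proof -
      have "integral {x..y} (\<lambda>t. (t - c) * speed t) = integral {x..y} (\<lambda>t. (t - x) * speed t + (x - c) * speed t)"
        by (simp add: algebra_simps)
      also have "\<dots> = integral {x..y} (\<lambda>t. (t - x) * speed t) + integral {x..y} (\<lambda>t. (x - c) * speed t)"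
        by (intro integral_add mi xy' integrable_on_mult_right si)
      finally show ?thesis by (simp add: L_def)
    qed
    moreover have "(LINT z:strip x y|surface_measure. z \<bullet> u - c) = (LINT z:strip x y|surface_measure. z \<bullet> u - x) + (x - c) * L"
      using moment_shift[OF st sets_strip, of x y c x] by (simp add: L)
    ultimately show "\<bar>\<Delta> x y\<bar> \<le> (y - x) * (\<rho> y - \<rho> x)" unfolding \<Delta>_def by auto
  qed
  then show ?thesis by (simp add: \<Delta>_def)
qed

text \<open>Projection to \<open>u'\<close> is 1-Lipschitz, and a ray in direction \<open>u\<close>
  that starts inside \<open>K\<close> on the line at \<open>c\<close> meets the frontier further
  right. Trimming by \<open>e / 2\<close> at both ends keeps the starting points off the
  frontier.\<close>

lemma cap_length_ge:
  assumes c: "left < c" "c < right"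
  shows "width c \<le> measure surface_measure (cap c)"
proof (rule field_le_epsilon)
  fix e :: real assume e: "0 < e"
  have "{lower c + e / 2..upper c - e / 2} \<subseteq> (\<lambda>z. z \<bullet> u') ` cap c"
  proof
    fix y assume y: "y \<in> {lower c + e / 2..upper c - e / 2}"
    define S where "S = (\<lambda>x. pt x y) ` {c..right + 1}"
    have "connected S" unfolding S_def pt_def by (intro connected_continuous_image continuous_intros) auto
    moreover have "pt c y \<in> S \<inter> K" using c y e by (auto simp: S_def pt_in_iff)
    moreover have "pt (right + 1) y \<in> S - K" using c by (auto simp: S_def pt_in_iff)
    ultimately have "S \<inter> frontier K \<noteq> {}" using connected_Int_frontier by blast
    then obtain x where x: "c \<le> x" "pt x y \<in> frontier K" by (auto simp: S_def)
    have "x \<noteq> c" using frontier_iff[of "pt c y"] c x y e by auto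
    then have "pt x y \<in> cap c" using x by (simp add: cap_def)
    then show "y \<in> (\<lambda>z. z \<bullet> u') ` cap c" by (rule rev_image_eqI) simp
  qed
  then have "ennreal (upper c - e / 2 - (lower c + e / 2)) \<le> hausdorff_outer 1 ((\<lambda>z. z \<bullet> u') ` cap c)"
    by (rule hausdorff_outer_Icc_ge)
  also have "\<dots> \<le> ennreal (1 ^ 1) * hausdorff_outer 1 (cap c)"
  proof (rule hausdorff_outer_lipschitz_image)
    show "dist (x \<bullet> u') (y \<bullet> u') \<le> 1 * dist x y" for x y :: 'a
      using Cauchy_Schwarz_ineq2[of "x - y" u'] unit by (simp add: dist_real_def dist_norm inner_diff_left)
  qed simp
  also have "\<dots> = emeasure surface_measure (cap c)"
    unfolding surface_measure_eq emeasure_hausdorff_measure[OF sets_cap] by simp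
  also have "\<dots> = ennreal (measure surface_measure (cap c))"
    using surface_finite[of "cap c"] by (intro emeasure_eq_ennreal_measure) (auto simp: cap_def)
  finally have "upper c - e / 2 - (lower c + e / 2) \<le> measure surface_measure (cap c)"
    by (simp add: ennreal_le_iff)
  then show "width c \<le> measure surface_measure (cap c) + e" by (simp add: width_def field_simps)
qed

text \<open>For both concave functions the slopes of chords from \<open>a\<close> decrease to the
  right, and at a common end point they add up to the nonpositive slope of the width; so any two
  slopes compare through the nearer end point.\<close>

lemma slope_compare:
  assumes a: "left < a" "a < right" and anti: "\<And>x y. a \<le> x \<Longrightarrow> x \<le> y \<Longrightarrow> y \<le> right \<Longrightarrow> width y \<le> width x"
  shows "upper_slope a \<le> lower_slope a"
proof -
  define su sl where "su y = (upper y - upper a) / (y - a)" and "sl y = (- lower y - - lower a) / (y - a)" for y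
  have in_r: "y \<in> {left..right}" if "a \<le> y" "y \<le> right" for y using that a by simp
  have anti_u: "su y \<le> su x" and anti_l: "sl y \<le> sl x" if "a < x" "x \<le> y" "y \<le> right" for x y
    using concave_three_slopes(2)[OF upper_concave in_r[of a] in_r[of y], of x]
      concave_three_slopes(2)[OF uminus_lower_concave in_r[of a] in_r[of y], of x] that
    by (cases "x = y"; simp add: su_def sl_def)+
  have sum: "su y + sl y \<le> 0" if "a < y" "y \<le> right" for y
  proof -
    have "su y + sl y = (width y - width a) / (y - a)"
      by (simp add: su_def sl_def width_def add_divide_distrib[symmetric])
    then show ?thesis using anti[of a y] that by (simp add: divide_le_0_iff)
  qed
  have "su y \<le> - sl y'" if "a < y" "y \<le> right" "a < y'" "y' \<le> right" for y y'
  proof -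
    have "a < min y y'" "min y y' \<le> right" using that by auto
    then show ?thesis
      using anti_u[of "min y y'" y] anti_l[of "min y y'" y'] sum[of "min y y'"] that by auto
  qed
  then have "su y \<le> - (SUP y\<in>{a<..right}. sl y)" if "a < y" "y \<le> right" for y
    using that a by (subst le_minus_iff, intro cSUP_least) (auto simp: le_minus_iff)
  then have "(SUP y\<in>{a<..right}. su y) \<le> - (SUP y\<in>{a<..right}. sl y)"
    using a by (intro cSUP_least) auto
  then show ?thesis by (simp add: upper_slope_def lower_slope_def su_def sl_def)
qed

text \<open>Compares, without division, the centroid of the region truncated at \<open>a + b\<close>
  with that of the whole arc \<open>cap a\<close>. Truncation keeps the slopes bounded; the arc
  beyond the cut is estimated through its length \<open>R\<close>.\<close>

lemma cap_moment_truncated: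
  assumes a: "left < a" and b: "0 < b" "a + b < right"
    and anti: "\<And>x y. a \<le> x \<Longrightarrow> x \<le> y \<Longrightarrow> y \<le> right \<Longrightarrow> width y \<le> width x"
  shows "measure surface_measure (cap a) * integral {a..a + b} (\<lambda>t. (t - a) * width t)
    \<le> (LINT z:cap a|surface_measure. z \<bullet> u - a) * integral {a..a + b} width"
proof -
  have shift: "integral {a..a + b} f = integral {0..b} (\<lambda>t. f (a + t))" for f :: "real \<Rightarrow> real"
    using integral_shift_Icc_real[of 0 b f a] by (simp add: o_def add.commute)
  define W where "W t = width (a + t)" for t
  define p q where "p t = upper_slope (a + t)" and "q t = lower_slope (a + t)" for t
  have slW: "- (q t - p t) * (t - s) \<le> W t - W s \<and> W t - W s \<le> - (q s - p s) * (t - s)"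
    if "0 \<le> s" "s < t" "t \<le> b" for s t
    using upper_slope[of "a + s" "a + t"] lower_slope[of "a + s" "a + t"] that a b
    by (simp add: W_def width_def p_def q_def left_diff_distrib)
  have contW: "continuous_on {0..b} W"
    by (rule slope_selection_continuous[of 0 b "\<lambda>t. - (q t - p t)"]) (use slW in auto)
  have antiW: "W t \<le> W s" if "0 \<le> s" "s \<le> t" "t \<le> b" for s t
    using anti[of "a + s" "a + t"] that b by (simp add: W_def)
  have W0: "0 < W t" if "0 \<le> t" "t \<le> b" for t
    using width_pos[of "a + t"] that a b by (simp add: W_def)
  define A0 A1 where "A0 = integral {0..b} W" and "A1 = integral {0..b} (\<lambda>t. t * W t)"
  have i0: "W integrable_on {0..b}" by (intro integrable_continuous_interval contW)
  have i1: "(\<lambda>t. t * W t) integrable_on {0..b}" by (intro integrable_continuous_interval continuous_intros contW)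
  have lin: "integral {0..b} (\<lambda>t. (t - d) * W t) = A1 - d * A0" for d
  proof -
    have "integral {0..b} (\<lambda>t. (t - d) * W t) = integral {0..b} (\<lambda>t. t * W t - d * W t)"
      by (simp add: left_diff_distrib)
    also have "\<dots> = A1 - integral {0..b} (\<lambda>t. d * W t)"
      unfolding A1_def by (intro integral_diff i1 integrable_on_mult_right i0)
    finally show ?thesis by (simp add: A0_def)
  qed
  have A0: "0 < A0"
  proof -
    have "integral {0..b} (\<lambda>_. W b) \<le> A0"
      unfolding A0_def using antiW by (intro integral_le i0) auto
    moreover have "0 < b * W b" using W0[of b] b by simp
    ultimately show ?thesis using b by simp
  qed
  have A1: "0 \<le> A1"
    unfolding A1_def using W0 by (intro integral_nonneg i1) (auto simp: less_imp_le)
  \<comment> \<open>A nonincreasing width puts the centroid in the nearer half: apply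
    \<open>integral_linear_mono_nonneg\<close> with the midpoint to
    \<open>W 0 - W t\<close>.\<close>
  have half: "2 * A1 \<le> b * A0"
  proof -
    have "0 \<le> integral {0..b} (\<lambda>t. (t - b / 2) * (W 0 - W t))"
      using b antiW by (intro integral_linear_mono_nonneg) (auto intro!: mono_onI)
    also have "\<dots> = integral {0..b} (\<lambda>t. (t - b / 2) * W 0 - (t - b / 2) * W t)" by (simp add: right_diff_distrib)
    also have "\<dots> = integral {0..b} (\<lambda>t. (t - b / 2) * W 0) - integral {0..b} (\<lambda>t. (t - b / 2) * W t)"
      by (intro integral_diff integrable_continuous_interval continuous_intros contW)
    also have "integral {0..b} (\<lambda>t. (t - b / 2) * W 0) = 0"
    proof -
      have "((\<lambda>t. (t - b / 2) * W 0) has_integral ((b - b / 2)\<^sup>2 / 2 * W 0 - (0 - b / 2)\<^sup>2 / 2 * W 0)) {0..b}"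
        using b
        by (intro fundamental_theorem_of_calculus)
           (auto intro!: derivative_eq_intros simp: has_real_derivative_iff_has_vector_derivative[symmetric])
      moreover have "(b - b / 2)\<^sup>2 / 2 * W 0 - (0 - b / 2)\<^sup>2 / 2 * W 0 = 0" by (simp add: power2_eq_square)
      ultimately show ?thesis by (metis integral_unique)
    qed
    finally show ?thesis by (simp add: lin)
  qed
  define m where "m = A1 / A0"
  have mA: "m * A0 = A1" using A0 by (simp add: m_def)
  have m: "0 \<le> m" "2 * m \<le> b" using A0 A1 half by (auto simp: m_def field_simps)
  \<comment> \<open>As \<open>m\<close> is the abscissa of the centroid, integration by parts yields
    the last hypothesis of \<open>cap_inequality\<close>.\<close>
  have "integral {0..b} (\<lambda>t. (q t - p t) * (t\<^sup>2 / 2 - m * t)) + W b * (b\<^sup>2 / 2 - m * b) = integral {0..b} (\<lambda>t. (t - m) * W t)"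
    by (rule weighted_slope_integral) (use b m slW in auto)
  also have "\<dots> = 0" by (simp add: lin mA)
  finally have mean: "integral {0..b} (\<lambda>t. (q t - p t) * (t\<^sup>2 / 2 - m * t)) + W b * (b\<^sup>2 / 2 - m * b) = 0" .
  define R where "R = measure surface_measure (cap (a + b))"
  have "0 \<le> integral {0..b} (\<lambda>x. (x - m) * (arc_speed (p x) + arc_speed (q x))) + (b - m) * R"
  proof (rule cap_inequality[OF b(1) m _ _ _ _ _ mean])
    show "antimono_on {0..b} p" using slope_mono(1) a b by (auto simp: monotone_on_def p_def)
    show "mono_on {0..b} q" using slope_mono(2) a b by (auto simp: mono_on_def q_def)
    show "p 0 \<le> q 0" using slope_compare[OF a _ anti] b by (simp add: p_def q_def)
    show "0 \<le> W b" using W0[of b] b by simp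
    show "W b \<le> R" unfolding R_def W_def by (rule cap_length_ge) (use a b in auto)
  qed
  also have "integral {0..b} (\<lambda>x. (x - m) * (arc_speed (p x) + arc_speed (q x)))
      = integral {a..a + b} (\<lambda>t. (t - (a + m)) * speed t)"
    by (subst shift) (simp add: p_def q_def speed_def)
  also have "\<dots> = (LINT z:strip a (a + b)|surface_measure. z \<bullet> u - (a + m))"
    by (rule strip_moment[symmetric]) (use a b in auto)
  \<comment> \<open>Points of \<open>cap (a + b)\<close> lie beyond the line at \<open>a + m\<close>
    by at least \<open>b - m\<close>.\<close>
  also have "(b - m) * R \<le> (LINT z:cap (a + b)|surface_measure. z \<bullet> u - (a + m))"
  proof -
    obtain C where C: "\<And>z. z \<in> frontier K \<Longrightarrow> \<bar>z \<bullet> u\<bar> \<le> C" using frontier_bounded by blast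
    show ?thesis unfolding R_def
      by (rule moment_between(1)[OF _ sets_cap, where hi = "C - (a + m)"]) (use C in \<open>force simp: cap_def\<close>)+
  qed
  also have "(LINT z:strip a (a + b)|surface_measure. z \<bullet> u - (a + m)) + (LINT z:cap (a + b)|surface_measure. z \<bullet> u - (a + m))
      = (LINT z:strip a (a + b) \<union> cap (a + b)|surface_measure. z \<bullet> u - (a + m))"
    by (rule moment_split[symmetric, OF _ sets_strip _ sets_cap]) (auto simp: strip_def cap_def)
  also have "strip a (a + b) \<union> cap (a + b) = cap a" using b by (auto simp: strip_def cap_def)
  also have "(LINT z:cap a|surface_measure. z \<bullet> u - (a + m)) = (LINT z:cap a|surface_measure. z \<bullet> u - a) - m * measure surface_measure (cap a)"
    using moment_shift[OF _ sets_cap, of a "a + m" a] by (simp add: cap_def)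
  finally have "m * measure surface_measure (cap a) \<le> (LINT z:cap a|surface_measure. z \<bullet> u - a)" by simp
  then have "m * measure surface_measure (cap a) * A0 \<le> (LINT z:cap a|surface_measure. z \<bullet> u - a) * A0"
    using A0 by (intro mult_right_mono) auto
  moreover have "m * measure surface_measure (cap a) * A0 = measure surface_measure (cap a) * A1"
    by (simp add: mA[symmetric])
  ultimately show ?thesis unfolding shift A0_def A1_def W_def by simp
qed

text \<open>Let the truncation tend to \<open>right\<close>: both sides of
  \<open>cap_moment_truncated\<close> are continuous in the end point, as indefinite
  integrals.\<close>

lemma cap_moment:
  assumes a: "left < a" "a < right"
    and anti: "\<And>x y. a \<le> x \<Longrightarrow> x \<le> y \<Longrightarrow> y \<le> right \<Longrightarrow> width y \<le> width x"
  shows "measure surface_measure (cap a) * integral {a..right} (\<lambda>t. (t - a) * width t)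
    \<le> (LINT z:cap a|surface_measure. z \<bullet> u - a) * integral {a..right} width"
proof -
  define N S where "N = (LINT z:cap a|surface_measure. z \<bullet> u - a)" and "S = measure surface_measure (cap a)"
  have m: "mono_on {a..right} (\<lambda>t. - width t)" using anti by (intro mono_onI) auto
  have i0: "width integrable_on {a..right}"
    using integrable_on_mono_mult[OF less_imp_le[OF a(2)] m, of "\<lambda>_. -1"] by (simp add: continuous_intros)
  have i1: "(\<lambda>t. (t - a) * width t) integrable_on {a..right}"
    using integrable_on_mono_mult[OF less_imp_le[OF a(2)] m, of "\<lambda>t. a - t"]
    by (simp add: continuous_intros algebra_simps)
  define F where "F x = N * integral {a..x} width - S * integral {a..x} (\<lambda>t. (t - a) * width t)" for x
  have cl: "closure {a<..<right} = {a..right}" using a by simp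
  have "0 \<le> F right"
  proof (rule continuous_ge_on_closure[of "{a<..<right}" F right 0])
    show "continuous_on (closure {a<..<right}) F"
      unfolding cl F_def
      by (intro continuous_intros indefinite_integral_continuous_1 i0 i1)
    show "right \<in> closure {a<..<right}" using a by (simp add: cl)
    show "0 \<le> F x" if "x \<in> {a<..<right}" for x
      using cap_moment_truncated[OF a(1), of "x - a"] that anti by (simp add: F_def N_def S_def)
  qed
  then show ?thesis by (simp add: F_def N_def S_def)
qed

text \<open>Fubini in the coordinates \<open>pt\<close>, where the slice at abscissa
  \<open>x\<close> has length \<open>width x\<close>. The coordinates change volume by some constant
  \<open>c\<close>, which cancels in \<open>cap_comparison\<close>.\<close>

lemma area_integral:
  obtains c where "0 < c"
    "\<And>h J. h \<in> borel_measurable borel \<Longrightarrow> (\<And>x. 0 \<le> h x) \<Longrightarrow> ((\<lambda>x. h x * width x) has_integral J) {left..right}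
      \<Longrightarrow> ennreal c * (\<integral>\<^sup>+z. ennreal (h (z \<bullet> u)) * indicator K z \<partial>lborel) = ennreal J"
proof -
  define L where "L = (\<lambda>p :: real \<times> real. pt (fst p) (snd p))"
  have lin: "linear L" by (rule linearI) (simp_all add: L_def pt_def algebra_simps)
  have "bij L"
    by (rule bij_betw_byWitness[where f' = "\<lambda>z. (z \<bullet> u, z \<bullet> u')"]) (auto simp: L_def pt_coords)
  from lborel_linear_vimage[OF lin this] obtain c
    where c: "0 < c" "\<And>A. A \<in> sets borel \<Longrightarrow> emeasure lborel (L -` A) = ennreal c * emeasure lborel A" by blast
  have Lm: "L \<in> borel_measurable borel"
    using lin by (intro borel_measurable_continuous_onI linear_continuous_on) (simp add: linear_linear)
  have dL: "distr lborel borel L = scale_measure (ennreal c) lborel"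
    by (rule measure_eqI) (use Lm c in \<open>simp_all add: emeasure_distr\<close>)
  have "ennreal c * (\<integral>\<^sup>+z. ennreal (h (z \<bullet> u)) * indicator K z \<partial>lborel) = ennreal J"
    if h: "h \<in> borel_measurable borel" "\<And>x. 0 \<le> h x" and J: "((\<lambda>x. h x * width x) has_integral J) {left..right}" for h J
  proof -
    define f where "f z = ennreal (h (z \<bullet> u)) * indicator K z" for z
    have [measurable]: "K \<in> sets borel" using cK by (simp add: borel_closed)
    note h(1)[measurable]
    have fm: "f \<in> borel_measurable borel" unfolding f_def by measurable
    have "ennreal c * (\<integral>\<^sup>+z. f z \<partial>lborel) = (\<integral>\<^sup>+z. f z \<partial>distr lborel borel L)"
      unfolding dL using fm by (simp add: nn_integral_scale_measure)
    also have "\<dots> = (\<integral>\<^sup>+p. f (L p) \<partial>lborel)" using Lm fm by (intro nn_integral_distr) auto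
    also have "\<dots> = (\<integral>\<^sup>+p. f (L p) \<partial>(lborel \<Otimes>\<^sub>M lborel))" by (simp only: lborel_prod)
    also have "\<dots> = (\<integral>\<^sup>+x. \<integral>\<^sup>+y. f (L (x, y)) \<partial>lborel \<partial>lborel)"
    proof (rule lborel.nn_integral_fst[symmetric])
      have "(\<lambda>p. f (L p)) \<in> borel_measurable borel" using measurable_compose[OF Lm fm] .
      then show "(\<lambda>p. f (L p)) \<in> borel_measurable (lborel \<Otimes>\<^sub>M lborel)"
        unfolding lborel_prod by (simp cong: measurable_cong_sets)
    qed
    also have "\<dots> = (\<integral>\<^sup>+x. indicator {left..right} x * ennreal (h x * width x) \<partial>lborel)"
    proof (rule nn_integral_cong)
      fix x :: real
      show "(\<integral>\<^sup>+y. f (L (x, y)) \<partial>lborel) = indicator {left..right} x * ennreal (h x * width x)"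
      proof (cases "x \<in> {left..right}")
        case True
        have "f (L (x, y)) = ennreal (h x) * indicator {lower x..upper x} y" for y
          using True by (auto simp: f_def L_def pt_in_iff indicator_def)
        then have "(\<integral>\<^sup>+y. f (L (x, y)) \<partial>lborel) = ennreal (h x) * emeasure lborel {lower x..upper x}"
          by (simp add: nn_integral_cmult_indicator)
        then show ?thesis using True slice(2)[OF True] h(2) by (simp add: width_def ennreal_mult)
      next
        case False
        then have "f (L (x, y)) = 0" for y by (auto simp: f_def L_def pt_in_iff)
        then show ?thesis using False by simp
      qed
    qed
    also have "\<dots> = (\<integral>\<^sup>+x. ennreal (indicator {left..right} x * (h x * width x)) \<partial>lborel)"
      by (intro nn_integral_cong) (simp split: split_indicator)
    also have "\<dots> = ennreal J"
      by (rule nn_integral_has_integral_lebesgue[OF _ J]) (use h(2) width_nonneg in auto)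
    finally show ?thesis by (simp add: f_def)
  qed
  with c(1) show thesis by (rule that)
qed

end

section \<open>Comparison of interior and boundary\<close>

lemma AE_uniform_measure_mem: "A \<in> sets M \<Longrightarrow> AE x in uniform_measure M A. x \<in> A"
  by (rule AE_uniform_measureI) auto

lemma integrable_continuous_compact_support:
  fixes f :: "'a::euclidean_space \<Rightarrow> 'b::euclidean_space"
  assumes "prob_space \<mu>" "sets \<mu> = sets borel" "AE x in \<mu>. x \<in> K" "compact K" "continuous_on UNIV f"
  shows "integrable \<mu> f"
proof -
  interpret prob_space \<mu> by fact
  have "bounded (f ` K)"
    using assms by (intro compact_imp_bounded compact_continuous_image continuous_on_subset[OF assms(5)]) auto
  then obtain B where B: "\<And>x. x \<in> K \<Longrightarrow> norm (f x) \<le> B" unfolding bounded_iff by auto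
  show ?thesis
  proof (rule integrable_const_bound)
    show "AE x in \<mu>. norm (f x) \<le> B" using assms(3) by eventually_elim (rule B)
    have "f \<in> borel_measurable borel" using assms(5) by (rule borel_measurable_continuous_onI)
    then show "f \<in> borel_measurable \<mu>" using measurable_cong_sets[OF assms(2) refl] by blast
  qed
qed

text \<open>Pointwise, lowering the threshold from \<open>a\<close> to \<open>a - t\<close> raises
  the excess by \<open>t\<close> where \<open>a \<le> X\<close>, by at most \<open>t\<close> where
  \<open>a - t < X\<close>, and by nothing elsewhere.\<close>

lemma expected_excess_increment:
  fixes X :: "'a \<Rightarrow> real"
  assumes "prob_space \<mu>" and X: "integrable \<mu> X" and t: "0 < t"
  shows "t * measure \<mu> {z \<in> space \<mu>. a \<le> X z} \<le> (\<integral>z. max 0 (X z - (a - t)) \<partial>\<mu>) - (\<integral>z. max 0 (X z - a) \<partial>\<mu>)"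
    "(\<integral>z. max 0 (X z - (a - t)) \<partial>\<mu>) - (\<integral>z. max 0 (X z - a) \<partial>\<mu>) \<le> t * measure \<mu> {z \<in> space \<mu>. a - t < X z}"
proof -
  interpret prob_space \<mu> by fact
  have [measurable]: "X \<in> borel_measurable \<mu>" using X by simp
  have i: "integrable \<mu> (\<lambda>z. max 0 (X z - c))" for c using X by (intro integrable_max) auto
  have j: "integrable \<mu> (\<lambda>z. t * indicator {z \<in> space \<mu>. P (X z)} z)"
    "(\<integral>z. t * indicator {z \<in> space \<mu>. P (X z)} z \<partial>\<mu>) = t * measure \<mu> {z \<in> space \<mu>. P (X z)}"
    if "Measurable.pred borel P" for P
  proof -
    note that[measurable]
    have s: "{z \<in> space \<mu>. P (X z)} \<in> sets \<mu>" by measurable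
    then show "integrable \<mu> (\<lambda>z. t * indicator {z \<in> space \<mu>. P (X z)} z)"
      by (intro integrable_mult_right) (auto simp: emeasure_eq_measure)
    show "(\<integral>z. t * indicator {z \<in> space \<mu>. P (X z)} z \<partial>\<mu>) = t * measure \<mu> {z \<in> space \<mu>. P (X z)}"
      using s by (simp add: Int_absorb1 sets.sets_into_space)
  qed
  have j1: "(\<integral>z. t * indicator {z \<in> space \<mu>. a \<le> X z} z \<partial>\<mu>) = t * measure \<mu> {z \<in> space \<mu>. a \<le> X z}"
    and j2: "(\<integral>z. t * indicator {z \<in> space \<mu>. a - t < X z} z \<partial>\<mu>) = t * measure \<mu> {z \<in> space \<mu>. a - t < X z}"
    by (rule j(2), measurable)+
  have d: "(\<integral>z. max 0 (X z - (a - t)) \<partial>\<mu>) - (\<integral>z. max 0 (X z - a) \<partial>\<mu>)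
      = (\<integral>z. max 0 (X z - (a - t)) - max 0 (X z - a) \<partial>\<mu>)" by (rule Bochner_Integration.integral_diff[symmetric, OF i i])
  show "t * measure \<mu> {z \<in> space \<mu>. a \<le> X z} \<le> (\<integral>z. max 0 (X z - (a - t)) \<partial>\<mu>) - (\<integral>z. max 0 (X z - a) \<partial>\<mu>)"
    unfolding d j1[symmetric]
    by (rule integral_mono[OF j(1) Bochner_Integration.integrable_diff[OF i i]])
       (use t in \<open>auto simp: max_def split: split_indicator\<close>)
  show "(\<integral>z. max 0 (X z - (a - t)) \<partial>\<mu>) - (\<integral>z. max 0 (X z - a) \<partial>\<mu>) \<le> t * measure \<mu> {z \<in> space \<mu>. a - t < X z}"
    unfolding d j2[symmetric]
    by (rule integral_mono[OF Bochner_Integration.integrable_diff[OF i i] j(1)])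
       (use t in \<open>auto simp: max_def split: split_indicator\<close>)
qed

locale planar_body_centered = planar_body K u u' for K :: "'a::euclidean_space set" and u u' +
  assumes surf_pos: "0 < emeasure surface_measure (frontier K)"
    and mean: "(\<integral>z. z \<partial>uniform_measure lborel K) = (\<integral>z. z \<partial>uniform_measure surface_measure (frontier K))"
begin

abbreviation \<mu>I :: "'a measure" where "\<mu>I \<equiv> uniform_measure lborel K"
abbreviation \<mu>B :: "'a measure" where "\<mu>B \<equiv> uniform_measure surface_measure (frontier K)"

lemma K_sets: "K \<in> sets lborel" "frontier K \<in> sets surface_measure"
  using cK by (simp_all add: sets_surface borel_closed)

lemma K_emeasure: "emeasure lborel K \<noteq> 0" "emeasure lborel K \<noteq> \<top>"
    "emeasure surface_measure (frontier K) \<noteq> 0" "emeasure surface_measure (frontier K) \<noteq> \<top>"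
proof -
  show "emeasure lborel K \<noteq> 0" using cK(3) emeasure_lborel_pos[of _ K] K_sets by fastforce
  show "emeasure lborel K \<noteq> \<top>" using emeasure_compact_finite[OF cK(1)] by simp
qed (use surf surf_pos in auto)

lemma prob_spaces: "prob_space \<mu>I" "prob_space \<mu>B"
  using K_sets K_emeasure by (auto intro: prob_space_uniform_measure)

lemma mu_space: "measure \<mu>I UNIV = 1" "measure \<mu>B (space surface_measure) = 1"
  using prob_spaces[THEN prob_space.prob_space] by simp_all

lemma sets_mu: "sets \<mu>I = sets borel" "sets \<mu>B = sets borel" by (simp_all add: sets_surface)

lemma AE_mu: "AE z in \<mu>I. z \<in> K" "AE z in \<mu>B. z \<in> K"
proof -
  show "AE z in \<mu>I. z \<in> K" by (rule AE_uniform_measure_mem[OF K_sets(1)])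
  show "AE z in \<mu>B. z \<in> K"
    using AE_uniform_measure_mem[OF K_sets(2)] by eventually_elim (use cK(4) frontier_subset_closed in blast)
qed

lemma integrable_mu:
  fixes f :: "'a \<Rightarrow> 'b::euclidean_space"
  assumes "continuous_on UNIV f"
  shows "integrable \<mu>I f" "integrable \<mu>B f"
  by (rule integrable_continuous_compact_support[OF _ _ _ cK(1) assms]; rule prob_spaces sets_mu AE_mu)+

lemma mean_inner: "(\<integral>z. z \<bullet> v \<partial>\<mu>I) = (\<integral>z. z \<bullet> v \<partial>\<mu>B)"
  using mean integral_inner_left[of v \<mu>I "\<lambda>z. z"] integral_inner_left[of v \<mu>B "\<lambda>z. z"] integrable_mu[of "\<lambda>z. z"]
  by simp

definition gap :: "real \<Rightarrow> real" where
  "gap a = (\<integral>z. max 0 (z \<bullet> u - a) \<partial>\<mu>B) - (\<integral>z. max 0 (z \<bullet> u - a) \<partial>\<mu>I)"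

text \<open>\<open>cap_moment\<close> for the normalised laws; the perimeter \<open>H\<close>, the
  area \<open>V\<close> and the constant \<open>c\<close> of \<open>area_integral\<close> enter both
  sides in the same way.\<close>

lemma cap_comparison:
  assumes a: "left < a" "a < right"
    and anti: "\<And>x y. a \<le> x \<Longrightarrow> x \<le> y \<Longrightarrow> y \<le> right \<Longrightarrow> width y \<le> width x"
  shows "measure \<mu>B {z. a < z \<bullet> u} * (\<integral>z. max 0 (z \<bullet> u - a) \<partial>\<mu>I)
    \<le> (\<integral>z. max 0 (z \<bullet> u - a) \<partial>\<mu>B) * measure \<mu>I {z. a \<le> z \<bullet> u}"
    "0 < measure \<mu>I {z. a \<le> z \<bullet> u}"
proof -
  define H V where "H = measure surface_measure (frontier K)" and "V = measure lborel K"
  have HV: "0 < H" "0 < V"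
    using K_emeasure by (simp_all add: H_def V_def zero_less_measure_iff emeasure_eq_ennreal_measure)
  have fm: "(\<lambda>z. max 0 (z \<bullet> u - a)) \<in> borel_measurable borel" by measurable
  have fm': "(\<lambda>z. max 0 (z \<bullet> u - a)) \<in> borel_measurable surface_measure"
    using fm measurable_cong_sets[OF sets_surface refl] by blast
  define S N where "S = measure surface_measure (cap a)" and "N = (LINT z:cap a|surface_measure. z \<bullet> u - a)"
  have S: "measure \<mu>B {z. a < z \<bullet> u} = S / H"
    using K_emeasure K_sets by (subst measure_uniform_measure) (auto simp: sets_surface S_def H_def cap_def)
  have "(LINT z:frontier K|surface_measure. max 0 (z \<bullet> u - a)) = N"
    unfolding N_def set_lebesgue_integral_def
    by (intro Bochner_Integration.integral_cong refl) (auto simp: cap_def split: split_indicator)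
  then have N: "(\<integral>z. max 0 (z \<bullet> u - a) \<partial>\<mu>B) = N / H"
    using integral_uniform_measure[OF K_sets(2) K_emeasure(3,4) fm'] by (simp add: H_def)
  have m: "mono_on {a..right} (\<lambda>t. - width t)" using anti by (intro mono_onI) auto
  define J0 J1 where "J0 = integral {a..right} width" and "J1 = integral {a..right} (\<lambda>t. (t - a) * width t)"
  have i0: "(width has_integral J0) {a..right}"
    using integrable_on_mono_mult[OF less_imp_le[OF a(2)] m, of "\<lambda>_. -1"]
    by (simp add: continuous_intros J0_def integrable_integral)
  have i1: "((\<lambda>t. (t - a) * width t) has_integral J1) {a..right}"
    using integrable_on_mono_mult[OF less_imp_le[OF a(2)] m, of "\<lambda>t. a - t"]
    by (simp add: continuous_intros algebra_simps J1_def integrable_integral)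
  have sub: "{a..right} \<subseteq> {left..right}" using a by auto
  have h0: "((\<lambda>x. indicator {a..} x * width x) has_integral J0) {left..right}"
    by (rule has_integral_eq[OF _ iffD2[OF has_integral_restrict[OF sub] i0]]) auto
  have h1: "((\<lambda>x. max 0 (x - a) * width x) has_integral J1) {left..right}"
    by (rule has_integral_eq[OF _ iffD2[OF has_integral_restrict[OF sub] i1]]) auto
  obtain c where c: "0 < c"
    "\<And>h J. h \<in> borel_measurable borel \<Longrightarrow> (\<And>x. 0 \<le> h x) \<Longrightarrow> ((\<lambda>x. h x * width x) has_integral J) {left..right}
      \<Longrightarrow> ennreal c * (\<integral>\<^sup>+z. ennreal (h (z \<bullet> u)) * indicator K z \<partial>lborel) = ennreal J"
    by (rule area_integral) blast
  have J: "0 \<le> J1" "0 \<le> J0"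
    using has_integral_nonneg[OF i1] has_integral_nonneg[OF i0] width_nonneg a by auto
  have LI: "c * (LINT z:K|lborel. h (z \<bullet> u)) = J'"
    if h: "h \<in> borel_measurable borel" "\<And>x. 0 \<le> h x" "((\<lambda>x. h x * width x) has_integral J') {left..right}" "0 \<le> J'" for h J'
  proof -
    note h(1)[measurable] K_sets(1)[measurable]
    have "(LINT z:K|lborel. h (z \<bullet> u)) = enn2real (\<integral>\<^sup>+z. ennreal (indicator K z *\<^sub>R h (z \<bullet> u)) \<partial>lborel)"
      unfolding set_lebesgue_integral_def using h(2) by (intro integral_eq_nn_integral) auto
    also have "(\<integral>\<^sup>+z. ennreal (indicator K z *\<^sub>R h (z \<bullet> u)) \<partial>lborel) = (\<integral>\<^sup>+z. ennreal (h (z \<bullet> u)) * indicator K z \<partial>lborel)"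
      by (intro nn_integral_cong) (simp split: split_indicator)
    finally have "c * (LINT z:K|lborel. h (z \<bullet> u)) = enn2real (ennreal c * (\<integral>\<^sup>+z. ennreal (h (z \<bullet> u)) * indicator K z \<partial>lborel))"
      using c(1) by (simp add: enn2real_mult)
    then show ?thesis using c(2)[OF h(1,2,3)] h(4) by simp
  qed
  have V0: "measure \<mu>I {z. a \<le> z \<bullet> u} = (LINT z:K|lborel. indicator {a..} (z \<bullet> u)) / V"
  proof -
    have "measure lborel (K \<inter> {z. a \<le> z \<bullet> u}) = (\<integral>z. indicator (K \<inter> {z. a \<le> z \<bullet> u}) z \<partial>lborel)" by simp
    also have "\<dots> = (LINT z:K|lborel. indicator {a..} (z \<bullet> u))"
      unfolding set_lebesgue_integral_def
      by (intro Bochner_Integration.integral_cong refl) (auto split: split_indicator)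
    finally have e: "measure lborel (K \<inter> {z. a \<le> z \<bullet> u}) = (LINT z:K|lborel. indicator {a..} (z \<bullet> u))" .
    have "measure \<mu>I {z. a \<le> z \<bullet> u} = measure lborel (K \<inter> {z. a \<le> z \<bullet> u}) / V"
      using K_emeasure K_sets by (subst measure_uniform_measure) (auto simp: V_def)
    then show ?thesis unfolding e .
  qed
  have V1: "(\<integral>z. max 0 (z \<bullet> u - a) \<partial>\<mu>I) = (LINT z:K|lborel. max 0 (z \<bullet> u - a)) / V"
    using integral_uniform_measure[OF K_sets(1) K_emeasure(1,2), of "\<lambda>z. max 0 (z \<bullet> u - a)"] fm by (simp add: V_def)
  have L0: "c * (LINT z:K|lborel. indicator {a..} (z \<bullet> u)) = J0"
    by (rule LI[OF _ _ h0 J(2)]) auto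
  have L1: "c * (LINT z:K|lborel. max 0 (z \<bullet> u - a)) = J1"
    by (rule LI[OF _ _ h1 J(1)]) auto
  have P0: "measure \<mu>I {z. a \<le> z \<bullet> u} = J0 / (c * V)" using c(1) by (simp add: V0 L0[symmetric])
  have P1: "(\<integral>z. max 0 (z \<bullet> u - a) \<partial>\<mu>I) = J1 / (c * V)" using c(1) by (simp add: V1 L1[symmetric])
  have "S * J1 \<le> N * J0"
    unfolding S_def N_def J0_def J1_def by (rule cap_moment[OF a anti])
  then have "S * J1 / (H * (c * V)) \<le> N * J0 / (H * (c * V))" using HV c(1) by (intro divide_right_mono) auto
  then show "measure \<mu>B {z. a < z \<bullet> u} * (\<integral>z. max 0 (z \<bullet> u - a) \<partial>\<mu>I)
    \<le> (\<integral>z. max 0 (z \<bullet> u - a) \<partial>\<mu>B) * measure \<mu>I {z. a \<le> z \<bullet> u}"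
    unfolding S N P0 P1 by simp
  have "0 < J0"
  proof -
    \<comment> \<open>Between \<open>a\<close> and the midpoint \<open>b\<close> the nonincreasing
      width is at least its positive value at \<open>b\<close>.\<close>
    define b where "b = (a + right) / 2"
    have b: "a < b" "b < right" using a by (auto simp: b_def)
    have wi: "width integrable_on {a..b}" "width integrable_on {b..right}"
      using i0 b by (auto intro: integrable_on_subinterval[of width "{a..right}"])
    have "integral {a..b} (\<lambda>_. width b) \<le> integral {a..b} width"
      by (rule integral_le) (use anti b wi in auto)
    moreover have "0 \<le> integral {b..right} width"
      by (rule integral_nonneg[OF wi(2)]) (use width_nonneg a b in auto)
    moreover have "integral {a..b} width + integral {b..right} width = J0"
      unfolding J0_def by (rule Henstock_Kurzweil_Integration.integral_combine) (use b i0 in auto)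
    moreover have "0 < (b - a) * width b" using width_pos[of b] a b by simp
    ultimately show ?thesis using b by simp
  qed
  then show "0 < measure \<mu>I {z. a \<le> z \<bullet> u}" using c(1) HV by (simp add: P0)
qed

text \<open>At a minimum of \<open>gap\<close>, comparing the difference quotients from the left shows that the boundary
  point lies beyond \<open>a\<close> with at least the probability of the interior point.\<close>

lemma gap_min_nonneg:
  assumes a: "left < a" "a < right"
    and anti: "\<And>x y. a \<le> x \<Longrightarrow> x \<le> y \<Longrightarrow> y \<le> right \<Longrightarrow> width y \<le> width x"
    and min: "\<And>y. gap a \<le> gap y"
  shows "0 \<le> gap a"
proof -
  define H where "H = measure surface_measure (frontier K)"
  have H: "0 < H" using K_emeasure by (simp add: H_def zero_less_measure_iff emeasure_eq_ennreal_measure)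
  have X: "integrable \<mu>I (\<lambda>z. z \<bullet> u)" "integrable \<mu>B (\<lambda>z. z \<bullet> u)"
    by (rule integrable_mu; intro continuous_intros)+
  have sp: "space \<mu>I = UNIV" "space \<mu>B = UNIV" by (simp_all add: surface_measure_def)
  have le: "measure \<mu>I {z. a \<le> z \<bullet> u} \<le> measure \<mu>B {z. a - t < z \<bullet> u}" if t: "0 < t" for t
  proof -
    have "t * measure \<mu>I {z. a \<le> z \<bullet> u} \<le> t * measure \<mu>B {z. a - t < z \<bullet> u}"
      using expected_excess_increment(1)[OF prob_spaces(1) X(1) t, of a] expected_excess_increment(2)[OF prob_spaces(2) X(2) t, of a]
        min[of "a - t"] unfolding gap_def sp by simp
    then show ?thesis using t by simp
  qed
  define p where "p = (left + a) / 2"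
  have p: "left < p" "p < a" using a by (auto simp: p_def)
  \<comment> \<open>The comparison holds for the event \<open>a - t < z \<bullet> u\<close> with
    \<open>t > 0\<close>; to reach \<open>t = 0\<close>, boundary mass on the line at
    \<open>a\<close> must be excluded. The mass of the strip in between is an integral of
    \<open>speed\<close>, so \<open>F\<close> is continuous up to \<open>a\<close>.\<close>
  define F where "F x = measure \<mu>B {z. a < z \<bullet> u} + integral {x..a} speed / H" for x
  have mB: "measure \<mu>B {z. x < z \<bullet> u} = measure surface_measure (cap x) / H" for x
    using K_emeasure K_sets by (subst measure_uniform_measure) (auto simp: sets_surface H_def cap_def)
  have F: "F x = measure \<mu>B {z. x < z \<bullet> u}" if "p < x" "x < a" for x
  proof -
    have "cap x = strip x a \<union> cap a" "strip x a \<inter> cap a = {}" using that by (auto simp: cap_def strip_def)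
    moreover have "emeasure surface_measure (strip x a) < \<top>" "emeasure surface_measure (cap a) < \<top>"
      by (rule surface_finite; simp add: strip_def cap_def)+
    ultimately have "measure surface_measure (cap x) = measure surface_measure (strip x a) + measure surface_measure (cap a)"
      using sets_strip sets_cap by (simp only:) (intro measure_Union; auto simp: sets_surface)
    moreover have "measure surface_measure (strip x a) = integral {x..a} speed"
      by (rule strip_length) (use p that a in auto)
    ultimately show ?thesis unfolding F_def mB by (simp add: add_divide_distrib)
  qed
  have cl: "closure {p<..<a} = {p..a}" using p by simp
  have "measure \<mu>I {z. a \<le> z \<bullet> u} \<le> F a"
  proof (rule continuous_ge_on_closure[of "{p<..<a}" F a])
    have "speed integrable_on {p..a}" using speed_integrable[of p a "\<lambda>_. 1"] p a by simp
    then show "continuous_on (closure {p<..<a}) F"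
      unfolding cl F_def using H by (intro continuous_intros indefinite_integral_continuous_1') auto
    show "a \<in> closure {p<..<a}" using p by (simp add: cl)
    show "measure \<mu>I {z. a \<le> z \<bullet> u} \<le> F x" if "x \<in> {p<..<a}" for x
      using le[of "a - x"] F[of x] that by simp
  qed
  then have B: "measure \<mu>I {z. a \<le> z \<bullet> u} \<le> measure \<mu>B {z. a < z \<bullet> u}" by (simp add: F_def)
  define EI EB where "EI = (\<integral>z. max 0 (z \<bullet> u - a) \<partial>\<mu>I)" and "EB = (\<integral>z. max 0 (z \<bullet> u - a) \<partial>\<mu>B)"
  have "0 \<le> EI" unfolding EI_def by (rule integral_nonneg_AE) simp
  then have "measure \<mu>I {z. a \<le> z \<bullet> u} * EI \<le> measure \<mu>B {z. a < z \<bullet> u} * EI"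
    using B by (intro mult_right_mono)
  also have "\<dots> \<le> EB * measure \<mu>I {z. a \<le> z \<bullet> u}" unfolding EI_def EB_def by (rule cap_comparison(1)[OF a anti])
  finally have "EI \<le> EB" using cap_comparison(2)[OF a anti] by (simp add: mult.commute)
  then show ?thesis by (simp add: gap_def EI_def EB_def)
qed

lemma gap_continuous: "continuous_on UNIV gap"
proof -
  have X: "integrable \<mu>I (\<lambda>z. z \<bullet> u)" "integrable \<mu>B (\<lambda>z. z \<bullet> u)"
    by (rule integrable_mu; intro continuous_intros)+
  have *: "continuous_on UNIV (\<lambda>a. \<integral>z. max 0 (X z - a) \<partial>\<mu>)"
    if P: "prob_space \<mu>" and X: "integrable \<mu> X" for \<mu> :: "'a measure" and X :: "'a \<Rightarrow> real"
  proof -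
    interpret prob_space \<mu> by fact
    define E where "E a = (\<integral>z. max 0 (X z - a) \<partial>\<mu>)" for a
    have inc: "0 \<le> E x - E y \<and> E x - E y \<le> y - x" if "x < y" for x y
    proof -
      have t: "0 < y - x" using that by simp
      have "(y - x) * measure \<mu> {z \<in> space \<mu>. x < X z} \<le> (y - x) * 1"
        using t prob_le_1 by (intro mult_left_mono) auto
      moreover have "0 \<le> (y - x) * measure \<mu> {z \<in> space \<mu>. y \<le> X z}" using t by simp
      ultimately show ?thesis
        using expected_excess_increment[OF P X t, of y] by (simp add: E_def)
    qed
    have "continuous_on UNIV E"
    proof (rule lipschitz_on_continuous_on[of 1], rule lipschitz_onI)
      show "dist (E x) (E y) \<le> 1 * dist x y" for x y
        using inc[of x y] inc[of y x] by (cases x y rule: linorder_cases) (auto simp: dist_real_def)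
    qed simp
    then show ?thesis by (simp add: E_def[abs_def])
  qed
  show ?thesis unfolding gap_def by (intro continuous_on_diff *[OF prob_spaces(2) X(2)] *[OF prob_spaces(1) X(1)])
qed

text \<open>To the left of the range of the coordinate the excess is affine and the equal means
  cancel; to the right it is zero.\<close>

lemma gap_outside: "a \<le> left \<or> right \<le> a \<Longrightarrow> gap a = 0"
proof -
  have r: "left \<le> z \<bullet> u" "z \<bullet> u \<le> right" if "z \<in> K" for z using in_iff[of z] that by auto
  have X: "integrable \<mu>I (\<lambda>z. z \<bullet> u)" "integrable \<mu>B (\<lambda>z. z \<bullet> u)"
    by (rule integrable_mu; intro continuous_intros)+
  interpret I: prob_space \<mu>I by (rule prob_spaces)
  interpret B: prob_space \<mu>B by (rule prob_spaces)
  have m: "(\<lambda>z. z \<bullet> u) \<in> borel_measurable \<mu>I" "(\<lambda>z. z \<bullet> u) \<in> borel_measurable \<mu>B" using X by auto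
  assume "a \<le> left \<or> right \<le> a"
  then show "gap a = 0"
  proof
    assume a: "a \<le> left"
    have "(\<integral>z. max 0 (z \<bullet> u - a) \<partial>\<mu>I) = (\<integral>z. z \<bullet> u - a \<partial>\<mu>I)"
      using AE_mu(1) m by (intro integral_cong_AE) (auto elim!: eventually_mono dest!: r(1) simp: max_def a order.trans[OF a])
    also have "\<dots> = (\<integral>z. z \<bullet> u \<partial>\<mu>I) - a" using X by (simp add: mu_space)
    also have "\<dots> = (\<integral>z. z \<bullet> u - a \<partial>\<mu>B)" using X by (simp add: mu_space mean_inner)
    also have "\<dots> = (\<integral>z. max 0 (z \<bullet> u - a) \<partial>\<mu>B)"
      using AE_mu(2) m by (intro integral_cong_AE) (auto elim!: eventually_mono dest!: r(1) simp: max_def a order.trans[OF a])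
    finally show ?thesis by (simp add: gap_def)
  next
    assume a: "right \<le> a"
    have "(\<integral>z. max 0 (z \<bullet> u - a) \<partial>\<mu>I) = (\<integral>z. 0 \<partial>\<mu>I)"
      using AE_mu(1) m by (intro integral_cong_AE) (auto elim!: eventually_mono dest!: r(2) simp: max_def intro: antisym order.trans[OF _ a])
    moreover have "(\<integral>z. max 0 (z \<bullet> u - a) \<partial>\<mu>B) = (\<integral>z. 0 \<partial>\<mu>B)"
      using AE_mu(2) m by (intro integral_cong_AE) (auto elim!: eventually_mono dest!: r(2) simp: max_def intro: antisym order.trans[OF _ a])
    ultimately show ?thesis by (simp add: gap_def)
  qed
qed

lemma gap_nonneg: "0 \<le> gap a"
proof -
  obtain m where m: "m \<in> {left..right}" "\<And>y. y \<in> {left..right} \<Longrightarrow> gap m \<le> gap y"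
    using continuous_attains_inf[of "{left..right}" gap] left_less_right continuous_on_subset[OF gap_continuous]
    by (metis atLeastatMost_empty_iff2 compact_Icc less_imp_le subset_UNIV linorder_not_less)
  have "0 \<le> gap m"
  proof (rule ccontr)
    assume neg: "\<not> 0 \<le> gap m"
    \<comment> \<open>\<open>gap\<close> vanishes at the ends of the shadow and outside it, so a
      negative minimum over the shadow is interior and global.\<close>
    then have mi: "left < m" "m < right" using gap_outside[of m] m(1) by force+
    have min: "gap m \<le> gap y" for y using m(2)[of y] gap_outside[of y] neg by (cases "y \<in> {left..right}") auto
    show False
    proof (cases "\<forall>x y. m \<le> x \<longrightarrow> x \<le> y \<longrightarrow> y \<le> right \<longrightarrow> width y \<le> width x")
      case True
      then show False using gap_min_nonneg[OF mi _ min] neg by blast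
    next
      case False
      then obtain x y where xy: "m \<le> x" "x < y" "y \<le> right" "width x < width y"
        by (metis linorder_not_le order_le_less)
      \<comment> \<open>An increase of the width to the right of \<open>m\<close> is a positive
        chord slope; by concavity chords further left are at least as steep, so the width is
        nondecreasing to the left of \<open>m\<close>.\<close>
      have mono: "width s \<le> width t" if st: "left \<le> s" "s \<le> t" "t \<le> m" for s t
      proof (cases "s = t")
        case False
        then have lt: "s < t" using st by simp
        have pos: "0 < (width y - width x) / (y - x)" using xy by simp
        have in_r: "s \<in> {left..right}" "t \<in> {left..right}" "x \<in> {left..right}" "y \<in> {left..right}"
          using st lt xy mi by auto
        have "(width x - width s) / (x - s) \<le> (width t - width s) / (t - s)"
          using concave_three_slopes(2)[OF width_concave in_r(1,3) lt] st xy by (cases "t = x") auto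
        moreover have "(width y - width x) / (y - x) \<le> (width x - width s) / (x - s)"
          using concave_three_slopes(1)[OF width_concave in_r(1,4), of x] lt st xy by auto
        ultimately have "0 < (width t - width s) / (t - s)" using pos by linarith
        then show ?thesis using lt by (simp add: zero_less_divide_iff)
      qed simp
      \<comment> \<open>Reversing \<open>u\<close> turns \<open>gap a\<close> into \<open>gap (- a)\<close> because the means agree.\<close>
      interpret R: planar_body_centered K "- u" u'
        by unfold_locales (use dim body unit surf surf_pos mean in auto)
      have pt: "R.pt x y = pt (- x) y" for x y by (simp add: R.pt_def pt_def)
      have w: "R.width x = width (- x)" for x
        by (simp add: R.width_def width_def R.upper_def R.lower_def upper_def lower_def pt)
      have im: "(\<lambda>z. z \<bullet> - u) ` K = {- right..- left}"
      proof -
        have "(\<lambda>z. z \<bullet> - u) ` K = uminus ` ((\<lambda>z. z \<bullet> u) ` K)" by (simp add: image_image)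
        then show ?thesis by (simp add: shadow)
      qed
      have lr: "R.left = - right" "R.right = - left"
        unfolding R.left_def R.right_def im using left_less_right by simp_all
      have g: "R.gap (- x) = gap x" for x
      proof -
        have X: "integrable \<mu>I (\<lambda>z. z \<bullet> u)" "integrable \<mu>B (\<lambda>z. z \<bullet> u)"
          by (rule integrable_mu; intro continuous_intros)+
        have i: "integrable \<mu>I (\<lambda>z. max 0 (z \<bullet> u - x))" "integrable \<mu>B (\<lambda>z. max 0 (z \<bullet> u - x))"
          by (rule integrable_mu; intro continuous_intros)+
        interpret I: prob_space \<mu>I by (rule prob_spaces)
        interpret B: prob_space \<mu>B by (rule prob_spaces)
        have e: "max 0 (z \<bullet> - u - - x) = max 0 (z \<bullet> u - x) - (z \<bullet> u - x)" for z by (auto simp: max_def)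
        show ?thesis unfolding R.gap_def gap_def e using X i by (simp add: mu_space mean_inner)
      qed
      have "0 \<le> R.gap (- m)"
      proof (rule R.gap_min_nonneg)
        show "R.left < - m" "- m < R.right" using mi by (auto simp: lr)
        show "R.width y \<le> R.width x" if "- m \<le> x" "x \<le> y" "y \<le> R.right" for x y
          using mono[of "- y" "- x"] that by (simp add: w lr)
        show "R.gap (- m) \<le> R.gap y" for y using min[of "- y"] g[of m] g[of "- y"] by simp
      qed
      then show False using neg g by simp
    qed
  qed
  then show ?thesis using m(2)[of a] gap_outside[of a] by (cases "a \<in> {left..right}") auto
qed

end

text \<open>The affine part has equal means, and each summand
  \<open>max 0 (v \<bullet> x + b)\<close> reduces to \<open>gap\<close> in the direction of
  \<open>v\<close>. Each bound of \<open>ridge_approximation\<close> is used where its law lives: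
  domination on \<open>K\<close> for the interior point, near equality on the frontier for the
  boundary point.\<close>

lemma integral_uniform_planar_le:
  fixes K :: "'a::euclidean_space set" and \<phi> :: "'a \<Rightarrow> real"
  assumes dim: "DIM('a) = 2" and K: "convex_body K"
    and P: "0 < emeasure surface_measure (frontier K)" "emeasure surface_measure (frontier K) < \<top>"
    and cvx: "convex_on UNIV \<phi>"
    and mean: "(\<integral>x. x \<partial>uniform_measure lborel K) = (\<integral>x. x \<partial>uniform_measure surface_measure (frontier K))"
  shows "(\<integral>x. \<phi> x \<partial>uniform_measure lborel K) \<le> (\<integral>x. \<phi> x \<partial>uniform_measure surface_measure (frontier K))"
proof -
  let ?I = "uniform_measure lborel K" and ?B = "uniform_measure surface_measure (frontier K)"
  have frame: "\<exists>u'. norm u' = 1 \<and> u \<bullet> u' = 0" for u :: 'a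
  proof -
    obtain y where "y \<noteq> 0" "orthogonal u y" using orthogonal_to_vector_exists[of u] dim by auto
    then show ?thesis by (intro exI[of _ "y /\<^sub>R norm y"]) (auto simp: orthogonal_def)
  qed
  have centered: "\<exists>u'. planar_body_centered K u u'" if "norm u = 1" for u
    using frame[of u] that by (auto simp: planar_body_centered_def planar_body_def planar_body_centered_axioms_def dim K P mean)
  obtain e :: 'a where e: "norm e = 1" using norm_Basis nonempty_Basis by blast
  then obtain e' where "planar_body_centered K e e'" using centered by blast
  then interpret planar_body_centered K e e' .
  have ramp: "(\<integral>x. max 0 (v \<bullet> x + b) \<partial>?I) \<le> (\<integral>x. max 0 (v \<bullet> x + b) \<partial>?B)" for v b
  proof (cases "v = 0")
    case True
    show ?thesis using True by (simp add: mu_space)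
  next
    case False
    define u where "u = v /\<^sub>R norm v"
    have "norm u = 1" using False by (simp add: u_def)
    then obtain u' where "planar_body_centered K u u'" using centered by blast
    then interpret Q: planar_body_centered K u u' .
    have "v \<bullet> x + b = norm v * (x \<bullet> u - (- b / norm v))" for x
      using False by (simp add: u_def inner_commute field_simps)
    then have eq: "max 0 (v \<bullet> x + b) = norm v * max 0 (x \<bullet> u - (- b / norm v))" for x
      by (simp add: max_mult_distrib_left)
    show ?thesis unfolding eq using Q.gap_nonneg[of "- b / norm v"]
      by (simp add: Q.gap_def mult_left_mono)
  qed
  have ridge: "continuous_on UNIV \<Phi> \<and> (\<integral>x. \<Phi> x \<partial>?I) \<le> (\<integral>x. \<Phi> x \<partial>?B)" if "\<Phi> \<in> ridges" for \<Phi>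
    using that
  proof induction
    case (step \<Phi> s v b)
    have c: "continuous_on UNIV (\<lambda>x. s * max 0 (v \<bullet> x + b))" by (intro continuous_intros)
    have "continuous_on UNIV \<Phi>" using step by simp
    moreover have "(\<integral>x. s * max 0 (v \<bullet> x + b) \<partial>?I) \<le> (\<integral>x. s * max 0 (v \<bullet> x + b) \<partial>?B)"
      using ramp[of v b] step by (simp add: mult_left_mono)
    ultimately show ?case
      using step c integrable_mu[OF c] integrable_mu[of \<Phi>] by (auto intro: continuous_on_add)
  qed simp
  have \<phi>c: "continuous_on UNIV \<phi>" by (rule convex_on_UNIV_continuous[OF cvx])
  show ?thesis
  proof (rule field_le_epsilon)
    fix \<epsilon> :: real assume "0 < \<epsilon>"
    then obtain \<Phi> a b where \<Phi>: "\<Phi> \<in> ridges" "\<And>x. x \<in> K \<Longrightarrow> \<phi> x \<le> \<Phi> x + a \<bullet> x + b"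
      "\<And>x. x \<in> frontier K \<Longrightarrow> \<Phi> x + a \<bullet> x + b \<le> \<phi> x + \<epsilon>"
      using ridge_approximation[OF dim K cvx] by metis
    interpret I: prob_space ?I by (rule prob_spaces)
    interpret B: prob_space ?B by (rule prob_spaces)
    have c: "continuous_on UNIV \<Phi>" using ridge[OF \<Phi>(1)] by simp
    have ca: "continuous_on UNIV (\<lambda>x. x \<bullet> a)" by (intro continuous_intros)
    have c': "continuous_on UNIV (\<lambda>x. \<Phi> x + a \<bullet> x + b)" by (intro continuous_intros c)
    have "(\<integral>x. \<phi> x \<partial>?I) \<le> (\<integral>x. \<Phi> x + a \<bullet> x + b \<partial>?I)"
      using AE_mu(1) by (intro integral_mono_AE integrable_mu \<phi>c c') (auto elim!: eventually_mono dest: \<Phi>(2))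
    also have "\<dots> = (\<integral>x. \<Phi> x \<partial>?I) + (\<integral>x. x \<bullet> a \<partial>?I) + b"
      using integrable_mu[OF c] integrable_mu[OF ca] by (simp add: inner_commute[of a] mu_space)
    also have "\<dots> \<le> (\<integral>x. \<Phi> x \<partial>?B) + (\<integral>x. x \<bullet> a \<partial>?B) + b"
      using ridge[OF \<Phi>(1)] mean_inner[of a] by simp
    also have "\<dots> = (\<integral>x. \<Phi> x + a \<bullet> x + b \<partial>?B)"
      using integrable_mu[OF c] integrable_mu[OF ca] by (simp add: inner_commute[of a] mu_space)
    also have "\<dots> \<le> (\<integral>x. \<phi> x + \<epsilon> \<partial>?B)"
      using AE_uniform_measure_mem[OF K_sets(2)]
      by (intro integral_mono_AE integrable_mu c' continuous_on_add \<phi>c continuous_on_const) (auto elim!: eventually_mono dest: \<Phi>(3))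
    also have "\<dots> = (\<integral>x. \<phi> x \<partial>?B) + \<epsilon>" using integrable_mu(2)[OF \<phi>c] by (simp add: mu_space)
    finally show "(\<integral>x. \<phi> x \<partial>?I) \<le> (\<integral>x. \<phi> x \<partial>?B) + \<epsilon>" .
  qed
qed

theorem theorem2:
  fixes K :: "'a::euclidean_space set"
    and M :: "'w measure" and N :: "'v measure"
    and I :: "'w \<Rightarrow> 'a" and B :: "'v \<Rightarrow> 'a"
  assumes "convex_body K"
    and "prob_space M" and "prob_space N"
    and "I \<in> borel_measurable M" and "distr M borel I = uniform_measure lborel K"
    and "B \<in> borel_measurable N" and "distr N borel B = uniform_measure surface_measure (frontier K)"
    and "(DIM('a) = 2 \<and> (\<integral>w. I w \<partial>M) = (\<integral>v. B v \<partial>N)) \<or>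
         (polytope K \<and>
          (\<exists>c r. inscribed_sphere c r K \<and> c = (\<integral>w. I w \<partial>M) \<and> c = (\<integral>v. B v \<partial>N)))"
  shows "convex_order_le M I N B"
  unfolding convex_order_le_def
proof (intro allI impI)
  fix \<phi> :: "'a \<Rightarrow> real" assume cvx: "convex_on UNIV \<phi>"
  let ?I = "uniform_measure lborel K" and ?B = "uniform_measure surface_measure (frontier K)"
  have cK: "compact K" "closed K" using assms(1) compact_imp_closed by (auto simp: convex_body_def)
  have Ks: "K \<in> sets lborel" "frontier K \<in> sets surface_measure"
    using cK by (simp_all add: surface_measure_def borel_closed)
  have P: "prob_space ?I" "prob_space ?B"
    using prob_space.prob_space_distr[OF assms(2,4)] prob_space.prob_space_distr[OF assms(3,6)] assms(5,7) by simp_all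
  \<comment> \<open>The law of \<open>B\<close> is a probability measure, which forces the surface
    measure of the frontier to be positive and finite.\<close>
  note pos = uniform_measure_prob_pos[OF P(2) Ks(2)]
  have AEs: "AE z in ?I. z \<in> K" "AE z in ?B. z \<in> K"
    using AE_uniform_measure_mem[OF Ks(1)] AE_uniform_measure_mem[OF Ks(2)] frontier_subset_closed[OF cK(2)]
    by (auto elim: eventually_mono)
  have int: "integrable ?I f" "integrable ?B f" if "continuous_on UNIV f" for f :: "'a \<Rightarrow> 'b::euclidean_space"
    by (rule integrable_continuous_compact_support[OF _ _ _ cK(1) that]; use P AEs in \<open>simp add: surface_measure_def\<close>)+
  have mI: "(\<integral>w. I w \<partial>M) = (\<integral>z. z \<partial>?I)" and mB: "(\<integral>v. B v \<partial>N) = (\<integral>z. z \<partial>?B)"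
    using integral_distr[OF assms(4), of "\<lambda>z. z"] integral_distr[OF assms(6), of "\<lambda>z. z"] assms(5,7) by simp_all
  have \<phi>c: "continuous_on UNIV \<phi>" by (rule convex_on_UNIV_continuous[OF cvx])
  then have \<phi>m: "\<phi> \<in> borel_measurable borel" by (rule borel_measurable_continuous_onI)
  have "(\<integral>x. \<phi> x \<partial>?I) \<le> (\<integral>x. \<phi> x \<partial>?B)"
    using assms(8)
  proof
    assume "DIM('a) = 2 \<and> (\<integral>w. I w \<partial>M) = (\<integral>v. B v \<partial>N)"
    then show ?thesis using integral_uniform_planar_le[OF _ assms(1) pos cvx] mI mB by simp
  next
    assume "polytope K \<and> (\<exists>c r. inscribed_sphere c r K \<and> c = (\<integral>w. I w \<partial>M) \<and> c = (\<integral>v. B v \<partial>N))"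
    then obtain c r where "polytope K" "inscribed_sphere c r K" "(\<integral>z. z \<partial>?I) = c" using mI by metis
    then show ?thesis
      using integral_uniform_circumscribed_polytope_le[OF assms(1) _ _ pos cvx int(1)] by simp
  qed
  moreover have "integrable M (\<lambda>w. \<phi> (I w))" "integrable N (\<lambda>v. \<phi> (B v))"
    using int[OF \<phi>c] assms(5,7) integrable_distr_eq[OF assms(4) \<phi>m] integrable_distr_eq[OF assms(6) \<phi>m] by simp_all
  moreover have "(\<integral>w. \<phi> (I w) \<partial>M) = (\<integral>x. \<phi> x \<partial>?I)" "(\<integral>v. \<phi> (B v) \<partial>N) = (\<integral>x. \<phi> x \<partial>?B)"
    using integral_distr[OF assms(4) \<phi>m] integral_distr[OF assms(6) \<phi>m] assms(5,7) by simp_all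
  ultimately show "integrable M (\<lambda>w. \<phi> (I w)) \<and> integrable N (\<lambda>v. \<phi> (B v)) \<and> (\<integral>w. \<phi> (I w) \<partial>M) \<le> (\<integral>v. \<phi> (B v) \<partial>N)"
    by simp
qed

end
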